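(* Let $K\in\{1,-1\}$ and $R=1$. Let $F:\mathcal M_K\to\mathbb R$ (twice differentiable) have a minimizer $x_g^\ast$ and let $R_g\ge d(x_0,x_g^\ast)$. If $K>0$ assume $2R_g+R<\frac{\pi}{2\sqrt K}$. (By solving the ball subproblems more accurately and in smaller balls, one can relax this condition to $cR_g+R<\frac{\pi}{2\sqrt K}$ for any constants $c>1$, $R>0$.) Let $F$ be $L$-smooth and $\mu$-strongly g-convex in $\bar B(0,2R_g+R)$, i.e. in $\exp_{x_0}(\bar B(0,2R_g+R))$. Then Algorithm 2 (written out in the context) obtains an $\varepsilon$-minimizer of $F$ after $$\widetilde O\big(\zeta^{3/2}\sqrt{L/\mu}\big)$$ calls to the gradient oracle of $F$. By means of regularization, one obtains an algorithm for the $L$-smooth g-convex case with rates $$\widetilde O\big(\zeta^{3/2}\delta^{-1/2}\sqrt{\zeta+LR_g^2/\varepsilon}\big).$$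
   Context: $\mathcal M_K$ denotes any manifold that is a subset of an $n$-dimensional complete simply connected Riemannian manifold of constant sectional curvature $K$ (hyperbolic space if $K=-1$, the unit sphere if $K=1$), with the inherited metric, containing $\exp_{x_0}(\bar B(0,R_g))$, where $x_0\in\mathcal M_K$ is the initial point and $\bar B(0,r)\subset T_{x_0}\mathcal M_K$ is the closed ball. $d$ is the Riemannian distance, and for $p\in\mathcal M_K$, $\bar B(p,r)$ is the closed Riemannian ball. $F$ is $L$-smooth, resp. $\mu$-strongly g-convex ($\mu>0$), in $\mathcal N$ if $F(y)\le F(x)+\langle\nabla F(x),\exp_x^{-1}(y)\rangle+\frac L2d(x,y)^2$, resp. $F(y)\ge F(x)+\langle\nabla F(x),\exp_x^{-1}(y)\rangle+\frac\mu2d(x,y)^2$, for all $x,y\in\mathcal N$; g-convex is the latter with $\mu=0$. An $\varepsilon$-minimizer is a point $\hat x$ with $F(\hat x)-F(x_g^\ast)\le\varepsilon$. $\zeta=R_g\sqrt{|K|}\coth(R_g\sqrt{|K|})$ if $K<0$, else $1$; $\delta=R_g\sqrt K\cot(R_g\sqrt K)$ if $K>0$, else $1$. $\widetilde O(\cdot)$ omits logarithmic factors (and treats $R\sqrt{|K|}$ as $O(1)$). Algorithm 2 (ball optimization boosting). Set $R=1$, $p_0=x_0$. If $R_g\le R$, return $\mathrm{AlgSC}(\bar B(p_0,R_g),p_0,F,\varepsilon)$. Otherwise set $T=\lceil\frac{2R_g}{R}\ln(\frac{LR_g^2}{\varepsilon})\rceil$ and $\varepsilon'=\min\{\frac{R\varepsilon}{4R_g},\frac{\mu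 R_g^2}{2T^2}\}$; for $k=1,\dots,T$ set $\mathcal X_k=\bar B(p_{k-1},R)$ and $p_k=\mathrm{AlgSC}(\mathcal X_k,p_{k-1},F,\varepsilon')$. Return $p_T$. $\mathrm{AlgSC}(\bar B(p,r),p,F,\eta)$ optimizes $F$ over $\bar B(p,r)$ with accuracy $\eta$ from the initial point $p$, by running Algorithm 1 in $\lceil\log_2(\mu r^2/\eta)-1\rceil$ stages: stage $j$ starts at (and centers the geodesic map at) the output of the previous stage ($p$ for $j=1$), with radius $r_j$, $r_1=r$, $r_{j}=r_{j-1}/\sqrt2$, and target accuracy $\mu r_j^2/4$. Algorithm 1, with center $c$, radius $r$, accuracy $\eta$. Let $h$ be the gnomonic ($K=1$) or Beltrami–Klein ($K=-1$) projection into $\mathbb R^n$ with $h(c)=0$, $\mathcal X=h(\bar B(c,r))$, $f=F\circ h^{-1}$, $\Pi_{\mathcal X}$ the Euclidean projection onto $\mathcal X$; $\gamma_n=\cosh^{-2}(r)$, $\gamma_p=\cosh^{-3}(r)$ if $K=-1$, and $\gamma_n=\cos^3(r)$, $\gamma_p=\cos^2(r)$ if $K=1$; $\tilde L=O(L(R_g+1))$ a Lipschitz constant of $\nabla f$ on $\mathcal X$; $N=\lceil\sqrt{4\tilde L\|\tilde x^\ast\|^2/(\gamma_n^2\gamma_p\eta)}\,\rceil$ iterations, where $\tilde x^\ast\in\arg\min_{\mathcal X}f$. Set $\tilde x_0=\tilde z_0=0$, $A_0=0$. For $i=0,\dots,N-1$: $a_{i+1}=(i+1)\gamma_n^2\gamma_p/(2\tilde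 L)$; $A_{i+1}=A_i+a_{i+1}$; choose $\lambda$ as below; $\tilde\chi_i=(1-\lambda)\tilde x_i+\lambda\Pi_{\mathcal X}(\tilde z_i)$; $\tilde\zeta_i=\tilde z_i-\frac{a_{i+1}}{\gamma_n}\nabla f(\tilde\chi_i)$; $\tilde x_{i+1}=(1-\lambda)\tilde x_i+\lambda\Pi_{\mathcal X}(\tilde\zeta_i)$; $\tilde z_{i+1}=\tilde z_i-\frac{a_{i+1}}{\gamma_n}\nabla f(\tilde x_{i+1})$. Return $h^{-1}(\tilde x_N)$. Choice of $\lambda$: $\lambda=1$ for $i=0$; for $i\ge1$, $\lambda=\frac{a_{i+1}/\gamma_n}{A_i\hat\gamma+a_{i+1}/\gamma_n}$ with $\hat\gamma\in[\gamma_p,1/\gamma_n]$ such that $f(\tilde x_{i+1})-f(\tilde x_i)\le\hat\gamma\langle\nabla f(\tilde x_{i+1}),\tilde x_{i+1}-\tilde x_i\rangle+\frac{A_N\eta}{2(N-1)A_i}$, where $A_N=N(N+1)\gamma_n^2\gamma_p/(4\tilde L)$; one tries $\hat\gamma=1/\gamma_n$, then $\hat\gamma=\gamma_p$, and otherwise bisects over $\lambda$ between these two, keeping the half at whose endpoints $\langle\nabla f(\tilde x_{i+1}),\tilde x_{i+1}-\tilde x_i\rangle$ has opposite signs, until the inequality holds. Regularization: with $\Delta\ge F(x_0)-F(x_g^\ast)$, one minimizes successively $F(x)+\frac{\mu_i}{2}d(x,x_0)^2$, $i=0,1,\dots,\lceil\log_2(\Delta/\varepsilon)\rceil$, with $\mu_0=\Delta/R_g^2$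 and $\mu_i=\mu_{i-1}/2$, each time with the algorithm for the strongly g-convex case started at the previous output, until the gap is reduced by a factor $1/4$.
   Formalization: AlgSC always runs at least one stage, i.e. max(1, ⌈log₂(μr²/η)−1⌉) stages; with zero stages (η ≥ μr²/2) it would return its initial point, which need not be an ε-minimizer. *)

theory Defs
  imports "HOL-Analysis.Analysis"
begin

section \<open>Model spaces of constant curvature\<close>

text \<open>
  With n = DIM('a), the complete simply connected n-dimensional space of curvature K is realised
  inside 'a \<times> real: the unit sphere for K = 1, the upper sheet of the hyperboloid for K = -1.
  In both cases the Riemannian metric is the restriction of the following bilinear form.
\<close>

type_synonym 'a point = "'a \<times> real"

definition form :: "real \<Rightarrow> 'a::euclidean_space point \<Rightarrow> 'a point \<Rightarrow> real" where
  "form K p q = fst p \<bullet> fst q + K * (snd p * snd q)"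

definition model_space :: "real \<Rightarrow> 'a::euclidean_space point set" where
  "model_space K = {p. form K p p = K \<and> (K = -1 \<longrightarrow> snd p > 0)}"

definition tangent :: "real \<Rightarrow> 'a::euclidean_space point \<Rightarrow> 'a point set" where
  "tangent K p = {v. form K p v = 0}"

definition rnorm :: "real \<Rightarrow> 'a::euclidean_space point \<Rightarrow> real" where
  "rnorm K v = sqrt (form K v v)"

definition rdist :: "real \<Rightarrow> 'a::euclidean_space point \<Rightarrow> 'a point \<Rightarrow> real" where
  "rdist K p q = (if K > 0 then arccos (form K p q) else arcosh (- form K p q))"

definition rexp :: "real \<Rightarrow> 'a::euclidean_space point \<Rightarrow> 'a point \<Rightarrow> 'a point" where
  "rexp K p v =
     (let t = rnorm K v in
      if t = 0 then p
      else if K > 0 then cos t *\<^sub>R p + (sin t / t) *\<^sub>R v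
      else cosh t *\<^sub>R p + (sinh t / t) *\<^sub>R v)"

text \<open>
  The inverse exponential map, for q not antipodal to p: the tangential part q - K * form K p q * p
  of q points in the direction of q and has length sin d, respectively sinh d.
\<close>

definition rlog :: "real \<Rightarrow> 'a::euclidean_space point \<Rightarrow> 'a point \<Rightarrow> 'a point" where
  "rlog K p q =
     (let w = q - (K * form K p q) *\<^sub>R p in (rdist K p q / rnorm K w) *\<^sub>R w)"

definition rball :: "real \<Rightarrow> 'a::euclidean_space point \<Rightarrow> real \<Rightarrow> 'a point set" where
  "rball K p r = {q \<in> model_space K. rdist K p q \<le> r}"

definition exp_ball :: "real \<Rightarrow> 'a::euclidean_space point \<Rightarrow> real \<Rightarrow> 'a point set" where
  "exp_ball K p r = rexp K p ` {v \<in> tangent K p. rnorm K v \<le> r}"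


section \<open>Function classes\<close>

text \<open>Differentiation at p is done in the chart exp_p; at boundary points of M it is one-sided.\<close>

definition has_rgrad ::
  "real \<Rightarrow> 'a::euclidean_space point set \<Rightarrow> ('a point \<Rightarrow> real) \<Rightarrow> 'a point \<Rightarrow> 'a point \<Rightarrow> bool" where
  "has_rgrad K M F p g \<longleftrightarrow>
     g \<in> tangent K p \<and>
     ((\<lambda>v. F (rexp K p v)) has_derivative form K g) (at 0 within {v \<in> tangent K p. rexp K p v \<in> M})"

definition twice_differentiable ::
  "real \<Rightarrow> 'a::euclidean_space point set \<Rightarrow> ('a point \<Rightarrow> real) \<Rightarrow> ('a point \<Rightarrow> 'a point) \<Rightarrow> bool" where
  "twice_differentiable K M F G \<longleftrightarrow>
     (\<forall>p\<in>M. has_rgrad K M F p (G p)) \<and>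
     (\<forall>p\<in>M. (\<lambda>v. G (rexp K p v)) differentiable (at 0 within {v \<in> tangent K p. rexp K p v \<in> M}))"

text \<open>
  Below, G is the gradient field of F, and v is the initial velocity of a minimising geodesic from
  x to y = exp_x(v), i.e. the inverse exponential map of x evaluated at y.
\<close>

definition smooth_on ::
  "real \<Rightarrow> ('a::euclidean_space point \<Rightarrow> real) \<Rightarrow> ('a point \<Rightarrow> 'a point) \<Rightarrow> real \<Rightarrow> 'a point set \<Rightarrow> bool"
where
  "smooth_on K F G L N \<longleftrightarrow>
     (\<forall>x\<in>N. \<forall>y\<in>N. \<forall>v\<in>tangent K x. rexp K x v = y \<and> rnorm K v = rdist K x y \<longrightarrow>
        F y \<le> F x + form K (G x) v + L / 2 * (rdist K x y)\<^sup>2)"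

definition strongly_gconvex_on ::
  "real \<Rightarrow> ('a::euclidean_space point \<Rightarrow> real) \<Rightarrow> ('a point \<Rightarrow> 'a point) \<Rightarrow> real \<Rightarrow> 'a point set \<Rightarrow> bool"
where
  "strongly_gconvex_on K F G \<mu> N \<longleftrightarrow>
     (\<forall>x\<in>N. \<forall>y\<in>N. \<forall>v\<in>tangent K x. rexp K x v = y \<and> rnorm K v = rdist K x y \<longrightarrow>
        F y \<ge> F x + form K (G x) v + \<mu> / 2 * (rdist K x y)\<^sup>2)"

definition gconvex_on ::
  "real \<Rightarrow> ('a::euclidean_space point \<Rightarrow> real) \<Rightarrow> ('a point \<Rightarrow> 'a point) \<Rightarrow> 'a point set \<Rightarrow> bool"
where
  "gconvex_on K F G N \<longleftrightarrow> strongly_gconvex_on K F G 0 N"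

definition zeta_const :: "real \<Rightarrow> real \<Rightarrow> real" where
  "zeta_const K Rg =
     (if K < 0
      then Rg * sqrt \<bar>K\<bar> * (cosh (Rg * sqrt \<bar>K\<bar>) / sinh (Rg * sqrt \<bar>K\<bar>))
      else 1)"

definition delta_const :: "real \<Rightarrow> real \<Rightarrow> real" where
  "delta_const K Rg = (if K > 0 then Rg * sqrt K * cot (Rg * sqrt K) else 1)"


section \<open>Gnomonic and Beltrami--Klein projections\<close>

text \<open>
  A linear isometry A of 'a onto the tangent space at c identifies that tangent space with n-space.
  Both projections are the central projection, from the origin of the ambient space, onto the affine
  tangent plane c + A(u).
\<close>

definition is_frame :: "real \<Rightarrow> 'a::euclidean_space point \<Rightarrow> ('a \<Rightarrow> 'a point) \<Rightarrow> bool" where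
  "is_frame K c A \<longleftrightarrow>
     linear A \<and> (\<forall>u. A u \<in> tangent K c) \<and> (\<forall>u w. form K (A u) (A w) = u \<bullet> w)"

definition geod_map :: "real \<Rightarrow> 'a::euclidean_space point \<Rightarrow> ('a \<Rightarrow> 'a point) \<Rightarrow> 'a point \<Rightarrow> 'a" where
  "geod_map K c A p = (\<Sum>b\<in>Basis. (K * form K (A b) p / form K c p) *\<^sub>R b)"

definition geod_inv :: "real \<Rightarrow> 'a::euclidean_space point \<Rightarrow> ('a \<Rightarrow> 'a point) \<Rightarrow> 'a \<Rightarrow> 'a point" where
  "geod_inv K c A u = (1 / sqrt (1 + K * (u \<bullet> u))) *\<^sub>R (c + A u)"

text \<open>
  The Euclidean gradient at u of the function F read in the chart: the adjoint of the derivative of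
  the inverse chart applied to the value of G. One evaluation uses one evaluation of G.
\<close>

definition chart_grad ::
  "real \<Rightarrow> 'a::euclidean_space point \<Rightarrow> ('a \<Rightarrow> 'a point) \<Rightarrow> ('a point \<Rightarrow> 'a point) \<Rightarrow> 'a \<Rightarrow> 'a" where
  "chart_grad K c A G u =
     (\<Sum>b\<in>Basis. form K (G (geod_inv K c A u)) (frechet_derivative (geod_inv K c A) (at u) b) *\<^sub>R b)"

definition gamma_n :: "real \<Rightarrow> real \<Rightarrow> real" where
  "gamma_n K r = (if K > 0 then cos r ^ 3 else 1 / cosh r ^ 2)"

definition gamma_p :: "real \<Rightarrow> real \<Rightarrow> real" where
  "gamma_p K r = (if K > 0 then cos r ^ 2 else 1 / cosh r ^ 3)"


section \<open>The accelerated method in the chart\<close>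

text \<open>
  The algorithms are relations between input, output and the number of gradient calls made; an
  input has no output when the algorithm does not terminate or queries F outside of its domain.

  \<open>step_size\<close> is a(i), \<open>step_sum\<close> is A(i). In the following definitions b stands for
  a(i+1) / gamma_n, and l for lambda.
\<close>

definition step_size :: "real \<Rightarrow> real \<Rightarrow> real \<Rightarrow> nat \<Rightarrow> real" where
  "step_size gn gp Lt i = real i * gn\<^sup>2 * gp / (2 * Lt)"

definition step_sum :: "real \<Rightarrow> real \<Rightarrow> real \<Rightarrow> nat \<Rightarrow> real" where
  "step_sum gn gp Lt i = (\<Sum>j=1..i. step_size gn gp Lt j)"

definition next_x ::
  "('a::euclidean_space \<Rightarrow> 'a) \<Rightarrow> 'a set \<Rightarrow> real \<Rightarrow> 'a \<Rightarrow> 'a \<Rightarrow> real \<Rightarrow> 'a" where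
  "next_x gf X b x z l =
     (let chi = (1 - l) *\<^sub>R x + l *\<^sub>R closest_point X z;
          ze = z - b *\<^sub>R gf chi
      in (1 - l) *\<^sub>R x + l *\<^sub>R closest_point X ze)"

definition slope ::
  "('a::euclidean_space \<Rightarrow> 'a) \<Rightarrow> 'a set \<Rightarrow> real \<Rightarrow> 'a \<Rightarrow> 'a \<Rightarrow> real \<Rightarrow> real" where
  "slope gf X b x z l = (let x' = next_x gf X b x z l in gf x' \<bullet> (x' - x))"

definition lam_of :: "real \<Rightarrow> real \<Rightarrow> real \<Rightarrow> real" where
  "lam_of b A g = b / (A * g + b)"

text \<open>The inverse of \<open>lam_of\<close>.\<close>

definition gam_of :: "real \<Rightarrow> real \<Rightarrow> real \<Rightarrow> real" where
  "gam_of b A l = b * (1 - l) / (A * l)"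

definition accepts ::
  "('a::euclidean_space \<Rightarrow> real) \<Rightarrow> ('a \<Rightarrow> 'a) \<Rightarrow> 'a set \<Rightarrow> real \<Rightarrow> real \<Rightarrow> real \<Rightarrow> 'a \<Rightarrow> 'a \<Rightarrow> real \<Rightarrow> bool"
where
  "accepts f gf X b A err x z l \<longleftrightarrow>
     f (next_x gf X b x z l) - f x \<le> gam_of b A l * slope gf X b x z l + err"

text \<open>\<open>bisection acc s l u m n\<close>: started on [l,u], the bisection stops at m after n trials.\<close>

inductive bisection :: "(real \<Rightarrow> bool) \<Rightarrow> (real \<Rightarrow> real) \<Rightarrow> real \<Rightarrow> real \<Rightarrow> real \<Rightarrow> nat \<Rightarrow> bool"
  for acc :: "real \<Rightarrow> bool" and s :: "real \<Rightarrow> real"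
where
  stop: "acc ((l + u) / 2) \<Longrightarrow> bisection acc s l u ((l + u) / 2) 1"
| left: "\<not> acc ((l + u) / 2) \<Longrightarrow> s l * s ((l + u) / 2) < 0 \<Longrightarrow>
    bisection acc s l ((l + u) / 2) m n \<Longrightarrow> bisection acc s l u m (Suc n)"
| right: "\<not> acc ((l + u) / 2) \<Longrightarrow> s ((l + u) / 2) * s u < 0 \<Longrightarrow>
    bisection acc s ((l + u) / 2) u m n \<Longrightarrow> bisection acc s l u m (Suc n)"

inductive line_search ::
  "(real \<Rightarrow> bool) \<Rightarrow> (real \<Rightarrow> real) \<Rightarrow> real \<Rightarrow> real \<Rightarrow> real \<Rightarrow> nat \<Rightarrow> bool"
  for acc :: "real \<Rightarrow> bool" and s :: "real \<Rightarrow> real" and l u :: real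
where
  first_end: "acc l \<Longrightarrow> line_search acc s l u l 1"
| second_end: "\<not> acc l \<Longrightarrow> acc u \<Longrightarrow> line_search acc s l u u 2"
| bisect: "\<not> acc l \<Longrightarrow> \<not> acc u \<Longrightarrow> bisection acc s l u m n \<Longrightarrow> line_search acc s l u m (2 + n)"

text \<open>
  \<open>alg1_iter f gf X gn gp Lt N \<eta> i x z n\<close>: the iterates after i iterations are x and z, and n
  gradients have been evaluated; each trial value of lambda costs two (at chi and at the next x).
\<close>

inductive alg1_iter ::
  "('a::euclidean_space \<Rightarrow> real) \<Rightarrow> ('a \<Rightarrow> 'a) \<Rightarrow> 'a set \<Rightarrow> real \<Rightarrow> real \<Rightarrow> real \<Rightarrow> nat \<Rightarrow> real \<Rightarrow>
   nat \<Rightarrow> 'a \<Rightarrow> 'a \<Rightarrow> nat \<Rightarrow> bool"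
  for f :: "'a \<Rightarrow> real" and gf :: "'a \<Rightarrow> 'a" and X :: "'a set" and gn gp Lt :: real
    and N :: nat and \<eta> :: real
where
  start: "alg1_iter f gf X gn gp Lt N \<eta> 0 0 0 0"
| first: "alg1_iter f gf X gn gp Lt N \<eta> 0 x z n \<Longrightarrow> 0 < N \<Longrightarrow>
    b = step_size gn gp Lt 1 / gn \<Longrightarrow>
    x' = next_x gf X b x z 1 \<Longrightarrow>
    alg1_iter f gf X gn gp Lt N \<eta> 1 x' (z - b *\<^sub>R gf x') (n + 2)"
| step: "alg1_iter f gf X gn gp Lt N \<eta> i x z n \<Longrightarrow> 1 \<le> i \<Longrightarrow> i < N \<Longrightarrow>
    b = step_size gn gp Lt (i + 1) / gn \<Longrightarrow>
    A = step_sum gn gp Lt i \<Longrightarrow>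
    AN = real N * (real N + 1) * gn\<^sup>2 * gp / (4 * Lt) \<Longrightarrow>
    err = AN * \<eta> / (2 * (real N - 1) * A) \<Longrightarrow>
    line_search (accepts f gf X b A err x z) (slope gf X b x z)
      (lam_of b A (1 / gn)) (lam_of b A gp) l t \<Longrightarrow>
    x' = next_x gf X b x z l \<Longrightarrow>
    alg1_iter f gf X gn gp Lt N \<eta> (i + 1) x' (z - b *\<^sub>R gf x') (n + 2 * t)"

definition alg1 ::
  "real \<Rightarrow> 'a::euclidean_space point set \<Rightarrow> ('a point \<Rightarrow> real) \<Rightarrow> ('a point \<Rightarrow> 'a point) \<Rightarrow>
   ('a \<Rightarrow> 'a point) \<Rightarrow> real \<Rightarrow> 'a point \<Rightarrow> real \<Rightarrow> real \<Rightarrow> 'a point \<Rightarrow> nat \<Rightarrow> bool"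
where
  "alg1 K M F G A Lt c r \<eta> out calls \<longleftrightarrow>
     (let X = geod_map K c A ` rball K c r;
          f = F \<circ> geod_inv K c A;
          gf = chart_grad K c A G;
          gn = gamma_n K r;
          gp = gamma_p K r
      in rball K c r \<subseteq> M \<and> lipschitz_on Lt X gf \<and>
         (\<exists>xs\<in>X. (\<forall>u\<in>X. f xs \<le> f u) \<and>
           (let N = nat \<lceil>sqrt (4 * Lt * (norm xs)\<^sup>2 / (gn\<^sup>2 * gp * \<eta>))\<rceil>
            in \<exists>x z. alg1_iter f gf X gn gp Lt N \<eta> N x z calls \<and> out = geod_inv K c A x)))"


section \<open>Strongly g-convex optimisation over a ball, and ball optimisation boosting\<close>

text \<open>
  \<open>frame\<close> supplies the identification of every tangent space with n-space, and \<open>cL\<close> is the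
  constant hidden in the Lipschitz constant O(L (Rg + 1)). The factor \<open>\<sigma>\<close> scales the accuracy
  of every stage; the method proper has \<open>\<sigma> = 1\<close>. At least one stage is always run, also when
  \<open>log 2 (\<mu> * r\<^sup>2 / \<eta>) - 1\<close> is not positive: without it the initial point would be returned
  unchanged, although it need not be an \<open>\<eta>\<close>-minimizer in that range.
\<close>

inductive sc_stages ::
  "real \<Rightarrow> 'a::euclidean_space point set \<Rightarrow> ('a point \<Rightarrow> real) \<Rightarrow> ('a point \<Rightarrow> 'a point) \<Rightarrow>
   ('a point \<Rightarrow> 'a \<Rightarrow> 'a point) \<Rightarrow> real \<Rightarrow> real \<Rightarrow> real \<Rightarrow> 'a point \<Rightarrow> real \<Rightarrow>
   nat \<Rightarrow> 'a point \<Rightarrow> nat \<Rightarrow> bool"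
  for K :: real and M :: "'a point set" and F :: "'a point \<Rightarrow> real" and G :: "'a point \<Rightarrow> 'a point"
    and frame :: "'a point \<Rightarrow> 'a \<Rightarrow> 'a point" and \<sigma> \<mu> Lt :: real and p :: "'a point" and r :: real
where
  start: "sc_stages K M F G frame \<sigma> \<mu> Lt p r 0 p 0"
| stage: "sc_stages K M F G frame \<sigma> \<mu> Lt p r j c n \<Longrightarrow>
    rj = r / sqrt 2 ^ j \<Longrightarrow>
    alg1 K M F G (frame c) Lt c rj (\<sigma> * (\<mu> * rj\<^sup>2 / 4)) c' m \<Longrightarrow>
    sc_stages K M F G frame \<sigma> \<mu> Lt p r (Suc j) c' (n + m)"

definition alg_sc ::
  "real \<Rightarrow> 'a::euclidean_space point set \<Rightarrow> ('a point \<Rightarrow> real) \<Rightarrow> ('a point \<Rightarrow> 'a point) \<Rightarrow>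
   ('a point \<Rightarrow> 'a \<Rightarrow> 'a point) \<Rightarrow> real \<Rightarrow> real \<Rightarrow> real \<Rightarrow> 'a point \<Rightarrow> real \<Rightarrow> real \<Rightarrow>
   'a point \<Rightarrow> nat \<Rightarrow> bool"
where
  "alg_sc K M F G frame \<sigma> \<mu> Lt p r \<eta> out calls \<longleftrightarrow>
     sc_stages K M F G frame \<sigma> \<mu> Lt p r (nat (max 1 \<lceil>log 2 (\<mu> * r\<^sup>2 / \<eta>) - 1\<rceil>)) out calls"

inductive boost_steps ::
  "real \<Rightarrow> 'a::euclidean_space point set \<Rightarrow> ('a point \<Rightarrow> real) \<Rightarrow> ('a point \<Rightarrow> 'a point) \<Rightarrow>
   ('a point \<Rightarrow> 'a \<Rightarrow> 'a point) \<Rightarrow> real \<Rightarrow> real \<Rightarrow> real \<Rightarrow> real \<Rightarrow> real \<Rightarrow> 'a point \<Rightarrow>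
   nat \<Rightarrow> 'a point \<Rightarrow> nat \<Rightarrow> bool"
  for K :: real and M :: "'a point set" and F :: "'a point \<Rightarrow> real" and G :: "'a point \<Rightarrow> 'a point"
    and frame :: "'a point \<Rightarrow> 'a \<Rightarrow> 'a point" and \<sigma> \<mu> Lt R \<epsilon>' :: real and x0 :: "'a point"
where
  start: "boost_steps K M F G frame \<sigma> \<mu> Lt R \<epsilon>' x0 0 x0 0"
| step: "boost_steps K M F G frame \<sigma> \<mu> Lt R \<epsilon>' x0 k p n \<Longrightarrow>
    alg_sc K M F G frame \<sigma> \<mu> Lt p R \<epsilon>' p' m \<Longrightarrow>
    boost_steps K M F G frame \<sigma> \<mu> Lt R \<epsilon>' x0 (Suc k) p' (n + m)"

definition alg2 ::
  "real \<Rightarrow> 'a::euclidean_space point set \<Rightarrow> ('a point \<Rightarrow> 'a \<Rightarrow> 'a point) \<Rightarrow> real \<Rightarrow> real \<Rightarrow> real \<Rightarrow>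
   ('a point \<Rightarrow> real) \<Rightarrow> ('a point \<Rightarrow> 'a point) \<Rightarrow> real \<Rightarrow> real \<Rightarrow> real \<Rightarrow> 'a point \<Rightarrow> real \<Rightarrow>
   'a point \<Rightarrow> nat \<Rightarrow> bool"
where
  "alg2 K M frame R \<sigma> cL F G L \<mu> Rg x0 \<epsilon> out calls \<longleftrightarrow>
     (let Lt = cL * (L * (Rg + 1)) in
      if Rg \<le> R then alg_sc K M F G frame \<sigma> \<mu> Lt x0 Rg \<epsilon> out calls
      else
        (let T = nat \<lceil>2 * Rg / R * ln (L * Rg\<^sup>2 / \<epsilon>)\<rceil>;
             \<epsilon>' = min (R * \<epsilon> / (4 * Rg)) (\<mu> * Rg\<^sup>2 / (2 * (real T)\<^sup>2))
         in boost_steps K M F G frame \<sigma> \<mu> Lt R \<epsilon>' x0 T out calls))"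


section \<open>Regularisation\<close>

definition reg_fun :: "real \<Rightarrow> ('a::euclidean_space point \<Rightarrow> real) \<Rightarrow> 'a point \<Rightarrow> real \<Rightarrow> 'a point \<Rightarrow> real"
where
  "reg_fun K F x0 m x = F x + m / 2 * (rdist K x x0)\<^sup>2"

definition reg_grad ::
  "real \<Rightarrow> ('a::euclidean_space point \<Rightarrow> 'a point) \<Rightarrow> 'a point \<Rightarrow> real \<Rightarrow> 'a point \<Rightarrow> 'a point"
where
  "reg_grad K G x0 m x = G x - m *\<^sub>R rlog K x x0"

text \<open>
  The i-th regularised problem is treated with smoothness constant \<open>L + cS * \<zeta> * \<mu>\<^sub>i\<close> and strong
  g-convexity constant \<open>cC * \<delta> * \<mu>\<^sub>i\<close>. The gap of its starting point is at most \<open>\<Delta> / 2^i\<close>,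
  so for \<open>\<kappa> \<le> 1/4\<close> the accuracy \<open>\<kappa> * \<Delta> / 2^i\<close> reduces this bound by a factor of at least 4.
\<close>

inductive reg_rounds ::
  "real \<Rightarrow> 'a::euclidean_space point set \<Rightarrow> ('a point \<Rightarrow> 'a \<Rightarrow> 'a point) \<Rightarrow> real \<Rightarrow> real \<Rightarrow> real \<Rightarrow>
   real \<Rightarrow> real \<Rightarrow> real \<Rightarrow>
   ('a point \<Rightarrow> real) \<Rightarrow> ('a point \<Rightarrow> 'a point) \<Rightarrow> real \<Rightarrow> real \<Rightarrow> 'a point \<Rightarrow> real \<Rightarrow>
   nat \<Rightarrow> 'a point \<Rightarrow> nat \<Rightarrow> bool"
  for K :: real and M :: "'a point set" and frame :: "'a point \<Rightarrow> 'a \<Rightarrow> 'a point"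
    and R \<sigma> cL cS cC \<kappa> :: real and F :: "'a point \<Rightarrow> real" and G :: "'a point \<Rightarrow> 'a point"
    and L Rg :: real and x0 :: "'a point" and \<Delta> :: real
where
  start: "reg_rounds K M frame R \<sigma> cL cS cC \<kappa> F G L Rg x0 \<Delta> 0 x0 0"
| round: "reg_rounds K M frame R \<sigma> cL cS cC \<kappa> F G L Rg x0 \<Delta> i y n \<Longrightarrow>
    m = \<Delta> / Rg\<^sup>2 / 2 ^ i \<Longrightarrow>
    alg2 K M frame R \<sigma> cL (reg_fun K F x0 m) (reg_grad K G x0 m)
      (L + cS * zeta_const K Rg * m) (cC * delta_const K Rg * m) Rg y (\<kappa> * \<Delta> / 2 ^ i) y' k \<Longrightarrow>
    reg_rounds K M frame R \<sigma> cL cS cC \<kappa> F G L Rg x0 \<Delta> (Suc i) y' (n + k)"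

definition reg_alg ::
  "real \<Rightarrow> 'a::euclidean_space point set \<Rightarrow> ('a point \<Rightarrow> 'a \<Rightarrow> 'a point) \<Rightarrow> real \<Rightarrow> real \<Rightarrow> real \<Rightarrow>
   real \<Rightarrow> real \<Rightarrow> real \<Rightarrow>
   ('a point \<Rightarrow> real) \<Rightarrow> ('a point \<Rightarrow> 'a point) \<Rightarrow> real \<Rightarrow> real \<Rightarrow> 'a point \<Rightarrow> real \<Rightarrow> real \<Rightarrow>
   'a point \<Rightarrow> nat \<Rightarrow> bool"
where
  "reg_alg K M frame R \<sigma> cL cS cC \<kappa> F G L Rg x0 \<Delta> \<epsilon> out calls \<longleftrightarrow>
     reg_rounds K M frame R \<sigma> cL cS cC \<kappa> F G L Rg x0 \<Delta> (nat (\<lceil>log 2 (\<Delta> / \<epsilon>)\<rceil> + 1)) out calls"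


section \<open>Standing assumptions, and what it means to solve the problem\<close>

text \<open>
  M may be any subset of the model space. N is the set on which F is assumed to be L-smooth and
  (strongly) g-convex.
\<close>

definition setting ::
  "real \<Rightarrow> 'a::euclidean_space point set \<Rightarrow> ('a point \<Rightarrow> 'a \<Rightarrow> 'a point) \<Rightarrow> ('a point \<Rightarrow> real) \<Rightarrow>
   ('a point \<Rightarrow> 'a point) \<Rightarrow> 'a point \<Rightarrow> 'a point \<Rightarrow> real \<Rightarrow> 'a point set \<Rightarrow> bool"
where
  "setting K M frame F G x0 xs Rg N \<longleftrightarrow>
     (\<forall>c\<in>model_space K. is_frame K c (frame c)) \<and>
     M \<subseteq> model_space K \<and> x0 \<in> M \<and> exp_ball K x0 Rg \<subseteq> M \<and> N \<subseteq> M \<and>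
     twice_differentiable K M F G \<and>
     xs \<in> M \<and> (\<forall>y\<in>M. F xs \<le> F y) \<and>
     0 < Rg \<and> rdist K x0 xs \<le> Rg"

text \<open>Total correctness together with a bound B on the number of gradient calls.\<close>

definition solves ::
  "('a point \<Rightarrow> nat \<Rightarrow> bool) \<Rightarrow> 'a::euclidean_space point set \<Rightarrow> ('a point \<Rightarrow> real) \<Rightarrow> 'a point \<Rightarrow>
   real \<Rightarrow> real \<Rightarrow> bool"
where
  "solves run M F xs \<epsilon> B \<longleftrightarrow>
     (\<exists>out calls. run out calls) \<and>
     (\<forall>out calls. run out calls \<longrightarrow> out \<in> M \<and> F out - F xs \<le> \<epsilon> \<and> real calls \<le> B)"

text \<open>
  The absolute constant and the exponent of the logarithmic factor hidden in the asymptotic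
  notation. They are numerals rather than existentially quantified because a bound variable could
  depend on the type 'a, hence on the dimension. Their size is immaterial.
\<close>

definition hidden :: "real \<Rightarrow> real" where
  "hidden x = 10 ^ 30 * ln (2 + x) ^ 10"

end

theory Submission
  imports Defs
begin

text \<open>
  In the gnomonic or Beltrami--Klein chart centred at \<open>c\<close> geodesics become segments, so a g-convex
  function becomes tilted-convex: it satisfies the gradient inequality up to a factor in
  \<open>[gamma_p, 1/gamma_n]\<close> in front of the gradient term. The mirror-prox iteration of Algorithm 1 needs, at
  every step, a factor for which the gradient inequality holds between consecutive iterates; the continuous
  slope changes sign between the two extreme factors, so bisection finds one, and the usual potential argument
  gives the accelerated rate in a ball of radius at most 1.

  The delicate point of the boosting argument is that all queries stay where \<open>F\<close> is known to be regular. An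
  approximate minimizer over a ball that does not reach the global minimizer \<open>xs\<close> is closer to \<open>xs\<close> than the
  centre was, since otherwise a short move towards \<open>xs\<close> would stay in the ball and decrease \<open>F\<close> by more than
  the accuracy. Hence the distances to \<open>xs\<close> never exceed their initial bound, and comparison with the point of
  the ball on the geodesic to \<open>xs\<close> contracts the gap by \<open>1 - R / Rg\<close> in each step.

  For g-convex \<open>F\<close> the Hessian comparison for \<open>d\<^sup>2 / 2\<close> makes the regularised functions smooth and strongly
  g-convex. Their minimizers lie within \<open>Rg\<close> of \<open>x0\<close> and consecutive ones within a fixed fraction of \<open>Rg\<close> of
  each other, so every round starts within \<open>Rg\<close> of its minimizer.
\<close>

section \<open>Geodesics and triangles in the model spaces\<close>

text \<open>Chart distortion is bounded by absolute constants only on balls of bounded radius, where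
  cosh r \<le> 31/20 or cos r \<ge> 7/8; this is why the global problem is cut into balls. The
  obstacle is that the Lipschitz constant of the chart gradient depends on the size of the gradient
  of \<open>F\<close> in the ball, not only on \<open>L\<close>, while regularity is assumed on a
  bounded set. A bound of the form \<open>nrm (G p)\<close> \<le> C L d(p, xs) is extracted from the
  two quadratic inequalities along geodesics. On the sphere a fixed amount of room is kept around
  each query, and one geodesic step gives the bound. In hyperbolic space queries may approach the
  boundary, so the bound is carried from \<open>xs\<close> to p by arbitrarily short steps. The
  power 3/2 of zeta is one factor from the number of balls and a square root from the factor Rg + 1
  in the Lipschitz constant. Both curvatures share one calculus through \<open>cs\<close> and
  \<open>sn\<close>; the sign of \<open>K\<close> is split only where monotonicity or numerical
  bounds enter.\<close>

definition cs :: "real \<Rightarrow> real \<Rightarrow> real" where "cs K t = (if K > 0 then cos t else cosh t)"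
definition sn :: "real \<Rightarrow> real \<Rightarrow> real" where "sn K t = (if K > 0 then sin t else sinh t)"

lemma cs_sn_simps [simp]:
  "cs 1 t = cos t" "cs (-1) t = cosh t" "sn 1 t = sin t" "sn (-1) t = sinh t"
  by (auto simp: cs_def sn_def)

lemma cs_0 [simp]: "cs K 0 = 1" and sn_0 [simp]: "sn K 0 = 0"
  by (auto simp: cs_def sn_def)

lemma cs_minus [simp]: "cs K (- t) = cs K t" and sn_minus [simp]: "sn K (- t) = - sn K t"
  by (auto simp: cs_def sn_def)

lemma cs_abs [simp]: "cs K \<bar>t\<bar> = cs K t"
  by (auto simp: abs_if)

lemma form_commute: "form K p q = form K q p"
  by (simp add: form_def inner_commute mult.commute)

lemma form_add_left: "form K (p + p') q = form K p q + form K p' q"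
  and form_add_right: "form K q (p + p') = form K q p + form K q p'"
  and form_diff_left: "form K (p - p') q = form K p q - form K p' q"
  and form_diff_right: "form K q (p - p') = form K q p - form K q p'"
  and form_scale_left: "form K (a *\<^sub>R p) q = a * form K p q"
  and form_scale_right: "form K q (a *\<^sub>R p) = a * form K q p"
  and form_minus_left: "form K (- p) q = - form K p q"
  and form_minus_right: "form K q (- p) = - form K q p"
  and form_zero_left: "form K 0 q = 0"
  and form_zero_right: "form K q 0 = 0"
  by (auto simp: form_def algebra_simps inner_add_left inner_add_right inner_diff_left inner_diff_right)

lemmas form_simps = form_add_left form_add_right form_diff_left form_diff_right
  form_scale_left form_scale_right form_minus_left form_minus_right form_zero_left form_zero_right

lemma form_sum_right: "form K q (\<Sum>i\<in>I. f i) = (\<Sum>i\<in>I. form K q (f i))"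
  by (induction I rule: infinite_finite_induct) (auto simp: form_simps)

text \<open>\<open>gpt K p e\<close> is the geodesic through \<open>p\<close> with unit velocity \<open>e\<close>, and \<open>gtan K p e\<close> its velocity.\<close>

definition gpt :: "real \<Rightarrow> 'a::euclidean_space point \<Rightarrow> 'a point \<Rightarrow> real \<Rightarrow> 'a point" where
  "gpt K p e t = cs K t *\<^sub>R p + sn K t *\<^sub>R e"

definition gtan :: "real \<Rightarrow> 'a::euclidean_space point \<Rightarrow> 'a point \<Rightarrow> real \<Rightarrow> 'a point" where
  "gtan K p e t = (- K * sn K t) *\<^sub>R p + cs K t *\<^sub>R e"

definition utan :: "real \<Rightarrow> 'a::euclidean_space point \<Rightarrow> 'a point \<Rightarrow> bool" where
  "utan K p e \<longleftrightarrow> e \<in> tangent K p \<and> form K e e = 1"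

lemma gpt_0 [simp]: "gpt K p e 0 = p" and gtan_0 [simp]: "gtan K p e 0 = e"
  by (auto simp: gpt_def gtan_def)

text \<open>The frames are input of the algorithms, so they are fixed together with
  \<open>K\<close>. They also carry the inner product of \<open>'a\<close> to every tangent space,
  which is how positivity and Cauchy--Schwarz are obtained there although the ambient form is
  indefinite for K = -1.\<close>

locale space_form =
  fixes K :: real and fr :: "'a::euclidean_space point \<Rightarrow> 'a \<Rightarrow> 'a point"
  assumes K: "K = 1 \<or> K = -1"
    and frames: "\<And>c. c \<in> model_space K \<Longrightarrow> is_frame K c (fr c)"
begin

abbreviation S where "S \<equiv> model_space K :: 'a point set"
abbreviation d where "d \<equiv> rdist K :: 'a point \<Rightarrow> 'a point \<Rightarrow> real"
abbreviation nrm where "nrm \<equiv> rnorm K :: 'a point \<Rightarrow> real"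
abbreviation ip where "ip \<equiv> form K :: 'a point \<Rightarrow> 'a point \<Rightarrow> real"

lemma K_unit_simps [simp]: "K * K = 1" "K\<^sup>2 = 1" "K * (K * x) = x" "K \<noteq> 0" "\<bar>K\<bar> = 1"
  using K by auto

lemma cs_sn_sq: "(cs K t)\<^sup>2 + K * (sn K t)\<^sup>2 = 1"
  using K by (auto simp: cosh_square_eq)

lemma sn_sq: "(sn K t)\<^sup>2 = K * (1 - (cs K t)\<^sup>2)"
  using K by (auto simp: cosh_square_eq sin_squared_eq)

lemma cs_add: "cs K (a + b) = cs K a * cs K b - K * (sn K a * sn K b)"
  using K by (auto simp: cos_add cosh_add)

lemma sn_add: "sn K (a + b) = sn K a * cs K b + cs K a * sn K b"
  using K by (auto simp: sin_add sinh_add)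

lemma cs_diff: "cs K (a - b) = cs K a * cs K b + K * (sn K a * sn K b)"
  using cs_add[of a "-b"] by simp

lemma sn_diff: "sn K (a - b) = sn K a * cs K b - cs K a * sn K b"
  using sn_add[of a "-b"] by simp

lemma sn_pos: "0 < t \<Longrightarrow> (0 < K \<Longrightarrow> t < pi) \<Longrightarrow> 0 < sn K t"
  using K by (auto simp: sin_gt_zero)

lemma sn_nonneg: "0 \<le> t \<Longrightarrow> (0 < K \<Longrightarrow> t \<le> pi) \<Longrightarrow> 0 \<le> sn K t"
  using K by (auto simp: sin_ge_zero)

lemma cs_inj: "cs K a = cs K b \<Longrightarrow> 0 \<le> a \<Longrightarrow> 0 \<le> b \<Longrightarrow> (0 < K \<Longrightarrow> a \<le> pi \<and> b \<le> pi) \<Longrightarrow> a = b"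
  using K cos_inj_pi[of a b] by (auto simp: order_antisym dest: arg_cong[of _ _ arcosh] simp: arcosh_cosh_real)

lemma cs_pos: "(0 < K \<Longrightarrow> \<bar>t\<bar> < pi/2) \<Longrightarrow> 0 < cs K t"
  using K cos_gt_zero_pi[of t] by auto

lemma model_form: "p \<in> S \<Longrightarrow> ip p p = K"
  by (simp add: model_space_def)

lemma frame_linear: "p \<in> S \<Longrightarrow> linear (fr p)"
  and frame_tangent: "p \<in> S \<Longrightarrow> ip p (fr p u) = 0"
  and frame_form: "p \<in> S \<Longrightarrow> ip (fr p u) (fr p w) = u \<bullet> w"
  using frames unfolding is_frame_def tangent_def by auto

lemma frame_tangent': "p \<in> S \<Longrightarrow> ip (fr p u) p = 0"
  using frame_tangent form_commute by metis

text \<open>The map sending (u, s) to \<open>fr p u + s *\<^sub>R p\<close> is a linear endomorphism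
  of the ambient space. It is injective, since pairing with \<open>p\<close> recovers s and the
  isometry of the frame recovers u; hence it is onto.\<close>

lemma tangential_decomposition:
  assumes "p \<in> S"
  shows "\<exists>u. q = fr p u + (K * ip p q) *\<^sub>R p"
proof -
  define f :: "'a point \<Rightarrow> 'a point" where "f z = fr p (fst z) + snd z *\<^sub>R p" for z
  interpret A: linear "fr p" by (rule frame_linear[OF assms])
  have lin: "linear f"
    unfolding f_def by (rule linearI) (auto simp: A.add A.scale algebra_simps)
  have "inj f"
  proof (rule linear_injective_0[OF lin, THEN iffD2], intro allI impI)
    fix z assume z: "f z = 0"
    have 1: "ip p (f z) = snd z * K"
      using assms by (simp add: f_def form_simps frame_tangent model_form)
    then have s: "snd z = 0" using z by (simp add: form_simps)
    have "ip (f z) (f z) = fst z \<bullet> fst z"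
      using s assms by (simp add: f_def frame_form)
    then have "fst z = 0" using z by (simp add: form_simps)
    with s show "z = 0" by (simp add: prod_eq_iff)
  qed
  then have "surj f" using lin linear_injective_imp_surjective by blast
  then obtain z where z: "q = f z" by (metis surjD)
  have "ip p q = snd z * K"
    using assms by (simp add: z f_def form_simps frame_tangent model_form)
  then have "snd z = K * ip p q" by (simp add: algebra_simps)
  then show ?thesis using z f_def by metis
qed

lemma tangent_frame:
  assumes "p \<in> S" "v \<in> tangent K p"
  shows "\<exists>u. v = fr p u"
  using tangential_decomposition[OF assms(1), of v] assms(2) by (auto simp: tangent_def)

lemma tangent_form_nonneg: "p \<in> S \<Longrightarrow> v \<in> tangent K p \<Longrightarrow> 0 \<le> ip v v"
  using tangent_frame[of p v] by (auto simp: frame_form)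

lemma tangent_form_eq_0: "p \<in> S \<Longrightarrow> v \<in> tangent K p \<Longrightarrow> ip v v = 0 \<Longrightarrow> v = 0"
  using tangent_frame[of p v] frame_linear[of p] by (auto simp: frame_form linear_0)

lemma nrm_sq: "p \<in> S \<Longrightarrow> v \<in> tangent K p \<Longrightarrow> (nrm v)\<^sup>2 = ip v v"
  using tangent_form_nonneg[of p v] by (simp add: rnorm_def)

lemma nrm_nonneg: "p \<in> S \<Longrightarrow> v \<in> tangent K p \<Longrightarrow> 0 \<le> nrm v"
  using tangent_form_nonneg[of p v] by (simp add: rnorm_def)

lemma tangent_CS:
  assumes "p \<in> S" "v \<in> tangent K p" "w \<in> tangent K p"
  shows "\<bar>ip v w\<bar> \<le> nrm v * nrm w"
proof -
  obtain a b where "v = fr p a" "w = fr p b" using tangent_frame assms by blast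
  then show ?thesis
    using Cauchy_Schwarz_ineq2[of a b] assms
    by (simp add: frame_form rnorm_def norm_eq_sqrt_inner)
qed

lemma tangent_scale: "v \<in> tangent K p \<Longrightarrow> a *\<^sub>R v \<in> tangent K p"
  by (simp add: tangent_def form_simps)

lemma nrm_scale: "nrm (a *\<^sub>R v) = \<bar>a\<bar> * nrm v"
  by (simp add: rnorm_def form_simps real_sqrt_mult power2_eq_square[symmetric] mult.assoc[symmetric])

text \<open>Cauchy--Schwarz in the first components gives |fst p . fst q| < |snd p * snd q|, so the
  product of the last coordinates decides the sign of the form.\<close>

lemma hyperbolic_sheet:
  assumes "K = -1" "p \<in> S" "ip q q = -1"
  shows "snd q > 0 \<longleftrightarrow> ip p q < 0" "ip p q \<noteq> 0"
proof -
  have p: "fst p \<bullet> fst p = (snd p)\<^sup>2 - 1" "snd p > 0"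
    using assms by (auto simp: model_space_def form_def power2_eq_square)
  have q: "fst q \<bullet> fst q = (snd q)\<^sup>2 - 1"
    using assms by (auto simp: form_def power2_eq_square)
  have "(fst p \<bullet> fst q)\<^sup>2 \<le> (fst p \<bullet> fst p) * (fst q \<bullet> fst q)"
    by (rule Cauchy_Schwarz_ineq)
  also have "\<dots> = (snd p * snd q)\<^sup>2 - (snd p)\<^sup>2 - (fst q \<bullet> fst q)"
    unfolding p q by (simp add: algebra_simps power2_eq_square)
  also have "\<dots> < (snd p * snd q)\<^sup>2"
    using p(2) inner_ge_zero[of "fst q"] zero_less_power[of "snd p" 2] by linarith
  finally have "(fst p \<bullet> fst q)\<^sup>2 < (snd p * snd q)\<^sup>2" .
  then have *: "\<bar>fst p \<bullet> fst q\<bar> < \<bar>snd p * snd q\<bar>"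
    by (simp add: abs_le_square_iff[symmetric] not_le[symmetric])
  show "snd q > 0 \<longleftrightarrow> ip p q < 0" "ip p q \<noteq> 0"
    using * p(2) assms(1) zero_less_mult_iff[of "snd p" "snd q"]
    by (auto simp: form_def)
qed

text \<open>Evaluating the form on the decomposition of \<open>q\<close> at \<open>p\<close> gives K
  = |u|^2 + K (ip p q)^2; the sign of K turns this into an upper or a lower bound on (ip p
  q)^2.\<close>

lemma form_range:
  assumes "p \<in> S" "q \<in> S"
  shows "0 < K \<Longrightarrow> \<bar>ip p q\<bar> \<le> 1" "K = -1 \<Longrightarrow> ip p q \<le> -1"
proof -
  obtain u where u: "q = fr p u + (K * ip p q) *\<^sub>R p" using tangential_decomposition assms(1) by blast
  have "K = ip (fr p u + (K * ip p q) *\<^sub>R p) (fr p u + (K * ip p q) *\<^sub>R p)"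
    using model_form[OF assms(2)] u by simp
  also have "\<dots> = u \<bullet> u + K * (ip p q)\<^sup>2"
    using assms K
    by (auto simp: form_simps frame_form frame_tangent frame_tangent' model_form power2_eq_square)
  finally have *: "K = u \<bullet> u + K * (ip p q)\<^sup>2" .
  show "\<bar>ip p q\<bar> \<le> 1" if "0 < K"
  proof -
    have "K = 1" using that K by auto
    then have "(ip p q)\<^sup>2 = 1 - u \<bullet> u" using * by auto
    then have "(ip p q)\<^sup>2 \<le> 1" using inner_ge_zero[of u] by linarith
    then show ?thesis by (simp add: abs_square_le_1)
  qed
  assume K': "K = -1"
  then have "(ip p q)\<^sup>2 = 1 + u \<bullet> u" using * by auto
  then have "1 \<le> (ip p q)\<^sup>2" using inner_ge_zero[of u] by linarith
  moreover have "ip p q < 0"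
    using hyperbolic_sheet(1)[OF K' assms(1), of q] assms(2) K' by (auto simp: model_space_def)
  ultimately show "ip p q \<le> -1"
    using abs_le_square_iff[of 1 "ip p q"] by auto
qed

lemma d_nonneg: "p \<in> S \<Longrightarrow> q \<in> S \<Longrightarrow> 0 \<le> d p q"
  and d_le_pi: "p \<in> S \<Longrightarrow> q \<in> S \<Longrightarrow> 0 < K \<Longrightarrow> d p q \<le> pi"
  and cs_d: "p \<in> S \<Longrightarrow> q \<in> S \<Longrightarrow> cs K (d p q) = K * ip p q"
  using form_range[of p q] K
  by (auto simp: rdist_def arccos_lbound arccos_ubound abs_le_iff)

lemma d_unique:
  assumes "p \<in> S" "q \<in> S" "0 \<le> t" "0 < K \<Longrightarrow> t \<le> pi" "cs K t = K * ip p q"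
  shows "d p q = t"
  by (rule cs_inj) (use assms d_nonneg d_le_pi cs_d in auto)

lemma d_commute: "d p q = d q p"
  by (simp add: rdist_def form_commute)

lemma d_self [simp]: "p \<in> S \<Longrightarrow> d p p = 0"
  by (rule d_unique) (auto simp: model_form)

lemma exists_utan: "p \<in> S \<Longrightarrow> \<exists>e. utan K p e"
proof -
  assume "p \<in> S"
  obtain b :: 'a where "b \<in> Basis" using nonempty_Basis by blast
  then have "utan K p (fr p b)"
    using \<open>p \<in> S\<close> by (simp add: utan_def tangent_def frame_tangent frame_form)
  then show ?thesis ..
qed

text \<open>The tangential part of \<open>q\<close> has length \<open>sn K (d p q)\<close>, and
  normalising it gives the direction. If it vanishes, \<open>q\<close> is \<open>p\<close> or its
  antipode, and every unit direction serves.\<close>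

lemma gpt_polar:
  assumes "p \<in> S" "q \<in> S"
  obtains e where "utan K p e" "q = gpt K p e (d p q)"
proof -
  obtain u where u: "q = fr p u + (K * ip p q) *\<^sub>R p" using tangential_decomposition assms(1) by blast
  have "K = ip (fr p u + (K * ip p q) *\<^sub>R p) (fr p u + (K * ip p q) *\<^sub>R p)"
    using model_form[OF assms(2)] u by simp
  also have "\<dots> = u \<bullet> u + K * (K * ip p q)\<^sup>2"
    using assms K
    by (auto simp: form_simps frame_form frame_tangent frame_tangent' model_form power2_eq_square)
  finally have "K = u \<bullet> u + K * (cs K (d p q))\<^sup>2" using cs_d[OF assms] by simp
  then have "u \<bullet> u = (sn K (d p q))\<^sup>2"
    unfolding sn_sq by (simp add: algebra_simps)
  moreover have sn0: "0 \<le> sn K (d p q)" using sn_nonneg d_nonneg d_le_pi assms by blast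
  ultimately have nu: "norm u = sn K (d p q)" by (simp add: norm_eq_sqrt_inner)
  interpret A: linear "fr p" by (rule frame_linear[OF assms(1)])
  show ?thesis
  proof (cases "u = 0")
    case True
    obtain e where "utan K p e" using exists_utan assms(1) by blast
    moreover have "q = gpt K p e (d p q)"
      using u True nu cs_d[OF assms] by (simp add: gpt_def A.zero)
    ultimately show ?thesis using that by blast
  next
    case False
    define e where "e = fr p ((1 / norm u) *\<^sub>R u)"
    have "(1 / norm u) *\<^sub>R u \<bullet> (1 / norm u) *\<^sub>R u = 1"
      using False by (simp add: dot_square_norm power2_eq_square)
    then have "utan K p e"
      unfolding utan_def tangent_def e_def using frame_form[OF assms(1)] frame_tangent[OF assms(1)]
      by (metis mem_Collect_eq)
    moreover have "fr p u = norm u *\<^sub>R e"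
      unfolding e_def A.scale[symmetric] using False by simp
    then have "q = gpt K p e (d p q)"
      using u nu cs_d[OF assms] by (simp add: gpt_def add.commute)
    ultimately show ?thesis using that by blast
  qed
qed

lemma d_eq_0: "p \<in> S \<Longrightarrow> q \<in> S \<Longrightarrow> d p q = 0 \<Longrightarrow> p = q"
  by (metis gpt_polar gpt_0)

context
  fixes p e assumes p: "p \<in> S" and e: "utan K p e"
begin

lemma utan_form: "ip p e = 0" "ip e p = 0" "ip e e = 1"
  using e form_commute[of K p e] by (auto simp: utan_def tangent_def)

lemma gpt_form: "ip (gpt K p e s) (gpt K p e t) = K * cs K (t - s)"
  by (simp add: gpt_def form_simps utan_form model_form[OF p] cs_diff algebra_simps)

lemma gtan_form: "ip (gtan K p e s) (gtan K p e s) = 1"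
proof -
  have "ip (gtan K p e s) (gtan K p e s) = K * (sn K s * sn K s) * (K * K) + cs K s * cs K s"
    unfolding gtan_def by (simp add: form_simps utan_form model_form[OF p] algebra_simps)
  then show ?thesis using cs_sn_sq[of s] by (simp add: power2_eq_square)
qed

lemma gpt_in: "gpt K p e s \<in> S"
proof -
  have f: "ip (gpt K p e s) (gpt K p e s) = K" by (simp add: gpt_form)
  have "snd (gpt K p e s) > 0" if "K = -1"
  proof -
    have "ip p (gpt K p e s) = K * cs K s" using gpt_form[of 0 s] by simp
    then show ?thesis using hyperbolic_sheet[OF that p, of "gpt K p e s"] f that by simp
  qed
  then show ?thesis using f by (simp add: model_space_def)
qed

lemma gtan_tangent: "gtan K p e s \<in> tangent K (gpt K p e s)"
  by (simp add: tangent_def gpt_def gtan_def form_simps utan_form model_form[OF p] algebra_simps)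

lemma gtan_utan: "utan K (gpt K p e s) (gtan K p e s)"
  by (simp add: utan_def gtan_tangent gtan_form)

lemma gpt_shift: "gpt K (gpt K p e s) (gtan K p e s) t = gpt K p e (s + t)"
  by (simp add: gpt_def gtan_def cs_add sn_add algebra_simps)

lemma d_gpt: "(0 < K \<Longrightarrow> \<bar>t - s\<bar> \<le> pi) \<Longrightarrow> d (gpt K p e s) (gpt K p e t) = \<bar>t - s\<bar>"
  by (rule d_unique) (auto simp: gpt_in gpt_form)

lemma rexp_gpt: "rexp K p (t *\<^sub>R e) = gpt K p e t"
proof -
  have "nrm (t *\<^sub>R e) = \<bar>t\<bar>" unfolding nrm_scale by (simp add: rnorm_def utan_form)
  then show ?thesis
    using K by (auto simp: rexp_def gpt_def Let_def abs_if)
qed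

lemma nrm_utan: "nrm (t *\<^sub>R e) = \<bar>t\<bar>"
  unfolding nrm_scale by (simp add: rnorm_def utan_form)

end

lemma rexp_gtan: "p \<in> S \<Longrightarrow> utan K p e \<Longrightarrow> rexp K (gpt K p e s) ((t - s) *\<^sub>R gtan K p e s) = gpt K p e t"
  by (simp add: rexp_gpt[OF gpt_in gtan_utan] gpt_shift)

lemma tangent_polar:
  assumes "p \<in> S" "v \<in> tangent K p"
  obtains e where "utan K p e" "v = nrm v *\<^sub>R e"
proof (cases "v = 0")
  case True
  obtain e where "utan K p e" using exists_utan assms(1) by blast
  moreover have "nrm v = 0" using True by (simp add: rnorm_def form_simps)
  ultimately show ?thesis using that[of e] True by simp
next
  case False
  then have n: "nrm v \<noteq> 0"
    using tangent_form_eq_0[OF assms] nrm_sq[OF assms] by auto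
  define e where "e = (1 / nrm v) *\<^sub>R v"
  have "ip e e = ip v v / (nrm v)\<^sup>2"
    by (simp add: e_def form_simps power2_eq_square)
  then have "ip e e = 1" using n nrm_sq[OF assms] by auto
  then have "utan K p e"
    using tangent_scale[OF assms(2)] by (simp add: e_def utan_def)
  moreover have "v = nrm v *\<^sub>R e" using n by (simp add: e_def)
  ultimately show ?thesis using that by blast
qed

lemma rexp_in: "p \<in> S \<Longrightarrow> v \<in> tangent K p \<Longrightarrow> rexp K p v \<in> S"
  by (metis tangent_polar rexp_gpt gpt_in)

lemma d_rexp: "p \<in> S \<Longrightarrow> v \<in> tangent K p \<Longrightarrow> (0 < K \<Longrightarrow> nrm v \<le> pi) \<Longrightarrow> d p (rexp K p v) = nrm v"
proof -
  assume a: "p \<in> S" "v \<in> tangent K p" "0 < K \<Longrightarrow> nrm v \<le> pi"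
  obtain e where e: "utan K p e" "v = nrm v *\<^sub>R e" using tangent_polar a by blast
  have "rexp K p v = gpt K p e (nrm v)" using rexp_gpt[OF a(1) e(1)] e(2) by metis
  then show ?thesis
    using d_gpt[OF a(1) e(1), of "nrm v" 0] nrm_nonneg[OF a(1,2)] a(3) by simp
qed

text \<open>Regularity is assumed on an \<open>exp_ball\<close>, whereas triangle inequalities speak
  about \<open>rball\<close>. Up to radius pi the exponential map does not travel past the antipode,
  so the length of a vector is the distance it covers.\<close>

lemma exp_ball_eq:
  assumes "p \<in> S" "0 < K \<Longrightarrow> r \<le> pi"
  shows "exp_ball K p r = rball K p r"
proof
  show "exp_ball K p r \<subseteq> rball K p r"
  proof
    fix q assume "q \<in> exp_ball K p r"
    then obtain v where "v \<in> tangent K p" "nrm v \<le> r" "q = rexp K p v"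
      by (auto simp: exp_ball_def)
    then show "q \<in> rball K p r"
      using assms rexp_in[of p v] d_rexp[of p v] by (simp add: rball_def) (metis order_trans)
  qed
  show "rball K p r \<subseteq> exp_ball K p r"
  proof
    fix q assume "q \<in> rball K p r"
    then have q: "q \<in> S" "d p q \<le> r" by (auto simp: rball_def)
    obtain e where e: "utan K p e" "q = gpt K p e (d p q)" using gpt_polar assms q by blast
    have "q = rexp K p (d p q *\<^sub>R e)" using rexp_gpt[OF assms(1) e(1)] e(2) by simp
    moreover have "d p q *\<^sub>R e \<in> tangent K p" using e(1) by (simp add: utan_def tangent_def form_simps)
    moreover have "nrm (d p q *\<^sub>R e) \<le> r"
      using nrm_utan[OF assms(1) e(1)] q d_nonneg[OF assms(1) q(1)] by simp
    ultimately show "q \<in> exp_ball K p r" by (auto simp: exp_ball_def)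
  qed
qed

lemma law_of_cosines:
  assumes "x \<in> S" "utan K x e" "utan K x e'"
  shows "K * ip (gpt K x e b) (gpt K x e' c) = cs K b * cs K c + K * (sn K b * sn K c * ip e e')"
  using assms form_commute[of K e x]
  by (simp add: gpt_def form_simps utan_form model_form algebra_simps)

lemma utan_CS: "x \<in> S \<Longrightarrow> utan K x e \<Longrightarrow> utan K x e' \<Longrightarrow> \<bar>ip e e'\<bar> \<le> 1"
  using tangent_CS[of x e e'] by (simp add: utan_def rnorm_def)

text \<open>The law of cosines at \<open>b\<close> writes \<open>cs K (d a c)\<close> in terms of
  the angle there, and its extreme value is the addition formula for the sum of the two sides. On
  the sphere a sum beyond pi is covered by the diameter.\<close>

lemma d_triangle:
  assumes "a \<in> S" "b \<in> S" "c \<in> S"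
  shows "d a c \<le> d a b + d b c"
proof -
  obtain e where e: "utan K b e" "a = gpt K b e (d b a)" using gpt_polar assms by blast
  obtain e' where e': "utan K b e'" "c = gpt K b e' (d b c)" using gpt_polar assms by blast
  define x y where "x = d b a" and "y = d b c"
  have xy: "0 \<le> x" "0 \<le> y" "0 < K \<Longrightarrow> x \<le> pi" "0 < K \<Longrightarrow> y \<le> pi"
    using d_nonneg d_le_pi assms by (auto simp: x_def y_def)
  have *: "cs K (d a c) = cs K x * cs K y + K * (sn K x * sn K y * ip e e')"
    using law_of_cosines[OF assms(2) e(1) e'(1), of x y] cs_d[OF assms(1,3)] e(2) e'(2)
    by (simp add: x_def y_def)
  have k: "\<bar>ip e e'\<bar> \<le> 1" using utan_CS assms e e' by blast
  have "0 \<le> sn K x * sn K y" using sn_nonneg xy by simp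
  then have m: "sn K x * sn K y * ip e e' \<le> sn K x * sn K y"
      "- (sn K x * sn K y) \<le> sn K x * sn K y * ip e e'"
    using k mult_left_mono[of "ip e e'" 1 "sn K x * sn K y"]
      mult_left_mono[of "-1" "ip e e'" "sn K x * sn K y"] by auto
  have "d a c \<le> x + y"
  proof (cases "K = 1")
    case True
    show ?thesis
    proof (cases "x + y \<le> pi")
      case le: True
      have "cos (d a c) \<ge> cos (x + y)" using * m True by (simp add: cos_add)
      then show ?thesis
        using cos_mono_le_eq[of "x + y" "d a c"] xy le True d_nonneg[OF assms(1,3)] d_le_pi[OF assms(1,3)]
        by auto
    next
      case False
      then show ?thesis using d_le_pi[OF assms(1,3)] True by auto
    qed
  next
    case False
    then have K': "K = -1" using K by auto
    have "cosh (d a c) \<le> cosh (x + y)" using * m K' by (simp add: cosh_add)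
    then show ?thesis
      using cosh_real_nonneg_le_iff[of "d a c" "x + y"] xy d_nonneg[OF assms(1,3)] by auto
  qed
  then show ?thesis by (simp add: x_def y_def d_commute)
qed

text \<open>The definition quantifies over initial velocities of minimising geodesics. On a fixed
  unit-speed geodesic, parameters at most pi apart are joined by such a velocity, and smoothness
  becomes an inequality in one variable.\<close>

lemma smooth_geo:
  assumes "smooth_on K F G L N" "p \<in> S" "utan K p e" "gpt K p e s \<in> N" "gpt K p e t \<in> N"
    "0 < K \<Longrightarrow> \<bar>t - s\<bar> \<le> pi"
  shows "F (gpt K p e t) \<le> F (gpt K p e s) + (t - s) * ip (G (gpt K p e s)) (gtan K p e s) + L / 2 * (t - s)\<^sup>2"
proof -
  let ?v = "(t - s) *\<^sub>R gtan K p e s"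
  have d: "d (gpt K p e s) (gpt K p e t) = \<bar>t - s\<bar>" using d_gpt assms by blast
  have "?v \<in> tangent K (gpt K p e s)" using gtan_tangent assms tangent_scale by blast
  moreover have "rexp K (gpt K p e s) ?v = gpt K p e t" using rexp_gtan assms by blast
  moreover have "nrm ?v = \<bar>t - s\<bar>" using nrm_utan[OF gpt_in gtan_utan] assms by blast
  ultimately show ?thesis
    using assms(1,4,5) d unfolding smooth_on_def by (fastforce simp: form_simps)
qed

lemma convex_geo:
  assumes "strongly_gconvex_on K F G L N" "p \<in> S" "utan K p e" "gpt K p e s \<in> N" "gpt K p e t \<in> N"
    "0 < K \<Longrightarrow> \<bar>t - s\<bar> \<le> pi"
  shows "F (gpt K p e t) \<ge> F (gpt K p e s) + (t - s) * ip (G (gpt K p e s)) (gtan K p e s) + L / 2 * (t - s)\<^sup>2"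
proof -
  let ?v = "(t - s) *\<^sub>R gtan K p e s"
  have d: "d (gpt K p e s) (gpt K p e t) = \<bar>t - s\<bar>" using d_gpt assms by blast
  have "?v \<in> tangent K (gpt K p e s)" using gtan_tangent assms tangent_scale by blast
  moreover have "rexp K (gpt K p e s) ?v = gpt K p e t" using rexp_gtan assms by blast
  moreover have "nrm ?v = \<bar>t - s\<bar>" using nrm_utan[OF gpt_in gtan_utan] assms by blast
  ultimately show ?thesis
    using assms(1,4,5) d unfolding strongly_gconvex_on_def by (fastforce simp: form_simps)
qed

text \<open>Spherical linear interpolation and its hyperbolic analogue. Pairing it with a third
  point expresses the cosine of the distance to that point by the cosines at the two ends of the
  segment; this is the source of all convexity statements about balls.\<close>

lemma gpt_interp:
  "sn K E *\<^sub>R gpt K p e t = sn K (E - t) *\<^sub>R p + sn K t *\<^sub>R gpt K p e E"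
  by (simp add: gpt_def sn_diff algebra_simps)

end

section \<open>The accelerated method for tilted-convex functions\<close>

text \<open>The Fenchel conjugate of half the squared norm restricted to \<open>X\<close>.\<close>

definition dgf_conj :: "'a::euclidean_space set \<Rightarrow> 'a \<Rightarrow> real" where
  "dgf_conj X z = z \<bullet> closest_point X z - (norm (closest_point X z))\<^sup>2 / 2"

text \<open>The projection of z maximises z . w - |w|^2 / 2 over \<open>X\<close>; the obtuse angle
  at the projection yields the quadratic surplus in the last term.\<close>

lemma dgf_conj_ge:
  fixes z :: "'a::euclidean_space"
  assumes "convex X" "closed X" "w \<in> X"
  shows "dgf_conj X z \<ge> z \<bullet> w - (norm w)\<^sup>2 / 2 + (norm (w - closest_point X z))\<^sup>2 / 2"
proof -
  let ?P = "closest_point X z"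
  have "(z - ?P) \<bullet> (w - ?P) \<le> 0" using closest_point_dot[OF assms] by simp
  moreover have "(norm (w - ?P))\<^sup>2 = w \<bullet> w - 2 * (w \<bullet> ?P) + ?P \<bullet> ?P"
    by (simp add: power2_norm_eq_inner inner_diff_left inner_diff_right inner_commute)
  moreover have "(z - ?P) \<bullet> (w - ?P) = z \<bullet> w - z \<bullet> ?P - ?P \<bullet> w + ?P \<bullet> ?P"
    by (simp add: inner_diff_left inner_diff_right)
  ultimately show ?thesis
    unfolding dgf_conj_def power2_norm_eq_inner inner_commute[of "closest_point X z" w] by linarith
qed

text \<open>The mirror-prox step: the extragradient error is absorbed by the two quadratic terms.\<close>

lemma extragradient_step:
  fixes z :: "'a::euclidean_space"
  assumes X: "convex X" "closed X" "X \<noteq> {}"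
    and ze: "ze = z - b *\<^sub>R g0" and z': "z' = z - b *\<^sub>R g1" and b: "0 \<le> b"
    and lip: "norm (g1 - g0) \<le> c * norm (closest_point X ze - closest_point X z)" and bc: "b * c \<le> 1"
  shows "b * (g1 \<bullet> closest_point X ze) \<le> dgf_conj X z - dgf_conj X z'"
proof -
  define P Q P' where "P = closest_point X z" and "Q = closest_point X ze" and "P' = closest_point X z'"
  have in_X: "Q \<in> X" "P' \<in> X" using closest_point_in_set X by (auto simp: Q_def P'_def)
  have 1: "dgf_conj X z \<ge> z \<bullet> Q - (norm Q)\<^sup>2 / 2 + (norm (Q - P))\<^sup>2 / 2"
    unfolding P_def using dgf_conj_ge X in_X by blast
  have 2: "dgf_conj X ze \<ge> ze \<bullet> P' - (norm P')\<^sup>2 / 2 + (norm (P' - Q))\<^sup>2 / 2"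
    unfolding Q_def using dgf_conj_ge X in_X by blast
  have 3: "dgf_conj X ze = ze \<bullet> Q - (norm Q)\<^sup>2 / 2" by (simp add: dgf_conj_def Q_def)
  have 4: "dgf_conj X z' = z' \<bullet> P' - (norm P')\<^sup>2 / 2" by (simp add: dgf_conj_def P'_def)
  have "(g1 - g0) \<bullet> (Q - P') \<le> norm (g1 - g0) * norm (Q - P')" by (rule norm_cauchy_schwarz)
  also have "\<dots> \<le> c * norm (Q - P) * norm (Q - P')"
    using lip by (intro mult_right_mono) (auto simp: P_def Q_def)
  finally have "b * ((g1 - g0) \<bullet> (Q - P')) \<le> b * (c * norm (Q - P) * norm (Q - P'))"
    using b by (rule mult_left_mono)
  also have "\<dots> = (b * c) * (norm (Q - P) * norm (Q - P'))" by (simp add: algebra_simps)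
  also have "\<dots> \<le> 1 * (norm (Q - P) * norm (Q - P'))"
    using bc by (intro mult_right_mono) auto
  also have "\<dots> \<le> (norm (Q - P))\<^sup>2 / 2 + (norm (P' - Q))\<^sup>2 / 2"
    using sum_squares_bound[of "norm (Q - P)" "norm (P' - Q)"] by (simp add: norm_minus_commute)
  finally have 5: "b * ((g1 - g0) \<bullet> (Q - P')) \<le> (norm (Q - P))\<^sup>2 / 2 + (norm (P' - Q))\<^sup>2 / 2" .
  \<comment> \<open>Inequality 1 tests the conjugate at \<open>z\<close> with \<open>Q\<close>,
    inequality 2 tests it at \<open>ze\<close> with \<open>P'\<close>. Eliminating
    \<open>dgf_conj X ze\<close> by 3 leaves this expression, whose only error is the gradient
    difference bounded in 5.\<close>
  have "z \<bullet> Q - ze \<bullet> Q + ze \<bullet> P' - z' \<bullet> P' = b * (g1 \<bullet> Q) - b * ((g1 - g0) \<bullet> (Q - P'))"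
    unfolding ze z' by (simp add: inner_diff_left inner_diff_right algebra_simps)
  then show ?thesis using 1 2 3 4 5 by (simp add: Q_def)
qed

text \<open>Here h is the tolerance: whatever lies within h of a zero of s is accepted. The retained
  half always has a sign change, hence contains a zero, and once its half-length is at most h its
  midpoint must be accepted. So m halvings of an interval of length at most 2^m h suffice.\<close>

lemma bisection_props:
  fixes s :: "real \<Rightarrow> real"
  assumes "continuous_on {l..u} s" "l < u" "s l < 0" "0 < s u" "u - l \<le> 2 ^ m * h" "1 \<le> m"
    and acc: "\<And>x y. x \<in> {l..u} \<Longrightarrow> y \<in> {l..u} \<Longrightarrow> s x = 0 \<Longrightarrow> \<bar>y - x\<bar> \<le> h \<Longrightarrow> acc y"
    and h: "0 < h"
  shows "(\<exists>t n. bisection acc s l u t n) \<and>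
     (\<forall>t n. bisection acc s l u t n \<longrightarrow> t \<in> {l..u} \<and> acc t \<and> n \<le> m)"
  using assms
proof (induction m arbitrary: l u)
  case 0 then show ?case by simp
next
  case (Suc m)
  define w where "w = (l + u) / 2"
  have w: "l < w" "w < u" "w - l = (u - l) / 2" "u - w = (u - l) / 2"
    using Suc.prems(2) by (auto simp: w_def field_simps)
  obtain x where x: "x \<in> {l..u}" "s x = 0"
    using IVT'[of s l 0 u] Suc.prems by (auto simp: less_imp_le)
  \<comment> \<open>A slope of exactly 0 passes neither strict sign test of
    \<open>bisection\<close>, so a run reaching it could only stop; it does, being a zero
    itself.\<close>
  have wacc: "acc w" if "s w = 0"
    using Suc.prems(7)[of w w] that w h by auto
  show ?case
  proof (cases "acc w")
    case True
    have "bisection acc s l u w 1" unfolding w_def using True by (intro bisection.stop) (simp add: w_def)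
    moreover have "t = w \<and> n = 1" if "bisection acc s l u t n" for t n
      using that by cases (use True in \<open>simp_all add: w_def\<close>)
    ultimately show ?thesis using w True by (metis Suc.prems(6) atLeastAtMost_iff less_imp_le)
  next
    case False
    have m1: "1 \<le> m"
    proof (rule ccontr)
      assume "\<not> 1 \<le> m"
      then have "m = 0" by simp
      then have "(u - l) / 2 \<le> h" using Suc.prems(5) by simp
      moreover have "\<bar>w - x\<bar> \<le> (u - l) / 2"
        using x w(3,4) unfolding atLeastAtMost_iff by linarith
      ultimately have "acc w" using Suc.prems(7)[of x w] x w by auto
      then show False using False by simp
    qed
    have sw: "s w \<noteq> 0" using False wacc by blast
    show ?thesis
    proof (cases "s w > 0")
      case pos: True
      have IH: "(\<exists>t n. bisection acc s l w t n) \<and>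
         (\<forall>t n. bisection acc s l w t n \<longrightarrow> t \<in> {l..w} \<and> acc t \<and> n \<le> m)"
      proof (rule Suc.IH)
        show "continuous_on {l..w} s" using Suc.prems(1) w by (rule_tac continuous_on_subset) auto
        show "w - l \<le> 2 ^ m * h" using Suc.prems(5) w by simp
        show "acc y" if "x \<in> {l..w}" "y \<in> {l..w}" "s x = 0" "\<bar>y - x\<bar> \<le> h" for x y
          using Suc.prems(7)[of x y] that w by auto
      qed (use w pos Suc.prems m1 h in auto)
      have st: "bisection acc s l u t (Suc n)" if "bisection acc s l w t n" for t n
        using that False pos Suc.prems(3)
        by (intro bisection.left) (auto simp: w_def mult_neg_pos)
      have inv: "\<exists>n'. n = Suc n' \<and> bisection acc s l w t n'" if "bisection acc s l u t n" for t n
        using that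
      proof cases
        case stop then show ?thesis using False by (simp add: w_def)
      next
        case left then show ?thesis by (auto simp: w_def)
      next
        case right
        then have "s w * s u < 0" by (simp add: w_def)
        then show ?thesis using pos Suc.prems(4) by (simp add: mult_less_0_iff)
      qed
      have ex: "\<exists>t n. bisection acc s l u t n" using IH st by blast
      have "t \<in> {l..u} \<and> acc t \<and> n \<le> Suc m" if b: "bisection acc s l u t n" for t n
      proof -
        obtain n' where "n = Suc n'" "bisection acc s l w t n'" using inv[OF b] by blast
        then have "t \<in> {l..w} \<and> acc t \<and> n' \<le> m" "n = Suc n'" using IH by blast+
        then show ?thesis using w by simp
      qed
      then show ?thesis using ex by blast
    next
      case False
      then have neg: "s w < 0" using sw by simp
      have nacc: "\<not> acc w" by fact
      have IH: "(\<exists>t n. bisection acc s w u t n) \<and>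
         (\<forall>t n. bisection acc s w u t n \<longrightarrow> t \<in> {w..u} \<and> acc t \<and> n \<le> m)"
      proof (rule Suc.IH)
        show "continuous_on {w..u} s" using Suc.prems(1) w by (rule_tac continuous_on_subset) auto
        show "u - w \<le> 2 ^ m * h" using Suc.prems(5) w by simp
        show "acc y" if "x \<in> {w..u}" "y \<in> {w..u}" "s x = 0" "\<bar>y - x\<bar> \<le> h" for x y
          using Suc.prems(7)[of x y] that w by auto
      qed (use w neg Suc.prems m1 h in auto)
      have st: "bisection acc s l u t (Suc n)" if "bisection acc s w u t n" for t n
        using that nacc neg Suc.prems(4)
        by (intro bisection.right) (auto simp: w_def mult_neg_pos)
      have inv: "\<exists>n'. n = Suc n' \<and> bisection acc s w u t n'" if "bisection acc s l u t n" for t n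
        using that
      proof cases
        case stop then show ?thesis using nacc by (simp add: w_def)
      next
        case right then show ?thesis by (auto simp: w_def)
      next
        case left
        then have "s l * s w < 0" by (simp add: w_def)
        then show ?thesis using neg Suc.prems(3) by (simp add: mult_less_0_iff)
      qed
      have ex: "\<exists>t n. bisection acc s l u t n" using IH st by blast
      have "t \<in> {l..u} \<and> acc t \<and> n \<le> Suc m" if b: "bisection acc s l u t n" for t n
      proof -
        obtain n' where "n = Suc n'" "bisection acc s w u t n'" using inv[OF b] by blast
        then have "t \<in> {w..u} \<and> acc t \<and> n' \<le> m" "n = Suc n'" using IH by blast+
        then show ?thesis using w by simp
      qed
      then show ?thesis using ex by blast
    qed
  qed
qed

text \<open>If both ends are rejected, \<open>lo\<close> and \<open>up\<close> force s l < 0 < s u,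
  which is the sign change that the bisection starts from.\<close>

lemma line_search_props:
  fixes s :: "real \<Rightarrow> real"
  assumes "continuous_on {l..u} s" "l < u" "u - l \<le> 2 ^ m * h" "1 \<le> m"
    and acc: "\<And>x y. x \<in> {l..u} \<Longrightarrow> y \<in> {l..u} \<Longrightarrow> s x = 0 \<Longrightarrow> \<bar>y - x\<bar> \<le> h \<Longrightarrow> acc y"
    and h: "0 < h"
    and lo: "0 \<le> s l \<Longrightarrow> acc l" and up: "s u \<le> 0 \<Longrightarrow> acc u"
  shows "(\<exists>t n. line_search acc s l u t n) \<and>
     (\<forall>t n. line_search acc s l u t n \<longrightarrow> t \<in> {l..u} \<and> acc t \<and> n \<le> 2 + m)"
proof (cases "acc l \<or> acc u")
  case True
  then have "\<exists>t n. line_search acc s l u t n"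
    using line_search.first_end[of acc l s u] line_search.second_end[of acc l u s] by blast
  moreover have "t \<in> {l..u} \<and> acc t \<and> n \<le> 2 + m" if "line_search acc s l u t n" for t n
    using that by cases (use True assms in auto)
  ultimately show ?thesis by blast
next
  case False
  then have s: "s l < 0" "0 < s u" using lo up by force+
  have B: "(\<exists>t n. bisection acc s l u t n) \<and>
     (\<forall>t n. bisection acc s l u t n \<longrightarrow> t \<in> {l..u} \<and> acc t \<and> n \<le> m)"
    using bisection_props[of l u s m h acc] assms s by blast
  have "\<exists>t n. line_search acc s l u t n"
    using B line_search.bisect[of acc l u s] False by blast
  moreover have "t \<in> {l..u} \<and> acc t \<and> n \<le> 2 + m" if "line_search acc s l u t n" for t n
    using that by cases (use False B in auto)
  ultimately show ?thesis by blast
qed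

text \<open>In particular the constant A_N in the error term of the line search is
  \<open>step_sum\<close> at N.\<close>

lemma step_sum_eq: "step_sum gn gp Lt i = real i * (real i + 1) * gn\<^sup>2 * gp / (4 * Lt)"
proof (induction i)
  case (Suc i)
  have eq: "step_sum gn gp Lt (Suc i) = step_sum gn gp Lt i + step_size gn gp Lt (Suc i)"
    by (simp add: step_sum_def)
  show ?case unfolding eq Suc step_size_def by (cases "Lt = 0") (auto simp: field_simps)
qed (simp add: step_sum_def)

text \<open>This is what remains of g-convexity and smoothness in the chart: the factor \<theta> in
  the gradient inequality may change from pair to pair, and only its range is known. Quantitatively,
  \<open>\<tau>\<close> and \<open>gm\<close> affect just the number of bisection trials; the number
  of iterations is governed by \<open>Lt\<close>, \<open>gn\<close> and \<open>gp\<close>.\<close>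

locale tilted =
  fixes f :: "'a::euclidean_space \<Rightarrow> real" and gf :: "'a \<Rightarrow> 'a" and X :: "'a set" and \<tau> gn gp Lt gm :: real
  assumes X: "convex X" "compact X" "0 \<in> X" "\<And>x. x \<in> X \<Longrightarrow> norm x \<le> \<tau>"
    and gn: "0 < gn" "gn \<le> 1" and gp: "0 < gp" "gp \<le> 1" and Lt: "0 < Lt" and \<tau>: "0 < \<tau>"
    and tilt: "\<And>x y. x \<in> X \<Longrightarrow> y \<in> X \<Longrightarrow> \<exists>\<theta>. gp \<le> \<theta> \<and> \<theta> \<le> 1 / gn \<and> f y \<ge> f x + \<theta> * (gf x \<bullet> (y - x))"
    and lip: "\<And>x y. x \<in> X \<Longrightarrow> y \<in> X \<Longrightarrow> norm (gf x - gf y) \<le> Lt * norm (x - y)"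
    and gm: "\<And>x. x \<in> X \<Longrightarrow> norm (gf x) \<le> gm"
begin

abbreviation P where "P \<equiv> closest_point X"

lemma cX: "closed X" "X \<noteq> {}" using X compact_imp_closed by auto

lemma P_in: "P z \<in> X" using closest_point_in_set cX by blast

lemma P_lip: "norm (P x - P y) \<le> norm (x - y)"
  using closest_point_lipschitz[OF X(1) cX, of x y] by (simp add: dist_norm)

lemma X_diff: "x \<in> X \<Longrightarrow> y \<in> X \<Longrightarrow> norm (x - y) \<le> 2 * \<tau>"
  using X(4)[of x] X(4)[of y] norm_triangle_ineq4[of x y] by linarith

lemma gm_nonneg: "0 \<le> gm" using gm[OF X(3)] norm_ge_zero order_trans by blast

lemma comb_in: "x \<in> X \<Longrightarrow> y \<in> X \<Longrightarrow> 0 \<le> l \<Longrightarrow> l \<le> 1 \<Longrightarrow> (1 - l) *\<^sub>R x + l *\<^sub>R y \<in> X"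
  using X(1) by (simp add: convex_alt)

lemma next_x_in: "x \<in> X \<Longrightarrow> 0 \<le> l \<Longrightarrow> l \<le> 1 \<Longrightarrow> next_x gf X b x z l \<in> X"
  by (simp add: next_x_def Let_def comb_in P_in)

text \<open>Although \<theta> is unknown, an extreme factor is always safe once the sign of the
  slope is known: 1/gn for a nonnegative slope, gp for a nonpositive one (\<open>tilt_down\<close>).
  These are the two ends of the line search.\<close>

lemma tilt_up:
  assumes "x \<in> X" "y \<in> X" "0 \<le> gf y \<bullet> (y - x)"
  shows "f y - f x \<le> (1 / gn) * (gf y \<bullet> (y - x))"
proof -
  obtain \<theta> where \<theta>: "\<theta> \<le> 1 / gn" "f x \<ge> f y + \<theta> * (gf y \<bullet> (x - y))" using tilt[OF assms(2,1)] by blast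
  have "gf y \<bullet> (x - y) = - (gf y \<bullet> (y - x))" by (simp add: inner_diff_right)
  then have "f y - f x \<le> \<theta> * (gf y \<bullet> (y - x))" using \<theta> by simp
  also have "\<dots> \<le> (1 / gn) * (gf y \<bullet> (y - x))" using \<theta> assms by (intro mult_right_mono) auto
  finally show ?thesis .
qed

lemma tilt_down:
  assumes "x \<in> X" "y \<in> X" "gf y \<bullet> (y - x) \<le> 0"
  shows "f y - f x \<le> gp * (gf y \<bullet> (y - x))"
proof -
  obtain \<theta> where \<theta>: "gp \<le> \<theta>" "f x \<ge> f y + \<theta> * (gf y \<bullet> (x - y))" using tilt[OF assms(2,1)] by blast
  have "gf y \<bullet> (x - y) = - (gf y \<bullet> (y - x))" by (simp add: inner_diff_right)
  then have "f y - f x \<le> \<theta> * (gf y \<bullet> (y - x))" using \<theta> by simp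
  also have "\<dots> \<le> gp * (gf y \<bullet> (y - x))" using \<theta> assms by (intro mult_right_mono_neg) auto
  finally show ?thesis .
qed

lemma f_lip:
  assumes "x \<in> X" "y \<in> X" shows "f y - f x \<le> (gm / gn) * norm (y - x)"
proof (cases "0 \<le> gf y \<bullet> (y - x)")
  case True
  have "gf y \<bullet> (y - x) \<le> gm * norm (y - x)"
    using norm_cauchy_schwarz[of "gf y" "y - x"] gm[OF assms(2)]
    by (meson mult_right_mono norm_ge_zero order_trans)
  then have "(1 / gn) * (gf y \<bullet> (y - x)) \<le> (1 / gn) * (gm * norm (y - x))"
    using gn by (intro mult_left_mono) auto
  then show ?thesis using tilt_up[OF assms True] by simp
next
  case False
  have "f y - f x \<le> 0"
    using tilt_down[OF assms] False gp mult_nonneg_nonpos[of gp "gf y \<bullet> (y - x)"] by auto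
  also have "0 \<le> (gm / gn) * norm (y - x)" using gm_nonneg gn by simp
  finally show ?thesis .
qed

lemma f_continuous: "continuous_on X f"
proof -
  have "(gm / gn)-lipschitz_on X f"
  proof (rule lipschitz_onI)
    fix x y assume xy: "x \<in> X" "y \<in> X"
    show "dist (f x) (f y) \<le> gm / gn * dist x y"
      using f_lip[OF xy] f_lip[OF xy(2,1)] by (auto simp: dist_norm norm_minus_commute abs_le_iff)
  qed (use gm_nonneg gn in auto)
  then show ?thesis by (rule lipschitz_on_continuous_on)
qed

text \<open>Towards a point of no larger value the factor 1/gn can be used without looking at the
  slope: a negative slope would give f x < f y.\<close>

lemma tilt_min:
  assumes "x \<in> X" "y \<in> X" "f y \<le> f x"
  shows "f x - f y \<le> (1 / gn) * (gf x \<bullet> (x - y))"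
proof (cases "0 \<le> gf x \<bullet> (x - y)")
  case True
  then show ?thesis using tilt_up[OF assms(2,1)] by simp
next
  case False
  then have "f x - f y \<le> gp * (gf x \<bullet> (x - y))" using tilt_down[OF assms(2,1)] by simp
  also have "\<dots> < 0" using False gp by (simp add: mult_pos_neg)
  finally show ?thesis using assms(3) by simp
qed

text \<open>The potential is A (f x - f y) plus the Fenchel gap of the dual point z at y. The
  comparison with the minimizer y is weighted by a, the accepted inequality between consecutive
  iterates by A, and \<open>extragradient_step\<close> pays for the linear term at the projected
  point.\<close>

lemma potential_step:
  assumes "x \<in> X" "y \<in> X" "\<And>w. w \<in> X \<Longrightarrow> f y \<le> f w"
    and l: "0 < l" "l \<le> 1" and a: "a = b * gn" and b: "0 \<le> b" and bl: "b * Lt * l \<le> 1"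
    and x': "x' = next_x gf X b x z l" and z': "z' = z - b *\<^sub>R gf x'"
    and acc: "A * (f x' - f x) \<le> (b * (1 - l) / l) * (gf x' \<bullet> (x' - x)) + e"
  shows "(A + a) * (f x' - f y) + dgf_conj X z' - z' \<bullet> y \<le> A * (f x - f y) + dgf_conj X z - z \<bullet> y + e"
proof -
  define chi where "chi = (1 - l) *\<^sub>R x + l *\<^sub>R P z"
  define ze where "ze = z - b *\<^sub>R gf chi"
  have x'2: "x' = (1 - l) *\<^sub>R x + l *\<^sub>R P ze"
    unfolding x' next_x_def chi_def ze_def by (simp add: Let_def)
  have in_X: "chi \<in> X" "x' \<in> X"
    unfolding chi_def x'2 using comb_in[OF assms(1) P_in] l by auto
  have "norm (gf x' - gf chi) \<le> Lt * norm (x' - chi)" using lip in_X by blast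
  also have "x' - chi = l *\<^sub>R (P ze - P z)" by (simp add: x'2 chi_def algebra_simps)
  finally have lp: "norm (gf x' - gf chi) \<le> (Lt * l) * norm (P ze - P z)" using l by simp
  have 1: "b * (gf x' \<bullet> P ze) \<le> dgf_conj X z - dgf_conj X z'"
    by (rule extragradient_step[OF X(1) cX ze_def z' b lp]) (use bl in \<open>simp add: mult.assoc\<close>)
  have "f x' - f y \<le> (1 / gn) * (gf x' \<bullet> (x' - y))"
    using tilt_min[OF in_X(2) assms(2)] assms(3)[OF in_X(2)] by simp
  then have "a * (f x' - f y) \<le> a * ((1 / gn) * (gf x' \<bullet> (x' - y)))"
    using a b gn by (intro mult_left_mono) auto
  then have 2: "a * (f x' - f y) \<le> b * (gf x' \<bullet> (x' - y))" using a gn by simp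
  \<comment> \<open>Both x' - x and x' - P ze are multiples of x - P ze because x' is their convex
    combination. This is what makes the coefficient b (1 - l) / l of the accepted inequality cancel
    exactly.\<close>
  define q where "q = gf x' \<bullet> (x - P ze)"
  have "x' - x = (- l) *\<^sub>R (x - P ze)" by (simp add: x'2 algebra_simps)
  then have "gf x' \<bullet> (x' - x) = - l * q" unfolding q_def by (metis inner_scaleR_right)
  moreover have "x' - P ze = (1 - l) *\<^sub>R (x - P ze)" by (simp add: x'2 algebra_simps)
  then have "gf x' \<bullet> (x' - P ze) = (1 - l) * q" unfolding q_def by (metis inner_scaleR_right)
  ultimately have "b * (gf x' \<bullet> (x' - P ze)) = - (b * (1 - l) / l) * (gf x' \<bullet> (x' - x))"
    using l by simp
  then have 3: "b * (gf x' \<bullet> x') - b * (gf x' \<bullet> P ze) = - (b * (1 - l) / l) * (gf x' \<bullet> (x' - x))"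
    by (simp add: inner_diff_right algebra_simps)
  have "z' \<bullet> y = z \<bullet> y - b * (gf x' \<bullet> y)" unfolding z' by (simp add: inner_diff_left)
  moreover have "gf x' \<bullet> (x' - y) = gf x' \<bullet> x' - gf x' \<bullet> y" by (simp add: inner_diff_right)
  ultimately show ?thesis using 1 2 3 acc by (simp add: algebra_simps)
qed

text \<open>Projections are nonexpansive and \<open>gf\<close> is Lipschitz, so the next iterate
  depends on lambda in a Lipschitz way. Continuity gives a zero of the slope; the constant gives the
  tolerance around it.\<close>

lemma next_x_lip:
  assumes "x \<in> X" "0 \<le> l" "l \<le> 1" "0 \<le> l'" "l' \<le> 1" "0 \<le> b"
  shows "norm (next_x gf X b x z l - next_x gf X b x z l') \<le> 2 * \<tau> * (1 + b * Lt) * \<bar>l - l'\<bar>"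
proof -
  define chi where "chi l = (1 - l) *\<^sub>R x + l *\<^sub>R P z" for l
  define Q where "Q l = P (z - b *\<^sub>R gf (chi l))" for l
  have c: "chi l \<in> X" "chi l' \<in> X" using assms by (auto simp: chi_def comb_in P_in)
  have "norm (Q l - Q l') \<le> norm ((z - b *\<^sub>R gf (chi l)) - (z - b *\<^sub>R gf (chi l')))"
    unfolding Q_def by (rule P_lip)
  also have "\<dots> = norm (b *\<^sub>R (gf (chi l') - gf (chi l)))" by (simp add: algebra_simps)
  also have "\<dots> = b * norm (gf (chi l) - gf (chi l'))" using assms by (simp add: norm_minus_commute)
  also have "\<dots> \<le> b * (Lt * norm (chi l - chi l'))" using lip c assms by (intro mult_left_mono) auto
  also have "chi l - chi l' = (l - l') *\<^sub>R (P z - x)" by (simp add: chi_def algebra_simps)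
  also have "norm \<dots> \<le> \<bar>l - l'\<bar> * (2 * \<tau>)" using X_diff P_in assms by (simp add: mult_left_mono)
  finally have 1: "norm (Q l - Q l') \<le> b * (Lt * (\<bar>l - l'\<bar> * (2 * \<tau>)))"
    using assms Lt by (smt (verit) mult_left_mono)
  have "next_x gf X b x z l - next_x gf X b x z l' = (l - l') *\<^sub>R (Q l - x) + l' *\<^sub>R (Q l - Q l')"
    by (simp add: next_x_def Let_def Q_def chi_def algebra_simps)
  also have "norm \<dots> \<le> \<bar>l - l'\<bar> * norm (Q l - x) + l' * norm (Q l - Q l')"
    using norm_triangle_ineq[of "(l - l') *\<^sub>R (Q l - x)" "l' *\<^sub>R (Q l - Q l')"] assms by simp
  also have "\<dots> \<le> \<bar>l - l'\<bar> * (2 * \<tau>) + 1 * norm (Q l - Q l')"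
    using X_diff P_in assms by (intro add_mono mult_left_mono mult_right_mono) (auto simp: Q_def)
  also have "\<dots> \<le> \<bar>l - l'\<bar> * (2 * \<tau>) + b * (Lt * (\<bar>l - l'\<bar> * (2 * \<tau>)))" using 1 by simp
  finally show ?thesis by (simp add: algebra_simps)
qed

lemma slope_lip:
  assumes "x \<in> X" "0 \<le> l" "l \<le> 1" "0 \<le> l'" "l' \<le> 1" "0 \<le> b"
  shows "\<bar>slope gf X b x z l - slope gf X b x z l'\<bar> \<le> (2 * \<tau> * Lt + gm) * (2 * \<tau> * (1 + b * Lt) * \<bar>l - l'\<bar>)"
proof -
  define u v where "u = next_x gf X b x z l" and "v = next_x gf X b x z l'"
  have uv: "u \<in> X" "v \<in> X" using next_x_in assms by (auto simp: u_def v_def)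
  have "slope gf X b x z l - slope gf X b x z l' = (gf u - gf v) \<bullet> (u - x) + gf v \<bullet> (u - v)"
    by (simp add: slope_def Let_def u_def v_def inner_diff_left inner_diff_right)
  also have "\<bar>\<dots>\<bar> \<le> norm (gf u - gf v) * norm (u - x) + norm (gf v) * norm (u - v)"
    using Cauchy_Schwarz_ineq2[of "gf u - gf v" "u - x"] Cauchy_Schwarz_ineq2[of "gf v" "u - v"] by linarith
  also have "\<dots> \<le> (Lt * norm (u - v)) * (2 * \<tau>) + gm * norm (u - v)"
    using lip uv X_diff assms gm Lt gm_nonneg by (intro add_mono mult_mono) auto
  also have "\<dots> = (2 * \<tau> * Lt + gm) * norm (u - v)" by (simp add: algebra_simps)
  also have "\<dots> \<le> (2 * \<tau> * Lt + gm) * (2 * \<tau> * (1 + b * Lt) * \<bar>l - l'\<bar>)"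
    using next_x_lip[OF assms, of z] \<tau> Lt gm_nonneg unfolding u_def v_def by (intro mult_left_mono) auto
  finally show ?thesis .
qed

lemma slope_continuous:
  assumes "x \<in> X" "0 \<le> b" "0 \<le> l" "u \<le> 1"
  shows "continuous_on {l..u} (slope gf X b x z)"
proof -
  have "((2 * \<tau> * Lt + gm) * (2 * \<tau> * (1 + b * Lt)))-lipschitz_on {l..u} (slope gf X b x z)"
  proof (rule lipschitz_onI)
    fix t t' assume "t \<in> {l..u}" "t' \<in> {l..u}"
    then show "dist (slope gf X b x z t) (slope gf X b x z t') \<le> (2 * \<tau> * Lt + gm) * (2 * \<tau> * (1 + b * Lt)) * dist t t'"
      using slope_lip[OF assms(1), of t t' b z] assms by (simp add: dist_real_def mult.assoc)
  qed (use \<tau> Lt gm_nonneg assms in auto)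
  then show ?thesis by (rule lipschitz_on_continuous_on)
qed

text \<open>Where the slope vanishes, the next iterate has value at most f x by
  \<open>tilt_down\<close>. At distance h from there both the value and the slope have changed by a
  Lipschitz constant times h, and \<open>err\<close> absorbs this. The ends l and u correspond to
  the factors 1/gn and gp; gn * gp < 1 keeps them apart.\<close>

lemma line_search_tilted:
  assumes x: "x \<in> X" and b: "0 < b" and A: "0 < A" and m: "1 \<le> m"
    and h: "h > 0" "1 \<le> 2 ^ m * h"
    and err: "(1 / gn) * (2 * gm + 2 * \<tau> * Lt) * (2 * \<tau> * (1 + b * Lt)) * h \<le> err"
    and gngp: "gn * gp < 1"
  defines "l \<equiv> lam_of b A (1 / gn)" and "u \<equiv> lam_of b A gp"
  shows "(\<exists>t n. line_search (accepts f gf X b A err x z) (slope gf X b x z) l u t n) \<and>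
    (\<forall>t n. line_search (accepts f gf X b A err x z) (slope gf X b x z) l u t n \<longrightarrow>
        t \<in> {l..u} \<and> accepts f gf X b A err x z t \<and> n \<le> 2 + m)"
    and "0 < l" "u \<le> 1"
proof -
  have den: "0 < A * (1 / gn) + b" "0 < A * gp + b" using A b gn gp by (auto intro!: add_pos_pos)
  have lt: "gp < 1 / gn" using gngp gn by (simp add: field_simps)
  show l0: "0 < l" using den b by (simp add: l_def lam_of_def)
  show u1: "u \<le> 1" using den A b gp by (simp add: u_def lam_of_def)
  have lu: "l < u"
    unfolding l_def u_def lam_of_def using den b mult_strict_left_mono[OF lt A]
    by (intro divide_strict_left_mono) (auto intro!: mult_pos_pos)
  have err0: "0 \<le> err"
    using err gn gm_nonneg \<tau> Lt b h by (smt (verit) divide_nonneg_nonneg mult_nonneg_nonneg zero_le_one)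
  have gam_lam: "gam_of b A (lam_of b A g) = g" if "0 < A * g + b" for g
  proof -
    define D where "D = A * g + b"
    have "1 - b / D = A * g / D" using that by (simp add: D_def field_simps)
    then show ?thesis using that A b by (simp add: gam_of_def lam_of_def D_def[symmetric])
  qed
  have gl: "gam_of b A l = 1 / gn" and gu: "gam_of b A u = gp"
    unfolding l_def u_def using den by (auto intro!: gam_lam)
  have gam: "0 \<le> gam_of b A t" "gam_of b A t \<le> 1 / gn" if "t \<in> {l..u}" for t
  proof -
    show "0 \<le> gam_of b A t" using that l0 u1 b A by (auto simp: gam_of_def)
    have "gam_of b A t = (b / A) * (1 / t - 1)"
      using that l0 A by (simp add: gam_of_def field_simps)
    also have "\<dots> \<le> (b / A) * (1 / l - 1)"
      using that l0 b A by (intro mult_left_mono) (auto simp: frac_le)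
    also have "\<dots> = gam_of b A l"
      using l0 A by (simp add: gam_of_def field_simps)
    finally show "gam_of b A t \<le> 1 / gn" by (simp add: gl)
  qed
  let ?s = "slope gf X b x z" and ?n = "next_x gf X b x z"
  have nin: "?n t \<in> X" if "t \<in> {l..u}" for t using that next_x_in x l0 u1 by auto
  have accI: "accepts f gf X b A err x z y"
    if t: "t \<in> {l..u}" "y \<in> {l..u}" "?s t = 0" "\<bar>y - t\<bar> \<le> h" for t y
  proof -
    define D where "D = 2 * \<tau> * (1 + b * Lt) * h"
    have D0: "0 \<le> D" using \<tau> b Lt h by (simp add: D_def)
    have le: "2 * \<tau> * (1 + b * Lt) * \<bar>y - t\<bar> \<le> D"
      unfolding D_def using t \<tau> b Lt by (intro mult_left_mono) auto
    have 1: "norm (?n y - ?n t) \<le> D"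
      using next_x_lip[OF x, of y t b z] le t l0 u1 b by auto
    have "\<bar>?s y - ?s t\<bar> \<le> (2 * \<tau> * Lt + gm) * (2 * \<tau> * (1 + b * Lt) * \<bar>y - t\<bar>)"
      using slope_lip[OF x, of y t b z] t l0 u1 b by auto
    also have "\<dots> \<le> (2 * \<tau> * Lt + gm) * D"
      using le \<tau> Lt gm_nonneg by (intro mult_left_mono) auto
    finally have 2: "\<bar>?s y\<bar> \<le> (2 * \<tau> * Lt + gm) * D" using t by simp
    have "f (?n t) - f x \<le> 0"
      using tilt_down[OF x nin[OF t(1)]] t(3) by (simp add: slope_def Let_def)
    moreover have "f (?n y) - f (?n t) \<le> (gm / gn) * D"
      using f_lip[OF nin nin, OF t(1,2)] 1 gm_nonneg gn by (smt (verit) divide_nonneg_pos mult_left_mono)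
    moreover have "- gam_of b A y * ?s y \<le> (1 / gn) * ((2 * \<tau> * Lt + gm) * D)"
    proof -
      have "- gam_of b A y * ?s y \<le> gam_of b A y * \<bar>?s y\<bar>" using gam[OF t(2)]
        by (metis abs_ge_minus_self minus_mult_commute mult_left_mono)
      also have "\<dots> \<le> (1 / gn) * ((2 * \<tau> * Lt + gm) * D)"
        using gam[OF t(2)] 2 gn by (intro mult_mono) auto
      finally show ?thesis .
    qed
    ultimately have "f (?n y) - f x - gam_of b A y * ?s y \<le> (gm / gn) * D + (1 / gn) * ((2 * \<tau> * Lt + gm) * D)"
      by linarith
    also have "\<dots> = (1 / gn) * (2 * gm + 2 * \<tau> * Lt) * (2 * \<tau> * (1 + b * Lt)) * h"
      using gn by (simp add: D_def field_simps)
    also have "\<dots> \<le> err" by (rule err)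
    finally show ?thesis by (simp add: accepts_def)
  qed
  have lo: "accepts f gf X b A err x z l" if "0 \<le> ?s l"
    using tilt_up[OF x nin[of l]] that lu err0 unfolding accepts_def gl by (simp add: slope_def Let_def)
  have up: "accepts f gf X b A err x z u" if "?s u \<le> 0"
    using tilt_down[OF x nin[of u]] that lu err0 unfolding accepts_def gu by (simp add: slope_def Let_def)
  have cont: "continuous_on {l..u} ?s" using slope_continuous x b l0 u1 by simp
  have len: "u - l \<le> 2 ^ m * h" using h l0 u1 by linarith
  show "(\<exists>t n. line_search (accepts f gf X b A err x z) ?s l u t n) \<and>
    (\<forall>t n. line_search (accepts f gf X b A err x z) ?s l u t n \<longrightarrow>
        t \<in> {l..u} \<and> accepts f gf X b A err x z t \<and> n \<le> 2 + m)"
    by (rule line_search_props[OF cont lu len m accI h(1) lo up])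
qed

context
  fixes N m :: nat and \<eta> :: real
  assumes \<eta>: "0 < \<eta>" and m: "1 \<le> m" and gngp: "gn * gp < 1"
    and hm: "8 * \<tau> * (gm + \<tau> * Lt) * (real N)\<^sup>2 / (\<eta> * gn) \<le> 2 ^ m"
begin

abbreviation "iter \<equiv> alg1_iter f gf X gn gp Lt N \<eta>"
abbreviation "AN \<equiv> real N * (real N + 1) * gn\<^sup>2 * gp / (4 * Lt)"
abbreviation "AA i \<equiv> step_sum gn gp Lt i"
abbreviation "bs i \<equiv> step_size gn gp Lt (i + 1) / gn"
abbreviation "es i \<equiv> AN * \<eta> / (2 * (real N - 1) * AA i)"

lemma A_pos: "1 \<le> i \<Longrightarrow> 0 < AA i"
  using gn gp Lt by (simp add: step_sum_eq)

lemma b_pos: "0 < bs i"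
  using gn gp Lt by (simp add: step_size_def)

lemma A_Suc: "AA (i + 1) = AA i + bs i * gn"
  using gn by (simp add: step_sum_def)

text \<open>The step condition of the extragradient estimate, and the reason for steps growing
  linearly in i: with lambda at most b / (A gp + b) the claim is b^2 Lt \<le> A gp + b, which
  reduces to (i + 1)^2 \<le> i (i + 1) + 2 (i + 1) and (gn gp)^2 \<le> gn gp.\<close>

lemma step_lam_bound: assumes "l \<le> lam_of (bs i) (AA i) gp" shows "bs i * Lt * l \<le> 1"
proof -
  have b: "bs i = (real i + 1) * (gn * gp) / (2 * Lt)"
    using gn Lt by (simp add: step_size_def power2_eq_square field_simps)
  have A: "AA i = real i * (real i + 1) * gn\<^sup>2 * gp / (4 * Lt)" by (rule step_sum_eq)
  have A0: "0 \<le> AA i * gp" unfolding A using gn gp Lt by simp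
  have den: "0 < AA i * gp + bs i" using A0 b_pos[of i] by linarith
  have "bs i * Lt * bs i = (real i + 1)\<^sup>2 * (gn * gp)\<^sup>2 / (4 * Lt)"
    unfolding b using Lt by (simp add: power2_eq_square field_simps)
  also have "\<dots> \<le> AA i * gp + bs i"
  proof -
    have g: "(gn * gp)\<^sup>2 \<le> gn * gp"
      using gn gp gngp by (simp add: power2_eq_square mult_le_cancel_left1 mult_left_le)
    have "(real i + 1)\<^sup>2 * (gn * gp)\<^sup>2 = real i * (real i + 1) * (gn * gp)\<^sup>2 + (real i + 1) * (gn * gp)\<^sup>2"
      by (simp add: power2_eq_square algebra_simps)
    also have "\<dots> \<le> real i * (real i + 1) * (gn * gp)\<^sup>2 + 2 * ((real i + 1) * (gn * gp))"
    proof -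
      have "(real i + 1) * (gn * gp)\<^sup>2 \<le> (real i + 1) * (gn * gp)" using g by (intro mult_left_mono) auto
      moreover have "0 \<le> (real i + 1) * (gn * gp)" using gn gp by simp
      ultimately show ?thesis by linarith
    qed
    finally have "(real i + 1)\<^sup>2 * (gn * gp)\<^sup>2 / (4 * Lt) \<le>
       (real i * (real i + 1) * (gn * gp)\<^sup>2 + 2 * ((real i + 1) * (gn * gp))) / (4 * Lt)"
      using Lt by (intro divide_right_mono) auto
    also have "\<dots> = AA i * gp + bs i"
      unfolding A b using Lt by (simp add: power2_eq_square field_simps)
    finally show ?thesis .
  qed
  finally have fin: "bs i * Lt * bs i \<le> AA i * gp + bs i" .
  have *: "bs i * Lt * bs i / (AA i * gp + bs i) \<le> 1"
    by (rule divide_le_eq_1_pos[OF den, THEN iffD2, OF fin])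
  have "bs i * Lt * l \<le> bs i * Lt * lam_of (bs i) (AA i) gp"
    using assms mult_pos_pos[OF b_pos[of i] Lt] by (intro mult_left_mono) linarith+
  also have "\<dots> = bs i * Lt * bs i / (AA i * gp + bs i)" by (simp add: lam_of_def)
  finally show ?thesis using * by linarith
qed

lemma b_Lt: "i < N \<Longrightarrow> bs i * Lt \<le> real N / 2"
proof -
  assume "i < N"
  have "bs i * Lt = (real i + 1) * (gn * gp) / 2"
    using gn Lt by (simp add: step_size_def power2_eq_square field_simps)
  also have "\<dots> \<le> real N * 1 / 2"
    using \<open>i < N\<close> gngp gn gp by (intro divide_right_mono mult_mono) auto
  finally show ?thesis by simp
qed

text \<open>Since A_i \<le> A_N the permitted error is at least \<eta> / (2 N), and 1 + b Lt \<le>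
  N. Hence one tolerance, the inverse of the quantity bounded by 2^m in \<open>hm\<close>, works for
  every iteration.\<close>

lemma search:
  assumes "x \<in> X" "1 \<le> i" "i < N"
  shows "(\<exists>t n. line_search (accepts f gf X (bs i) (AA i) (es i) x z) (slope gf X (bs i) x z)
        (lam_of (bs i) (AA i) (1 / gn)) (lam_of (bs i) (AA i) gp) t n) \<and>
    (\<forall>t n. line_search (accepts f gf X (bs i) (AA i) (es i) x z) (slope gf X (bs i) x z)
        (lam_of (bs i) (AA i) (1 / gn)) (lam_of (bs i) (AA i) gp) t n \<longrightarrow>
        t \<in> {lam_of (bs i) (AA i) (1 / gn)..lam_of (bs i) (AA i) gp} \<and>
        accepts f gf X (bs i) (AA i) (es i) x z t \<and> n \<le> 2 + m)"
    "0 < lam_of (bs i) (AA i) (1 / gn)" "lam_of (bs i) (AA i) gp \<le> 1"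
proof -
  have N: "2 \<le> N" using assms by linarith
  define C where "C = 8 * \<tau> * (gm + \<tau> * Lt) * (real N)\<^sup>2 / (\<eta> * gn)"
  have C0: "0 < C"
    unfolding C_def using \<tau> gm_nonneg Lt N \<eta> gn by (auto intro!: divide_pos_pos mult_pos_pos add_nonneg_pos)
  define h where "h = 1 / C"
  have "C \<le> 2 ^ m" using hm by (simp only: C_def)
  then have h: "0 < h" "1 \<le> 2 ^ m * h" using C0 by (auto simp: h_def field_simps)
  have "AA i \<le> AN"
    unfolding step_sum_eq using assms gn gp Lt
    by (intro divide_right_mono mult_right_mono mult_mono) auto
  then have r: "1 \<le> AN / AA i" using A_pos[OF assms(2)] by (simp only: le_divide_eq_1_pos)
  have "es i = (AN / AA i) * (\<eta> / (2 * (real N - 1)))" by simp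
  moreover have "(AN / AA i) * (\<eta> / (2 * (real N - 1))) \<ge> 1 * (\<eta> / (2 * (real N - 1)))"
    using r N \<eta> by (intro mult_right_mono) auto
  moreover have "\<eta> / (2 * (real N - 1)) \<ge> \<eta> / (2 * real N)"
    using N \<eta> by (intro divide_left_mono) auto
  ultimately have e: "\<eta> / (2 * real N) \<le> es i" by linarith
  have "(1 / gn) * (2 * gm + 2 * \<tau> * Lt) * (2 * \<tau> * (1 + bs i * Lt)) * h
      \<le> (1 / gn) * (2 * gm + 2 * \<tau> * Lt) * (2 * \<tau> * real N) * h"
  proof -
    have "1 + bs i * Lt \<le> real N" using b_Lt[OF assms(3)] N by linarith
    then show ?thesis
      using gn gm_nonneg \<tau> Lt h by (intro mult_right_mono mult_left_mono) auto
  qed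
  also have "\<dots> = (4 * \<tau> * (gm + \<tau> * Lt) * real N / gn) * h" by (simp add: field_simps)
  also have "\<dots> = \<eta> / (2 * real N)"
  proof -
    have Ceq: "C = (4 * \<tau> * (gm + \<tau> * Lt) * real N / gn) * (2 * real N / \<eta>)"
      using \<eta> gn by (simp add: C_def power2_eq_square field_simps)
    moreover have "0 < 4 * \<tau> * (gm + \<tau> * Lt) * real N / gn"
      using \<tau> gm_nonneg Lt N gn by (auto intro!: divide_pos_pos mult_pos_pos add_nonneg_pos)
    moreover have "v * (1 / (v * (2 * n / \<eta>))) = \<eta> / (2 * n)" if "0 < v" "0 < n" for v n :: real
      using that \<eta> by (simp add: field_simps)
    moreover have "0 < real N" using N by simp
    ultimately show ?thesis unfolding h_def Ceq by blast
  qed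
  also note e
  finally have err: "(1 / gn) * (2 * gm + 2 * \<tau> * Lt) * (2 * \<tau> * (1 + bs i * Lt)) * h \<le> es i" .
  note L = line_search_tilted(1)[OF assms(1) b_pos A_pos[OF assms(2)] m h err gngp, of z]
    line_search_tilted(2,3)[OF assms(1) b_pos A_pos[OF assms(2)] m h err gngp]
  show "(\<exists>t n. line_search (accepts f gf X (bs i) (AA i) (es i) x z) (slope gf X (bs i) x z)
        (lam_of (bs i) (AA i) (1 / gn)) (lam_of (bs i) (AA i) gp) t n) \<and>
    (\<forall>t n. line_search (accepts f gf X (bs i) (AA i) (es i) x z) (slope gf X (bs i) x z)
        (lam_of (bs i) (AA i) (1 / gn)) (lam_of (bs i) (AA i) gp) t n \<longrightarrow>
        t \<in> {lam_of (bs i) (AA i) (1 / gn)..lam_of (bs i) (AA i) gp} \<and>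
        accepts f gf X (bs i) (AA i) (es i) x z t \<and> n \<le> 2 + m)"
    "0 < lam_of (bs i) (AA i) (1 / gn)" "lam_of (bs i) (AA i) gp \<le> 1"
    by (fact L)+
qed

text \<open>Every iteration with a line search raises the potential by at most A_i err = A_N \<eta>
  / (2 (N - 1)). The first one has A = 0 and lambda = 1 and costs nothing, whence the factor i - 1;
  the conditional avoids a negative bound at i = 0.\<close>

lemma iter_inv:
  assumes "iter i x z n" "y \<in> X" "\<And>w. w \<in> X \<Longrightarrow> f y \<le> f w"
  shows "i \<le> N \<and> x \<in> X \<and> n \<le> i * (2 * (2 + m)) \<and>
     AA i * (f x - f y) + dgf_conj X z - z \<bullet> y \<le> (real i - 1) * (if 1 \<le> i then AN * \<eta> / (2 * (real N - 1)) else 0)"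
  using assms(1)
proof (induction rule: alg1_iter.induct)
  case start
  have "P 0 = 0" using X(3) by (simp add: closest_point_self)
  then show ?case using X(3) by (simp add: dgf_conj_def step_sum_def)
next
  case (first x z n b x')
  have x': "x' \<in> X" using next_x_in first by auto
  have bb: "b = bs 0" using first by simp
  have "(0 + b * gn) * (f x' - f y) + dgf_conj X (z - b *\<^sub>R gf x') - (z - b *\<^sub>R gf x') \<bullet> y
      \<le> 0 * (f x - f y) + dgf_conj X z - z \<bullet> y + 0"
  proof (rule potential_step[where l = 1])
    have "b * Lt = gn * gp / 2"
      unfolding bb using gn Lt by (simp add: step_size_def power2_eq_square field_simps)
    then show "b * Lt * 1 \<le> 1" using gngp by simp
  qed (use first assms b_pos[of 0] in auto)
  moreover have "AA 1 = b * gn" using A_Suc[of 0] bb by (simp add: step_sum_def)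
  ultimately show ?case using first x' by (simp add: step_sum_def)
next
  case (step i x z n b A AN' err l t x')
  have xX: "x \<in> X" using step by simp
  have b: "b = bs i" and A: "A = AA i" and err: "err = es i" using step by auto
  have Apos: "0 < A" using A_pos step A by simp
  note S = search(1)[OF xX step(2,3), of z] search(2,3)[OF xX step(2,3)]
  have l: "lam_of (bs i) (AA i) (1 / gn) \<le> l" "l \<le> lam_of (bs i) (AA i) gp"
    and acc: "accepts f gf X b A err x z l" and t: "t \<le> 2 + m"
    using S(1) step(8) unfolding b A err by auto
  have l0: "0 < l" "l \<le> 1" using l S by auto
  have x': "x' \<in> X" using next_x_in step xX l0 by auto
  have acc': "f x' - f x \<le> gam_of b A l * (gf x' \<bullet> (x' - x)) + err"
    using acc step(9) by (simp add: accepts_def slope_def Let_def)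
  have "A * (f x' - f x) \<le> A * (gam_of b A l * (gf x' \<bullet> (x' - x)) + err)"
    using acc' Apos by (intro mult_left_mono) auto
  also have "\<dots> = (b * (1 - l) / l) * (gf x' \<bullet> (x' - x)) + A * err"
    using Apos l0 by (simp add: gam_of_def field_simps)
  finally have acc2: "A * (f x' - f x) \<le> (b * (1 - l) / l) * (gf x' \<bullet> (x' - x)) + A * err" .
  define e where "e = AN * \<eta> / (2 * (real N - 1))"
  have Ai: "AA (i + 1) = A + b * gn" using A_Suc[of i] by (simp add: A b)
  have Ae: "A * err = e"
  proof -
    have "A * (E / (c * A)) = E / c" for E c using Apos by simp
    then show ?thesis unfolding err A e_def by blast
  qed
  have "AA (i + 1) * (f x' - f y) + dgf_conj X (z - b *\<^sub>R gf x') - (z - b *\<^sub>R gf x') \<bullet> y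
      \<le> A * (f x - f y) + dgf_conj X z - z \<bullet> y + A * err"
    unfolding Ai
    by (rule potential_step[OF xX assms(2) assms(3) l0 refl _ _ step(9) refl acc2])
       (use step_lam_bound[OF l(2)] b_pos[of i] in \<open>auto simp: b\<close>)
  moreover have "A * (f x - f y) + dgf_conj X z - z \<bullet> y \<le> (real i - 1) * e"
    using step.IH step(2) by (simp add: e_def A)
  ultimately have V: "AA (i + 1) * (f x' - f y) + dgf_conj X (z - b *\<^sub>R gf x') - (z - b *\<^sub>R gf x') \<bullet> y
      \<le> (real i - 1) * e + e"
    unfolding Ae by linarith
  have "(if 1 \<le> i + 1 then AN * \<eta> / (2 * (real N - 1)) else 0) = e" by (simp add: e_def)
  moreover have "(real i - 1) * e + e = (real (i + 1) - 1) * e" by (simp add: left_diff_distrib)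
  moreover have "n + 2 * t \<le> (i + 1) * (2 * (2 + m))"
    using step.IH t by simp
  moreover have "i + 1 \<le> N" using step(3) by simp
  ultimately show ?case using x' V by (simp only:)
qed

lemma iter_exists: "i \<le> N \<Longrightarrow> \<exists>x z n. iter i x z n"
proof (induction i)
  case 0 then show ?case using alg1_iter.start by blast
next
  case (Suc i)
  then obtain x z n where I: "iter i x z n" by auto
  show ?case
  proof (cases "i = 0")
    case True
    have "0 < N" using Suc.prems by simp
    from alg1_iter.first[OF I[unfolded True] this refl refl] show ?thesis
      unfolding True One_nat_def by blast
  next
    case False
    \<comment> \<open>The minimizer is the reference point that \<open>iter_inv\<close> asks for;
      what is extracted is that the iterate lies in \<open>X\<close>, where the line search
      succeeds.\<close>
    obtain y where "y \<in> X" "\<And>w. w \<in> X \<Longrightarrow> f y \<le> f w"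
      using continuous_attains_inf[OF X(2) cX(2) f_continuous] by blast
    then have "x \<in> X" using iter_inv[OF I] by blast
    then obtain t k where "line_search (accepts f gf X (bs i) (AA i) (es i) x z) (slope gf X (bs i) x z)
        (lam_of (bs i) (AA i) (1 / gn)) (lam_of (bs i) (AA i) gp) t k"
      using search(1)[of x i z] False Suc by auto
    then show ?thesis
      using alg1_iter.step[OF I _ _ refl refl refl refl _ refl] False Suc by fastforce
  qed
qed

text \<open>After N iterations half of A_N \<eta> pays for the line searches and half for |y|^2 / 2,
  which is what the choice of N guarantees. N = 0 happens only when the minimizer is the starting
  point 0.\<close>

lemma iter_result:
  assumes "iter N x z n" "y \<in> X" "\<And>w. w \<in> X \<Longrightarrow> f y \<le> f w"
    and N: "4 * Lt * (norm y)\<^sup>2 / (gn\<^sup>2 * gp * \<eta>) \<le> (real N)\<^sup>2"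
  shows "x \<in> X" "f x \<le> f y + \<eta>" "n \<le> N * (2 * (2 + m))"
proof -
  note I = iter_inv[OF assms(1-3)]
  show "x \<in> X" "n \<le> N * (2 * (2 + m))" using I by auto
  show "f x \<le> f y + \<eta>"
  proof (cases "N = 0")
    case True
    have "0 < gn\<^sup>2 * gp * \<eta>" using gn gp \<eta> by simp
    then have "4 * Lt * (norm y)\<^sup>2 \<le> 0" using N True by (simp add: divide_le_0_iff)
    then have "y = 0" using Lt by (simp add: mult_le_0_iff)
    moreover have "x = 0" using assms(1) True by (auto elim: alg1_iter.cases)
    ultimately show ?thesis using \<eta> by simp
  next
    case False
    have "z \<bullet> y - (norm y)\<^sup>2 / 2 \<le> dgf_conj X z"
      using dgf_conj_ge[OF X(1) cX(1) assms(2), of z] zero_le_power2[of "norm (y - P z)"] by linarith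
    \<comment> \<open>For N = 1 the divisor is 0 and the quotient is 0 by convention, in agreement
      with the absence of a line search.\<close>
    moreover have "(real N - 1) * (AN * \<eta> / (2 * (real N - 1))) \<le> AN * \<eta> / 2"
      using False gn gp Lt \<eta> by (cases "N = 1") (auto simp: field_simps)
    moreover have "AA N = AN" by (rule step_sum_eq)
    ultimately have *: "AN * (f x - f y) \<le> AN * \<eta> / 2 + (norm y)\<^sup>2 / 2"
      using I False by auto
    have "4 * Lt * (norm y)\<^sup>2 \<le> (real N)\<^sup>2 * (gn\<^sup>2 * gp * \<eta>)"
      using N gn gp \<eta> by (simp add: divide_le_eq mult.commute)
    also have "\<dots> \<le> (real N * (real N + 1)) * (gn\<^sup>2 * gp * \<eta>)"
      using gn gp \<eta> by (intro mult_right_mono) (auto simp: power2_eq_square distrib_left)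
    finally have y: "(norm y)\<^sup>2 \<le> AN * \<eta>" using Lt by (simp add: field_simps)
    define a where "a = AN"
    have "a * (f x - f y) \<le> a * \<eta>"
      using * y unfolding a_def[symmetric] by linarith
    moreover have "0 < a" using False gn gp Lt by (simp add: a_def)
    ultimately have "f x - f y \<le> \<eta>" using mult_le_cancel_left_pos by blast
    then show ?thesis by simp
  qed
qed

end
end

section \<open>Charts of small balls\<close>

lemma sinh_le_mult_cosh: "0 \<le> x \<Longrightarrow> sinh x \<le> x * cosh (x::real)"
proof -
  assume "0 \<le> x"
  have "0 * cosh 0 - sinh 0 \<le> x * cosh x - sinh x"
  proof (rule DERIV_nonneg_imp_nondecreasing[OF \<open>0 \<le> x\<close>])
    fix t :: real assume "0 \<le> t" "t \<le> x"
    have "((\<lambda>t. t * cosh t - sinh t) has_real_derivative (t * sinh t)) (at t)"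
      by (auto intro!: derivative_eq_intros)
    then show "\<exists>y. ((\<lambda>t. t * cosh t - sinh t) has_real_derivative y) (at t) \<and> 0 \<le> y"
      using \<open>0 \<le> t\<close> by (intro exI[of _ "t * sinh t"]) auto
  qed
  then show ?thesis by simp
qed

lemma le_sinh: "0 \<le> x \<Longrightarrow> x \<le> sinh (x::real)"
proof -
  assume "0 \<le> x"
  have "sinh 0 - 0 \<le> sinh x - x"
  proof (rule DERIV_nonneg_imp_nondecreasing[OF \<open>0 \<le> x\<close>])
    fix t :: real
    have "((\<lambda>t. sinh t - t) has_real_derivative (cosh t - 1)) (at t)"
      by (auto intro!: derivative_eq_intros)
    then show "\<exists>y. ((\<lambda>t. sinh t - t) has_real_derivative y) (at t) \<and> 0 \<le> y"
      using cosh_real_ge_1[of t] by (intro exI[of _ "cosh t - 1"]) auto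
  qed
  then show ?thesis by simp
qed

lemma mult_cos_le_sin: "0 \<le> x \<Longrightarrow> x \<le> pi \<Longrightarrow> x * cos x \<le> sin (x::real)"
proof -
  assume x: "0 \<le> x" "x \<le> pi"
  have "sin 0 - 0 * cos 0 \<le> sin x - x * cos x"
  proof (rule DERIV_nonneg_imp_nondecreasing[OF x(1)])
    fix t :: real assume t: "0 \<le> t" "t \<le> x"
    have "((\<lambda>t. sin t - t * cos t) has_real_derivative (t * sin t)) (at t)"
      by (auto intro!: derivative_eq_intros)
    then show "\<exists>y. ((\<lambda>t. sin t - t * cos t) has_real_derivative y) (at t) \<and> 0 \<le> y"
      using t x by (intro exI[of _ "t * sin t"]) (auto intro!: mult_nonneg_nonneg sin_ge_zero)
  qed
  then show ?thesis by simp
qed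

text \<open>Halving the argument: two points of a ball of radius r are at most 2 r apart, so
  comparing half their distance with r gives a square of cosh r instead of cosh (2 r).
  \<open>mult_cos_sq_le_sin\<close> is the spherical counterpart; both feed the powers in
  \<open>gamma_n\<close> and \<open>gamma_p\<close>.\<close>

lemma sinh_le_mult_cosh_sq: "0 \<le> x \<Longrightarrow> x / 2 \<le> r \<Longrightarrow> sinh x \<le> x * (cosh (r::real))\<^sup>2"
proof -
  assume x: "0 \<le> x" "x / 2 \<le> r"
  have "sinh x = 2 * (sinh (x/2) * cosh (x/2))" using sinh_add[of "x/2" "x/2"] by simp
  also have "\<dots> \<le> 2 * ((x/2 * cosh (x/2)) * cosh (x/2))"
    using sinh_le_mult_cosh[of "x/2"] x cosh_real_nonneg[of "x/2"] by (intro mult_left_mono mult_right_mono) auto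
  also have "\<dots> = x * (cosh (x/2))\<^sup>2" by (simp add: power2_eq_square)
  also have "\<dots> \<le> x * (cosh r)\<^sup>2"
    using x cosh_real_nonneg_le_iff[of "x/2" r] by (intro mult_left_mono power_mono) auto
  finally show ?thesis .
qed

lemma mult_cos_sq_le_sin: "0 \<le> x \<Longrightarrow> x / 2 \<le> r \<Longrightarrow> r \<le> pi/2 \<Longrightarrow> x * (cos (r::real))\<^sup>2 \<le> sin x"
proof -
  assume x: "0 \<le> x" "x / 2 \<le> r" "r \<le> pi/2"
  have c: "0 \<le> cos r" "cos r \<le> cos (x/2)"
    using x cos_mono_le_eq[of "x/2" r] by (auto intro!: cos_ge_zero)
  have "x * (cos r)\<^sup>2 \<le> x * (cos (x/2))\<^sup>2" using x c by (intro mult_left_mono power_mono) auto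
  also have "\<dots> = 2 * ((x/2 * cos (x/2)) * cos (x/2))" by (simp add: power2_eq_square)
  also have "\<dots> \<le> 2 * (sin (x/2) * cos (x/2))"
    using mult_cos_le_sin[of "x/2"] x c by (intro mult_left_mono mult_right_mono) auto
  also have "\<dots> = sin x" using sin_double[of "x/2"] by simp
  finally show ?thesis .
qed

lemma cosh_1_le: "cosh (1::real) \<le> 31/20"
proof -
  have e: "exp 1 < (272/100::real)" by (rule e_less_272)

  have "27/10 < exp (1::real)" using e_approx_32 by (simp add: abs_real_def inverse_eq_divide split: if_splits)
  then have "exp (-1::real) < 10/27" by (simp add: exp_minus field_simps)
  then show ?thesis using e by (simp add: cosh_def)
qed

lemma cos_half_ge: "7/8 \<le> cos (1/2::real)"
  using cos_double[of "1/4::real"] sin_x_le_x[of "1/4"] sin_ge_zero[of "1/4"] pi_gt3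
    cos_squared_eq[of "1/4::real"] power_mono[of "sin (1/4)" "1/4::real" 2]
  by (simp add: power2_eq_square)

text \<open>Comparing the expansions at x and y of the value at a third point z isolates (g y - g x)
  . (z - y) up to O(D^2), D being the distance of x and y. The test point must not leave the ball
  even if y lies on its boundary: y is first shrunk towards 0, and the shrunk points with and
  without a shift along the unit vector e of g y - g x differ by (D / 2) e.\<close>

lemma quadratic_bounds_imp_lipschitz:
  fixes f :: "'a::real_inner \<Rightarrow> real" and g :: "'a \<Rightarrow> 'a"
  assumes q: "\<And>x y. norm x \<le> \<tau> \<Longrightarrow> norm y \<le> \<tau> \<Longrightarrow> \<bar>f y - f x - g x \<bullet> (y - x)\<bar> \<le> c * (norm (y - x))\<^sup>2"
    and \<tau>: "0 < \<tau>" and c: "0 \<le> c" and xy: "norm x \<le> \<tau>" "norm y \<le> \<tau>"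
  shows "norm (g y - g x) \<le> 24 * c * norm (y - x)"
proof (cases "g y = g x \<or> x = y")
  case True
  then show ?thesis using c by auto
next
  case False
  define \<Delta> where "\<Delta> = g y - g x"
  define D where "D = norm (y - x)"
  have D: "0 < D" "D \<le> 2 * \<tau>"
    using False xy norm_triangle_ineq4[of y x] by (auto simp: D_def)
  have n\<Delta>: "0 < norm \<Delta>" using False by (simp add: \<Delta>_def)
  define e where "e = (1 / norm \<Delta>) *\<^sub>R \<Delta>"
  have ne: "norm e = 1" using n\<Delta> by (simp add: e_def)
  define t where "t = D / (2 * \<tau>)"
  have t: "0 < t" "t \<le> 1" "t * \<tau> = D / 2" using D \<tau> by (auto simp: t_def)
  have B: "\<bar>\<Delta> \<bullet> (z - y)\<bar> \<le> 6 * c * D\<^sup>2" if z: "norm z \<le> \<tau>" "norm (z - y) \<le> D" for z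
  proof -
    have "norm (z - x) \<le> 2 * D"
      using norm_triangle_ineq[of "z - y" "y - x"] z by (simp add: D_def)
    then have a: "(norm (z - x))\<^sup>2 \<le> 4 * D\<^sup>2" "(norm (z - y))\<^sup>2 \<le> D\<^sup>2"
      using power_mono[of "norm (z - x)" "2 * D" 2] power_mono[OF z(2), of 2] by (auto simp: power_mult_distrib)
    have "\<Delta> \<bullet> (z - y) = g y \<bullet> (z - y) - g x \<bullet> (z - x) + g x \<bullet> (y - x)"
      by (simp add: \<Delta>_def inner_diff_left inner_diff_right)
    then have "\<bar>\<Delta> \<bullet> (z - y)\<bar> \<le> c * (norm (z - y))\<^sup>2 + c * (norm (z - x))\<^sup>2 + c * (norm (y - x))\<^sup>2"
      using q[OF xy(2) z(1)] q[OF xy(1) z(1)] q[OF xy] by linarith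
    also have "\<dots> \<le> c * D\<^sup>2 + c * (4 * D\<^sup>2) + c * D\<^sup>2"
      using a c by (intro add_mono mult_left_mono) (auto simp: D_def)
    finally show ?thesis by simp
  qed
  define z1 where "z1 = (1 - t) *\<^sub>R y + (t * \<tau>) *\<^sub>R e"
  define z0 where "z0 = (1 - t) *\<^sub>R y"
  have y1: "(1 - t) * norm y \<le> (1 - t) * \<tau>" "t * norm y \<le> t * \<tau>" using xy t by (auto intro!: mult_left_mono)
  have "norm z1 \<le> (1 - t) * norm y + t * \<tau>"
    unfolding z1_def using norm_triangle_ineq[of "(1 - t) *\<^sub>R y" "(t * \<tau>) *\<^sub>R e"] t(1,2) \<tau> ne by simp
  then have "norm z1 \<le> \<tau>" using y1 by (simp add: left_diff_distrib)
  moreover have "z1 - y = (t * \<tau>) *\<^sub>R e - t *\<^sub>R y" by (simp add: z1_def algebra_simps)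
  then have "norm (z1 - y) \<le> t * \<tau> + t * norm y"
    using norm_triangle_ineq4[of "(t * \<tau>) *\<^sub>R e" "t *\<^sub>R y"] t(1,2) \<tau> ne by simp
  then have "norm (z1 - y) \<le> D" using y1 t by simp
  ultimately have 1: "\<bar>\<Delta> \<bullet> (z1 - y)\<bar> \<le> 6 * c * D\<^sup>2" by (rule B)
  have "norm z0 \<le> \<tau>" using y1(1) t D by (simp add: z0_def left_diff_distrib)
  moreover have "z0 - y = (- t) *\<^sub>R y" by (simp add: z0_def algebra_simps)
  then have "norm (z0 - y) \<le> D" using y1 t D by simp
  ultimately have 2: "\<bar>\<Delta> \<bullet> (z0 - y)\<bar> \<le> 6 * c * D\<^sup>2" by (rule B)
  have "\<Delta> \<bullet> e = norm \<Delta>" using n\<Delta> by (simp add: e_def power2_norm_eq_inner[symmetric] power2_eq_square)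
  then have "\<Delta> \<bullet> (z1 - y) - \<Delta> \<bullet> (z0 - y) = D / 2 * norm \<Delta>"
    using t by (simp add: z1_def z0_def inner_diff_right inner_add_right)
  then have "D / 2 * norm \<Delta> \<le> 12 * c * D\<^sup>2" using 1 2 by linarith
  then have "D * norm \<Delta> \<le> D * (24 * c * D)" by (simp add: power2_eq_square algebra_simps)
  then show ?thesis using D mult_le_cancel_left_pos by (simp add: \<Delta>_def D_def[symmetric])
qed

section \<open>Central projection onto a tangent plane, its inverse and their distortion\<close>

context space_form begin

text \<open>The normalising factor of the inverse chart; by \<open>al_cs\<close> it is the
  (hyperbolic) cosine of the distance to the centre. \<open>dinv\<close> is the derivative of the
  inverse chart, see \<open>hinv_derivative\<close>.\<close>

definition al :: "'a \<Rightarrow> real" where "al u = 1 / sqrt (1 + K * (u \<bullet> u))"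

definition dinv :: "'a point \<Rightarrow> 'a \<Rightarrow> 'a \<Rightarrow> 'a point" where
  "dinv c u h = al u *\<^sub>R fr c h - (K * al u ^ 3 * (u \<bullet> h)) *\<^sub>R (c + fr c u)"

context
  fixes c assumes c: "c \<in> S"
begin

abbreviation "hinv \<equiv> geod_inv K c (fr c)"
abbreviation "hmap \<equiv> geod_map K c (fr c)"

lemma hinv_al: "hinv u = al u *\<^sub>R (c + fr c u)"
  by (simp add: geod_inv_def al_def)

lemma al_pos: "0 < 1 + K * (u \<bullet> u) \<Longrightarrow> 0 < al u"
  by (simp add: al_def)

lemma al_sq: "0 < 1 + K * (u \<bullet> u) \<Longrightarrow> (al u)\<^sup>2 * (1 + K * (u \<bullet> u)) = 1"
  by (simp add: al_def power_divide)

lemma hinv_form: "ip c (hinv u) = K * al u"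
  by (simp add: hinv_al form_simps frame_tangent[OF c] model_form[OF c])

lemma hinv_in: assumes "0 < 1 + K * (u \<bullet> u)" shows "hinv u \<in> S"
proof -
  have "ip (hinv u) (hinv u) = (al u)\<^sup>2 * (K + u \<bullet> u)"
    by (simp add: hinv_al form_simps frame_tangent[OF c] frame_tangent'[OF c] frame_form[OF c] model_form[OF c] power2_eq_square algebra_simps)
  also have "\<dots> = K * ((al u)\<^sup>2 * (1 + K * (u \<bullet> u)))" by (simp add: algebra_simps)
  finally have f: "ip (hinv u) (hinv u) = K" using al_sq[OF assms] by simp
  moreover have "snd (hinv u) > 0" if "K = -1"
    using hyperbolic_sheet(1)[OF that c, of "hinv u"] f that hinv_form[of u] al_pos[OF assms] by simp
  ultimately show ?thesis by (simp add: model_space_def)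
qed

lemma hmap_hinv: assumes "0 < 1 + K * (u \<bullet> u)" shows "hmap (hinv u) = u"
proof -
  have *: "K * ip (fr c b) (hinv u) / ip c (hinv u) = u \<bullet> b" for b
  proof -
    have "ip (fr c b) (hinv u) = al u * (u \<bullet> b)"
      by (simp add: hinv_al form_simps frame_tangent'[OF c] frame_form[OF c] inner_commute)
    then show ?thesis using al_pos[OF assms] hinv_form[of u] by simp
  qed
  show ?thesis unfolding geod_map_def * by (rule euclidean_representation)
qed

lemma al_cs: assumes "0 < 1 + K * (u \<bullet> u)" shows "al u = cs K (d c (hinv u))"
  using cs_d[OF c hinv_in[OF assms]] by (simp add: hinv_form)

lemma norm_sq_cs: assumes "0 < 1 + K * (u \<bullet> u)" shows "u \<bullet> u = K * (1 / (cs K (d c (hinv u)))\<^sup>2 - 1)"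
proof -
  have "1 / (al u)\<^sup>2 = 1 + K * (u \<bullet> u)" using al_sq[OF assms] al_pos[OF assms] by (simp add: field_simps)
  then show ?thesis unfolding al_cs[OF assms, symmetric] by (simp add: algebra_simps)
qed

lemma hmap_works:
  assumes p: "p \<in> S" and pos: "0 < K \<Longrightarrow> d c p < pi/2"
  shows "hinv (hmap p) = p" "0 < 1 + K * (hmap p \<bullet> hmap p)"
proof -
  let ?t = "cs K (d c p)"
  have t: "0 < ?t" using cs_pos[of "d c p"] d_nonneg[OF c p] pos K by auto
  obtain u where u: "p = fr c u + (K * ip c p) *\<^sub>R c" using tangential_decomposition[OF c] by blast
  then have u: "p = fr c u + ?t *\<^sub>R c" using cs_d[OF c p] by simp
  interpret A: linear "fr c" by (rule frame_linear[OF c])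
  have r: "K * ip (fr c b) p / ip c p = ((1 / ?t) *\<^sub>R u) \<bullet> b" for b
  proof -
    have "ip c p = K * ?t" using cs_d[OF c p] by simp
    moreover have "ip (fr c b) p = b \<bullet> u"
      by (subst u) (simp add: form_simps frame_tangent'[OF c] frame_form[OF c])
    ultimately show ?thesis using t by (simp add: inner_commute field_simps)
  qed
  have h: "hmap p = (1 / ?t) *\<^sub>R u" unfolding geod_map_def r by (rule euclidean_representation)
  have "K = ip (fr c u + ?t *\<^sub>R c) (fr c u + ?t *\<^sub>R c)" using model_form[OF p] u by simp
  also have "\<dots> = u \<bullet> u + K * ?t\<^sup>2"
    by (simp add: form_simps frame_tangent[OF c] frame_tangent'[OF c] frame_form[OF c] model_form[OF c] power2_eq_square)
  finally have uu: "u \<bullet> u = K - K * ?t\<^sup>2" by simp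
  have *: "1 + K * (hmap p \<bullet> hmap p) = 1 / ?t\<^sup>2"
    using t by (simp add: h uu power2_eq_square field_simps)
  then show "0 < 1 + K * (hmap p \<bullet> hmap p)" using t by simp
  have "al (hmap p) = ?t" unfolding al_def * using t by (simp add: real_sqrt_divide)
  then show "hinv (hmap p) = p"
    using t u by (simp add: hinv_al h A.scale algebra_simps)
qed

lemma hinv_derivative:
  assumes "0 < 1 + K * (u \<bullet> u)" shows "(hinv has_derivative dinv c u) (at u)"
proof -
  have bl: "bounded_linear (fr c)" using frame_linear[OF c] by (simp add: linear_conv_bounded_linear)
  have A: "(fr c has_derivative fr c) (at u)" by (rule bounded_linear_imp_has_derivative[OF bl])
  have q: "((\<lambda>u. 1 + K * (u \<bullet> u)) has_derivative (\<lambda>h. K * (2 * (u \<bullet> h)))) (at u)"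
    by (auto intro!: derivative_eq_intros simp: inner_commute)
  have "((\<lambda>w. 1 / sqrt w) has_real_derivative (- (1 / (2 * sqrt w ^ 3)))) (at w)" if "0 < w" for w
    using that by (auto intro!: derivative_eq_intros simp: power3_eq_cube field_simps)
  from DERIV_compose_FDERIV[OF this[OF assms] q]
  have a: "(al has_derivative (\<lambda>h. - (K * al u ^ 3 * (u \<bullet> h)))) (at u)"
    by (simp add: al_def[abs_def] power_divide)
  have "((\<lambda>u. al u *\<^sub>R (c + fr c u)) has_derivative
      (\<lambda>h. al u *\<^sub>R fr c h + (- (K * al u ^ 3 * (u \<bullet> h))) *\<^sub>R (c + fr c u))) (at u)"
    by (auto intro!: derivative_eq_intros a A)
  then show ?thesis by (simp add: hinv_al[abs_def] dinv_def[abs_def])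
qed

lemma linear_dinv: "linear (dinv c u)"
  unfolding dinv_def[abs_def] using frame_linear[OF c]
  by (intro linearI) (auto simp: linear_add linear_scale inner_add_right algebra_simps)

lemma chart_grad_inner:
  assumes "0 < 1 + K * (u \<bullet> u)"
  shows "chart_grad K c (fr c) G u \<bullet> h = ip (G (hinv u)) (dinv c u h)"
proof -
  interpret D: linear "dinv c u" by (rule linear_dinv)
  have fd: "frechet_derivative hinv (at u) = dinv c u"
    using frechet_derivative_at[OF hinv_derivative[OF assms]] by simp
  have "dinv c u h = (\<Sum>b\<in>Basis. (h \<bullet> b) *\<^sub>R dinv c u b)"
    using D.sum[of "\<lambda>b. (h \<bullet> b) *\<^sub>R b" Basis] by (simp add: D.scale euclidean_representation)
  then have "ip (G (hinv u)) (dinv c u h) = (\<Sum>b\<in>Basis. (h \<bullet> b) * ip (G (hinv u)) (dinv c u b))"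
    by (simp add: form_sum_right form_simps)
  also have "\<dots> = chart_grad K c (fr c) G u \<bullet> h"
    unfolding chart_grad_def fd by (simp add: inner_sum_left) (simp add: inner_commute mult.commute)
  finally show ?thesis by simp
qed

lemma dinv_form:
  assumes "0 < 1 + K * (u \<bullet> u)"
  shows "ip (dinv c u h) (dinv c u h) = (al u)\<^sup>2 * (h \<bullet> h) - K * (al u)^4 * (u \<bullet> h)\<^sup>2"
    and "ip (hinv u) (dinv c u h) = 0"
proof -
  define a q where "a = al u" and "q = u \<bullet> h"
  have s: "a\<^sup>2 * (1 + K * (u \<bullet> u)) = 1" using al_sq[OF assms] by (simp add: a_def)
  have "ip (dinv c u h) (dinv c u h) = a\<^sup>2 * (h \<bullet> h) - 2 * (K * a ^ 4 * q\<^sup>2) + K * (K * (a ^ 6 * q\<^sup>2 * (K + u \<bullet> u)))"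
    by (simp add: dinv_def form_simps frame_tangent[OF c] frame_tangent'[OF c] frame_form[OF c] model_form[OF c]
        a_def[symmetric] q_def[symmetric] inner_commute[of h u] power2_eq_square power3_eq_cube eval_nat_numeral algebra_simps)
  also have "K * (K * (a ^ 6 * q\<^sup>2 * (K + u \<bullet> u))) = K * a ^ 4 * q\<^sup>2 * (a\<^sup>2 * (1 + K * (u \<bullet> u)))"
    by (simp add: power2_eq_square eval_nat_numeral algebra_simps)
  finally show "ip (dinv c u h) (dinv c u h) = (al u)\<^sup>2 * (h \<bullet> h) - K * (al u)^4 * (u \<bullet> h)\<^sup>2"
    using s by (simp add: a_def q_def)
  have "ip (hinv u) (dinv c u h) = a\<^sup>2 * q - a\<^sup>2 * q * (a\<^sup>2 * (1 + K * (u \<bullet> u)))"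
    by (simp add: hinv_al dinv_def form_simps frame_tangent[OF c] frame_tangent'[OF c] frame_form[OF c] model_form[OF c]
        a_def[symmetric] q_def[symmetric] power2_eq_square power3_eq_cube algebra_simps)
  then show "ip (hinv u) (dinv c u h) = 0" using s by simp
qed

text \<open>Both sides lie in the plane through the origin spanned by the two projected points,
  which cuts the model space in their geodesic. The right-hand side is a multiple of the tangential
  part at \<open>hinv x\<close> of \<open>hinv y\<close>, so the derivative along the segment points
  along the geodesic.\<close>

lemma dinv_diff:
  assumes x: "0 < 1 + K * (x \<bullet> x)" and y: "0 < 1 + K * (y \<bullet> y)"
  shows "dinv c x (y - x) = (al x / al y) *\<^sub>R (hinv y - (K * ip (hinv x) (hinv y)) *\<^sub>R hinv x)"
proof -
  interpret A: linear "fr c" by (rule frame_linear[OF c])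
  have py: "0 < al y" "0 < al x" using al_pos x y by auto
  have f: "ip (hinv x) (hinv y) = al x * al y * (K + x \<bullet> y)"
    by (simp add: hinv_al form_simps frame_tangent[OF c] frame_tangent'[OF c] frame_form[OF c] model_form[OF c] algebra_simps)
  have s: "(al x)\<^sup>2 * (1 + K * (x \<bullet> x)) = 1" by (rule al_sq[OF x])
  have co: "al x * (al x / al y * (K * (al x * al y * (K + x \<bullet> y)))) = al x + K * al x ^ 3 * (x \<bullet> (y - x))"
  proof -
    have "al x * (al x / al y * (K * (al x * al y * (K + x \<bullet> y)))) = al x ^ 3 * (1 + K * (x \<bullet> y))"
      using py by (simp add: power3_eq_cube algebra_simps)
    also have "\<dots> = al x * ((al x)\<^sup>2 * (1 + K * (x \<bullet> x))) + K * al x ^ 3 * (x \<bullet> (y - x))"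
      by (simp add: power3_eq_cube power2_eq_square inner_diff_right algebra_simps)
    finally show ?thesis using s by simp
  qed
  have "(al x / al y) *\<^sub>R (hinv y - (K * ip (hinv x) (hinv y)) *\<^sub>R hinv x)
     = al x *\<^sub>R (c + fr c y) - (al x * (al x / al y * (K * (al x * al y * (K + x \<bullet> y))))) *\<^sub>R (c + fr c x)"
    using py unfolding f unfolding hinv_al by (simp add: scaleR_diff_right mult_ac)
  also have "\<dots> = dinv c x (y - x)"
    unfolding co by (simp add: dinv_def A.diff algebra_simps)
  finally show ?thesis by simp
qed

text \<open>The chart carries geodesics to segments, so the two directional derivatives differ by a factor only.\<close>

lemma chart_grad_polar:
  assumes x: "0 < 1 + K * (x \<bullet> x)" and y: "0 < 1 + K * (y \<bullet> y)"
    and e: "utan K (hinv x) e" "hinv y = gpt K (hinv x) e (d (hinv x) (hinv y))"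
  shows "dinv c x (y - x) = (al x / al y * sn K (d (hinv x) (hinv y))) *\<^sub>R e"
    and "chart_grad K c (fr c) G x \<bullet> (y - x) = al x / al y * sn K (d (hinv x) (hinv y)) * ip (G (hinv x)) e"
proof -
  have "gpt K (hinv x) e (d (hinv x) (hinv y)) = (K * ip (hinv x) (hinv y)) *\<^sub>R hinv x + sn K (d (hinv x) (hinv y)) *\<^sub>R e"
    using cs_d[OF hinv_in[OF x] hinv_in[OF y]] by (simp only: gpt_def)
  then have "hinv y - (K * ip (hinv x) (hinv y)) *\<^sub>R hinv x = sn K (d (hinv x) (hinv y)) *\<^sub>R e"
    using e(2) by (metis add_diff_cancel_left')
  then show 1: "dinv c x (y - x) = (al x / al y * sn K (d (hinv x) (hinv y))) *\<^sub>R e"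
    by (simp add: dinv_diff[OF x y])
  show "chart_grad K c (fr c) G x \<bullet> (y - x) = al x / al y * sn K (d (hinv x) (hinv y)) * ip (G (hinv x)) e"
    unfolding chart_grad_inner[OF x] 1 by (simp add: form_simps)
qed

end

text \<open>tan r or tanh r: the Euclidean radius of the chart image of a ball of radius r about the
  centre of the chart.\<close>

definition rad :: "real \<Rightarrow> real" where "rad r = sn K r / cs K r"

context
  fixes r :: real assumes r: "0 < r" "r \<le> 1" "0 < K \<longrightarrow> r \<le> 1/2"
begin

lemma r_pi: "0 < K \<Longrightarrow> r < pi/2"
  using r pi_gt3 by linarith

lemma cs_r_pos: "0 < cs K r"
  by (rule cs_pos) (use r r_pi in auto)

lemma cs_bounds_hyp: "K = -1 \<Longrightarrow> 0 \<le> a \<Longrightarrow> a \<le> r \<Longrightarrow> 1 \<le> cs K a \<and> cs K a \<le> cs K r \<and> cs K r \<le> 31/20"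
  using cosh_real_ge_1[of a] cosh_real_nonneg_le_iff[of a r] cosh_real_nonneg_le_iff[of r 1] cosh_1_le r by auto

lemma cs_bounds_sph: "K = 1 \<Longrightarrow> 0 \<le> a \<Longrightarrow> a \<le> r \<Longrightarrow> 7/8 \<le> cs K r \<and> cs K r \<le> cs K a \<and> cs K a \<le> 1"
proof -
  assume a: "K = 1" "0 \<le> a" "a \<le> r"
  then have "r \<le> 1/2" using r by simp
  then have "cos r \<ge> cos (1/2)" using r pi_gt3 by (intro cos_monotone_0_pi_le) auto
  moreover have "cos r \<le> cos a" using a r pi_gt3 \<open>r \<le> 1/2\<close> by (intro cos_monotone_0_pi_le) auto
  ultimately show ?thesis using cos_half_ge a(1) by simp
qed

lemma rad_sq: "(rad r)\<^sup>2 = K * (1 / (cs K r)\<^sup>2 - 1)"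
  using cs_r_pos by (simp add: rad_def power_divide sn_sq field_simps)

lemma rad_bounds: "0 < rad r" "rad r \<le> 8/7 * r"
proof -
  have s: "0 < sn K r" by (rule sn_pos) (use r r_pi pi_gt_zero in force)+
  then show "0 < rad r" using cs_r_pos by (simp add: rad_def)
  show "rad r \<le> 8/7 * r"
  proof (cases "K = 1")
    case True
    have "sin r \<le> r" using sin_x_le_x r by simp
    also have "r \<le> (8/7 * r) * cos r"
    proof -
      have "7/8 \<le> cos r" using cs_bounds_sph[OF True, of r] True r by auto
      then have "(8/7 * r) * (7/8) \<le> (8/7 * r) * cos r" using r by (intro mult_left_mono) auto
      then show ?thesis by simp
    qed
    finally show ?thesis using cs_r_pos unfolding rad_def by (simp add: True divide_le_eq)
  next
    case False
    then have K': "K = -1" using K by auto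
    have "sinh r \<le> r * cosh r" using sinh_le_mult_cosh r by simp
    also have "\<dots> \<le> (8/7 * r) * cosh r" using r cosh_real_ge_1[of r] by (intro mult_right_mono) auto
    finally show ?thesis using cs_r_pos unfolding rad_def by (simp add: K' divide_le_eq)
  qed
qed

text \<open>The radius restrictions make all chart constants absolute. The product gamma_n^2 gamma_p
  is cos r ^ 8 or cosh r ^ -7, and (31/20)^7 \<le> 22.\<close>

lemma gamma_bounds:
  "0 < gamma_n K r" "gamma_n K r \<le> 1" "0 < gamma_p K r" "gamma_p K r \<le> 1" "gamma_n K r * gamma_p K r < 1"
  "1/22 \<le> (gamma_n K r)\<^sup>2 * gamma_p K r" "10/25 \<le> gamma_n K r"
proof -
  have *: "0 < gamma_n K r \<and> gamma_n K r \<le> 1 \<and> 0 < gamma_p K r \<and> gamma_p K r \<le> 1 \<and> gamma_n K r < 1 \<and>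
      1/22 \<le> (gamma_n K r)\<^sup>2 * gamma_p K r \<and> 10/25 \<le> gamma_n K r"
  proof (cases "K = 1")
    case True
    have c: "7/8 \<le> cos r" "cos r \<le> 1" using cs_bounds_sph[OF True, of r] True r by auto
    have "cos r < 1" using cos_mono_less_eq[of r 0] r pi_gt3 True by auto
    then have l: "cos r ^ 3 < 1" using c power_less_one_iff[of "cos r" 3] by auto
    have "(343/512::real) = (7/8)^3" by (simp add: power_divide)
    also have "\<dots> \<le> cos r ^ 3" using c by (intro power_mono) auto
    finally have c3: "343/512 \<le> cos r ^ 3" .
    have "(5764801/16777216::real) = (7/8)^8" by (simp add: power_divide)
    also have "\<dots> \<le> cos r ^ 8" using c by (intro power_mono) auto
    finally have c8: "5764801/16777216 \<le> cos r ^ 8" .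
    have "(cos r ^ 3)\<^sup>2 * (cos r)\<^sup>2 = cos r ^ 8" by (simp add: power_mult[symmetric] power_add[symmetric])
    then show ?thesis
      using True c l c3 c8 by (auto simp: gamma_n_def gamma_p_def power_le_one)
  next
    case False
    then have K': "K = -1" using K by auto
    have c: "1 \<le> cosh r" "cosh r \<le> 31/20" using cs_bounds_hyp[OF K', of r] K' r by auto
    have "1 < cosh r" using cosh_real_nonneg_less_iff[of 0 r] r by auto
    then have l: "1 < (cosh r)\<^sup>2" using one_less_power[of "cosh r" 2] by auto
    have "cosh r ^ 2 \<le> (31/20)^2" using c by (intro power_mono) auto
    also have "\<dots> \<le> (5/2::real)" by (simp add: power_divide)
    finally have c2: "cosh r ^ 2 \<le> 5/2" .
    have "cosh r ^ 7 \<le> (31/20)^7" using c by (intro power_mono) auto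
    also have "\<dots> \<le> (22::real)" by (simp add: power_divide)
    finally have c7: "cosh r ^ 7 \<le> 22" .
    have c3: "1 \<le> cosh r ^ 3" using c by (simp add: one_le_power)
    have "0 < cosh r ^ 2" "0 < cosh r ^ 3" "0 < cosh r ^ 7" using c by auto
    moreover have "(1 / cosh r ^ 2)\<^sup>2 * (1 / cosh r ^ 3) = 1 / cosh r ^ 7"
      by (simp add: power_divide power_mult[symmetric] power_add[symmetric])
    ultimately show ?thesis
      using K' c2 c7 l c3 by (simp add: gamma_n_def gamma_p_def divide_le_eq le_divide_eq)
  qed
  then show "0 < gamma_n K r" "gamma_n K r \<le> 1" "0 < gamma_p K r" "gamma_p K r \<le> 1"
    "1/22 \<le> (gamma_n K r)\<^sup>2 * gamma_p K r" "10/25 \<le> gamma_n K r" by auto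
  show "gamma_n K r * gamma_p K r < 1"
    using * mult_left_le[of "gamma_p K r" "gamma_n K r"] by linarith
qed

context
  fixes c assumes c: "c \<in> S"
begin

abbreviation "hi \<equiv> geod_inv K c (fr c)"
abbreviation "hm \<equiv> geod_map K c (fr c)"

lemma rad_domain: assumes "norm u \<le> rad r" shows "0 < 1 + K * (u \<bullet> u)" "hi u \<in> rball K c r"
proof -
  have "u \<bullet> u \<le> (rad r)\<^sup>2"
    using assms power_mono[of "norm u" "rad r" 2] by (simp add: power2_norm_eq_inner)
  then have u: "u \<bullet> u \<le> K * (1 / (cs K r)\<^sup>2 - 1)" by (simp add: rad_sq)
  show pos: "0 < 1 + K * (u \<bullet> u)"
  proof (cases "K = 1")
    case True then show ?thesis using inner_ge_zero[of u] by (simp add: add_pos_nonneg)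
  next
    case False
    then have K': "K = -1" using K by auto
    have "0 < 1 / (cosh r)\<^sup>2" using cosh_real_pos by simp
    moreover have "u \<bullet> u \<le> 1 - 1 / (cosh r)\<^sup>2" using u K' by simp
    ultimately have "u \<bullet> u < 1" by linarith
    then show ?thesis using K' by simp
  qed
  define a where "a = d c (hi u)"
  have hin: "hi u \<in> S" using hinv_in[OF c pos] .
  have a: "0 \<le> a" "0 < K \<Longrightarrow> a \<le> pi" using d_nonneg[OF c hin] d_le_pi[OF c hin] by (auto simp: a_def)
  have ca: "0 < cs K a" using al_cs[OF c pos] al_pos[OF c pos] by (simp add: a_def)
  have **: "K * (1 / (cs K a)\<^sup>2 - 1) \<le> K * (1 / (cs K r)\<^sup>2 - 1)"
    using u norm_sq_cs[OF c pos] by (simp add: a_def)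
  have "a \<le> r"
  proof (cases "K = 1")
    case True
    then have "1 / (cs K a)\<^sup>2 \<le> 1 / (cs K r)\<^sup>2" using ** by simp
    then have "(cs K r)\<^sup>2 \<le> (cs K a)\<^sup>2" using ca cs_r_pos by (simp add: frac_le_eq divide_le_eq field_simps)
    then have "cs K r \<le> cs K a" using ca cs_r_pos power2_le_imp_le[of "cs K r" "cs K a"] by simp
    then show ?thesis using cos_mono_le_eq[of r a] a r pi_gt3 True by auto
  next
    case False
    then have K': "K = -1" using K by auto
    then have "1 / (cs K r)\<^sup>2 \<le> 1 / (cs K a)\<^sup>2" using ** by simp
    then have "(cs K a)\<^sup>2 \<le> (cs K r)\<^sup>2" using ca cs_r_pos by (simp add: frac_le_eq divide_le_eq field_simps)
    then have "cs K a \<le> cs K r" using ca cs_r_pos power2_le_imp_le[of "cs K a" "cs K r"] by simp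
    then show ?thesis using cosh_real_nonneg_le_iff[of a r] a r K' by auto
  qed
  then show "hi u \<in> rball K c r" using hin by (simp add: rball_def a_def)
qed

lemma hm_ball: assumes "p \<in> rball K c r" shows "norm (hm p) \<le> rad r" "hi (hm p) = p" "0 < 1 + K * (hm p \<bullet> hm p)"
proof -
  have p: "p \<in> S" "d c p \<le> r" using assms by (auto simp: rball_def)
  have a: "0 \<le> d c p" using d_nonneg c p by blast
  have W: "hi (hm p) = p" "0 < 1 + K * (hm p \<bullet> hm p)"
    using hmap_works[OF c p(1)] p r_pi by force+
  then show "hi (hm p) = p" "0 < 1 + K * (hm p \<bullet> hm p)" by auto
  have "hm p \<bullet> hm p = K * (1 / (cs K (d c p))\<^sup>2 - 1)" using norm_sq_cs[OF c W(2)] W(1) by simp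
  also have "\<dots> \<le> K * (1 / (cs K r)\<^sup>2 - 1)"
  proof (cases "K = 1")
    case True
    have "cs K r \<le> cs K (d c p)" using cs_bounds_sph[OF True a p(2)] by simp
    then have "1 / (cs K (d c p))\<^sup>2 \<le> 1 / (cs K r)\<^sup>2" using cs_r_pos by (intro divide_left_mono power_mono) auto
    then show ?thesis using True by simp
  next
    case False
    then have K': "K = -1" using K by auto
    have "cs K (d c p) \<le> cs K r" "1 \<le> cs K (d c p)" using cs_bounds_hyp[OF K' a p(2)] by auto
    then have "1 / (cs K r)\<^sup>2 \<le> 1 / (cs K (d c p))\<^sup>2" by (intro divide_left_mono power_mono) auto
    then show ?thesis using K' by simp
  qed
  finally have "(norm (hm p))\<^sup>2 \<le> (rad r)\<^sup>2" by (simp add: power2_norm_eq_inner rad_sq)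
  then show "norm (hm p) \<le> rad r" using rad_bounds power2_le_imp_le by (meson less_imp_le)
qed

lemma hm_image: "hm ` rball K c r = cball 0 (rad r)"
proof
  show "hm ` rball K c r \<subseteq> cball 0 (rad r)" using hm_ball by auto
  show "cball 0 (rad r) \<subseteq> hm ` rball K c r"
  proof
    fix u :: 'a assume "u \<in> cball 0 (rad r)"
    then have "norm u \<le> rad r" by simp
    then show "u \<in> hm ` rball K c r" using rad_domain hmap_hinv[OF c] by (metis imageI)
  qed
qed

section \<open>Tilted convexity and Lipschitz gradients in the chart\<close>

lemma pair_geometry:
  assumes x: "norm x \<le> rad r" and y: "norm y \<le> rad r"
  obtains e where "utan K (hi x) e" "hi y = gpt K (hi x) e (d (hi x) (hi y))"
    "0 \<le> d (hi x) (hi y)" "d (hi x) (hi y) \<le> 2 * r" "\<bar>d c (hi x) - d c (hi y)\<bar> \<le> d (hi x) (hi y)"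
    "hi x \<in> S" "hi y \<in> S" "0 \<le> d c (hi x)" "d c (hi x) \<le> r" "0 \<le> d c (hi y)" "d c (hi y) \<le> r"
    "al x = cs K (d c (hi x))" "al y = cs K (d c (hi y))" "0 < al x" "0 < al y"
proof -
  have b: "hi x \<in> S" "hi y \<in> S" "d c (hi x) \<le> r" "d c (hi y) \<le> r"
    using rad_domain x y by (auto simp: rball_def)
  have "d (hi x) (hi y) \<le> d c (hi x) + d c (hi y)"
    using d_triangle[OF b(1) c b(2)] d_commute by metis
  moreover have "d c (hi x) \<le> d c (hi y) + d (hi x) (hi y)"
    using d_triangle[OF c b(2) b(1)] d_commute by metis
  moreover have "d c (hi y) \<le> d c (hi x) + d (hi x) (hi y)"
    using d_triangle[OF c b(1) b(2)] by simp
  moreover obtain e where "utan K (hi x) e" "hi y = gpt K (hi x) e (d (hi x) (hi y))"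
    using gpt_polar b by metis
  ultimately show ?thesis
    using that[of e] b d_nonneg[OF b(1,2)] d_nonneg[OF c b(1)] d_nonneg[OF c b(2)]
      al_cs[OF c rad_domain(1)[OF x]] al_cs[OF c rad_domain(1)[OF y]]
      al_pos[OF c rad_domain(1)[OF x]] al_pos[OF c rad_domain(1)[OF y]] by auto
qed

text \<open>By \<open>chart_grad_polar\<close> the middle expression is the exact ratio of the
  geodesic first-order term to the chart one. The quotient \<delta> / sn \<delta> contributes at
  most a square of the cosine at r and the quotient of cosines at most one more power, which
  explains the exponent 3.\<close>

lemma theta_bounds:
  assumes "0 < \<delta>" "\<delta> \<le> 2 * r" "0 \<le> a" "a \<le> r" "0 \<le> b" "b \<le> r"
  shows "gamma_p K r \<le> \<delta> / sn K \<delta> * (cs K b / cs K a)" "\<delta> / sn K \<delta> * (cs K b / cs K a) \<le> 1 / gamma_n K r"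
proof -
  have "gamma_p K r \<le> \<delta> / sn K \<delta> * (cs K b / cs K a) \<and> \<delta> / sn K \<delta> * (cs K b / cs K a) \<le> 1 / gamma_n K r"
  proof (cases "K = 1")
    case True
    have A: "7/8 \<le> cos r" "cos r \<le> cos a" "cos a \<le> 1" "cos r \<le> cos b" "cos b \<le> 1"
      using cs_bounds_sph[OF True assms(3,4)] cs_bounds_sph[OF True assms(5,6)] True by auto
    have s: "0 < sin \<delta>" using assms True r pi_gt3 by (intro sin_gt_zero) auto
    have "sin \<delta> \<le> \<delta>" using sin_x_le_x assms by simp
    then have d1: "1 \<le> \<delta> / sin \<delta>" using s by simp
    have "\<delta> * (cos r)\<^sup>2 \<le> sin \<delta>" using mult_cos_sq_le_sin[of \<delta> r] assms r_pi True by auto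
    then have d2: "\<delta> / sin \<delta> \<le> 1 / (cos r)\<^sup>2" using s A by (simp add: field_simps)
    have q1: "cos r \<le> cos b / cos a"
    proof -
      have "cos r * cos a \<le> cos b * 1" using A by (intro mult_mono) auto
      then show ?thesis using A by (simp add: le_divide_eq)
    qed
    have q2: "cos b / cos a \<le> 1 / cos r" using A by (intro frac_le) auto
    have "1 * (cos r) \<le> \<delta> / sin \<delta> * (cos b / cos a)" using d1 q1 A by (intro mult_mono) auto
    moreover have "(cos r)\<^sup>2 \<le> cos r" using A by (simp add: power2_eq_square mult_left_le)
    moreover have "\<delta> / sin \<delta> * (cos b / cos a) \<le> 1 / (cos r)\<^sup>2 * (1 / cos r)"
      using d1 d2 q1 q2 A by (intro mult_mono) auto
    moreover have "1 / (cos r)\<^sup>2 * (1 / cos r) = 1 / cos r ^ 3" by (simp add: power2_eq_square power3_eq_cube)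
    ultimately show ?thesis using True by (simp add: gamma_n_def gamma_p_def)
  next
    case False
    then have K': "K = -1" using K by auto
    have A: "1 \<le> cosh a" "cosh a \<le> cosh r" "1 \<le> cosh b" "cosh b \<le> cosh r"
      using cs_bounds_hyp[OF K' assms(3,4)] cs_bounds_hyp[OF K' assms(5,6)] K' by auto
    have s: "0 < sinh \<delta>" using assms by simp
    have "\<delta> \<le> sinh \<delta>" using le_sinh assms by simp
    then have d1: "\<delta> / sinh \<delta> \<le> 1" using s by simp
    have "sinh \<delta> \<le> \<delta> * (cosh r)\<^sup>2" using sinh_le_mult_cosh_sq[of \<delta> r] assms by auto
    then have d2: "1 / (cosh r)\<^sup>2 \<le> \<delta> / sinh \<delta>" using s A by (simp add: field_simps)
    have q1: "1 / cosh r \<le> cosh b / cosh a" using A by (intro frac_le) auto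
    have "cosh b * 1 \<le> cosh r * cosh a" using A by (intro mult_mono) auto
    then have q2: "cosh b / cosh a \<le> cosh r" using A by (simp add: divide_le_eq)
    have "1 / (cosh r)\<^sup>2 * (1 / cosh r) \<le> \<delta> / sinh \<delta> * (cosh b / cosh a)"
      using d2 q1 assms s by (intro mult_mono) auto
    moreover have "1 / (cosh r)\<^sup>2 * (1 / cosh r) = 1 / cosh r ^ 3" by (simp add: power2_eq_square power3_eq_cube)
    moreover have "\<delta> / sinh \<delta> * (cosh b / cosh a) \<le> 1 * cosh r"
      using d1 q2 A assms s by (intro mult_mono) auto
    moreover have "cosh r \<le> (cosh r)\<^sup>2" using A by (simp add: power2_eq_square)
    ultimately show ?thesis using K' by (simp add: gamma_n_def gamma_p_def)
  qed
  then show "gamma_p K r \<le> \<delta> / sn K \<delta> * (cs K b / cs K a)" "\<delta> / sn K \<delta> * (cs K b / cs K a) \<le> 1 / gamma_n K r"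
    by auto
qed

text \<open>The first bound says that the geodesic and the chart first-order terms differ by
  O(\<delta>^2), the second that \<delta> is controlled by the length of the derivative along the
  chart segment. The deviation of sn \<delta> from \<delta> costs 2 and that of the quotient of
  cosines 49/20 * 2, together less than 7.\<close>

lemma sn_near:
  assumes "0 \<le> \<delta>" "\<delta> \<le> 2 * r" "0 \<le> a" "a \<le> r" "0 \<le> b" "b \<le> r" "\<bar>a - b\<bar> \<le> \<delta>"
  shows "\<bar>\<delta> - sn K \<delta> * (cs K a / cs K b)\<bar> \<le> 7 * \<delta>\<^sup>2" "\<delta> \<le> 8/5 * (sn K \<delta> * (cs K a / cs K b))"
proof -
  have d2: "\<delta> \<le> 2" using assms r by linarith
  have "\<bar>\<delta> - sn K \<delta>\<bar> \<le> 2 * \<delta>\<^sup>2 \<and> \<bar>sn K \<delta>\<bar> \<le> 49/20 * \<delta> \<and> \<bar>cs K a / cs K b - 1\<bar> \<le> 2 * \<delta> \<and>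
     \<delta> \<le> 8/5 * (sn K \<delta> * (cs K a / cs K b))"
  proof (cases "K = 1")
    case True
    have A: "7/8 \<le> cos r" "cos r \<le> cos a" "cos a \<le> 1" "cos r \<le> cos b" "cos b \<le> 1"
      using cs_bounds_sph[OF True assms(3,4)] cs_bounds_sph[OF True assms(5,6)] True by auto
    have s: "0 \<le> sin \<delta>" using assms True r pi_gt3 by (intro sin_ge_zero) auto
    have s1: "sin \<delta> \<le> \<delta>" using sin_x_le_x assms by simp
    have s2: "\<delta> * (cos (\<delta>/2))\<^sup>2 \<le> sin \<delta>" using mult_cos_sq_le_sin[of \<delta> "\<delta>/2"] assms r_pi True by auto
    have s3: "\<delta> * (cos r)\<^sup>2 \<le> sin \<delta>" using mult_cos_sq_le_sin[of \<delta> r] assms r_pi True by auto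
    have "(sin (\<delta>/2))\<^sup>2 \<le> (\<delta>/2)\<^sup>2"
      using sin_x_le_x[of "\<delta>/2"] sin_ge_zero[of "\<delta>/2"] assms d2 pi_gt3 by (intro power_mono) auto
    then have "\<delta> * (1 - (cos (\<delta>/2))\<^sup>2) \<le> \<delta> * (\<delta>/2)\<^sup>2"
      using assms by (intro mult_left_mono) (auto simp: sin_squared_eq)
    then have "\<delta> - sin \<delta> \<le> \<delta> * (\<delta>/2)\<^sup>2" using s2 by (simp add: algebra_simps)
    also have "\<dots> \<le> 2 * (\<delta>/2)\<^sup>2" using d2 by (intro mult_right_mono) auto
    also have "\<dots> \<le> 2 * \<delta>\<^sup>2" by (simp add: power_divide)
    finally have 1: "\<bar>\<delta> - sin \<delta>\<bar> \<le> 2 * \<delta>\<^sup>2" using s1 by simp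
    have "\<bar>cos a - cos b\<bar> \<le> \<bar>a - b\<bar>"
    proof -
      have "\<bar>cos a - cos b\<bar> = 2 * \<bar>sin ((a + b) / 2)\<bar> * \<bar>sin ((b - a) / 2)\<bar>"
        unfolding cos_diff_cos abs_mult by simp
      also have "\<dots> \<le> 2 * 1 * \<bar>(b - a) / 2\<bar>"
        by (intro mult_mono abs_sin_x_le_abs_x) auto
      finally show ?thesis by (simp add: abs_minus_commute)
    qed
    then have "\<bar>cos a - cos b\<bar> \<le> \<delta>" using assms by simp
    moreover have "\<bar>cos a / cos b - 1\<bar> = \<bar>cos a - cos b\<bar> / cos b" using A by (simp add: field_simps)
    moreover have "\<delta> / cos b \<le> \<delta> / (1/2)" using A assms by (intro divide_left_mono) auto
    moreover have "\<bar>cos a - cos b\<bar> / cos b \<le> \<delta> / cos b"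
      using calculation(1) A by (intro divide_right_mono) auto
    ultimately have 2: "\<bar>cos a / cos b - 1\<bar> \<le> 2 * \<delta>" by simp
    have "(7/8)^2 * \<delta> \<le> (cos r)\<^sup>2 * \<delta>" using A assms by (intro mult_right_mono power_mono) auto
    then have "49/64 * \<delta> \<le> sin \<delta>" using s3 by (simp add: power2_eq_square mult.commute)
    moreover have "7/8 \<le> cos a / cos b"
    proof -
      have "7/8 * cos b \<le> cos a" using A by linarith
      moreover have "0 < cos b" using A by linarith
      ultimately show ?thesis by (simp add: le_divide_eq)
    qed
    ultimately have "49/64 * \<delta> * (7/8) \<le> sin \<delta> * (cos a / cos b)" using assms by (intro mult_mono) auto
    then have "\<delta> \<le> 8/5 * (sin \<delta> * (cos a / cos b))" using assms(1) by linarith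
    then show ?thesis using 1 2 s s1 assms True by auto
  next
    case False
    then have K': "K = -1" using K by auto
    have A: "1 \<le> cosh a" "cosh a \<le> 31/20" "1 \<le> cosh b" "cosh b \<le> 31/20"
      using cs_bounds_hyp[OF K' assms(3,4)] cs_bounds_hyp[OF K' assms(5,6)] K' by auto
    have s: "0 \<le> sinh \<delta>" using assms by simp
    have s1: "\<delta> \<le> sinh \<delta>" using le_sinh assms by simp
    have s2: "sinh \<delta> \<le> \<delta> * (cosh (\<delta>/2))\<^sup>2" using sinh_le_mult_cosh_sq[of \<delta> "\<delta>/2"] assms by auto
    have ch: "cosh (\<delta>/2) \<le> 31/20" "1 \<le> cosh (\<delta>/2)"
      using cosh_real_nonneg_le_iff[of "\<delta>/2" 1] cosh_1_le assms d2 cosh_real_ge_1 by auto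
    have ch2: "(cosh (\<delta>/2))\<^sup>2 \<le> (31/20)\<^sup>2" using ch by (intro power_mono) auto
    have "sinh (\<delta>/2) \<le> (\<delta>/2) * cosh (\<delta>/2)" using assms by (intro sinh_le_mult_cosh) simp
    then have "(sinh (\<delta>/2))\<^sup>2 \<le> ((\<delta>/2) * cosh (\<delta>/2))\<^sup>2" using assms by (intro power_mono) auto
    also have "\<dots> = (\<delta>/2)\<^sup>2 * (cosh (\<delta>/2))\<^sup>2" by (rule power_mult_distrib)
    also have "\<dots> \<le> (\<delta>/2)\<^sup>2 * (31/20)\<^sup>2" using ch2 by (intro mult_left_mono) auto
    finally have sh: "(sinh (\<delta>/2))\<^sup>2 \<le> (\<delta>/2)\<^sup>2 * (31/20)\<^sup>2" .
    have "sinh \<delta> - \<delta> \<le> \<delta> * (sinh (\<delta>/2))\<^sup>2" using s2 by (simp add: cosh_square_eq algebra_simps)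
    also have "\<dots> \<le> 2 * ((\<delta>/2)\<^sup>2 * (31/20)\<^sup>2)" using d2 sh assms by (intro mult_mono) auto
    also have "\<dots> \<le> 2 * \<delta>\<^sup>2" by (simp add: power_divide)
    finally have 1: "\<bar>\<delta> - sinh \<delta>\<bar> \<le> 2 * \<delta>\<^sup>2" using s1 by simp
    have "sinh \<delta> \<le> \<delta> * (31/20)\<^sup>2" using s2 ch2 assms by (meson mult_left_mono order_trans)
    then have 3: "sinh \<delta> \<le> 49/20 * \<delta>" using assms by (simp add: power2_eq_square)
    have "\<bar>cosh a - cosh b\<bar> \<le> 2 * \<bar>a - b\<bar>"
    proof -
      have "\<bar>cosh x - cosh y\<bar> \<le> 2 * (y - x)" if xy: "0 \<le> x" "x < y" "y \<le> 1" for x y :: real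
      proof -
        have "\<exists>z>x. z < y \<and> cosh y - cosh x = (y - x) * sinh z"
          by (rule MVT2[OF xy(2)]) (auto intro!: derivative_eq_intros)
        then obtain z where z: "x < z" "z < y" "cosh y - cosh x = (y - x) * sinh z" by blast
        have "sinh z \<le> z * cosh z" using sinh_le_mult_cosh z xy by simp
        also have "\<dots> \<le> 1 * (31/20)"
          using z xy cosh_real_nonneg_le_iff[of z 1] cosh_1_le by (intro mult_mono) auto
        finally have "sinh z \<le> 2" by simp
        then have "(y - x) * sinh z \<le> (y - x) * 2" using xy by (intro mult_left_mono) auto
        moreover have "0 \<le> (y - x) * sinh z" using xy z by simp
        ultimately show ?thesis using z by simp
      qed
      from this[of a b] this[of b a] show ?thesis
        using assms r by (cases a b rule: linorder_cases) (auto simp: abs_minus_commute)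
    qed
    then have "\<bar>cosh a - cosh b\<bar> \<le> 2 * \<delta>" using assms by simp
    moreover have "\<bar>cosh a / cosh b - 1\<bar> = \<bar>cosh a - cosh b\<bar> / cosh b" using A by (simp add: field_simps)
    moreover have "\<bar>cosh a - cosh b\<bar> / cosh b \<le> \<bar>cosh a - cosh b\<bar> / 1"
      using A by (intro divide_left_mono) auto
    ultimately have 2: "\<bar>cosh a / cosh b - 1\<bar> \<le> 2 * \<delta>" by simp
    have "20/31 \<le> cosh a / cosh b"
    proof -
      have "20/31 * cosh b \<le> 20/31 * (31/20)" using A by (intro mult_left_mono) auto
      then have "20/31 * cosh b \<le> cosh a" using A by linarith
      then show ?thesis using A by (simp add: le_divide_eq)
    qed
    then have "\<delta> * (20/31) \<le> sinh \<delta> * (cosh a / cosh b)" using s1 assms by (intro mult_mono) auto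
    then have "\<delta> \<le> 8/5 * (sinh \<delta> * (cosh a / cosh b))" using assms by simp
    then show ?thesis using 1 2 3 s s1 assms K' by auto
  qed
  then have B: "\<bar>\<delta> - sn K \<delta>\<bar> \<le> 2 * \<delta>\<^sup>2" "\<bar>sn K \<delta>\<bar> \<le> 49/20 * \<delta>" "\<bar>cs K a / cs K b - 1\<bar> \<le> 2 * \<delta>"
     "\<delta> \<le> 8/5 * (sn K \<delta> * (cs K a / cs K b))" by auto
  show "\<delta> \<le> 8/5 * (sn K \<delta> * (cs K a / cs K b))" by (rule B)
  have "\<bar>sn K \<delta> * (cs K a / cs K b - 1)\<bar> \<le> (49/20 * \<delta>) * (2 * \<delta>)"
    unfolding abs_mult using B by (intro mult_mono) auto
  moreover have "\<delta> - sn K \<delta> * (cs K a / cs K b) = (\<delta> - sn K \<delta>) - sn K \<delta> * (cs K a / cs K b - 1)"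
    by (simp add: algebra_simps)
  ultimately have "\<bar>\<delta> - sn K \<delta> * (cs K a / cs K b)\<bar> \<le> 2 * \<delta>\<^sup>2 + (49/20 * \<delta>) * (2 * \<delta>)"
    using B(1) by linarith
  also have "\<dots> \<le> 7 * \<delta>\<^sup>2" by (simp add: power2_eq_square)
  finally show "\<bar>\<delta> - sn K \<delta> * (cs K a / cs K b)\<bar> \<le> 7 * \<delta>\<^sup>2" .
qed

text \<open>On the sphere the inverse chart contracts. In hyperbolic space the radial direction is
  stretched most, by the square of \<open>al\<close>, and (31/20)^2 \<le> 5/2.\<close>

lemma dinv_bound: assumes "norm x \<le> rad r" shows "nrm (dinv c x h) \<le> 5/2 * norm h"
proof -
  have pos: "0 < 1 + K * (x \<bullet> x)" using rad_domain[OF assms] by simp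
  have b: "hi x \<in> S" "d c (hi x) \<le> r" using rad_domain[OF assms] by (auto simp: rball_def)
  have a0: "0 \<le> d c (hi x)" using d_nonneg[OF c b(1)] .
  have al: "al x = cs K (d c (hi x))" by (rule al_cs[OF c pos])
  have s: "(al x)\<^sup>2 * (1 + K * (x \<bullet> x)) = 1" by (rule al_sq[OF c pos])
  have q: "(x \<bullet> h)\<^sup>2 \<le> (x \<bullet> x) * (h \<bullet> h)" by (rule Cauchy_Schwarz_ineq)
  have "ip (dinv c x h) (dinv c x h) \<le> (5/2)\<^sup>2 * (h \<bullet> h)"
  proof (cases "K = 1")
    case True
    have "0 \<le> al x" "al x \<le> 1" using cs_bounds_sph[OF True a0 b(2)] al by auto
    then have "(al x)\<^sup>2 \<le> 1" by (simp add: power_le_one)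
    then have "(al x)\<^sup>2 * (h \<bullet> h) \<le> 1 * (h \<bullet> h)" by (intro mult_right_mono) auto
    moreover have "0 \<le> (al x)^4 * (x \<bullet> h)\<^sup>2" by simp
    moreover have "1 * (h \<bullet> h) \<le> (5/2)\<^sup>2 * (h \<bullet> h)" by (intro mult_right_mono) auto
    moreover have "ip (dinv c x h) (dinv c x h) = (al x)\<^sup>2 * (h \<bullet> h) - (al x)^4 * (x \<bullet> h)\<^sup>2"
      unfolding dinv_form(1)[OF c pos] using True by simp
    ultimately show ?thesis by linarith
  next
    case False
    then have K': "K = -1" using K by auto
    have a: "0 \<le> al x" "al x \<le> 31/20" using cs_bounds_hyp[OF K' a0 b(2)] al by auto
    have "(al x)^4 * (x \<bullet> h)\<^sup>2 \<le> (al x)^4 * ((x \<bullet> x) * (h \<bullet> h))" using q by (intro mult_left_mono) auto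
    then have "ip (dinv c x h) (dinv c x h) \<le> (al x)\<^sup>2 * (h \<bullet> h) + (al x)^4 * ((x \<bullet> x) * (h \<bullet> h))"
      unfolding dinv_form(1)[OF c pos] using K' by simp
    also have "\<dots> = (al x)\<^sup>2 * (h \<bullet> h) * (1 + (al x)\<^sup>2 * (x \<bullet> x))"
      by (simp add: power2_eq_square eval_nat_numeral algebra_simps)
    also have "1 + (al x)\<^sup>2 * (x \<bullet> x) = (al x)\<^sup>2" using s K' by (simp add: algebra_simps)
    also have "(al x)\<^sup>2 * (h \<bullet> h) * (al x)\<^sup>2 = (al x)^4 * (h \<bullet> h)" by (simp add: power2_eq_square eval_nat_numeral)
    also have "\<dots> \<le> (31/20)^4 * (h \<bullet> h)" using a by (intro mult_right_mono power_mono) auto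
    also have "\<dots> \<le> (5/2)\<^sup>2 * (h \<bullet> h)" by (intro mult_right_mono) (auto simp: power2_eq_square eval_nat_numeral)
    finally show ?thesis .
  qed
  then have "sqrt (ip (dinv c x h) (dinv c x h)) \<le> sqrt ((5/2)\<^sup>2 * (h \<bullet> h))" by (rule real_sqrt_le_mono)
  then show ?thesis unfolding rnorm_def real_sqrt_mult norm_eq_sqrt_inner by simp
qed

context
  fixes F :: "'a point \<Rightarrow> real" and G and L \<mu> :: real and N and g :: real
  assumes sm: "smooth_on K F G L N" and sc: "strongly_gconvex_on K F G \<mu> N" and \<mu>: "0 \<le> \<mu>"
    and N: "rball K c r \<subseteq> N" and L: "0 < L"
    and G': "\<forall>p\<in>rball K c r. G p \<in> tangent K p \<and> nrm (G p) \<le> g"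
begin

lemmas G = G'[rule_format]

abbreviation "ff \<equiv> F \<circ> hi"
abbreviation "gg \<equiv> chart_grad K c (fr c) G"

lemma g_nonneg: "0 \<le> g"
proof -
  have "c \<in> rball K c r" using c r by (simp add: rball_def)
  then show ?thesis using G[of c] nrm_nonneg[OF c, of "G c"] by auto
qed

lemma hi_N: "norm x \<le> rad r \<Longrightarrow> hi x \<in> N"
  using rad_domain N by blast

text \<open>Here t is the geodesic first-order term. It is \<theta> times the chart slope, which
  gives tilted convexity, and it is also within 7 g \<delta>^2 of the chart slope, which gives a
  two-sided quadratic Taylor bound in the chart.\<close>

lemma chart_ineq:
  assumes x: "norm x \<le> rad r" and y: "norm y \<le> rad r"
  obtains t \<theta> where "gamma_p K r \<le> \<theta>" "\<theta> \<le> 1 / gamma_n K r" "\<theta> * (gg x \<bullet> (y - x)) = t"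
    "ff x + t + \<mu> / 2 * (d (hi x) (hi y))\<^sup>2 \<le> ff y" "ff y \<le> ff x + t + L / 2 * (d (hi x) (hi y))\<^sup>2"
    "\<bar>t - gg x \<bullet> (y - x)\<bar> \<le> 7 * g * (d (hi x) (hi y))\<^sup>2"
    "d (hi x) (hi y) \<le> 4 * norm (y - x)"
proof -
  obtain e where e: "utan K (hi x) e" "hi y = gpt K (hi x) e (d (hi x) (hi y))"
    and D: "0 \<le> d (hi x) (hi y)" "d (hi x) (hi y) \<le> 2 * r" "\<bar>d c (hi x) - d c (hi y)\<bar> \<le> d (hi x) (hi y)"
    and S: "hi x \<in> S" "hi y \<in> S" and X: "0 \<le> d c (hi x)" "d c (hi x) \<le> r" and Y: "0 \<le> d c (hi y)" "d c (hi y) \<le> r"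
    and al: "al x = cs K (d c (hi x))" "al y = cs K (d c (hi y))" "0 < al x" "0 < al y"
    using pair_geometry[OF x y] by metis
  define \<delta> where "\<delta> = d (hi x) (hi y)"
  define \<gamma> where "\<gamma> = ip (G (hi x)) e"
  have dom: "0 < 1 + K * (x \<bullet> x)" "0 < 1 + K * (y \<bullet> y)" using rad_domain x y by auto
  have cg: "gg x \<bullet> (y - x) = (sn K \<delta> * (al x / al y)) * \<gamma>"
    using chart_grad_polar(2)[OF c dom e] by (simp add: \<delta>_def \<gamma>_def)
  have dv: "dinv c x (y - x) = (sn K \<delta> * (al x / al y)) *\<^sub>R e"
    using chart_grad_polar(1)[OF c dom e] by (simp add: \<delta>_def mult.commute)
  have near: "\<bar>\<delta> - sn K \<delta> * (al x / al y)\<bar> \<le> 7 * \<delta>\<^sup>2" "\<delta> \<le> 8/5 * (sn K \<delta> * (al x / al y))"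
    using sn_near[OF D(1,2) X Y D(3)] by (simp_all add: \<delta>_def al)
  have \<gamma>g: "\<bar>\<gamma>\<bar> \<le> g"
  proof -
    have "\<bar>\<gamma>\<bar> \<le> nrm (G (hi x)) * nrm e"
      unfolding \<gamma>_def using tangent_CS[OF S(1)] G rad_domain(2)[OF x] e(1) by (auto simp: utan_def)
    moreover have "nrm e = 1" using e(1) by (simp add: utan_def rnorm_def)
    ultimately show ?thesis using G[OF rad_domain(2)[OF x]] by simp
  qed
  have pi: "0 < K \<Longrightarrow> \<bar>\<delta> - 0\<bar> \<le> pi" using D r pi_gt3 by (auto simp: \<delta>_def)
  have gy: "gpt K (hi x) e \<delta> = hi y" using e by (simp add: \<delta>_def)
  have up: "ff y \<le> ff x + \<delta> * \<gamma> + L / 2 * \<delta>\<^sup>2"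
    using smooth_geo[OF sm S(1) e(1), of 0 \<delta>] hi_N[OF x] hi_N[OF y] gy pi by (simp add: \<gamma>_def)
  have lo: "ff x + \<delta> * \<gamma> + \<mu> / 2 * \<delta>\<^sup>2 \<le> ff y"
    using convex_geo[OF sc S(1) e(1), of 0 \<delta>] hi_N[OF x] hi_N[OF y] gy pi by (simp add: \<gamma>_def)
  have tq: "\<bar>\<delta> * \<gamma> - gg x \<bullet> (y - x)\<bar> \<le> 7 * g * \<delta>\<^sup>2"
  proof -
    have "\<delta> * \<gamma> - gg x \<bullet> (y - x) = (\<delta> - sn K \<delta> * (al x / al y)) * \<gamma>" unfolding cg by (simp add: left_diff_distrib)
    also have "\<bar>\<dots>\<bar> \<le> (7 * \<delta>\<^sup>2) * g" unfolding abs_mult using near \<gamma>g by (intro mult_mono) auto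
    finally show ?thesis by (simp add: algebra_simps)
  qed
  have dl: "\<delta> \<le> 4 * norm (y - x)"
  proof -
    have "nrm (dinv c x (y - x)) = \<bar>sn K \<delta> * (al x / al y)\<bar>"
      unfolding dv by (rule nrm_utan[OF S(1) e(1)])
    then have "\<bar>sn K \<delta> * (al x / al y)\<bar> \<le> 5/2 * norm (y - x)" using dinv_bound[OF x, of "y - x"] by simp
    then show ?thesis using near(2) by linarith
  qed
  show ?thesis
  proof (cases "\<delta> = 0")
    case True
    then have "hi x = hi y" using d_eq_0[OF S] by (simp add: \<delta>_def)
    then have "x = y" using hmap_hinv[OF c dom(1)] hmap_hinv[OF c dom(2)] by metis
    then show ?thesis
      using that[of 1 0] gamma_bounds True up lo tq dl by (auto simp: \<delta>_def)
  next
    case False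
    then have \<delta>: "0 < \<delta>" using D by (simp add: \<delta>_def)
    have sn: "0 < sn K \<delta>" using sn_pos[OF \<delta>] D r pi_gt3 by (auto simp: \<delta>_def)
    have "\<delta> / sn K \<delta> * (al y / al x) * (gg x \<bullet> (y - x)) = \<delta> * \<gamma>"
      unfolding cg using sn al by simp
    then show ?thesis
      using that[of "\<delta> / sn K \<delta> * (al y / al x)" "\<delta> * \<gamma>"] theta_bounds[of \<delta> "d c (hi x)" "d c (hi y)"] \<delta> D X Y up lo tq dl
      by (auto simp: \<delta>_def al)
  qed
qed

text \<open>With \<delta> \<le> 4 |y - x| the Taylor remainder is at most 16 (7 g + L / 2) |y -
  x|^2, and \<open>quadratic_bounds_imp_lipschitz\<close> multiplies by 24. The summand with g is
  the cost of the curvature of the chart.\<close>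

lemma chart_lipschitz:
  assumes x: "norm x \<le> rad r" and y: "norm y \<le> rad r"
  shows "norm (gg x - gg y) \<le> 3000 * (g + L) * norm (x - y)"
proof -
  have "norm (gg x - gg y) \<le> 24 * (112 * g + 8 * L) * norm (x - y)"
  proof (rule quadratic_bounds_imp_lipschitz[where f = ff and \<tau> = "rad r"])
    fix x y :: 'a assume xy: "norm x \<le> rad r" "norm y \<le> rad r"
    obtain t where t: "ff x + t + \<mu> / 2 * (d (hi x) (hi y))\<^sup>2 \<le> ff y" "ff y \<le> ff x + t + L / 2 * (d (hi x) (hi y))\<^sup>2"
    "\<bar>t - gg x \<bullet> (y - x)\<bar> \<le> 7 * g * (d (hi x) (hi y))\<^sup>2"
    "d (hi x) (hi y) \<le> 4 * norm (y - x)"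
      using chart_ineq[OF xy] by metis
    have d0: "0 \<le> d (hi x) (hi y)" using pair_geometry[OF xy] by metis
    have "(d (hi x) (hi y))\<^sup>2 \<le> (4 * norm (y - x))\<^sup>2" using t(4) d0 by (intro power_mono) auto
    then have d2: "(d (hi x) (hi y))\<^sup>2 \<le> 16 * (norm (y - x))\<^sup>2" by (simp add: power_mult_distrib)
    have "0 \<le> \<mu> / 2 * (d (hi x) (hi y))\<^sup>2" "0 \<le> L / 2 * (d (hi x) (hi y))\<^sup>2" using \<mu> L by auto
    then have "\<bar>ff y - ff x - gg x \<bullet> (y - x)\<bar> \<le> 7 * g * (d (hi x) (hi y))\<^sup>2 + L / 2 * (d (hi x) (hi y))\<^sup>2"
      using t(1-3) by linarith
    also have "\<dots> = (7 * g + L / 2) * (d (hi x) (hi y))\<^sup>2" by (simp add: algebra_simps)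
    also have "\<dots> \<le> (7 * g + L / 2) * (16 * (norm (y - x))\<^sup>2)" using d2 g_nonneg L by (intro mult_left_mono) auto
    finally show "\<bar>ff y - ff x - gg x \<bullet> (y - x)\<bar> \<le> (112 * g + 8 * L) * (norm (y - x))\<^sup>2" by (simp add: algebra_simps)
  qed (use x y rad_bounds g_nonneg L in auto)
  also have "\<dots> \<le> 3000 * (g + L) * norm (x - y)"
    using g_nonneg L by (intro mult_right_mono) auto
  finally show ?thesis .
qed

lemma chart_grad_bound: assumes x: "norm x \<le> rad r" shows "norm (gg x) \<le> 5/2 * g"
proof (cases "gg x = 0")
  case False
  have dom: "0 < 1 + K * (x \<bullet> x)" and b: "hi x \<in> rball K c r" using rad_domain x by auto
  have S: "hi x \<in> S" using b by (simp add: rball_def)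
  have T: "dinv c x (gg x) \<in> tangent K (hi x)" using dinv_form(2)[OF c dom] by (simp add: tangent_def)
  have "norm (gg x) * norm (gg x) = ip (G (hi x)) (dinv c x (gg x))"
    unfolding chart_grad_inner[OF c dom, symmetric] by (simp add: power2_norm_eq_inner[symmetric] power2_eq_square)
  also have "\<dots> \<le> nrm (G (hi x)) * nrm (dinv c x (gg x))" using tangent_CS[OF S _ T] G[OF b] by (simp add: abs_le_iff)
  also have "\<dots> \<le> g * (5/2 * norm (gg x))"
    using G[OF b] dinv_bound[OF x] nrm_nonneg[OF S T] g_nonneg by (intro mult_mono) auto
  finally have "norm (gg x) * norm (gg x) \<le> (5/2 * g) * norm (gg x)" by (simp add: algebra_simps)
  then show ?thesis using False by simp
qed (use g_nonneg in simp)

lemma chart_tilted: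
  assumes "3000 * (g + L) \<le> Lt"
  shows "tilted ff gg (cball 0 (rad r)) (rad r) (gamma_n K r) (gamma_p K r) Lt (5/2 * g)"
proof
  show "0 < Lt" using assms g_nonneg L by (smt (verit) mult_pos_pos)
  fix x y :: 'a assume xy: "x \<in> cball 0 (rad r)" "y \<in> cball 0 (rad r)"
  then have xy': "norm x \<le> rad r" "norm y \<le> rad r" by auto
  obtain t \<theta> where "gamma_p K r \<le> \<theta>" "\<theta> \<le> 1 / gamma_n K r" "\<theta> * (gg x \<bullet> (y - x)) = t"
    "ff x + t + \<mu> / 2 * (d (hi x) (hi y))\<^sup>2 \<le> ff y"
    using chart_ineq[OF xy'] by metis
  moreover have "0 \<le> \<mu> / 2 * (d (hi x) (hi y))\<^sup>2" using \<mu> by simp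
  ultimately show "\<exists>\<theta>. gamma_p K r \<le> \<theta> \<and> \<theta> \<le> 1 / gamma_n K r \<and> ff x + \<theta> * (gg x \<bullet> (y - x)) \<le> ff y"
    by (intro exI[of _ \<theta>]) simp
  have "norm (gg x - gg y) \<le> 3000 * (g + L) * norm (x - y)" using chart_lipschitz xy' by blast
  also have "\<dots> \<le> Lt * norm (x - y)" using assms by (intro mult_right_mono) auto
  finally show "norm (gg x - gg y) \<le> Lt * norm (x - y)" .
qed (use rad_bounds gamma_bounds chart_grad_bound in auto)

end
end
end

text \<open>P is the square of the iteration count up to a constant, and Y measures the gradient
  bound against \<open>Lt * r\<close>; both enter only logarithmically through m, apart from the
  count itself. At most 12 sqrt P iterations are made, since 4 (8/7)^2 22 \<le> 11^2 and rounding up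
  costs one more, and each makes at most 2 (2 + m) gradient calls.\<close>

lemma alg1_solves:
  fixes r L \<mu> g Lt \<eta> Y P :: real and m :: nat
  assumes r: "0 < r" "r \<le> 1" "0 < K \<longrightarrow> r \<le> 1/2" and c: "c \<in> S"
    and sm: "smooth_on K F G L N" and sc: "strongly_gconvex_on K F G \<mu> N" and \<mu>: "0 \<le> \<mu>"
    and N: "rball K c r \<subseteq> N" and M: "rball K c r \<subseteq> M" and L: "0 < L"
    and G: "\<forall>p\<in>rball K c r. G p \<in> tangent K p \<and> nrm (G p) \<le> g"
    and Lt: "3000 * (g + L) \<le> Lt" and \<eta>: "0 < \<eta>"
    and Y: "1 \<le> Y" "g \<le> Lt * r * Y" and P: "P = Lt * r\<^sup>2 / \<eta>" "1 \<le> P"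
    and m: "1 \<le> m" "12600 * Y * P\<^sup>2 \<le> 2 ^ m"
  shows "\<exists>out calls. alg1 K M F G (fr c) Lt c r \<eta> out calls"
    and "\<And>out calls. alg1 K M F G (fr c) Lt c r \<eta> out calls \<Longrightarrow>
      out \<in> rball K c r \<and> (\<forall>y\<in>rball K c r. F out \<le> F y + \<eta>) \<and> real calls \<le> 24 * sqrt P * (2 + real m)"
proof -
  let ?hi = "geod_inv K c (fr c)" and ?hm = "geod_map K c (fr c)"
  let ?f = "F \<circ> ?hi" and ?g = "chart_grad K c (fr c) G"
  let ?gn = "gamma_n K r" and ?gp = "gamma_p K r" and ?X = "cball 0 (rad r) :: 'a set"
  have img: "?hm ` rball K c r = ?X" by (rule hm_image[OF r c])
  have g0: "0 \<le> g" by (rule g_nonneg[OF r c sm sc \<mu> N L G])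
  have Lt0: "0 < Lt" using Lt g0 L by (smt (verit) mult_pos_pos)
  note gb = gamma_bounds[OF r]
  have \<tau>: "0 < rad r" "rad r \<le> 8/7 * r" using rad_bounds[OF r] by auto
  interpret T: tilted ?f ?g ?X "rad r" ?gn ?gp Lt "5/2 * g"
    by (rule chart_tilted[OF r c sm sc \<mu> N L G Lt])
  have sP: "1 \<le> sqrt P" "(sqrt P)\<^sup>2 = P" using P(2) by auto
  \<comment> \<open>\<open>alg1\<close> reads its iteration count off some minimizer in the chart,
    so the count is a function of that minimizer and is bounded uniformly over the ball.\<close>
  define cnt where "cnt y = nat \<lceil>sqrt (4 * Lt * (norm y)\<^sup>2 / (?gn\<^sup>2 * ?gp * \<eta>))\<rceil>" for y :: 'a
  have cnt: "real (cnt y) \<le> 12 * sqrt P" "4 * Lt * (norm y)\<^sup>2 / (?gn\<^sup>2 * ?gp * \<eta>) \<le> (real (cnt y))\<^sup>2"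
    if y: "y \<in> ?X" for y
  proof -
    let ?q = "4 * Lt * (norm y)\<^sup>2 / (?gn\<^sup>2 * ?gp * \<eta>)"
    have q0: "0 \<le> ?q" using Lt0 gb \<eta> by auto
    have "norm y \<le> 8/7 * r" using y \<tau> by simp
    then have "(norm y)\<^sup>2 \<le> (8/7 * r)\<^sup>2" by (intro power_mono) auto
    then have "4 * Lt * (norm y)\<^sup>2 \<le> 4 * Lt * (8/7 * r)\<^sup>2" using Lt0 by (intro mult_left_mono) auto
    moreover have "1/22 * \<eta> \<le> ?gn\<^sup>2 * ?gp * \<eta>" using gb(6) \<eta> by (intro mult_right_mono) auto
    ultimately have "?q \<le> 4 * Lt * (8/7 * r)\<^sup>2 / (1/22 * \<eta>)"
      using \<eta> Lt0 by (intro frac_le) auto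
    also have "\<dots> = 5632/49 * P" unfolding P(1) by (simp add: power2_eq_square field_simps)
    also have "\<dots> \<le> (11 * sqrt P)\<^sup>2" using P(2) by (simp add: power_mult_distrib)
    finally have "?q \<le> (11 * sqrt P)\<^sup>2" .
    then have s: "sqrt ?q \<le> 11 * sqrt P" using sP by (intro real_le_lsqrt) auto
    have "0 \<le> sqrt ?q" using q0 by simp
    then have c: "sqrt ?q \<le> real (cnt y)" "real (cnt y) \<le> sqrt ?q + 1" unfolding cnt_def by linarith+
    show "real (cnt y) \<le> 12 * sqrt P" using c s sP by linarith
    have "(sqrt ?q)\<^sup>2 \<le> (real (cnt y))\<^sup>2" using c(1) \<open>0 \<le> sqrt ?q\<close> by (intro power_mono) auto
    then show "?q \<le> (real (cnt y))\<^sup>2" using q0 by simp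
  qed
  have hm: "8 * rad r * (5/2 * g + rad r * Lt) * (real n)\<^sup>2 / (\<eta> * ?gn) \<le> 2 ^ m"
    if n: "real n \<le> 12 * sqrt P" for n
  proof -
    have LrY: "0 \<le> Lt * r * Y" "0 \<le> Lt * (Y * (r * r))" using Lt0 r Y by auto
    have "rad r * Lt \<le> 8/7 * r * Lt" using \<tau> Lt0 by (intro mult_right_mono) auto
    also have "\<dots> \<le> 8/7 * (Lt * r * Y)" using Y(1) mult_left_mono[of 1 Y "Lt * r"] Lt0 r by (simp add: algebra_simps)
    finally have 1: "5/2 * g + rad r * Lt \<le> 51/14 * (Lt * r * Y)" using Y(2) by linarith
    have "(real n)\<^sup>2 \<le> (12 * sqrt P)\<^sup>2" using n by (intro power_mono) auto
    then have 2: "(real n)\<^sup>2 \<le> 144 * P" using sP by (simp add: power_mult_distrib)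
    have "8 * rad r * (5/2 * g + rad r * Lt) * (real n)\<^sup>2 \<le> 8 * (8/7 * r) * (51/14 * (Lt * r * Y)) * (144 * P)"
      using 1 2 \<tau> g0 Lt0 LrY r P by (intro mult_mono) auto
    moreover have "\<eta> * (2/5) \<le> \<eta> * ?gn" using gb(7) \<eta> by (intro mult_left_mono) auto
    ultimately have "8 * rad r * (5/2 * g + rad r * Lt) * (real n)\<^sup>2 / (\<eta> * ?gn)
        \<le> 8 * (8/7 * r) * (51/14 * (Lt * r * Y)) * (144 * P) / (\<eta> * (2/5))"
      using \<eta> Lt0 Y(1) r(1) P(2) by (intro frac_le mult_nonneg_nonneg) auto
    also have "\<dots> = 8 * (8/7) * (51/14) * 144 * (5/2) * (Lt * r\<^sup>2 / \<eta>) * Y * P"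
      using \<eta> by (simp add: power2_eq_square field_simps)
    also have "\<dots> = (8 * (8/7) * (51/14) * 144 * (5/2)) * (Y * P\<^sup>2)" unfolding P(1)[symmetric] by (simp add: power2_eq_square)
    also have "\<dots> \<le> 12600 * (Y * P\<^sup>2)" using Y by (intro mult_right_mono) auto
    also have "\<dots> \<le> 2 ^ m" using m(2) by simp
    finally show ?thesis .
  qed
  have al: "alg1 K M F G (fr c) Lt c r \<eta> out calls \<longleftrightarrow>
     (\<exists>xs\<in>?X. (\<forall>u\<in>?X. ?f xs \<le> ?f u) \<and>
        (\<exists>x z. alg1_iter ?f ?g ?X ?gn ?gp Lt (cnt xs) \<eta> (cnt xs) x z calls \<and> out = ?hi x))" for out calls
  proof -
    have "Lt-lipschitz_on ?X ?g"
      using T.lip Lt0 by (intro lipschitz_onI) (auto simp: dist_norm)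
    then show ?thesis unfolding alg1_def Let_def img cnt_def using M by simp
  qed
  obtain y where y: "y \<in> ?X" "\<And>w. w \<in> ?X \<Longrightarrow> ?f y \<le> ?f w"
    using continuous_attains_inf[OF T.X(2) T.cX(2) T.f_continuous] by blast
  obtain x z n where "alg1_iter ?f ?g ?X ?gn ?gp Lt (cnt y) \<eta> (cnt y) x z n"
    using T.iter_exists[OF \<eta> m(1) gb(5) hm[OF cnt(1)[OF y(1)]], of "cnt y"] by auto
  then show "\<exists>out calls. alg1 K M F G (fr c) Lt c r \<eta> out calls" using al y by blast
  show "out \<in> rball K c r \<and> (\<forall>y\<in>rball K c r. F out \<le> F y + \<eta>) \<and> real calls \<le> 24 * sqrt P * (2 + real m)"
    if run: "alg1 K M F G (fr c) Lt c r \<eta> out calls" for out calls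
  proof -
    obtain xs x z where xs: "xs \<in> ?X" "\<And>u. u \<in> ?X \<Longrightarrow> ?f xs \<le> ?f u"
      and it: "alg1_iter ?f ?g ?X ?gn ?gp Lt (cnt xs) \<eta> (cnt xs) x z calls" and out: "out = ?hi x"
      using run al by blast
    have h: "8 * rad r * (5/2 * g + rad r * Lt) * (real (cnt xs))\<^sup>2 / (\<eta> * ?gn) \<le> 2 ^ m"
      by (rule hm[OF cnt(1)[OF xs(1)]])
    note R = T.iter_result[OF \<eta> m(1) gb(5) h it xs cnt(2)[OF xs(1)]]
    have "out \<in> rball K c r" using rad_domain(2)[OF r c, of x] R(1) out by simp
    moreover have "F out \<le> F w + \<eta>" if "w \<in> rball K c r" for w
    proof -
      have "?hm w \<in> ?X" "?hi (?hm w) = w" using hm_ball[OF r c that] by auto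
      then have "?f xs \<le> F w" using xs(2) by fastforce
      then show ?thesis using R(2) out by simp
    qed
    moreover have "real calls \<le> 24 * sqrt P * (2 + real m)"
    proof -
      have "real calls \<le> real (cnt xs * (2 * (2 + m)))" using R(3) by (simp only: of_nat_le_iff)
      also have "\<dots> = real (cnt xs) * (2 * (2 + real m))" by (simp add: algebra_simps)
      also have "\<dots> \<le> (12 * sqrt P) * (2 * (2 + real m))" using cnt(1)[OF xs(1)] by (intro mult_right_mono) auto
      finally show ?thesis by (simp add: algebra_simps)
    qed
    ultimately show ?thesis by blast
  qed
qed

end

section \<open>Approximate minimizers over balls\<close>

lemma nonneg_of_quadratic:
  fixes A B :: real
  assumes "\<And>t. 0 < t \<Longrightarrow> t \<le> 1 \<Longrightarrow> 0 \<le> t * A + t\<^sup>2 * B"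
  shows "0 \<le> A"
proof (rule ccontr)
  assume "\<not> 0 \<le> A"
  then have A: "A < 0" by simp
  define t where "t = min 1 (- A / (2 * (\<bar>B\<bar> + 1)))"
  have t: "0 < t" "t \<le> 1" using A by (auto simp: t_def divide_neg_pos)
  have "t * (\<bar>B\<bar> + 1) \<le> - A / (2 * (\<bar>B\<bar> + 1)) * (\<bar>B\<bar> + 1)"
    by (intro mult_right_mono) (auto simp: t_def)
  also have "\<dots> = - A / 2" by (simp add: field_simps)
  finally have "t * (\<bar>B\<bar> + 1) \<le> - A / 2" .
  moreover have "t * B \<le> t * (\<bar>B\<bar> + 1)" using t by (intro mult_left_mono) auto
  ultimately have "A + t * B < 0" using A by linarith
  then have "t * (A + t * B) < 0" using t by (simp add: mult_pos_neg)
  then show False using assms[OF t] by (simp add: power2_eq_square algebra_simps)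
qed

context space_form begin

text \<open>First-order optimality is tested on chart segments, which stay in the Euclidean ball.
  Since the chart slope and the geodesic slope differ by a positive factor, optimality passes to
  geodesics, and strong g-convexity turns it into quadratic growth.\<close>

lemma ball_minimizer:
  fixes r L \<mu> g :: real
  assumes r: "0 < r" "r \<le> 1" "0 < K \<longrightarrow> r \<le> 1/2" and c: "c \<in> S"
    and sm: "smooth_on K F G L N" and sc: "strongly_gconvex_on K F G \<mu> N" and \<mu>: "0 \<le> \<mu>"
    and N: "rball K c r \<subseteq> N" and L: "0 < L"
    and G: "\<forall>p\<in>rball K c r. G p \<in> tangent K p \<and> nrm (G p) \<le> g"
  obtains y where "y \<in> rball K c r" "\<And>q. q \<in> rball K c r \<Longrightarrow> F y + \<mu> / 2 * (d y q)\<^sup>2 \<le> F q"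
proof -
  let ?hi = "geod_inv K c (fr c)" and ?hm = "geod_map K c (fr c)"
  let ?f = "F \<circ> ?hi" and ?g = "chart_grad K c (fr c) G"
  let ?X = "cball 0 (rad r) :: 'a set"
  interpret T: tilted ?f ?g ?X "rad r" "gamma_n K r" "gamma_p K r" "3000 * (g + L)" "5/2 * g"
    by (rule chart_tilted[OF r c sm sc \<mu> N L G order_refl])
  have g0: "0 \<le> g" by (rule g_nonneg[OF r c sm sc \<mu> N L G])
  obtain x where x: "x \<in> ?X" "\<And>w. w \<in> ?X \<Longrightarrow> ?f x \<le> ?f w"
    using continuous_attains_inf[OF T.X(2) T.cX(2) T.f_continuous] by blast
  have nx: "norm x \<le> rad r" using x by simp
  note CI = chart_ineq[OF r c sm sc \<mu> N L G]
  have opt: "0 \<le> ?g x \<bullet> (v - x)" if v: "v \<in> ?X" for v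
  proof (rule nonneg_of_quadratic[where B = "(7 * g + L / 2) * (16 * (norm (v - x))\<^sup>2)"])
    fix t :: real assume t: "0 < t" "t \<le> 1"
    define w where "w = (1 - t) *\<^sub>R x + t *\<^sub>R v"
    have wX: "w \<in> ?X" unfolding w_def using T.comb_in[OF x(1) v] t by simp
    have wx: "w - x = t *\<^sub>R (v - x)" by (simp add: w_def algebra_simps)
    have nw: "norm w \<le> rad r" using wX by simp
    obtain \<tau> where i: "?f w \<le> ?f x + \<tau> + L / 2 * (d (?hi x) (?hi w))\<^sup>2"
      "\<bar>\<tau> - ?g x \<bullet> (w - x)\<bar> \<le> 7 * g * (d (?hi x) (?hi w))\<^sup>2" "d (?hi x) (?hi w) \<le> 4 * norm (w - x)"
      using CI[OF nx nw] by metis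
    have d0: "0 \<le> d (?hi x) (?hi w)" using pair_geometry[OF r c nx nw] by metis
    have "(d (?hi x) (?hi w))\<^sup>2 \<le> (4 * norm (w - x))\<^sup>2" using i(3) d0 by (intro power_mono) auto
    also have "\<dots> = t\<^sup>2 * (16 * (norm (v - x))\<^sup>2)" using t by (simp add: wx power_mult_distrib)
    finally have D: "(7 * g + L / 2) * (d (?hi x) (?hi w))\<^sup>2 \<le> (7 * g + L / 2) * (t\<^sup>2 * (16 * (norm (v - x))\<^sup>2))"
      using g0 L by (intro mult_left_mono) auto
    have "0 \<le> ?g x \<bullet> (w - x) + (7 * g + L / 2) * (d (?hi x) (?hi w))\<^sup>2"
      using i(1,2) x(2)[OF wX] unfolding distrib_right by linarith
    then show "0 \<le> t * (?g x \<bullet> (v - x)) + t\<^sup>2 * ((7 * g + L / 2) * (16 * (norm (v - x))\<^sup>2))"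
      using D by (simp add: wx algebra_simps)
  qed
  show ?thesis
  proof (rule that[of "?hi x"])
    show "?hi x \<in> rball K c r" using rad_domain[OF r c nx] by simp
    fix q assume q: "q \<in> rball K c r"
    define v where "v = ?hm q"
    have v: "norm v \<le> rad r" "?hi v = q" using hm_ball[OF r c q] by (auto simp: v_def)
    obtain \<tau> \<theta> where "gamma_p K r \<le> \<theta>" "\<theta> * (?g x \<bullet> (v - x)) = \<tau>"
      "?f x + \<tau> + \<mu> / 2 * (d (?hi x) (?hi v))\<^sup>2 \<le> ?f v"
      using CI[OF nx v(1)] by metis
    moreover have "0 \<le> \<theta> * (?g x \<bullet> (v - x))"
      using calculation(1) gamma_bounds(3)[OF r] opt[of v] v by simp
    ultimately show "F (?hi x) + \<mu> / 2 * (d (?hi x) q)\<^sup>2 \<le> F q" using v(2) by simp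
  qed
qed

text \<open>The gradient inequalities at the intermediate point towards the two ends are weighted
  with E - t and t; the slopes cancel.\<close>

lemma strong_convex_segment:
  assumes sc: "strongly_gconvex_on K F G \<mu> N" and q: "q \<in> S" and e: "utan K q e" and t: "0 \<le> t" "t \<le> E" "0 < K \<longrightarrow> E \<le> pi"
    and N: "q \<in> N" "gpt K q e t \<in> N" "gpt K q e E \<in> N"
  shows "E * F (gpt K q e t) + \<mu> / 2 * (t * E * (E - t)) \<le> (E - t) * F q + t * F (gpt K q e E)"
proof -
  define \<gamma> where "\<gamma> = ip (G (gpt K q e t)) (gtan K q e t)"
  define h where "h = \<mu> / 2"
  have t': "0 < K \<Longrightarrow> t \<le> pi" "0 < K \<Longrightarrow> E - t \<le> pi" using t by auto
  have "F q \<ge> F (gpt K q e t) + (0 - t) * \<gamma> + \<mu> / 2 * (0 - t)\<^sup>2"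
    using convex_geo[OF sc q e, of t 0] N t t' by (simp add: \<gamma>_def)
  then have "(E - t) * F q \<ge> (E - t) * (F (gpt K q e t) + (0 - t) * \<gamma> + \<mu> / 2 * (0 - t)\<^sup>2)"
    using t by (intro mult_left_mono) auto
  moreover have "F (gpt K q e E) \<ge> F (gpt K q e t) + (E - t) * \<gamma> + \<mu> / 2 * (E - t)\<^sup>2"
    using convex_geo[OF sc q e, of t E] N t t' by (simp add: \<gamma>_def)
  then have "t * F (gpt K q e E) \<ge> t * (F (gpt K q e t) + (E - t) * \<gamma> + \<mu> / 2 * (E - t)\<^sup>2)"
    using t by (intro mult_left_mono) auto
  ultimately show ?thesis
    unfolding h_def[symmetric] by (simp add: algebra_simps power2_eq_square)
qed

text \<open>The Euclidean picture: x, at distance E from q, is no farther from c, so the direction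
  from q to x makes an acute angle with that to c, and after time t the squared distance to c is at
  most (1 - t / E) |c - q|^2 + t^2. Thus t < r^2 / E is admissible. The factor 1/3 absorbs
  curvature, and \<sigma> \<le> 2 cos E compensates the factor cos E that appears on the
  sphere.\<close>

lemma chord_in_ball:
  assumes c: "c \<in> S" and q: "q \<in> S" and e: "utan K q e"
    and r: "0 < r" "r \<le> 1" "0 < K \<longrightarrow> r \<le> 1/2" and cq: "d c q \<le> r"
    and E: "r \<le> E" "d c (gpt K q e E) \<le> E" "0 < K \<longrightarrow> E < pi/2" and \<sigma>: "0 < \<sigma>" "\<sigma> \<le> 1" "0 < K \<longrightarrow> \<sigma> \<le> 2 * cos E"
  defines "t \<equiv> \<sigma> * r\<^sup>2 / (3 * E)"
  shows "d c (gpt K q e t) \<le> r" "0 < t" "t \<le> \<sigma> * r / 3"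
proof -
  have E0: "0 < E" using E r by linarith
  show t0: "0 < t" using \<sigma> r E0 by (simp add: t_def)
  have "\<sigma> * r\<^sup>2 / (3 * E) \<le> \<sigma> * r\<^sup>2 / (3 * r)" using E r \<sigma> by (intro divide_left_mono) auto
  also have "\<dots> = \<sigma> * r / 3" using r by (simp add: power2_eq_square)
  finally show t1: "t \<le> \<sigma> * r / 3" by (simp add: t_def)
  have "\<sigma> * r \<le> 1 * r" using \<sigma> r by (intro mult_right_mono) auto
  then have t2: "t \<le> r / 3" using t1 by simp
  have tE: "t * E = \<sigma> * r\<^sup>2 / 3" using E0 by (simp add: t_def)
  define w x where "w = gpt K q e t" and "x = gpt K q e E"
  have S: "w \<in> S" "x \<in> S" using gpt_in[OF q e] by (auto simp: w_def x_def)
  have "sn K E * (K * ip c w) = sn K (E - t) * (K * ip c q) + sn K t * (K * ip c x)"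
    using arg_cong[OF gpt_interp[of E q e t], of "\<lambda>z. K * ip c z"]
    unfolding w_def x_def by (simp add: form_simps algebra_simps)
  then have eq: "sn K E * cs K (d c w) = sn K (E - t) * cs K (d c q) + sn K t * cs K (d c x)"
    using cs_d[OF c S(1)] cs_d[OF c S(2)] cs_d[OF c q] by simp
  have dn: "0 \<le> d c w" "0 \<le> d c q" "0 \<le> d c x" using d_nonneg c q S by auto
  have dx: "d c x \<le> E" using E by (simp add: x_def)
  show "d c (gpt K q e t) \<le> r"
  proof (cases "K = 1")
    case True
    have E': "E < pi/2" "r \<le> 1/2" "\<sigma> \<le> 2 * cos E" using E r \<sigma> True by auto
    have p3: "3 < pi" by (rule pi_gt3)
    have cE: "0 < cos E" using E' E0 by (intro cos_gt_zero_pi) auto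
    have s: "0 < sin t" "0 < sin E" "0 \<le> sin (E - t)"
      using t0 t2 E0 E r E' p3 by (auto intro!: sin_gt_zero sin_ge_zero)
    have ct: "7/8 \<le> cos t" "7/8 \<le> cos (r/2)"
      using cos_half_ge cos_monotone_0_pi_le[of t "1/2"] cos_monotone_0_pi_le[of "r/2" "1/2"] t0 t2 E' r p3 by auto
    have "t * (7/8) \<le> t * cos t" using ct t0 by (intro mult_left_mono) auto
    also have "\<dots> \<le> sin t" using mult_cos_le_sin t0 t2 E' p3 by simp
    finally have st: "t * (7/8) \<le> sin t" .
    have "r/2 * (7/8) \<le> r/2 * cos (r/2)" using ct r by (intro mult_left_mono) auto
    also have "\<dots> \<le> sin (r/2)" using mult_cos_le_sin[of "r/2"] r E' p3 by simp
    finally have "(r/2 * (7/8))\<^sup>2 \<le> (sin (r/2))\<^sup>2" using r by (intro power_mono) auto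
    moreover have "cos r = 1 - 2 * (sin (r/2))\<^sup>2" using cos_double_sin[of "r/2"] by simp
    ultimately have cr: "49/128 * r\<^sup>2 \<le> 1 - cos r" by (simp add: power2_eq_square)
    have "(sin (t/2))\<^sup>2 \<le> (t/2)\<^sup>2"
      using sin_x_le_x[of "t/2"] sin_ge_zero[of "t/2"] t0 t2 E' p3 by (intro power_mono) auto
    moreover have "cos t = 1 - 2 * (sin (t/2))\<^sup>2" using cos_double_sin[of "t/2"] by simp
    ultimately have c1: "1 - cos t \<le> t\<^sup>2 / 2" "0 \<le> 1 - cos t" by (auto simp: power2_eq_square)
    \<comment> \<open>The goal is the interpolation identity \<open>eq\<close> in its worst case d c
      q = r, d c x = E. Expanding sin (E - t) there turns the claim into \<open>key\<close>: a term
      of second order in t against one of first order.\<close>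
    have "cos r * (sin E * (1 - cos t)) \<le> 1 * (E * (t\<^sup>2 / 2))"
      using c1 sin_x_le_x[of E] E0 s by (intro mult_mono) auto
    also have "\<dots> = (t * E) * t / 2" by (simp add: power2_eq_square)
    also have "\<dots> = \<sigma> * (r\<^sup>2 * t / 6)" unfolding tE by simp
    also have "\<dots> \<le> (2 * cos E) * (r\<^sup>2 * t / 6)" using E' t0 by (intro mult_right_mono) auto
    also have "\<dots> \<le> (t * (7/8)) * (cos E * (49/128 * r\<^sup>2))" using cE t0 by (simp add: field_simps)
    also have "\<dots> \<le> sin t * (cos E * (1 - cos r))"
      using st cr cE t0 by (intro mult_mono mult_left_mono) auto
    finally have key: "cos r * (sin E * (1 - cos t)) \<le> sin t * (cos E * (1 - cos r))" .
    have q1: "cos r \<le> cos (d c q)" using cq dn r E' p3 by (intro cos_monotone_0_pi_le) auto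
    have x1: "cos E \<le> cos (d c x)" using dx dn E' p3 by (intro cos_monotone_0_pi_le) auto
    have "sin E * cos r \<le> sin (E - t) * cos r + sin t * cos E"
      using key by (simp add: sin_diff algebra_simps)
    also have "\<dots> \<le> sin (E - t) * cos (d c q) + sin t * cos (d c x)"
      using q1 x1 s by (intro add_mono mult_left_mono) auto
    also have "\<dots> = sin E * cos (d c w)" using eq True by simp
    finally have "cos r \<le> cos (d c w)" using s by simp
    then show ?thesis using cos_mono_le_eq[of r "d c w"] dn d_le_pi[OF c S(1)] r E' p3 True by (simp add: w_def)
  next
    case False
    then have K': "K = -1" using K by auto
    have cosh_half: "(cosh (1/2::real))\<^sup>2 \<le> 51/40"
    proof -
      have "cosh (1/2 + 1/2::real) = 2 * (cosh (1/2))\<^sup>2 - 1"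
        unfolding cosh_add using cosh_square_eq[of "1/2::real"] by (simp add: power2_eq_square)
      then show ?thesis using cosh_1_le by simp
    qed
    have "sinh (t/2) \<le> (t/2) * cosh (t/2)" using sinh_le_mult_cosh[of "t/2"] t0 by simp
    also have "\<dots> \<le> (t/2) * cosh (1/2)"
      using t0 t2 r cosh_real_nonneg_le_iff[of "t/2" "1/2"] by (intro mult_left_mono) auto
    finally have "(sinh (t/2))\<^sup>2 \<le> ((t/2) * cosh (1/2))\<^sup>2" using t0 by (intro power_mono) auto
    also have "\<dots> = (t/2)\<^sup>2 * (cosh (1/2))\<^sup>2" by (rule power_mult_distrib)
    also have "\<dots> \<le> (t/2)\<^sup>2 * (51/40)" using cosh_half by (intro mult_left_mono) auto
    finally have "(sinh (t/2))\<^sup>2 \<le> (t/2)\<^sup>2 * (51/40)" .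
    moreover have ch2: "cosh x = 1 + 2 * (sinh (x/2))\<^sup>2" for x :: real
      using cosh_add[of "x/2" "x/2"] cosh_square_eq[of "x/2"] by (simp add: power2_eq_square)
    ultimately have c1: "cosh t - 1 \<le> 51/80 * t\<^sup>2" using ch2[of t] by (simp add: power2_eq_square)
    have "(r/2)\<^sup>2 \<le> (sinh (r/2))\<^sup>2" using le_sinh[of "r/2"] r by (intro power_mono) auto
    then have cr: "r\<^sup>2 / 2 \<le> cosh r - 1" using ch2[of r] by (simp add: power2_eq_square)
    have crb: "cosh r \<le> 31/20" using cosh_real_nonneg_le_iff[of r 1] r cosh_1_le by linarith
    have sE: "sinh E \<le> E * cosh E" using sinh_le_mult_cosh E0 by simp
    have "cosh r * (sinh E * (cosh t - 1)) \<le> 31/20 * ((E * cosh E) * (51/80 * t\<^sup>2))"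
      using crb sE c1 E0 cosh_real_ge_1[of t] by (intro mult_mono) auto
    also have "\<dots> = 1581/1600 * cosh E * t * (t * E)" by (simp add: power2_eq_square)
    also have "\<dots> = 1581/4800 * cosh E * t * (\<sigma> * r\<^sup>2)" unfolding tE by simp
    also have "\<dots> \<le> 1581/4800 * cosh E * t * (1 * r\<^sup>2)" using \<sigma> t0 by (intro mult_left_mono mult_right_mono) auto
    also have "\<dots> \<le> t * (cosh E * (r\<^sup>2 / 2))" using t0 by (simp add: field_simps)
    also have "\<dots> \<le> sinh t * (cosh E * (cosh r - 1))"
      using le_sinh[of t] t0 cr by (intro mult_mono mult_left_mono) auto
    finally have key: "cosh r * (sinh E * (cosh t - 1)) \<le> sinh t * (cosh E * (cosh r - 1))" .
    have s: "0 < sinh t" "0 < sinh E" "0 \<le> sinh (E - t)" using t0 t2 E E0 r by auto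
    have q1: "cosh (d c q) \<le> cosh r" using cq dn r cosh_real_nonneg_le_iff by simp
    have x1: "cosh (d c x) \<le> cosh E" using dx dn E0 cosh_real_nonneg_le_iff by simp
    have "sinh E * cosh (d c w) = sinh (E - t) * cosh (d c q) + sinh t * cosh (d c x)" using eq K' by simp
    also have "\<dots> \<le> sinh (E - t) * cosh r + sinh t * cosh E" using q1 x1 s by (intro add_mono mult_left_mono) auto
    also have "\<dots> \<le> sinh E * cosh r" using key by (simp add: sinh_diff algebra_simps)
    finally have "cosh (d c w) \<le> cosh r" using s by simp
    then show ?thesis using cosh_real_nonneg_le_iff[of "d c w" r] dn r by (simp add: w_def)
  qed
qed

end

text \<open>
  The algorithm starts at \<open>s\<close>. Its later iterates are at distance less than \<open>D\<close> from the minimizer \<open>xs\<close>,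
  so with balls of radius at most \<open>r1\<close> it only queries points of the set in the assumption \<open>Q\<close>.
\<close>

locale core = space_form K fr for K :: real and fr :: "'a::euclidean_space point \<Rightarrow> 'a \<Rightarrow> 'a point" +
  fixes M N :: "'a point set" and F :: "'a point \<Rightarrow> real" and G :: "'a point \<Rightarrow> 'a point"
    and L \<mu> D r1 CG Lt \<sigma> :: real and xs s :: "'a point"
  assumes N: "N \<subseteq> M" "N \<subseteq> model_space K" and xs: "xs \<in> N" and G_tan: "\<And>p. p \<in> N \<Longrightarrow> G p \<in> tangent K p"
    and sm: "smooth_on K F G L N" and sc: "strongly_gconvex_on K F G \<mu> N" and L: "0 < L" and \<mu>: "0 < \<mu>"
    and s: "s \<in> model_space K" "rdist K s xs \<le> D"
    and r1: "0 < r1" "r1 \<le> D" "r1 \<le> 1" "0 < K \<Longrightarrow> r1 \<le> 1/2" and DK: "0 < K \<Longrightarrow> D + r1 < pi/2"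
    and \<sigma>: "0 < \<sigma>" "\<sigma> \<le> 1" "0 < K \<Longrightarrow> \<sigma> \<le> 2 * cos (D + r1)" and CG: "1 \<le> CG"
    and Q: "\<And>p. p \<in> model_space K \<Longrightarrow> rdist K s p \<le> r1 \<or> rdist K p xs < D + r1 \<Longrightarrow>
        p \<in> N \<and> rnorm K (G p) \<le> CG * L * rdist K p xs"
    and Lt: "10000 * CG * L * (D + 1) \<le> Lt"
begin

lemma xsS: "xs \<in> S" using xs N by auto

lemma D0: "0 < D" using r1 by linarith

lemma G_xs: "G xs = 0"
proof -
  have "nrm (G xs) \<le> 0" using Q[OF xsS] D0 r1 d_self[OF xsS] by auto
  then have "ip (G xs) (G xs) = 0"
    using nrm_sq[OF xsS G_tan[OF xs]] nrm_nonneg[OF xsS G_tan[OF xs]] by auto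
  then show ?thesis using tangent_form_eq_0[OF xsS G_tan[OF xs]] by simp
qed

lemma growth: assumes "q \<in> N" shows "F xs + \<mu> / 2 * (d xs q)\<^sup>2 \<le> F q" "F q \<le> F xs + L / 2 * (d xs q)\<^sup>2"
proof -
  have q: "q \<in> S" using assms N by auto
  obtain e where e: "utan K xs e" "q = gpt K xs e (d xs q)" using gpt_polar xsS q by blast
  have pi: "0 < K \<Longrightarrow> \<bar>d xs q - 0\<bar> \<le> pi" using d_nonneg[OF xsS q] d_le_pi[OF xsS q] by simp
  show "F xs + \<mu> / 2 * (d xs q)\<^sup>2 \<le> F q"
    using convex_geo[OF sc xsS e(1), of 0 "d xs q"] pi xs assms e(2) by (simp add: G_xs form_simps)
  show "F q \<le> F xs + L / 2 * (d xs q)\<^sup>2"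
    using smooth_geo[OF sm xsS e(1), of 0 "d xs q"] pi xs assms e(2) by (simp add: G_xs form_simps)
qed

lemma F_min: "q \<in> N \<Longrightarrow> F xs \<le> F q"
proof -
  assume "q \<in> N"
  moreover have "0 \<le> \<mu> / 2 * (d xs q)\<^sup>2" using \<mu> by simp
  ultimately show ?thesis using growth(1)[of q] by linarith
qed

lemma \<mu>_le_L: "\<mu> \<le> L"
proof -
  obtain e where e: "utan K xs e" using exists_utan xsS by blast
  let ?q = "gpt K xs e r1"
  have q: "?q \<in> S" "d xs ?q = r1" using gpt_in[OF xsS e] d_gpt[OF xsS e, of r1 0] r1 pi_gt3 by auto
  then have "?q \<in> N" using Q[OF q(1)] D0 d_commute by auto
  then have "\<mu> / 2 * r1\<^sup>2 \<le> L / 2 * r1\<^sup>2" using growth[of ?q, unfolded q(2)] by linarith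
  then show ?thesis using r1 by simp
qed

lemma Lt_bounds: "L \<le> Lt" "0 < Lt" "2 * CG * L \<le> Lt" "CG * L * (D + 1) \<le> Lt" "3000 * (CG * L * (D + 1) + L) \<le> Lt"
proof -
  have a: "1 * L \<le> CG * L" using CG L by (intro mult_right_mono) auto
  have b: "CG * L * 1 \<le> CG * L * (D + 1)" using D0 CG L by (intro mult_left_mono) auto
  show "L \<le> Lt" "0 < Lt" "2 * CG * L \<le> Lt" "CG * L * (D + 1) \<le> Lt" "3000 * (CG * L * (D + 1) + L) \<le> Lt"
  proof -
    define u where "u = CG * L * (D + 1)"
    have "L \<le> u" "10000 * u \<le> Lt" "CG * L \<le> u" using a b Lt by (auto simp: u_def mult.assoc)
    then show "L \<le> Lt" "0 < Lt" "2 * CG * L \<le> Lt" "CG * L * (D + 1) \<le> Lt" using L unfolding u_def[symmetric] by linarith+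
    have "3000 * (u + L) \<le> Lt" using L \<open>L \<le> u\<close> \<open>10000 * u \<le> Lt\<close> by (simp add: algebra_simps)
    then show "3000 * (CG * L * (D + 1) + L) \<le> Lt" by (simp add: u_def)
  qed
qed

text \<open>The parameter \<open>P\<close> of \<open>alg1_solves\<close> for the stage accuracy
  \<sigma> \<mu> r^2 / 4. The radius cancels, so all stages share one iteration bound.\<close>

definition Pc :: real where "Pc = 4 * Lt / (\<sigma> * \<mu>)"

lemma Pc: "1 \<le> Pc"
proof -
  have "\<sigma> * \<mu> \<le> 1 * L" using \<sigma> \<mu> \<mu>_le_L by (intro mult_mono) auto
  then have "\<sigma> * \<mu> \<le> 4 * Lt" using Lt_bounds by linarith
  then show ?thesis using \<sigma> \<mu> by (simp add: Pc_def le_divide_eq)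
qed

text \<open>
  If \<open>q\<close> were not closer to \<open>xs\<close> than \<open>c\<close>, then moving it towards \<open>xs\<close> as in \<open>chord_in_ball\<close> would contradict
  its near-optimality in the ball.
\<close>

lemma decrease:
  assumes c: "c \<in> S" "d c xs \<le> D" and r: "0 < r" "r \<le> r1" "r \<le> d c xs" and B: "rball K c r \<subseteq> N"
    and q: "q \<in> rball K c r" and min: "\<And>w. w \<in> rball K c r \<Longrightarrow> F q \<le> F w + \<sigma> * (\<mu> * r\<^sup>2 / 4)"
  shows "d q xs < d c xs"
proof (rule ccontr)
  assume "\<not> d q xs < d c xs"
  define E where "E = d q xs"
  have E: "d c xs \<le> E" "r \<le> E" using \<open>\<not> d q xs < d c xs\<close> r by (auto simp: E_def)
  have qS: "q \<in> S" "d c q \<le> r" "q \<in> N" using q B by (auto simp: rball_def)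
  have "E \<le> d q c + d c xs" unfolding E_def by (rule d_triangle[OF qS(1) c(1) xsS])
  then have ED: "E \<le> D + r1" using qS c r d_commute by (metis add.commute add_mono order_trans)
  have E0: "0 < E" using E r by linarith
  have r': "r \<le> 1" "0 < K \<longrightarrow> r \<le> 1/2" using r r1 by auto
  have EK: "0 < K \<longrightarrow> E < pi/2" using ED DK by force
  have \<sigma>E: "0 < K \<longrightarrow> \<sigma> \<le> 2 * cos E"
  proof
    assume k: "0 < K"
    have "cos (D + r1) \<le> cos E" using ED DK[OF k] E0 pi_gt3 by (intro cos_monotone_0_pi_le) auto
    then show "\<sigma> \<le> 2 * cos E" using \<sigma>(3)[OF k] by simp
  qed
  obtain e where e: "utan K q e" "xs = gpt K q e E" using gpt_polar[OF qS(1) xsS] by (auto simp: E_def)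
  define t where "t = \<sigma> * r\<^sup>2 / (3 * E)"
  have cx: "d c (gpt K q e E) \<le> E" using E e by simp
  note C = chord_in_ball[OF c(1) qS(1) e(1) r(1) r' qS(2) E(2) cx EK \<sigma>(1,2) \<sigma>E, folded t_def]
  have tE: "t \<le> E"
  proof -
    have "\<sigma> * r \<le> 1 * r" using \<sigma> r by (intro mult_right_mono) auto
    then show ?thesis using C(3) E r by linarith
  qed
  let ?w = "gpt K q e t"
  have w: "?w \<in> rball K c r" using C(1) gpt_in[OF qS(1) e(1)] by (simp add: rball_def)
  have piE: "0 < K \<longrightarrow> E \<le> pi" using EK pi_gt3 by fastforce
  have "E * F ?w + \<mu> / 2 * (t * E * (E - t)) \<le> (E - t) * F q + t * F xs"
    using strong_convex_segment[OF sc qS(1) e(1) less_imp_le[OF C(2)] tE piE] qS(3) w B e(2) xs by auto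
  moreover have "t * (F xs + \<mu> / 2 * E\<^sup>2) \<le> t * F q"
    using growth(1)[OF qS(3)] C(2) by (intro mult_left_mono) (auto simp: E_def d_commute)
  ultimately have "E * (F ?w + \<mu> / 2 * (2 * (t * E) - t\<^sup>2)) \<le> E * F q"
    by (simp add: algebra_simps power2_eq_square)
  then have "F ?w + \<mu> / 2 * (2 * (t * E) - t\<^sup>2) \<le> F q" using E0 by simp
  \<comment> \<open>With t E = \<sigma> r^2 / 3 and t^2 \<le> \<sigma> r^2 / 9 the left side is at
    least (2/3 - 1/9) of \<sigma> r^2, which exceeds one half.\<close>
  then have "\<mu> * (2 * (t * E) - t\<^sup>2) \<le> \<mu> * (\<sigma> * r\<^sup>2 / 2)" using min[OF w] by (simp add: algebra_simps)
  then have "2 * (t * E) - t\<^sup>2 \<le> \<sigma> * r\<^sup>2 / 2" using \<mu> by simp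
  moreover have "t * E = \<sigma> * r\<^sup>2 / 3" using E0 by (simp add: t_def)
  moreover have "t\<^sup>2 \<le> (\<sigma> * r / 3)\<^sup>2" using C by (intro power_mono) auto
  moreover have "(\<sigma> * r / 3)\<^sup>2 \<le> \<sigma> * r\<^sup>2 / 9"
  proof -
    have "\<sigma> * (\<sigma> * r\<^sup>2) \<le> 1 * (\<sigma> * r\<^sup>2)" using \<sigma> by (intro mult_right_mono) auto
    then show ?thesis by (simp add: power2_eq_square mult_ac)
  qed
  moreover have "0 < \<sigma> * r\<^sup>2" using \<sigma> r by simp
  ultimately show False by linarith
qed

section \<open>Approximate solution of one ball subproblem in stages\<close>

lemma query_ball:
  assumes "c \<in> S" "c = s \<or> d c xs < D" "0 < r" "r \<le> r1"
  shows "rball K c r \<subseteq> N" "\<forall>p\<in>rball K c r. G p \<in> tangent K p \<and> nrm (G p) \<le> CG * L * (r + d c xs)"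
proof -
  have *: "p \<in> N \<and> nrm (G p) \<le> CG * L * (r + d c xs)" if p: "p \<in> rball K c r" for p
  proof -
    have pS: "p \<in> S" "d c p \<le> r" using p by (auto simp: rball_def)
    have t: "d p xs \<le> d c p + d c xs" using d_triangle[OF pS(1) assms(1) xsS] d_commute by metis
    \<comment> \<open>The two alternatives for the centre match those of \<open>Q\<close>: a ball
      about the start is covered by its radius, and for later centres the strict bound D on their
      distance to \<open>xs\<close> keeps the inequality strict.\<close>
    have "d s p \<le> r1 \<or> d p xs < D + r1" using assms pS t by auto
    then have "p \<in> N" "nrm (G p) \<le> CG * L * d p xs" using Q pS by auto
    moreover have "CG * L * d p xs \<le> CG * L * (r + d c xs)" using t pS CG L by (intro mult_left_mono) auto
    ultimately show ?thesis by simp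
  qed
  then show "rball K c r \<subseteq> N" by blast
  show "\<forall>p\<in>rball K c r. G p \<in> tangent K p \<and> nrm (G p) \<le> CG * L * (r + d c xs)"
    using * G_tan by blast
qed

lemma sN: "s \<in> N"
  using Q[OF s(1)] s r1 d_self by auto

text \<open>If \<open>xs\<close> is within r, gradients in the ball are O(L r) and Y = 1 suffices;
  otherwise Y pays for their size relative to r. Accuracy \<sigma> \<mu> r^2 / 4 places the output
  within r / sqrt 2 of the minimizer y over the ball. Recording such a y, rather than
  \<open>xs\<close>, is what lets the next stage work on a smaller ball although \<open>xs\<close>
  may lie outside.\<close>

lemma one_stage:
  assumes c: "c \<in> S" "c = s \<or> d c xs < D" "d c xs \<le> D" and r: "0 < r" "r \<le> r1"
    and Y: "1 \<le> Y" "d c xs \<le> r \<or> 1 \<le> r * Y" and m: "1 \<le> m" "12600 * Y * Pc\<^sup>2 \<le> 2 ^ m"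
  shows "\<exists>out calls. alg1 K M F G (fr c) Lt c r (\<sigma> * (\<mu> * r\<^sup>2 / 4)) out calls"
    and "\<And>out calls. alg1 K M F G (fr c) Lt c r (\<sigma> * (\<mu> * r\<^sup>2 / 4)) out calls \<Longrightarrow>
      out \<in> S \<and> d out xs < D \<and> (d c xs \<le> r \<longrightarrow> d out xs \<le> r / sqrt 2) \<and>
      (\<forall>w\<in>rball K c r. F out \<le> F w + \<sigma> * (\<mu> * r\<^sup>2 / 4) \<and> (\<exists>y\<in>S. d out y \<le> r / sqrt 2 \<and> F y \<le> F w)) \<and>
      real calls \<le> 24 * sqrt Pc * (2 + real m)"
proof -
  let ?\<eta> = "\<sigma> * (\<mu> * r\<^sup>2 / 4)" and ?g = "CG * L * (r + d c xs)"
  have r': "r \<le> 1" "0 < K \<longrightarrow> r \<le> 1/2" using r r1 by auto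
  note B = query_ball[OF c(1,2) r]
  have BM: "rball K c r \<subseteq> M" using B N by blast
  have \<eta>: "0 < ?\<eta>" using \<sigma> \<mu> r by simp
  have gD: "?g \<le> CG * L * (D + 1)" using c r r1 CG L by (intro mult_left_mono) auto
  have "3000 * (?g + L) \<le> 3000 * (CG * L * (D + 1) + L)" by (intro mult_left_mono add_right_mono gD) simp
  then have Ltg: "3000 * (?g + L) \<le> Lt" using Lt_bounds(5) by linarith
  have gY: "?g \<le> Lt * r * Y"
  proof (cases "d c xs \<le> r")
    case True
    have "?g \<le> CG * L * (2 * r)" using True CG L by (intro mult_left_mono) auto
    also have "\<dots> \<le> Lt * r * 1" using Lt_bounds(3) r mult_right_mono[of "2 * CG * L" Lt r] by (simp add: algebra_simps)
    also have "\<dots> \<le> Lt * r * Y" using Y Lt_bounds r by (intro mult_left_mono) auto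
    finally show ?thesis .
  next
    case False
    then have "Lt * 1 \<le> Lt * (r * Y)" using Y Lt_bounds by (intro mult_left_mono) auto
    then show ?thesis using gD Lt_bounds(4) by (simp add: mult.assoc)
  qed
  have P: "Pc = Lt * r\<^sup>2 / ?\<eta>" using r \<sigma> \<mu> by (simp add: Pc_def field_simps)
  note A = alg1_solves[OF r(1) r' c(1) sm sc less_imp_le[OF \<mu>] B(1) BM L B(2) Ltg \<eta> Y(1) gY P Pc m]
  show "\<exists>out calls. alg1 K M F G (fr c) Lt c r ?\<eta> out calls" by (rule A(1))
  fix out calls assume run: "alg1 K M F G (fr c) Lt c r ?\<eta> out calls"
  have R: "out \<in> rball K c r" "\<And>w. w \<in> rball K c r \<Longrightarrow> F out \<le> F w + ?\<eta>" "real calls \<le> 24 * sqrt Pc * (2 + real m)"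
    using A(2)[OF run] by auto
  have oS: "out \<in> S" "out \<in> N" using R(1) B(1) by (auto simp: rball_def)
  obtain y where y: "y \<in> rball K c r" "\<And>q. q \<in> rball K c r \<Longrightarrow> F y + \<mu> / 2 * (d y q)\<^sup>2 \<le> F q"
    using ball_minimizer[OF r(1) r' c(1) sm sc less_imp_le[OF \<mu>] B(1) L B(2)] by metis
  have near: "a \<le> r / sqrt 2" if "\<mu> / 2 * a\<^sup>2 \<le> ?\<eta>" for a
  proof -
    have "\<mu> * a\<^sup>2 \<le> \<mu> * (\<sigma> * r\<^sup>2 / 2)" using that by (simp add: algebra_simps)
    then have "a\<^sup>2 \<le> \<sigma> * r\<^sup>2 / 2" using \<mu> by simp
    also have "\<dots> \<le> 1 * r\<^sup>2 / 2" using \<sigma>(2) by (intro divide_right_mono mult_right_mono) auto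
    also have "\<dots> = (r / sqrt 2)\<^sup>2" by (simp add: power_divide)
    finally have sq: "a\<^sup>2 \<le> (r / sqrt 2)\<^sup>2" .
    show ?thesis by (rule power2_le_imp_le[OF sq]) (use r in simp)
  qed
  have yS: "y \<in> S" using y(1) by (simp add: rball_def)
  have dy: "d out y \<le> r / sqrt 2"
  proof -
    have "\<mu> / 2 * (d y out)\<^sup>2 \<le> ?\<eta>" using y(2)[OF R(1)] R(2)[OF y(1)] by linarith
    then have "d y out \<le> r / sqrt 2" by (rule near)
    then show ?thesis by (simp only: d_commute)
  qed
  have sq: "r / sqrt 2 < r" using r by (simp add: divide_less_eq)
  have dx: "d out xs \<le> r / sqrt 2" if "d c xs \<le> r"
  proof -
    have "xs \<in> rball K c r" using that xsS by (simp add: rball_def)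
    then have "F out \<le> F xs + ?\<eta>" by (rule R(2))
    then have "\<mu> / 2 * (d xs out)\<^sup>2 \<le> ?\<eta>" using growth(1)[OF oS(2)] by linarith
    then show ?thesis using near d_commute by metis
  qed
  have dD: "d out xs < D"
  proof (cases "d c xs \<le> r")
    case True
    then show ?thesis using dx sq r r1 by linarith
  next
    case False
    then have "d out xs < d c xs" using decrease[OF c(1,3) r _ B(1) R(1) R(2)] by simp
    then show ?thesis using c(3) by linarith
  qed
  have W: "F out \<le> F w + ?\<eta> \<and> (\<exists>y\<in>S. d out y \<le> r / sqrt 2 \<and> F y \<le> F w)" if "w \<in> rball K c r" for w
  proof -
    have "0 \<le> \<mu> / 2 * (d y w)\<^sup>2" using \<mu> by simp
    then have "F y \<le> F w" using y(2)[OF that] by linarith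
    then show ?thesis using dy yS R(2)[OF that] by (intro conjI bexI[of _ y]) simp_all
  qed
  show "out \<in> S \<and> d out xs < D \<and> (d c xs \<le> r \<longrightarrow> d out xs \<le> r / sqrt 2) \<and>
      (\<forall>w\<in>rball K c r. F out \<le> F w + ?\<eta> \<and> (\<exists>y\<in>S. d out y \<le> r / sqrt 2 \<and> F y \<le> F w)) \<and>
      real calls \<le> 24 * sqrt Pc * (2 + real m)"
  proof (intro conjI impI)
    show "\<forall>w\<in>rball K c r. F out \<le> F w + ?\<eta> \<and> (\<exists>y\<in>S. d out y \<le> r / sqrt 2 \<and> F y \<le> F w)"
      by (intro ballI W)
  qed (fact oS(1), fact dD, erule dx, fact R(3))
qed

context
  fixes p :: "'a point" and r Y :: real and J m :: nat
  assumes p: "p \<in> S" "p = s \<or> d p xs < D" "d p xs \<le> D" and r: "0 < r" "r \<le> r1"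
    and Y: "1 \<le> Y" "d p xs \<le> r \<or> (\<forall>j<J. sqrt 2 ^ j \<le> r * Y)" and m: "1 \<le> m" "12600 * Y * Pc\<^sup>2 \<le> 2 ^ m"
begin

abbreviation "stages \<equiv> sc_stages K M F G fr \<sigma> \<mu> Lt p r"

lemma radius_pos: "0 < r / sqrt 2 ^ j" "r / sqrt 2 ^ j \<le> r1" "r / sqrt 2 ^ j / sqrt 2 = r / sqrt 2 ^ Suc j"
proof -
  have "1 \<le> sqrt 2 ^ j" by simp
  then have "r / sqrt 2 ^ j \<le> r / 1" using r by (intro divide_left_mono) auto
  then show "r / sqrt 2 ^ j \<le> r1" using r by simp
  show "0 < r / sqrt 2 ^ j" "r / sqrt 2 ^ j / sqrt 2 = r / sqrt 2 ^ Suc j"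
    using r by (auto simp: field_simps)
qed

text \<open>Each stage ball contains a point at least as good as any given w of the original ball,
  so shrinking the balls loses nothing. Accuracy is claimed from the first completed stage
  on.\<close>

lemma stages_inv:
  assumes "stages j c n" "j \<le> J"
  shows "c \<in> S \<and> (j = 0 \<longrightarrow> c = p) \<and> (1 \<le> j \<longrightarrow> d c xs < D) \<and> (d p xs \<le> r \<longrightarrow> d c xs \<le> r / sqrt 2 ^ j) \<and>
    (\<forall>w\<in>rball K p r. (1 \<le> j \<longrightarrow> F c \<le> F w + \<sigma> * \<mu> * r\<^sup>2 / 2 ^ (j + 1)) \<and>
       (\<exists>y\<in>S. d c y \<le> r / sqrt 2 ^ j \<and> F y \<le> F w)) \<and>
    real n \<le> real j * (24 * sqrt Pc * (2 + real m))"
  using assms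
proof (induction rule: sc_stages.induct)
  case start
  then show ?case using p by (auto simp: rball_def)
next
  case (stage j c n rj c' k)
  note I = stage.IH[OF Suc_leD[OF stage.prems]]
  have j: "j < J" using stage.prems by simp
  have c: "c \<in> S" "c = s \<or> d c xs < D" "d c xs \<le> D" using I p by (cases "j = 0"; auto)+
  note rp = radius_pos[of j]
  have Y': "d c xs \<le> rj \<or> 1 \<le> rj * Y"
    using Y(2) I j stage.hyps(2) by (auto simp: field_simps)
  note O = one_stage(2)[OF c _ _ Y(1) Y' m stage.hyps(3)]
  have O': "c' \<in> S" "d c' xs < D" "d c xs \<le> rj \<Longrightarrow> d c' xs \<le> rj / sqrt 2"
    "\<And>w. w \<in> rball K c rj \<Longrightarrow> F c' \<le> F w + \<sigma> * (\<mu> * rj\<^sup>2 / 4)"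
    "\<And>w. w \<in> rball K c rj \<Longrightarrow> \<exists>y\<in>S. d c' y \<le> rj / sqrt 2 \<and> F y \<le> F w"
    "real k \<le> 24 * sqrt Pc * (2 + real m)"
    using O rp stage.hyps(2) by auto
  have rj2: "rj / sqrt 2 = r / sqrt 2 ^ Suc j" using rp(3) stage.hyps(2) by simp
  have acc: "\<sigma> * (\<mu> * rj\<^sup>2 / 4) = \<sigma> * \<mu> * r\<^sup>2 / 2 ^ (Suc j + 1)"
  proof -
    have "(sqrt 2 ^ j)\<^sup>2 = (2::real) ^ j" by (metis power_mult mult.commute real_sqrt_pow2 zero_le_numeral)
    then show ?thesis using stage.hyps(2) by (simp add: power_divide)
  qed
  have W: "F c' \<le> F w + \<sigma> * \<mu> * r\<^sup>2 / 2 ^ (Suc j + 1) \<and> (\<exists>y\<in>S. d c' y \<le> r / sqrt 2 ^ Suc j \<and> F y \<le> F w)"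
    if w: "w \<in> rball K p r" for w
  proof -
    obtain y where y: "y \<in> S" "d c y \<le> r / sqrt 2 ^ j" "F y \<le> F w" using I w by blast
    then have "y \<in> rball K c rj" using stage.hyps(2) by (simp add: rball_def)
    then show ?thesis using O'(4,5)[of y] y(3) unfolding acc rj2 by force
  qed
  have "real (n + k) \<le> real (Suc j) * (24 * sqrt Pc * (2 + real m))"
    using I O'(6) by (simp add: algebra_simps)
  moreover have "d c' xs \<le> r / sqrt 2 ^ Suc j" if "d p xs \<le> r"
    using O'(3) I that stage.hyps(2) unfolding rj2 by simp
  ultimately show ?case using O'(1,2) W by simp
qed

lemma stages_exists: "j \<le> J \<Longrightarrow> \<exists>c n. stages j c n"
proof (induction j)
  case 0 then show ?case using sc_stages.start by blast
next
  case (Suc j)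
  then obtain c n where st: "stages j c n" by auto
  note I = stages_inv[OF st Suc_leD[OF Suc.prems]]
  have c: "c \<in> S" "c = s \<or> d c xs < D" "d c xs \<le> D" using I p by (cases "j = 0"; auto)+
  have Y': "d c xs \<le> r / sqrt 2 ^ j \<or> 1 \<le> r / sqrt 2 ^ j * Y"
    using Y(2) I Suc.prems by (auto simp: field_simps)
  obtain c' k where "alg1 K M F G (fr c) Lt c (r / sqrt 2 ^ j) (\<sigma> * (\<mu> * (r / sqrt 2 ^ j)\<^sup>2 / 4)) c' k"
    using one_stage(1)[OF c radius_pos(1,2) Y(1) Y' m] by blast
  then show ?case using sc_stages.stage[OF st refl] by blast
qed

lemma alg_sc_correct:
  assumes \<eta>: "0 < \<eta>" and J: "J = nat (max 1 \<lceil>log 2 (\<mu> * r\<^sup>2 / \<eta>) - 1\<rceil>)"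
  shows "\<exists>out calls. alg_sc K M F G fr \<sigma> \<mu> Lt p r \<eta> out calls"
    and "\<And>out calls. alg_sc K M F G fr \<sigma> \<mu> Lt p r \<eta> out calls \<Longrightarrow>
      out \<in> S \<and> d out xs < D \<and> (\<forall>w\<in>rball K p r. F out \<le> F w + \<eta>) \<and> real calls \<le> real J * (24 * sqrt Pc * (2 + real m))"
proof -
  have al: "alg_sc K M F G fr \<sigma> \<mu> Lt p r \<eta> out calls \<longleftrightarrow> stages J out calls" for out calls
    by (simp add: alg_sc_def J)
  show "\<exists>out calls. alg_sc K M F G fr \<sigma> \<mu> Lt p r \<eta> out calls" unfolding al using stages_exists by blast
  fix out calls assume "alg_sc K M F G fr \<sigma> \<mu> Lt p r \<eta> out calls"
  then have st: "stages J out calls" by (simp add: al)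
  \<comment> \<open>That at least one stage is run activates the accuracy part of
    \<open>stages_inv\<close>; the other bound makes \<mu> r^2 / 2^(J + 1) at most \<eta>.\<close>
  have J1: "1 \<le> J" "log 2 (\<mu> * r\<^sup>2 / \<eta>) - 1 \<le> real J" unfolding J by linarith+
  have pos: "0 < \<mu> * r\<^sup>2 / \<eta>" using \<mu> r \<eta> by simp
  have "\<mu> * r\<^sup>2 / \<eta> = 2 powr (log 2 (\<mu> * r\<^sup>2 / \<eta>))" using pos by simp
  also have "\<dots> \<le> 2 powr (real (J + 1))" using J1 by (intro powr_mono) auto
  also have "\<dots> = 2 ^ (J + 1)" by (rule powr_realpow) simp
  finally have "\<mu> * r\<^sup>2 / 2 ^ (J + 1) \<le> \<eta>" using \<eta> by (simp add: field_simps)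
  moreover have "\<sigma> * (\<mu> * r\<^sup>2 / 2 ^ (J + 1)) \<le> 1 * (\<mu> * r\<^sup>2 / 2 ^ (J + 1))"
    using \<sigma> \<mu> by (intro mult_right_mono) auto
  ultimately have "\<sigma> * \<mu> * r\<^sup>2 / 2 ^ (J + 1) \<le> \<eta>" by simp
  then show "out \<in> S \<and> d out xs < D \<and> (\<forall>w\<in>rball K p r. F out \<le> F w + \<eta>) \<and> real calls \<le> real J * (24 * sqrt Pc * (2 + real m))"
    using stages_inv[OF st order_refl] J1(1) by fastforce
qed

end

end

section \<open>Boosting from small balls to the global minimizer\<close>

definition stage_count :: "real \<Rightarrow> real \<Rightarrow> real \<Rightarrow> nat" where
  "stage_count \<mu> r \<eta> = nat (max 1 \<lceil>log 2 (\<mu> * r\<^sup>2 / \<eta>) - 1\<rceil>)"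

context core begin

lemma boost_contraction:
  assumes p: "p \<in> S" "p = s \<or> d p xs < D" "d p xs \<le> Rg" and \<rho>: "0 < \<rho>" "\<rho> \<le> r1" "\<rho> \<le> Rg"
  shows "\<exists>w\<in>rball K p \<rho>. F w - F xs \<le> (1 - \<rho> / Rg) * (F p - F xs)"
proof -
  have pN: "p \<in> N" using Q[OF p(1)] p(2) sN r1 by auto
  have gap: "0 \<le> F p - F xs" using F_min[OF pN] by simp
  show ?thesis
  proof (cases "d p xs \<le> \<rho>")
    case True
    then have "xs \<in> rball K p \<rho>" using xsS by (simp add: rball_def)
    moreover have "0 \<le> (1 - \<rho> / Rg) * (F p - F xs)" using gap \<rho> by (intro mult_nonneg_nonneg) auto
    ultimately show ?thesis by (intro bexI[of _ xs]) auto
  next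
    case False
    define E where "E = d p xs"
    have E: "\<rho> < E" "E \<le> Rg" using False p by (auto simp: E_def)
    obtain e where e: "utan K p e" "xs = gpt K p e E" using gpt_polar[OF p(1) xsS] by (auto simp: E_def)
    let ?w = "gpt K p e \<rho>"
    have "d p ?w = \<bar>\<rho> - 0\<bar>" using d_gpt[OF p(1) e(1), of \<rho> 0] \<rho> r1 pi_gt3 by auto
    then have w: "?w \<in> rball K p \<rho>" using gpt_in[OF p(1) e(1)] \<rho> by (simp add: rball_def)
    have wN: "?w \<in> N" using query_ball(1)[OF p(1,2) \<rho>(1,2)] w by blast
    have "0 < K \<longrightarrow> E \<le> pi" using d_le_pi[OF p(1) xsS] by (simp add: E_def)
    then have "E * F ?w + \<mu> / 2 * (\<rho> * E * (E - \<rho>)) \<le> (E - \<rho>) * F p + \<rho> * F xs"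
      using strong_convex_segment[OF sc p(1) e(1), of \<rho> E] E \<rho> pN wN xs e(2) by auto
    moreover have "0 \<le> \<mu> / 2 * (\<rho> * E * (E - \<rho>))" using \<mu> \<rho> E by simp
    ultimately have "E * (F ?w - F xs) \<le> (E - \<rho>) * (F p - F xs)" by (simp add: algebra_simps)
    then have "F ?w - F xs \<le> (E - \<rho>) / E * (F p - F xs)" using E \<rho> by (simp add: field_simps)
    also have "(E - \<rho>) / E = 1 - \<rho> / E" using E \<rho> by (simp add: field_simps)
    also have "(1 - \<rho> / E) * (F p - F xs) \<le> (1 - \<rho> / Rg) * (F p - F xs)"
      using E \<rho> gap by (intro mult_right_mono) (auto intro!: divide_left_mono)
    finally show ?thesis using w by blast
  qed
qed

context
  fixes Rg \<rho> \<epsilon>' :: real and J m :: nat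
  assumes Rg: "D \<le> Rg" and \<rho>: "0 < \<rho>" "\<rho> \<le> r1" "\<rho> \<le> Rg" and \<epsilon>': "0 < \<epsilon>'"
    and J: "J = stage_count \<mu> \<rho> \<epsilon>'" and m: "1 \<le> m" "12600 * (max 1 (sqrt 2 ^ J / \<rho>)) * Pc\<^sup>2 \<le> 2 ^ m"
begin

lemma boost_Y: "\<forall>j<J. sqrt 2 ^ j \<le> \<rho> * (max 1 (sqrt 2 ^ J / \<rho>))"
proof (intro allI impI)
  fix j assume "j < J"
  then have "sqrt 2 ^ j \<le> sqrt 2 ^ J" by (intro power_increasing) auto
  also have "\<dots> = \<rho> * (sqrt 2 ^ J / \<rho>)" using \<rho> by simp
  also have "\<dots> \<le> \<rho> * (max 1 (sqrt 2 ^ J / \<rho>))" using \<rho> by (intro mult_left_mono) auto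
  finally show "sqrt 2 ^ j \<le> \<rho> * (max 1 (sqrt 2 ^ J / \<rho>))" .
qed

text \<open>The additive term \<epsilon>' Rg / \<rho> is the fixed point of the affine recursion
  that multiplies the gap by 1 - \<rho> / Rg and adds \<epsilon>'.\<close>

lemma boost_inv:
  assumes "boost_steps K M F G fr \<sigma> \<mu> Lt \<rho> \<epsilon>' s k p n"
  shows "p \<in> S \<and> (p = s \<or> d p xs < D) \<and> d p xs \<le> D \<and>
    F p - F xs \<le> (1 - \<rho> / Rg) ^ k * (F s - F xs) + \<epsilon>' * Rg / \<rho> \<and>
    real n \<le> real k * (real J * (24 * sqrt Pc * (2 + real m)))"
  using assms
proof (induction rule: boost_steps.induct)
  case start
  have "0 \<le> \<epsilon>' * Rg / \<rho>" using \<epsilon>' \<rho> by simp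
  then show ?case using s by simp
next
  case (step k p n p' c)
  have p: "p \<in> S" "p = s \<or> d p xs < D" "d p xs \<le> D" using step.IH by auto
  have A: "p' \<in> S" "d p' xs < D" "\<And>w. w \<in> rball K p \<rho> \<Longrightarrow> F p' \<le> F w + \<epsilon>'"
      "real c \<le> real J * (24 * sqrt Pc * (2 + real m))"
    using alg_sc_correct(2)[OF p \<rho>(1,2) _ _ m \<epsilon>' J[unfolded stage_count_def] step.hyps(2)] boost_Y by auto
  have dR: "d p xs \<le> Rg" using p Rg by simp
  obtain w where w: "w \<in> rball K p \<rho>" "F w - F xs \<le> (1 - \<rho> / Rg) * (F p - F xs)"
    using boost_contraction[OF p(1,2) dR \<rho>] by blast
  define q where "q = 1 - \<rho> / Rg"
  have q: "0 \<le> q" using \<rho> by (simp add: q_def)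
  have "F p' - F xs \<le> q * (F p - F xs) + \<epsilon>'" using A(3)[OF w(1)] w(2) by (simp add: q_def)
  also have "\<dots> \<le> q * (q ^ k * (F s - F xs) + \<epsilon>' * Rg / \<rho>) + \<epsilon>'"
    using step.IH q by (intro add_right_mono mult_left_mono) (auto simp: q_def)
  also have "\<dots> = q ^ Suc k * (F s - F xs) + (q * (\<epsilon>' * Rg / \<rho>) + \<epsilon>')" by (simp add: algebra_simps)
  also have "q * (\<epsilon>' * Rg / \<rho>) + \<epsilon>' = \<epsilon>' * Rg / \<rho>" using \<rho> by (simp add: q_def field_simps)
  finally have "F p' - F xs \<le> (1 - \<rho> / Rg) ^ Suc k * (F s - F xs) + \<epsilon>' * Rg / \<rho>" by (simp add: q_def)
  moreover have "real (n + c) \<le> real (Suc k) * (real J * (24 * sqrt Pc * (2 + real m)))"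
    using step.IH A(4) by (simp add: algebra_simps)
  ultimately show ?case using A by auto
qed

lemma boost_exists: "\<exists>p n. boost_steps K M F G fr \<sigma> \<mu> Lt \<rho> \<epsilon>' s k p n"
proof (induction k)
  case 0 then show ?case using boost_steps.start by blast
next
  case (Suc k)
  then obtain p n where st: "boost_steps K M F G fr \<sigma> \<mu> Lt \<rho> \<epsilon>' s k p n" by blast
  have p: "p \<in> S" "p = s \<or> d p xs < D" "d p xs \<le> D" using boost_inv[OF st] by auto
  obtain p' c where "alg_sc K M F G fr \<sigma> \<mu> Lt p \<rho> \<epsilon>' p' c"
    using alg_sc_correct(1)[OF p \<rho>(1,2) _ _ m \<epsilon>' J[unfolded stage_count_def]] boost_Y by auto
  then show ?case using boost_steps.step[OF st] by blast
qed

end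

lemma initial_gap: "F s - F xs \<le> L / 2 * D\<^sup>2" "0 \<le> F s - F xs"
proof -
  have "(d xs s)\<^sup>2 \<le> D\<^sup>2" using s d_nonneg[OF xsS s(1)] d_commute by (intro power_mono) auto
  then have "L / 2 * (d xs s)\<^sup>2 \<le> L / 2 * D\<^sup>2" using L by (intro mult_left_mono) auto
  then show "F s - F xs \<le> L / 2 * D\<^sup>2" using growth(2)[OF sN] by linarith
  show "0 \<le> F s - F xs" using F_min[OF sN] by simp
qed

text \<open>
  In the first case \<open>r\<close> bounds the distance to the minimizer, so gradients shrink with the radius of the
  stage; in the second they need not, which costs the factor \<open>sqrt 2 ^ J / \<rho>\<close> in the bisection.
\<close>

lemma alg2_correct:
  fixes \<rho> \<epsilon> Rg cL :: real
  assumes \<rho>: "0 < \<rho>" "min \<rho> Rg = r1" and Rg: "D \<le> Rg" and \<epsilon>: "0 < \<epsilon>" and cL: "Lt = cL * (L * (Rg + 1))"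
    and small: "Rg \<le> \<rho> \<Longrightarrow> 1 \<le> m \<and> 12600 * Pc\<^sup>2 \<le> 2 ^ m \<and>
        real (stage_count \<mu> Rg \<epsilon>) * (24 * sqrt Pc * (2 + real m)) \<le> B"
    and large: "\<And>T \<epsilon>'. \<rho> < Rg \<Longrightarrow> T = nat \<lceil>2 * Rg / \<rho> * ln (L * Rg\<^sup>2 / \<epsilon>)\<rceil> \<Longrightarrow> 1 \<le> T \<Longrightarrow>
        \<epsilon>' = min (\<rho> * \<epsilon> / (4 * Rg)) (\<mu> * Rg\<^sup>2 / (2 * (real T)\<^sup>2)) \<Longrightarrow>
        \<exists>m\<ge>1. 12600 * max 1 (sqrt 2 ^ stage_count \<mu> \<rho> \<epsilon>' / \<rho>) * Pc\<^sup>2 \<le> 2 ^ m \<and>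
          real T * (real (stage_count \<mu> \<rho> \<epsilon>') * (24 * sqrt Pc * (2 + real m))) \<le> B"
    and B: "0 \<le> B"
  shows "\<exists>out calls. alg2 K M fr \<rho> \<sigma> cL F G L \<mu> Rg s \<epsilon> out calls"
    and "\<And>out calls. alg2 K M fr \<rho> \<sigma> cL F G L \<mu> Rg s \<epsilon> out calls \<Longrightarrow>
      out \<in> N \<and> (out = s \<or> d out xs < D) \<and> F out \<le> F xs + \<epsilon> \<and> real calls \<le> B"
proof -
  have NQ: "p \<in> N" if "p \<in> S" "d p xs < D" for p
    using Q[OF that(1)] that r1 by auto
  have "(\<exists>out calls. alg2 K M fr \<rho> \<sigma> cL F G L \<mu> Rg s \<epsilon> out calls) \<and>
    (\<forall>out calls. alg2 K M fr \<rho> \<sigma> cL F G L \<mu> Rg s \<epsilon> out calls \<longrightarrow>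
      out \<in> N \<and> (out = s \<or> d out xs < D) \<and> F out \<le> F xs + \<epsilon> \<and> real calls \<le> B)"
  proof (cases "Rg \<le> \<rho>")
    case True
    then have r: "Rg = r1" "D = Rg" "0 < Rg" using \<rho> Rg r1 by auto
    have al: "alg2 K M fr \<rho> \<sigma> cL F G L \<mu> Rg s \<epsilon> out calls \<longleftrightarrow> alg_sc K M F G fr \<sigma> \<mu> Lt s Rg \<epsilon> out calls" for out calls
      using True by (simp add: alg2_def cL)
    have m: "1 \<le> m" "12600 * 1 * Pc\<^sup>2 \<le> 2 ^ m" and
      BB: "real (stage_count \<mu> Rg \<epsilon>) * (24 * sqrt Pc * (2 + real m)) \<le> B" using small[OF True] by auto
    have sp: "s = s \<or> d s xs < D" by simp
    have rr: "Rg \<le> r1" using r by simp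
    have Y: "d s xs \<le> Rg \<or> (\<forall>j<stage_count \<mu> Rg \<epsilon>. sqrt 2 ^ j \<le> Rg * 1)" using s r by simp
    note A = alg_sc_correct[OF s(1) sp s(2) r(3) rr order_refl Y m \<epsilon> stage_count_def]
    have "xs \<in> rball K s Rg" using s r xsS by (simp add: rball_def)
    then have "out \<in> S \<and> d out xs < D \<and> F out \<le> F xs + \<epsilon> \<and> real calls \<le> B"
      if "alg_sc K M F G fr \<sigma> \<mu> Lt s Rg \<epsilon> out calls" for out calls
      using A(2)[OF that] BB by force
    then show ?thesis unfolding al using A(1) NQ by blast
  next
    case False
    then have r: "\<rho> = r1" "\<rho> < Rg" using \<rho> by auto
    define T where "T = nat \<lceil>2 * Rg / \<rho> * ln (L * Rg\<^sup>2 / \<epsilon>)\<rceil>"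
    define \<epsilon>' where "\<epsilon>' = min (\<rho> * \<epsilon> / (4 * Rg)) (\<mu> * Rg\<^sup>2 / (2 * (real T)\<^sup>2))"
    have al: "alg2 K M fr \<rho> \<sigma> cL F G L \<mu> Rg s \<epsilon> out calls \<longleftrightarrow>
        boost_steps K M F G fr \<sigma> \<mu> Lt \<rho> \<epsilon>' s T out calls" for out calls
      using False by (simp add: alg2_def cL T_def \<epsilon>'_def Let_def)
    have "D\<^sup>2 \<le> Rg\<^sup>2" using D0 Rg by (intro power_mono) auto
    then have "L / 2 * D\<^sup>2 \<le> L / 2 * Rg\<^sup>2" using L by (intro mult_left_mono) auto
    then have gap: "F s - F xs \<le> L / 2 * Rg\<^sup>2" using initial_gap by linarith
    have pos: "0 < L * Rg\<^sup>2 / \<epsilon>" using L r \<rho> \<epsilon> by simp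
    show ?thesis
    proof (cases "1 \<le> T")
      case T1: True
      obtain m where m: "m \<ge> 1" "12600 * max 1 (sqrt 2 ^ stage_count \<mu> \<rho> \<epsilon>' / \<rho>) * Pc\<^sup>2 \<le> 2 ^ m"
        and BB: "real T * (real (stage_count \<mu> \<rho> \<epsilon>') * (24 * sqrt Pc * (2 + real m))) \<le> B"
        using large[OF r(2) T_def T1 \<epsilon>'_def] by blast
      have \<epsilon>'p: "0 < \<epsilon>'" using \<epsilon> \<rho> r \<mu> T1 by (simp add: \<epsilon>'_def)
      have \<rho>': "\<rho> \<le> r1" "\<rho> \<le> Rg" using r by auto
      note I = boost_inv[OF Rg \<rho>(1) \<rho>' \<epsilon>'p refl m]
      have ln0: "0 < ln (L * Rg\<^sup>2 / \<epsilon>)"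
      proof (rule ccontr)
        assume "\<not> 0 < ln (L * Rg\<^sup>2 / \<epsilon>)"
        then have "2 * Rg / \<rho> * ln (L * Rg\<^sup>2 / \<epsilon>) \<le> 0" using r \<rho> by (intro mult_nonneg_nonpos) auto
        then show False using T1 unfolding T_def by linarith
      qed
      have q: "0 \<le> 1 - \<rho> / Rg" using r \<rho> by simp
      have "(1 - \<rho> / Rg) ^ T \<le> exp (- (\<rho> / Rg)) ^ T"
        using q exp_ge_add_one_self[of "- (\<rho> / Rg)"] by (intro power_mono) auto
      also have "\<dots> = exp (real T * (- (\<rho> / Rg)))" by (simp add: exp_of_nat_mult[symmetric])
      also have "\<dots> \<le> exp (- ln (L * Rg\<^sup>2 / \<epsilon>))"
      proof -
        have "2 * Rg / \<rho> * ln (L * Rg\<^sup>2 / \<epsilon>) \<le> real T" unfolding T_def by linarith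
        then have "2 * Rg / \<rho> * ln (L * Rg\<^sup>2 / \<epsilon>) * (\<rho> / Rg) \<le> real T * (\<rho> / Rg)"
          using r \<rho> by (intro mult_right_mono) auto
        then have "2 * ln (L * Rg\<^sup>2 / \<epsilon>) \<le> real T * (\<rho> / Rg)" using r \<rho> by (simp add: field_simps)
        then show ?thesis using ln0 by simp
      qed
      also have "\<dots> = \<epsilon> / (L * Rg\<^sup>2)" using pos by (simp add: exp_minus)
      finally have "(1 - \<rho> / Rg) ^ T * (F s - F xs) \<le> \<epsilon> / (L * Rg\<^sup>2) * (L / 2 * Rg\<^sup>2)"
        using gap initial_gap(2) q L \<epsilon> by (intro mult_mono) auto
      also have "\<dots> = \<epsilon> / 2" using L r \<rho> by simp
      finally have t1: "(1 - \<rho> / Rg) ^ T * (F s - F xs) \<le> \<epsilon> / 2" .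
      have "\<epsilon>' * Rg / \<rho> \<le> (\<rho> * \<epsilon> / (4 * Rg)) * Rg / \<rho>"
        using r \<rho> by (intro divide_right_mono mult_right_mono) (auto simp: \<epsilon>'_def)
      also have "\<dots> = \<epsilon> / 4" using r \<rho> by simp
      finally have t2: "\<epsilon>' * Rg / \<rho> \<le> \<epsilon> / 4" .
      have "out \<in> S \<and> (out = s \<or> d out xs < D) \<and> F out \<le> F xs + \<epsilon> \<and> real calls \<le> B"
        if "boost_steps K M F G fr \<sigma> \<mu> Lt \<rho> \<epsilon>' s T out calls" for out calls
      proof -
        have "F out - F xs \<le> (1 - \<rho> / Rg) ^ T * (F s - F xs) + \<epsilon>' * Rg / \<rho>" using I[OF that] by blast
        then show ?thesis using I[OF that] BB t1 t2 \<epsilon> by linarith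
      qed
      then show ?thesis unfolding al using boost_exists[OF Rg \<rho>(1) \<rho>' \<epsilon>'p refl m] NQ sN by blast
    next
      \<comment> \<open>The logarithm may be nonpositive, and then no ball is processed. In that
        case L Rg^2 \<le> \<epsilon>, and smoothness at \<open>xs\<close> makes the starting point
        accurate enough.\<close>
      case T0: False
      then have T: "T = 0" by simp
      have "ln (L * Rg\<^sup>2 / \<epsilon>) \<le> 0"
      proof (rule ccontr)
        assume "\<not> ln (L * Rg\<^sup>2 / \<epsilon>) \<le> 0"
        then have "0 < 2 * Rg / \<rho> * ln (L * Rg\<^sup>2 / \<epsilon>)" using r \<rho> by (intro mult_pos_pos) auto
        then show False using T unfolding T_def by linarith
      qed
      then have "L * Rg\<^sup>2 / \<epsilon> \<le> 1" using pos by simp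
      then have "L * Rg\<^sup>2 \<le> \<epsilon>" using \<epsilon> by simp
      then have "F s \<le> F xs + \<epsilon>" using gap \<epsilon> by linarith
      moreover have "boost_steps K M F G fr \<sigma> \<mu> Lt \<rho> \<epsilon>' s T out calls \<longleftrightarrow> out = s \<and> calls = 0" for out calls
        unfolding T by (auto intro: boost_steps.start elim: boost_steps.cases)
      ultimately show ?thesis unfolding al using sN B by simp
    qed
  qed
  then show "\<exists>out calls. alg2 K M fr \<rho> \<sigma> cL F G L \<mu> Rg s \<epsilon> out calls"
    and "\<And>out calls. alg2 K M fr \<rho> \<sigma> cL F G L \<mu> Rg s \<epsilon> out calls \<Longrightarrow>
      out \<in> N \<and> (out = s \<or> d out xs < D) \<and> F out \<le> F xs + \<epsilon> \<and> real calls \<le> B" by blast+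
qed

end

section \<open>The squared distance as a regulariser\<close>

lemma DERIV_cs: "K = 1 \<or> K = -1 \<Longrightarrow> (cs K has_real_derivative (- K * sn K t)) (at t)"
  and DERIV_sn: "K = 1 \<or> K = -1 \<Longrightarrow> (sn K has_real_derivative (cs K t)) (at t)"
  unfolding cs_def[abs_def] sn_def[abs_def] by (auto intro!: derivative_eq_intros)

context space_form begin

text \<open>Smoothness bounds F from above along the geodesic opposite to the gradient, by a
  decreasing linear term plus a quadratic one. The ball around x leaves room for this
  geodesic.\<close>

lemma gradient_zero_at_minimizer:
  assumes x: "x \<in> S" "G x \<in> tangent K x" and h: "0 < h" "0 < K \<Longrightarrow> h \<le> pi" and N: "rball K x h \<subseteq> N"
    and sm: "smooth_on K F G L N" and min: "\<And>q. q \<in> N \<Longrightarrow> F x \<le> F q"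
  shows "G x = 0"
proof -
  obtain e where e: "utan K x e" "G x = nrm (G x) *\<^sub>R e" using tangent_polar[OF x] by blast
  have ee: "ip e e = 1" using e(1) by (simp add: utan_def)
  have "ip (G x) e = ip (nrm (G x) *\<^sub>R e) e" using e(2) by simp
  then have Ge: "ip (G x) e = nrm (G x)" using ee by (simp add: form_simps)
  have "0 \<le> - (h * nrm (G x))"
  proof (rule nonneg_of_quadratic[where B = "L / 2 * h\<^sup>2"])
    fix t :: real assume t: "0 < t" "t \<le> 1"
    have th: "t * h \<le> h" "0 < t * h" using t h by auto
    have pi: "0 < K \<Longrightarrow> \<bar>- (t * h) - 0\<bar> \<le> pi" using h(2) th by force
    have "d x (gpt K x e (- (t * h))) = t * h" using d_gpt[OF x(1) e(1), of "- (t * h)" 0] pi t h by simp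
    then have N1: "gpt K x e (- (t * h)) \<in> N"
      using N th gpt_in[OF x(1) e(1)] by (auto simp: rball_def)
    have "x \<in> N" using N x h by (auto simp: rball_def)
    then have "F (gpt K x e (- (t * h))) \<le> F x + (- (t * h)) * ip (G x) e + L / 2 * (t * h)\<^sup>2"
      using smooth_geo[OF sm x(1) e(1), of 0 "- (t * h)"] N1 pi by simp
    then show "0 \<le> t * (- (h * nrm (G x))) + t\<^sup>2 * (L / 2 * h\<^sup>2)"
      using min[OF N1] Ge by (simp add: power_mult_distrib algebra_simps)
  qed
  then have "nrm (G x) \<le> 0" using h by (simp add: mult_le_0_iff)
  then have "ip (G x) (G x) = 0" using nrm_sq[OF x] nrm_nonneg[OF x] by auto
  then show ?thesis using tangent_form_eq_0[OF x] by simp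
qed

text \<open>Geodesic convexity of balls, of radius below pi/2 on the sphere. In
  \<open>gpt_interp\<close> the weights sn (b - t) and sn t add up to at least sn b on the sphere
  and to at most sn b in hyperbolic space, which is the favourable direction for cos and for
  cosh.\<close>

lemma ball_segment:
  assumes o: "o' \<in> S" and x: "x \<in> S" and e: "utan K x e" and t: "0 \<le> t" "t \<le> b" "0 < K \<Longrightarrow> b < pi"
    and r: "d x o' \<le> r" "d (gpt K x e b) o' \<le> r" "0 < K \<Longrightarrow> r < pi/2"
  shows "d (gpt K x e t) o' \<le> r"
proof (cases "b = 0")
  case True
  then show ?thesis using t r by simp
next
  case False
  then have b: "0 < b" using t by simp
  define y w where "y = gpt K x e b" and "w = gpt K x e t"
  have S: "y \<in> S" "w \<in> S" using gpt_in[OF x e] by (auto simp: y_def w_def)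
  have sb: "0 < sn K b" using sn_pos b t by blast
  have sn0: "0 \<le> sn K (b - t)" "0 \<le> sn K t" using t by (auto intro!: sn_nonneg)
  have "sn K b * (K * ip o' w) = sn K (b - t) * (K * ip o' x) + sn K t * (K * ip o' y)"
    using arg_cong[OF gpt_interp[of b x e t], of "\<lambda>z. K * ip o' z"]
    unfolding w_def y_def by (simp add: form_simps algebra_simps)
  then have eq: "sn K b * cs K (d w o') = sn K (b - t) * cs K (d x o') + sn K t * cs K (d y o')"
    using cs_d[OF o S(2)] cs_d[OF o S(1)] cs_d[OF o x] by (simp add: d_commute)
  have dn: "0 \<le> d w o'" "0 \<le> d x o'" "0 \<le> d y o'" using d_nonneg o S x by auto
  have r0: "0 \<le> r" using r dn by linarith
  have dy: "d y o' \<le> r" using r by (simp add: y_def)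
  show ?thesis
  proof (cases "K = 1")
    case True
    have r': "r < pi/2" "b < pi" using r t True by auto
    have c: "0 < cos r" using r' r0 by (intro cos_gt_zero_pi) auto
    have "sin b = sin (b - t) * cos t + sin t * cos (b - t)" using sin_add[of "b - t" t] by simp
    also have "\<dots> \<le> sin (b - t) * 1 + sin t * 1"
      using sn0 True by (intro add_mono mult_left_mono) auto
    finally have "sin b * cos r \<le> (sin (b - t) + sin t) * cos r" using c by simp
    also have "\<dots> = sin (b - t) * cos r + sin t * cos r" by (simp add: algebra_simps)
    also have "\<dots> \<le> sin (b - t) * cos (d x o') + sin t * cos (d y o')"
      using sn0 True r(1) dy dn r' by (intro add_mono mult_left_mono cos_monotone_0_pi_le) auto
    also have "\<dots> = sin b * cos (d w o')" using eq True by simp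
    finally have "cos r \<le> cos (d w o')" using sb True by simp
    then show ?thesis using cos_mono_le_eq[of r "d w o'"] dn d_le_pi[OF S(2) o] r' r0 True by (simp add: w_def)
  next
    case False
    then have K': "K = -1" using K by auto
    have "sinh (b - t) * 1 + sinh t * 1 \<le> sinh (b - t) * cosh t + sinh t * cosh (b - t)"
      using sn0 K' cosh_real_ge_1 by (intro add_mono mult_left_mono) auto
    also have "\<dots> = sinh b" using sinh_add[of "b - t" t] by simp
    finally have s: "sinh (b - t) + sinh t \<le> sinh b" by simp
    have "sinh b * cosh (d w o') = sinh (b - t) * cosh (d x o') + sinh t * cosh (d y o')" using eq K' by simp
    also have "\<dots> \<le> sinh (b - t) * cosh r + sinh t * cosh r"
      using sn0 K' r(1) dy dn r0 cosh_real_nonneg_le_iff by (intro add_mono mult_left_mono) auto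
    also have "\<dots> = (sinh (b - t) + sinh t) * cosh r" by (simp add: algebra_simps)
    also have "\<dots> \<le> sinh b * cosh r" using s by (intro mult_right_mono) auto
    finally have "cosh (d w o') \<le> cosh r" using sb K' by simp
    then show ?thesis using cosh_real_nonneg_le_iff[of "d w o'" r] dn r0 by (simp add: w_def)
  qed
qed

text \<open>A distance is recovered from its cosine u; \<open>nd\<close> keeps u away from the
  values where the inverse function is not differentiable.\<close>

lemma cs_arc_deriv:
  assumes u: "(u has_real_derivative u') (at t)" and nd: "0 < K * (1 - (u t)\<^sup>2)" and u0: "K = -1 \<Longrightarrow> 0 < u t"
  defines "\<delta> \<equiv> \<lambda>t. if 0 < K then arccos (u t) else arcosh (u t)"
  shows "(\<delta> has_real_derivative (- K * u' / sn K (\<delta> t))) (at t)" "0 < sn K (\<delta> t)" "0 < \<delta> t" "cs K (\<delta> t) = u t"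
    "(sn K (\<delta> t))\<^sup>2 = K * (1 - (u t)\<^sup>2)"
proof -
  have "(\<delta> has_real_derivative (- K * u' / sn K (\<delta> t))) (at t) \<and> 0 < sn K (\<delta> t) \<and> 0 < \<delta> t \<and> cs K (\<delta> t) = u t"
  proof (cases "K = 1")
    case True
    have "(u t)\<^sup>2 < 1" using nd True by simp
    then have a: "-1 < u t" "u t < 1" by (auto simp: abs_square_less_1 abs_less_iff)
    have s: "sin (arccos (u t)) = sqrt (1 - (u t)\<^sup>2)" using a by (simp add: sin_arccos)
    have p: "0 < sqrt (1 - (u t)\<^sup>2)" using nd True by simp
    have "((\<lambda>t. arccos (u t)) has_real_derivative (inverse (- sqrt (1 - (u t)\<^sup>2)) * u')) (at t)"
      using DERIV_chain2[OF DERIV_arccos[OF a] u] by simp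
    moreover have "0 < arccos (u t)" using arccos_lt_bounded[OF a] by simp
    ultimately show ?thesis
      using True p s a by (simp add: \<delta>_def field_simps)
  next
    case False
    then have K': "K = -1" using K by auto
    have "1 < (u t)\<^sup>2" using nd K' by simp
    then have a: "1 < u t" using u0[OF K'] by (metis less_imp_le one_power2 power2_less_imp_less)
    have s: "sinh (arcosh (u t)) = sqrt ((u t)\<^sup>2 - 1)" using a by (simp add: sinh_arcosh_real)
    have p: "0 < sqrt ((u t)\<^sup>2 - 1)" using nd K' by simp
    have "(arcosh has_real_derivative 1 / sqrt ((u t)\<^sup>2 - 1)) (at (u t))"
      using arcosh_real_has_field_derivative[OF a] by simp
    then have "((\<lambda>t. arcosh (u t)) has_real_derivative (1 / sqrt ((u t)\<^sup>2 - 1) * u')) (at t)"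
      using DERIV_chain2[OF _ u] by blast
    moreover have "0 < arcosh (u t)" using a by simp
    ultimately show ?thesis
      using K' p s a by (simp add: \<delta>_def)
  qed
  then show "(\<delta> has_real_derivative (- K * u' / sn K (\<delta> t))) (at t)" "0 < sn K (\<delta> t)" "0 < \<delta> t" "cs K (\<delta> t) = u t"
    by auto
  then show "(sn K (\<delta> t))\<^sup>2 = K * (1 - (u t)\<^sup>2)" by (simp add: sn_sq)
qed

text \<open>
  Along a unit-speed geodesic at distance \<open>\<delta>\<close> from a point, the second derivative of \<open>\<delta>\<^sup>2 / 2\<close>
  is \<open>\<delta>'\<^sup>2 + \<delta> * cot_K \<delta> * (1 - \<delta>'\<^sup>2)\<close> with \<open>\<bar>\<delta>'\<bar> \<le> 1\<close>.
\<close>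

lemma half_sq_taylor:
  fixes c k b lb ub :: real
  assumes c: "0 < c" "0 < K \<Longrightarrow> c < pi" and k: "\<bar>k\<bar> < 1" and b: "0 < b"
  defines "u \<equiv> \<lambda>t. cs K c * cs K t + K * (k * sn K c * sn K t)"
  defines "\<delta> \<equiv> \<lambda>t. if 0 < K then arccos (u t) else arcosh (u t)"
  assumes u0: "\<And>t. 0 \<le> t \<Longrightarrow> t \<le> b \<Longrightarrow> K = -1 \<Longrightarrow> 0 < u t"
    and lohi: "\<And>t. 0 \<le> t \<Longrightarrow> t \<le> b \<Longrightarrow> lb \<le> \<delta> t * cs K (\<delta> t) / sn K (\<delta> t) \<and> \<delta> t * cs K (\<delta> t) / sn K (\<delta> t) \<le> ub"
    and lh: "lb \<le> 1" "1 \<le> ub"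
  shows "c\<^sup>2 / 2 - b * (c * k) + lb / 2 * b\<^sup>2 \<le> (\<delta> b)\<^sup>2 / 2" "(\<delta> b)\<^sup>2 / 2 \<le> c\<^sup>2 / 2 - b * (c * k) + ub / 2 * b\<^sup>2"
proof -
  define u' where "u' t = K * (k * sn K c * cs K t - cs K c * sn K t)" for t
  have du: "(u has_real_derivative u' t) (at t)" for t
    unfolding u_def u'_def by (auto intro!: derivative_eq_intros DERIV_cs DERIV_sn K simp: algebra_simps)
  have du': "(u' has_real_derivative (- K * u t)) (at t)" for t
  proof -
    have "(u' has_real_derivative (K * (k * sn K c * (- K * sn K t) - cs K c * cs K t))) (at t)"
      unfolding u'_def by (auto intro!: derivative_eq_intros DERIV_cs DERIV_sn K)
    moreover have "K * (k * sn K c * (- K * sn K t) - cs K c * cs K t) = - K * u t"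
      by (simp add: u_def algebra_simps)
    ultimately show ?thesis by simp
  qed
  have sc: "0 < sn K c" using sn_pos c by blast
  \<comment> \<open>The combination of u^2 and K u'^2 is constant in t, as cos and sin (or cosh and
    sinh) satisfy u'' = -K u. The remainder is positive for |k| < 1, so sn \<delta> never vanishes
    and |\<delta>'| \<le> 1.\<close>
  have id: "K * (1 - (u t)\<^sup>2) - (u' t)\<^sup>2 = (1 - k\<^sup>2) * (sn K c)\<^sup>2" for t
  proof -
    have "(u t)\<^sup>2 + K * (u' t)\<^sup>2 = ((cs K t)\<^sup>2 + K * (sn K t)\<^sup>2) * ((cs K c)\<^sup>2 + K * (k\<^sup>2 * (sn K c)\<^sup>2))"
      unfolding u_def u'_def by (simp add: power2_eq_square algebra_simps)
    then have e: "(u t)\<^sup>2 + K * (u' t)\<^sup>2 = (cs K c)\<^sup>2 + K * (k\<^sup>2 * (sn K c)\<^sup>2)" by (simp add: cs_sn_sq)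
    have "K * (1 - (u t)\<^sup>2) - (u' t)\<^sup>2 = K * (1 - ((u t)\<^sup>2 + K * (u' t)\<^sup>2))" by (simp add: algebra_simps)
    also have "\<dots> = K * (1 - (cs K c)\<^sup>2) - k\<^sup>2 * (sn K c)\<^sup>2" unfolding e by (simp add: algebra_simps)
    finally show ?thesis by (simp add: sn_sq algebra_simps)
  qed
  have "k\<^sup>2 < 1" using k by (simp add: abs_square_less_1)
  then have pos: "0 < (1 - k\<^sup>2) * (sn K c)\<^sup>2" using sc by simp
  have nd: "0 < K * (1 - (u t)\<^sup>2)" for t using id[of t] pos zero_le_power2[of "u' t"] by linarith
  define \<delta>' where "\<delta>' t = - K * u' t / sn K (\<delta> t)" for t
  define \<phi> where "\<phi> t = (\<delta> t)\<^sup>2 / 2" for t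
  define \<phi>1 where "\<phi>1 t = \<delta> t * \<delta>' t" for t
  define \<phi>2 where "\<phi>2 t = (\<delta>' t)\<^sup>2 + \<delta> t * cs K (\<delta> t) / sn K (\<delta> t) * (1 - (\<delta>' t)\<^sup>2)" for t
  have D: "(\<delta> has_real_derivative \<delta>' t) (at t)" "0 < sn K (\<delta> t)" "0 < \<delta> t" "cs K (\<delta> t) = u t"
    "(sn K (\<delta> t))\<^sup>2 = K * (1 - (u t)\<^sup>2)" if "0 \<le> t" "t \<le> b" for t
    using cs_arc_deriv[OF du nd u0[OF that]] unfolding \<delta>'_def \<delta>_def by simp_all
  have d1: "(\<phi> has_real_derivative \<phi>1 t) (at t)" if "0 \<le> t" "t \<le> b" for t
    unfolding \<phi>_def \<phi>1_def by (auto intro!: derivative_eq_intros D[OF that])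
  have d2: "(\<phi>1 has_real_derivative \<phi>2 t) (at t)" if t: "0 \<le> t" "t \<le> b" for t
  proof -
    have sd: "((\<lambda>t. sn K (\<delta> t)) has_real_derivative (cs K (\<delta> t) * \<delta>' t)) (at t)"
      using DERIV_chain2[OF DERIV_sn[OF K] D(1)[OF t]] by simp
    have nz: "sn K (\<delta> t) \<noteq> 0" using D(2)[OF t] by simp
    have "(\<phi>1 has_real_derivative (\<delta>' t * \<delta>' t + \<delta> t *
        (((- K * (- K * u t)) * sn K (\<delta> t) - (- K * u' t) * (cs K (\<delta> t) * \<delta>' t)) / (sn K (\<delta> t) * sn K (\<delta> t))))) (at t)"
      unfolding \<phi>1_def[abs_def] \<delta>'_def
      by (rule derivative_eq_intros D(1)[OF t, unfolded \<delta>'_def] sd[unfolded \<delta>'_def] du' nz refl)+ (simp add: algebra_simps)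
    moreover have "- K * u' t = \<delta>' t * sn K (\<delta> t)" using nz by (simp add: \<delta>'_def)
    then have "\<delta>' t * \<delta>' t + \<delta> t *
        (((- K * (- K * u t)) * sn K (\<delta> t) - (- K * u' t) * (cs K (\<delta> t) * \<delta>' t)) / (sn K (\<delta> t) * sn K (\<delta> t))) = \<phi>2 t"
      using nz D(4)[OF t] by (simp add: \<phi>2_def power2_eq_square field_simps)
    ultimately show ?thesis by simp
  qed
  define dd where "dd m = (if m = 0 then \<phi> else if m = 1 then \<phi>1 else \<phi>2)" for m :: nat
  have dd: "dd 0 = \<phi>" "dd (Suc 0) = \<phi>1" "dd 2 = \<phi>2" by (auto simp: dd_def)
  have "\<exists>t>0. t < b \<and> \<phi> b = (\<Sum>m<2. dd m 0 / fact m * b ^ m) + dd 2 t / fact 2 * b ^ 2"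
  proof (rule Maclaurin[OF b])
    show "\<forall>(m::nat) t. m < 2 \<and> 0 \<le> t \<and> t \<le> b \<longrightarrow> (dd m has_real_derivative dd (Suc m) t) (at t)"
    proof (intro allI impI)
      fix m :: nat and t assume "m < 2 \<and> 0 \<le> t \<and> t \<le> b"
      then have "m = 0 \<or> m = 1" and t: "0 \<le> t" "t \<le> b" by auto
      then show "(dd m has_real_derivative dd (Suc m) t) (at t)"
        using d1[OF t] d2[OF t] by (auto simp: dd_def)
    qed
  qed (auto simp: dd)
  moreover have "(\<Sum>m<2. dd m 0 / fact m * b ^ m) = \<phi> 0 + \<phi>1 0 * b"
    by (simp add: numeral_2_eq_2 dd)
  ultimately obtain t where t: "0 < t" "t < b" "\<phi> b = \<phi> 0 + \<phi>1 0 * b + \<phi>2 t / 2 * b\<^sup>2"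
    by (auto simp: dd)
  have t': "0 \<le> t" "t \<le> b" using t by auto
  have d0: "\<delta> 0 = c" using c by (auto simp: \<delta>_def u_def arccos_cos arcosh_cosh_real) (use K in \<open>auto simp: arccos_cos arcosh_cosh_real\<close>)
  have p0: "\<phi>1 0 = - (c * k)" using sc by (simp add: \<phi>1_def d0 \<delta>'_def u'_def)
  define q where "q = (\<delta>' t)\<^sup>2"
  have "(u' t)\<^sup>2 \<le> (sn K (\<delta> t))\<^sup>2" using id[of t] pos D(5)[OF t'] by linarith
  then have q: "0 \<le> q" "q \<le> 1" using D(2)[OF t'] by (auto simp: q_def \<delta>'_def power_divide power_mult_distrib)
  define X where "X = \<delta> t * cs K (\<delta> t) / sn K (\<delta> t)"
  have X: "lb \<le> X" "X \<le> ub" using lohi[OF t'] by (auto simp: X_def)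
  \<comment> \<open>The second derivative is a convex combination of 1 and X, which is why bounds
    \<open>lb\<close> \<le> 1 \<le> \<open>ub\<close> on X carry over to it.\<close>
  have P: "\<phi>2 t = q * 1 + (1 - q) * X" by (simp add: \<phi>2_def q_def X_def)
  have "q * lb + (1 - q) * lb \<le> \<phi>2 t" unfolding P using q X lh by (intro add_mono mult_left_mono) auto
  then have l: "lb \<le> \<phi>2 t" by (simp add: algebra_simps)
  have "\<phi>2 t \<le> q * ub + (1 - q) * ub" unfolding P using q X lh by (intro add_mono mult_left_mono) auto
  then have h: "\<phi>2 t \<le> ub" by (simp add: algebra_simps)
  have "lb / 2 * b\<^sup>2 \<le> \<phi>2 t / 2 * b\<^sup>2" "\<phi>2 t / 2 * b\<^sup>2 \<le> ub / 2 * b\<^sup>2" using l h by (auto intro!: mult_right_mono)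
  then show "c\<^sup>2 / 2 - b * (c * k) + lb / 2 * b\<^sup>2 \<le> (\<delta> b)\<^sup>2 / 2" "(\<delta> b)\<^sup>2 / 2 \<le> c\<^sup>2 / 2 - b * (c * k) + ub / 2 * b\<^sup>2"
    using t(3) p0 d0 by (simp_all add: \<phi>_def algebra_simps)
qed

text \<open>For b = 0, c = 0 or collinear directions the distance may fail to be differentiable, but
  there the flat law of cosines is exact. In all other cases \<open>half_sq_taylor\<close> applies.
  On the sphere \<delta> cot \<delta> lies between cos Dm and 1; in hyperbolic space \<delta> coth
  \<delta> lies between 1 and 1 + \<delta> \<le> 1 + c + b.\<close>

lemma half_sq_compare:
  assumes x: "x \<in> S" and e: "utan K x e" and e': "utan K x e'" and b: "0 \<le> b" "0 < K \<Longrightarrow> b \<le> pi" and c: "0 \<le> c"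
    and near: "\<And>t. 0 < K \<Longrightarrow> 0 \<le> t \<Longrightarrow> t \<le> b \<Longrightarrow> d (gpt K x e t) (gpt K x e' c) \<le> Dm" "0 < K \<Longrightarrow> Dm < pi/2" "0 < K \<Longrightarrow> c < pi"
  defines "lb \<equiv> if 0 < K then cos Dm else 1" and "ub \<equiv> if 0 < K then 1 else 1 + c + b"
  defines "a \<equiv> d (gpt K x e b) (gpt K x e' c)" and "k \<equiv> ip e e'"
  shows "c\<^sup>2 / 2 - b * (c * k) + lb / 2 * b\<^sup>2 \<le> a\<^sup>2 / 2" "a\<^sup>2 / 2 \<le> c\<^sup>2 / 2 - b * (c * k) + ub / 2 * b\<^sup>2"
proof -
  define y where "y = gpt K x e' c"
  have yS: "y \<in> S" using gpt_in[OF x e'] by (simp add: y_def)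
  define u where "u = (\<lambda>t. cs K c * cs K t + K * (k * sn K c * sn K t))"
  have du: "cs K (d (gpt K x e t) y) = u t" for t
    using cs_d[OF gpt_in[OF x e, of t] yS] law_of_cosines[OF x e e', of t c] by (simp add: y_def u_def k_def algebra_simps)
  have d0: "0 \<le> d (gpt K x e t) y" for t using d_nonneg[OF gpt_in[OF x e] yS] .
  have dpi: "0 < K \<Longrightarrow> d (gpt K x e t) y \<le> pi" for t using d_le_pi[OF gpt_in[OF x e] yS] .
  have kb: "\<bar>k\<bar> \<le> 1" using utan_CS[OF x e e'] by (simp add: k_def)
  have cpi: "0 < K \<Longrightarrow> c \<le> pi" using near(3) by force
  have cd: "d x y = c" using d_gpt[OF x e', of c 0] c cpi by (simp add: y_def)
  have Dm0: "0 \<le> Dm" if "0 < K" using near(1)[OF that order_refl b(1)] d0[of 0] by (simp add: y_def)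
  have lo1: "lb \<le> 1" by (simp add: lb_def)
  have hi1: "1 \<le> ub" using b c by (simp add: ub_def)
  have "c\<^sup>2 / 2 - b * (c * k) + lb / 2 * b\<^sup>2 \<le> a\<^sup>2 / 2 \<and> a\<^sup>2 / 2 \<le> c\<^sup>2 / 2 - b * (c * k) + ub / 2 * b\<^sup>2"
  proof (cases "b = 0 \<or> c = 0 \<or> \<bar>k\<bar> = 1")
    case True
    have main: "a\<^sup>2 = c\<^sup>2 - 2 * (b * (c * k)) + b\<^sup>2"
    proof -
      consider "b = 0" | "c = 0" "b \<noteq> 0" | "k = 1" | "k = -1" "b \<noteq> 0" "c \<noteq> 0" using True by (auto simp: abs_if split: if_splits)
      then show ?thesis
      proof cases
        case 1 then show ?thesis using cd by (simp add: a_def y_def[symmetric])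
      next
        case 2
        then have "a = b" using d_gpt[OF x e, of b 0] b by (simp add: a_def d_commute)
        then show ?thesis using 2 by simp
      next
        case 3
        have "a = \<bar>c - b\<bar>" unfolding a_def y_def[symmetric]
        proof (rule d_unique[OF gpt_in[OF x e] yS])
          show "cs K \<bar>c - b\<bar> = K * ip (gpt K x e b) y"
            using du[of b] cs_d[OF gpt_in[OF x e, of b] yS] 3 by (simp add: u_def cs_diff algebra_simps)
        qed (use b c near in auto)
        then show ?thesis using 3 by (simp add: power2_eq_square algebra_simps)
      next
        case 4
        \<comment> \<open>For opposite directions with c + b beyond pi, the geodesic would be at
          distance exactly pi/2 from \<open>y\<close> at time pi/2 - c, against Dm < pi/2.\<close>
        have "0 < K \<Longrightarrow> c + b \<le> pi"
        proof (rule ccontr)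
          assume k: "0 < K" "\<not> c + b \<le> pi"
          have K1: "K = 1" using k(1) K by auto
          have cDm: "c \<le> Dm" using near(1)[OF k(1) order_refl b(1)] cd by (simp add: y_def)
          then have t: "0 \<le> pi/2 - c" "pi/2 - c \<le> b" using near(2)[OF k(1)] k pi_gt_zero by linarith+
          have "cs K (d (gpt K x e (pi/2 - c)) y) = cos (c + (pi/2 - c))"
            unfolding du u_def cos_add using K1 4 by simp
          then have "cos (d (gpt K x e (pi/2 - c)) y) = cos (pi/2)" using K1 by simp
          then have "d (gpt K x e (pi/2 - c)) y = pi/2"
            using cos_inj_pi[of "d (gpt K x e (pi/2 - c)) y" "pi/2"] d0 dpi[OF k(1)] by auto
          then show False using near(1)[OF k(1) t] near(2)[OF k(1)] by (simp add: y_def)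
        qed
        moreover have "cs K (c + b) = K * ip (gpt K x e b) y"
          using du[of b] cs_d[OF gpt_in[OF x e, of b] yS] 4 by (simp add: u_def cs_add algebra_simps)
        ultimately have "a = c + b" unfolding a_def y_def[symmetric]
          using d_unique[OF gpt_in[OF x e] yS, of "c + b"] b c by simp
        then show ?thesis using 4 by (simp add: power2_eq_square algebra_simps)
      qed
    qed
    have "lb * b\<^sup>2 \<le> 1 * b\<^sup>2" "1 * b\<^sup>2 \<le> ub * b\<^sup>2"
      by (rule mult_right_mono[OF lo1], simp) (rule mult_right_mono[OF hi1], simp)
    moreover have m2: "a\<^sup>2 / 2 = c\<^sup>2 / 2 - b * (c * k) + b\<^sup>2 / 2" unfolding main by (simp add: field_simps)
    ultimately show ?thesis unfolding m2 by simp
  next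
    case False
    then have p: "0 < b" "0 < c" "\<bar>k\<bar> < 1" using b c kb by auto
    have \<delta>: "(if 0 < K then arccos (u t) else arcosh (u t)) = d (gpt K x e t) y" for t
      using du[of t] d0[of t] dpi[of t] K by (auto simp: arccos_cos arcosh_cosh_real dest: sym)
    have u0: "0 < u t" if "0 \<le> t" "t \<le> b" "K = -1" for t
      using du[of t] that cosh_real_pos by (metis cs_sn_simps(2))
    have B: "lb \<le> \<Delta> * cs K \<Delta> / sn K \<Delta> \<and> \<Delta> * cs K \<Delta> / sn K \<Delta> \<le> ub"
      if t: "0 \<le> t" "t \<le> b" "\<Delta> = d (gpt K x e t) y" and nz: "0 < sn K \<Delta>" for t \<Delta>
    proof (cases "K = 1")
      case True
      have \<Delta>: "0 \<le> \<Delta>" "\<Delta> \<le> Dm" "Dm < pi/2" using d0 near(1)[of t] near(2) t True by (auto simp: y_def)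
      have s: "0 < sin \<Delta>" "sin \<Delta> \<le> \<Delta>" using nz True \<Delta> sin_x_le_x by auto
      have c0: "0 \<le> cos \<Delta>" using \<Delta> by (intro cos_ge_zero) auto
      have "cos Dm \<le> cos \<Delta>" using \<Delta> by (intro cos_monotone_0_pi_le) auto
      also have "\<dots> = sin \<Delta> * cos \<Delta> / sin \<Delta>" using s by simp
      also have "\<dots> \<le> \<Delta> * cos \<Delta> / sin \<Delta>" using s c0 by (intro divide_right_mono mult_right_mono) auto
      finally have "cos Dm \<le> \<Delta> * cos \<Delta> / sin \<Delta>" .
      moreover have "\<Delta> * cos \<Delta> / sin \<Delta> \<le> 1" using mult_cos_le_sin[of \<Delta>] \<Delta> s by simp
      ultimately show ?thesis using True by (simp add: lb_def ub_def)
    next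
      case False
      then have K': "K = -1" using K by auto
      have \<Delta>0: "0 \<le> \<Delta>" using d0 t by simp
      have s: "0 < sinh \<Delta>" using nz K' by simp
      have "1 \<le> \<Delta> * cosh \<Delta> / sinh \<Delta>" using sinh_le_mult_cosh[OF \<Delta>0] s by simp
      moreover have "\<Delta> * cosh \<Delta> / sinh \<Delta> \<le> 1 + \<Delta>"
      proof -
        have "\<Delta> * (cosh \<Delta> - sinh \<Delta>) \<le> \<Delta> * 1" using \<Delta>0 by (intro mult_left_mono) (auto simp: cosh_minus_sinh)
        then have "\<Delta> * cosh \<Delta> \<le> (1 + \<Delta>) * sinh \<Delta>" using le_sinh[OF \<Delta>0] by (simp add: algebra_simps)
        then show ?thesis using s by (simp add: divide_le_eq)
      qed
      moreover have "\<Delta> \<le> b + c"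
      proof -
        have "\<Delta> \<le> d (gpt K x e t) x + d x y" using d_triangle[OF gpt_in[OF x e] x yS] t by simp
        moreover have "d (gpt K x e t) x = t" using d_gpt[OF x e, of 0 t] t K' by simp
        ultimately show ?thesis using cd t by simp
      qed
      ultimately show ?thesis using K' by (simp add: lb_def ub_def)
    qed
    have nd: "0 < sn K (d (gpt K x e t) y)" if "0 \<le> t" "t \<le> b" for t
    proof (rule sn_pos)
      show "d (gpt K x e t) y < pi" if k: "0 < K"
        using near(1)[OF k \<open>0 \<le> t\<close> \<open>t \<le> b\<close>] near(2)[OF k] pi_gt_zero unfolding y_def by linarith
      show "0 < d (gpt K x e t) y"
      proof (rule ccontr)
        assume "\<not> 0 < d (gpt K x e t) y"
        then have "d (gpt K x e t) y = 0" using d0[of t] by simp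
        then have u1: "u t = 1" using du[of t] by simp
        have "(u t)\<^sup>2 + K * (k * sn K c * cs K t - cs K c * sn K t)\<^sup>2 = ((cs K t)\<^sup>2 + K * (sn K t)\<^sup>2) * ((cs K c)\<^sup>2 + K * (k\<^sup>2 * (sn K c)\<^sup>2))"
          unfolding u_def by (simp add: power2_eq_square algebra_simps)
        then have "1 + K * (k * sn K c * cs K t - cs K c * sn K t)\<^sup>2 = 1 - K * ((1 - k\<^sup>2) * (sn K c)\<^sup>2)"
          unfolding cs_sn_sq u1 using cs_sn_sq[of c] by (simp add: algebra_simps)
        then have "K * ((k * sn K c * cs K t - cs K c * sn K t)\<^sup>2 + (1 - k\<^sup>2) * (sn K c)\<^sup>2) = 0"
          by (simp add: algebra_simps)
        then have "(k * sn K c * cs K t - cs K c * sn K t)\<^sup>2 = - ((1 - k\<^sup>2) * (sn K c)\<^sup>2)"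
          by (simp add: eq_neg_iff_add_eq_0)
        moreover have "k\<^sup>2 < 1" using p by (simp add: abs_square_less_1)
        then have "0 < (1 - k\<^sup>2) * (sn K c)\<^sup>2" using sn_pos[of c] p near(3) by simp
        ultimately show False using zero_le_power2[of "k * sn K c * cs K t - cs K c * sn K t"] by linarith
      qed
    qed
    have hB: "lb \<le> (if 0 < K then arccos (u t) else arcosh (u t)) * cs K (if 0 < K then arccos (u t) else arcosh (u t)) /
          sn K (if 0 < K then arccos (u t) else arcosh (u t)) \<and>
        (if 0 < K then arccos (u t) else arcosh (u t)) * cs K (if 0 < K then arccos (u t) else arcosh (u t)) /
          sn K (if 0 < K then arccos (u t) else arcosh (u t)) \<le> ub" if "0 \<le> t" "t \<le> b" for t
      unfolding \<delta> using B[OF that refl nd[OF that]] .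
    have T1: "c\<^sup>2 / 2 - b * (c * k) + lb / 2 * b\<^sup>2 \<le> (if 0 < K then arccos (u b) else arcosh (u b))\<^sup>2 / 2"
      unfolding u_def by (rule half_sq_taylor(1)[where lb = lb and ub = ub]) (fact p near(3) u0[unfolded u_def] hB[unfolded u_def] lo1 hi1)+
    have T2: "(if 0 < K then arccos (u b) else arcosh (u b))\<^sup>2 / 2 \<le> c\<^sup>2 / 2 - b * (c * k) + ub / 2 * b\<^sup>2"
      unfolding u_def by (rule half_sq_taylor(2)[where lb = lb and ub = ub]) (fact p near(3) u0[unfolded u_def] hB[unfolded u_def] lo1 hi1)+
    show ?thesis using T1 T2 unfolding \<delta> by (simp add: a_def y_def)
  qed
  then show "c\<^sup>2 / 2 - b * (c * k) + lb / 2 * b\<^sup>2 \<le> a\<^sup>2 / 2" "a\<^sup>2 / 2 \<le> c\<^sup>2 / 2 - b * (c * k) + ub / 2 * b\<^sup>2" by auto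
qed

lemma rlog_gpt:
  assumes x: "x \<in> S" and e: "utan K x e" and c: "0 \<le> c" "0 < K \<longrightarrow> c < pi"
  shows "rlog K x (gpt K x e c) = c *\<^sub>R e"
proof (cases "c = 0")
  case True
  then show ?thesis using x by (simp add: rlog_def Let_def)
next
  case False
  have cp: "0 < K \<Longrightarrow> c \<le> pi" using c by force
  have d: "d x (gpt K x e c) = c" using d_gpt[OF x e, of c 0] c cp by simp
  have "K * ip x (gpt K x e c) = cs K c"
    using gpt_form[OF x e, of 0 c] by simp
  then have w: "gpt K x e c - (K * ip x (gpt K x e c)) *\<^sub>R x = sn K c *\<^sub>R e" by (simp add: gpt_def)
  have s: "0 < sn K c" using sn_pos[of c] False c by auto
  have "nrm (sn K c *\<^sub>R e) = sn K c" using nrm_utan[OF x e] s by simp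
  then show ?thesis unfolding rlog_def Let_def w d using s by simp
qed

text \<open>The comparison for half the squared distance, multiplied by m, with its first-order term
  rewritten through \<open>rlog\<close>. A ball of radius R < pi/2 is convex, so on the sphere the
  whole segment from x to y stays within R of the centre. In hyperbolic space c \<le> R and b \<le>
  2 R give 1 + 3 R.\<close>

lemma reg_compare:
  fixes R m :: real
  assumes o: "o' \<in> S" and R: "0 < K \<longrightarrow> R < pi/2" and m: "0 \<le> m"
    and x: "x \<in> rball K o' R" and y: "y \<in> rball K o' R" and v: "v \<in> tangent K x" "rexp K x v = y" "nrm v = d x y"
  defines "lb \<equiv> if 0 < K then cos R else 1" and "ub \<equiv> if 0 < K then 1 else 1 + 3 * R"
  shows "reg_fun K F o' m y \<ge> F y + (m / 2 * (d x o')\<^sup>2 + ip (reg_grad K G o' m x) v - ip (G x) v + m * lb / 2 * (d x y)\<^sup>2)"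
    and "reg_fun K F o' m y \<le> F y + (m / 2 * (d x o')\<^sup>2 + ip (reg_grad K G o' m x) v - ip (G x) v + m * ub / 2 * (d x y)\<^sup>2)"
proof -
  have xS: "x \<in> S" "d x o' \<le> R" and yS: "y \<in> S" "d y o' \<le> R"
    using x y d_commute by (auto simp: rball_def)
  define b c where "b = d x y" and "c = d x o'"
  have b: "0 \<le> b" using d_nonneg xS yS by (simp add: b_def)
  have c: "0 \<le> c" using d_nonneg xS o by (simp add: c_def)
  have b2: "b \<le> 2 * R" using d_triangle[OF xS(1) o yS(1)] xS yS d_commute[of o' y] by (simp add: b_def)
  obtain e where e: "utan K x e" "v = b *\<^sub>R e" using tangent_polar[OF xS(1) v(1)] v(3) by (auto simp: b_def)
  have y_e: "y = gpt K x e b" using rexp_gpt[OF xS(1) e(1), of b] v(2) e(2) by simp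
  obtain e' where e': "utan K x e'" "o' = gpt K x e' c" using gpt_polar[OF xS(1) o] by (auto simp: c_def)
  have cb: "c < pi \<and> b < pi" if "0 < K"
  proof -
    have "R < pi/2" using R that by blast
    then show ?thesis using xS b2 pi_gt_zero unfolding c_def by linarith
  qed
  have cpi: "0 < K \<longrightarrow> c < pi" and bpi: "0 < K \<longrightarrow> b < pi" using cb by blast+
  have near: "d (gpt K x e t) (gpt K x e' c) \<le> R" if "0 < K" "0 \<le> t" "t \<le> b" for t
    using ball_segment[OF o xS(1) e(1) that(2,3), of R] bpi R xS(2) yS(2) y_e e'(2) by auto
  have bp: "0 < K \<Longrightarrow> b \<le> pi" using bpi by force
  note H = half_sq_compare[OF xS(1) e(1) e'(1) b bp c near, unfolded e'(2)[symmetric] y_e[symmetric]]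
  have rl: "rlog K x o' = c *\<^sub>R e'" using rlog_gpt[OF xS(1) e'(1) c cpi] e'(2) by simp
  have rg: "ip (reg_grad K G o' m x) v - ip (G x) v = - (m * (b * (c * ip e e')))"
    unfolding reg_grad_def rl e(2) by (simp add: form_simps form_commute[of K e' e] algebra_simps)
  have H1: "c\<^sup>2 / 2 - b * (c * ip e e') + lb / 2 * b\<^sup>2 \<le> (d y o')\<^sup>2 / 2"
    using H(1) R cpi unfolding lb_def by auto
  have H2: "(d y o')\<^sup>2 / 2 \<le> c\<^sup>2 / 2 - b * (c * ip e e') + (if 0 < K then 1 else 1 + c + b) / 2 * b\<^sup>2"
    using H(2) R cpi by auto
  have "(if 0 < K then 1 else 1 + c + b) / 2 * b\<^sup>2 \<le> ub / 2 * b\<^sup>2"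
    using b2 xS by (intro mult_right_mono) (auto simp: ub_def c_def)
  then have H3: "(d y o')\<^sup>2 / 2 \<le> c\<^sup>2 / 2 - b * (c * ip e e') + ub / 2 * b\<^sup>2" using H2 by linarith
  have "m * (c\<^sup>2 / 2 - b * (c * ip e e') + lb / 2 * b\<^sup>2) \<le> m * ((d y o')\<^sup>2 / 2)" using H1 m by (rule mult_left_mono)
  then show "reg_fun K F o' m y \<ge> F y + (m / 2 * (d x o')\<^sup>2 + ip (reg_grad K G o' m x) v - ip (G x) v + m * lb / 2 * (d x y)\<^sup>2)"
    using rg unfolding reg_fun_def b_def[symmetric] c_def[symmetric] by (simp add: algebra_simps)
  have "m * ((d y o')\<^sup>2 / 2) \<le> m * (c\<^sup>2 / 2 - b * (c * ip e e') + ub / 2 * b\<^sup>2)" using H3 m by (rule mult_left_mono)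
  then show "reg_fun K F o' m y \<le> F y + (m / 2 * (d x o')\<^sup>2 + ip (reg_grad K G o' m x) v - ip (G x) v + m * ub / 2 * (d x y)\<^sup>2)"
    using rg unfolding reg_fun_def b_def[symmetric] c_def[symmetric] by (simp add: algebra_simps)
qed

lemma reg_smooth:
  assumes "o' \<in> S" "0 < K \<longrightarrow> R < pi/2" "0 \<le> m" "smooth_on K F G L (rball K o' R)"
  shows "smooth_on K (reg_fun K F o' m) (reg_grad K G o' m) (L + m * (if 0 < K then 1 else 1 + 3 * R)) (rball K o' R)"
  unfolding smooth_on_def
proof (intro ballI impI)
  fix x y v assume h: "x \<in> rball K o' R" "y \<in> rball K o' R" "v \<in> tangent K x" "rexp K x v = y \<and> nrm v = d x y"
  have "F y \<le> F x + ip (G x) v + L / 2 * (d x y)\<^sup>2" using assms(4) h unfolding smooth_on_def by blast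
  then show "reg_fun K F o' m y \<le> reg_fun K F o' m x + ip (reg_grad K G o' m x) v + (L + m * (if 0 < K then 1 else 1 + 3 * R)) / 2 * (d x y)\<^sup>2"
    using reg_compare(2)[OF assms(1,2,3) h(1,2,3), of F G] h(4) unfolding add_divide_distrib distrib_right
    by (simp add: reg_fun_def[of K F o' m x])
qed

lemma reg_convex:
  assumes "o' \<in> S" "0 < K \<longrightarrow> R < pi/2" "0 \<le> m" "strongly_gconvex_on K F G 0 (rball K o' R)"
  shows "strongly_gconvex_on K (reg_fun K F o' m) (reg_grad K G o' m) (m * (if 0 < K then cos R else 1)) (rball K o' R)"
  unfolding strongly_gconvex_on_def
proof (intro ballI impI)
  fix x y v assume h: "x \<in> rball K o' R" "y \<in> rball K o' R" "v \<in> tangent K x" "rexp K x v = y \<and> nrm v = d x y"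
  have "F y \<ge> F x + ip (G x) v + 0 / 2 * (d x y)\<^sup>2" using assms(4) h unfolding strongly_gconvex_on_def by blast
  then show "reg_fun K F o' m x + ip (reg_grad K G o' m x) v + m * (if 0 < K then cos R else 1) / 2 * (d x y)\<^sup>2 \<le> reg_fun K F o' m y"
    using reg_compare(1)[OF assms(1,2,3) h(1,2,3), of F G] h(4)
    by (simp add: reg_fun_def[of K F o' m x])
qed

lemma reg_grad_tangent:
  assumes "o' \<in> S" "x \<in> S" "G x \<in> tangent K x" shows "reg_grad K G o' m x \<in> tangent K x"
proof -
  have "rlog K x o' \<in> tangent K x"
    using model_form[OF assms(2)] by (simp add: rlog_def Let_def tangent_def form_simps)
  then show ?thesis using assms(3) by (simp add: reg_grad_def tangent_def form_simps)
qed

section \<open>Gradient bounds in terms of the distance to a minimizer\<close>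

lemma unit_gradient:
  assumes "p \<in> S" "G p \<in> tangent K p"
  obtains e where "utan K p e" "ip (G p) e = nrm (G p)"
proof -
  obtain e where e: "utan K p e" "G p = nrm (G p) *\<^sub>R e" using tangent_polar[OF assms] by blast
  have ee: "ip e e = 1" using e(1) by (simp add: utan_def)
  have "ip (G p) e = ip (nrm (G p) *\<^sub>R e) e" using e(2) by simp
  then have "ip (G p) e = nrm (G p)" using ee by (simp add: form_simps)
  then show ?thesis using that e(1) by blast
qed

lemma convex_geo_0:
  assumes "strongly_gconvex_on K F G \<mu> N" "0 \<le> \<mu>" "p \<in> S" "utan K p e" "gpt K p e s \<in> N" "gpt K p e t \<in> N"
    "0 < K \<Longrightarrow> \<bar>t - s\<bar> \<le> pi"
  shows "F (gpt K p e t) \<ge> F (gpt K p e s) + (t - s) * ip (G (gpt K p e s)) (gtan K p e s)"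
proof -
  have "0 \<le> \<mu> / 2 * (t - s)\<^sup>2" using assms(2) by simp
  then show ?thesis using convex_geo[OF assms(1,3-7)] by linarith
qed

text \<open>One step of length s0 along the gradient raises F by at least s0 |G p| by convexity,
  while smoothness at \<open>xs\<close> caps the value there by a multiple of L D^2. As D and R0 are
  at most 2, s0 = min R0 D is at least D R0 / 2, and one factor D cancels.\<close>

lemma gradient_bound_room:
  assumes p: "p \<in> S" "G p \<in> tangent K p" and R0: "0 < R0" "R0 \<le> 2" "rball K p R0 \<subseteq> N"
    and xs: "xs \<in> S" "xs \<in> N" "G xs = 0" "\<And>q. q \<in> N \<Longrightarrow> F xs \<le> F q" and dp: "d p xs \<le> 2" and NS: "N \<subseteq> S"
    and sm: "smooth_on K F G L N" and sc: "strongly_gconvex_on K F G \<mu> N" "0 \<le> \<mu>" and L: "0 < L"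
  shows "nrm (G p) \<le> 4 / R0 * L * d p xs"
proof (cases "d p xs = 0")
  case True
  then have "G p = 0" using d_eq_0[OF p(1) xs(1)] xs by simp
  then show ?thesis using True by (simp add: rnorm_def form_simps)
next
  case False
  define D where "D = d p xs"
  have D: "0 < D" using False d_nonneg[OF p(1) xs(1)] by (simp add: D_def)
  define s0 where "s0 = min R0 D"
  have s0: "0 < s0" "s0 \<le> R0" "s0 \<le> D" using D R0 by (auto simp: s0_def)
  obtain e where e: "utan K p e" "ip (G p) e = nrm (G p)" using unit_gradient[of p G, OF p] by blast
  let ?z = "gpt K p e s0"
  have pi: "0 < K \<Longrightarrow> \<bar>s0 - 0\<bar> \<le> pi" using s0 R0 pi_gt3 by auto
  have zS: "?z \<in> S" "d p ?z = s0" using gpt_in[OF p(1) e(1)] d_gpt[OF p(1) e(1), of s0 0] pi s0 by auto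
  then have zN: "?z \<in> N" using R0 s0 by (auto simp: rball_def)
  have pN: "p \<in> N" using R0 p by (auto simp: rball_def)
  have 1: "F p + s0 * nrm (G p) \<le> F ?z"
    using convex_geo_0[OF sc p(1) e(1), of 0 s0] pN zN pi e(2) by simp
  obtain e' where e': "utan K xs e'" "?z = gpt K xs e' (d xs ?z)" using gpt_polar[OF xs(1) zS(1)] by blast
  have dz: "0 \<le> d xs ?z" "d xs ?z \<le> D + s0"
    using d_nonneg[OF xs(1) zS(1)] d_triangle[OF xs(1) p(1) zS(1)] zS(2) d_commute by (auto simp: D_def)
  have pi': "0 < K \<Longrightarrow> \<bar>d xs ?z - 0\<bar> \<le> pi" using d_le_pi[OF xs(1) zS(1)] dz by simp
  have "F ?z \<le> F xs + L / 2 * (d xs ?z)\<^sup>2"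
    using smooth_geo[OF sm xs(1) e'(1), of 0 "d xs ?z"] xs zN e'(2) pi' by (simp add: form_simps)
  also have "L / 2 * (d xs ?z)\<^sup>2 \<le> L / 2 * (2 * D)\<^sup>2" using dz s0 L by (intro mult_left_mono power_mono) auto
  finally have "s0 * nrm (G p) \<le> 2 * L * D * D" using 1 xs(4)[OF pN] by (simp add: power2_eq_square algebra_simps)
  also have "2 * L * D * D \<le> s0 * (4 / R0 * L * D)"
  proof -
    have "D * R0 \<le> s0 * 2"
    proof (cases "R0 \<le> D")
      case True
      have "D * R0 \<le> 2 * R0" using dp R0 by (intro mult_right_mono) (auto simp: D_def)
      then show ?thesis using True by (simp add: s0_def)
    next
      case False
      have "D * R0 \<le> D * 2" using D R0 by (intro mult_left_mono) auto
      then show ?thesis using False by (simp add: s0_def)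
    qed
    then have "(2 * L * D) * (D * R0) \<le> (2 * L * D) * (s0 * 2)" using L D by (intro mult_left_mono) auto
    then show ?thesis using R0 by (simp add: field_simps)
  qed
  finally have "nrm (G p) \<le> 4 / R0 * L * D" using s0(1) by (simp only: mult_le_cancel_left_pos)
  then show ?thesis by (simp only: D_def)
qed

text \<open>The test point z lies at distance \<delta> from p along the gradient. Convexity at p and
  q and smoothness at q bound \<delta> |G p| by the pairing of G q with w plus 2 L \<delta>^2, where
  w is the difference of the initial velocities from q to z and to p. Nonpositive curvature makes
  |w| at most d p z = \<delta>.\<close>

lemma gradient_step_hyp:
  assumes K': "K = -1" and q: "q \<in> S" "G q \<in> tangent K q" "q \<in> N" and p: "p \<in> S" "G p \<in> tangent K p"
    and \<delta>: "d p q = \<delta>" "0 < \<delta>" and N: "rball K p \<delta> \<subseteq> N"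
    and sm: "smooth_on K F G L N" and sc: "strongly_gconvex_on K F G \<mu> N" "0 \<le> \<mu>" and L: "0 < L"
  shows "nrm (G p) \<le> nrm (G q) + 2 * L * \<delta>"
proof -
  have nK: "\<not> 0 < K" using K' by simp
  obtain e where e: "utan K p e" "ip (G p) e = nrm (G p)" using unit_gradient[of p G, OF p] by blast
  define z where "z = gpt K p e \<delta>"
  have zS: "z \<in> S" "d p z = \<delta>" using gpt_in[OF p(1) e(1)] d_gpt[OF p(1) e(1), of \<delta> 0] \<delta> nK by (auto simp: z_def)
  have zN: "z \<in> N" and pN: "p \<in> N" using N zS p \<delta> by (auto simp: rball_def)
  have 1: "F p + \<delta> * nrm (G p) \<le> F z"
    using convex_geo_0[OF sc p(1) e(1), of 0 \<delta>] pN zN nK e(2) by (simp add: z_def)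
  define b where "b = d q z"
  obtain e1 where e1: "utan K q e1" "z = gpt K q e1 b" using gpt_polar[OF q(1) zS(1)] by (auto simp: b_def)
  obtain e2 where e2: "utan K q e2" "p = gpt K q e2 \<delta>" using gpt_polar[OF q(1) p(1)] \<delta> d_commute by metis
  have b: "0 \<le> b" "b \<le> 2 * \<delta>"
    using d_nonneg[OF q(1) zS(1)] d_triangle[OF q(1) p(1) zS(1)] zS \<delta> d_commute[of q p] by (auto simp: b_def)
  have z_up: "F z \<le> F q + b * ip (G q) e1 + L / 2 * b\<^sup>2"
    using smooth_geo[OF sm q(1) e1(1), of 0 b] q zN e1(2) nK by simp
  have p_lo: "F q + \<delta> * ip (G q) e2 \<le> F p"
    using convex_geo_0[OF sc q(1) e2(1), of 0 \<delta>] q pN e2(2) nK by simp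
  define w where "w = b *\<^sub>R e1 - \<delta> *\<^sub>R e2"
  have wt: "w \<in> tangent K q" using e1(1) e2(1) by (simp add: w_def utan_def tangent_def form_simps)
  have H: "\<delta>\<^sup>2 / 2 - b * (\<delta> * ip e1 e2) + (if 0 < K then cos 0 else 1) / 2 * b\<^sup>2 \<le> (d (gpt K q e1 b) (gpt K q e2 \<delta>))\<^sup>2 / 2"
    by (rule half_sq_compare(1)[OF q(1) e1(1) e2(1) b(1)]) (use nK \<delta> in auto)
  then have H: "\<delta>\<^sup>2 / 2 - b * (\<delta> * ip e1 e2) + 1 / 2 * b\<^sup>2 \<le> \<delta>\<^sup>2 / 2"
    using e1(2)[symmetric] e2(2)[symmetric] zS(2) d_commute[of z p] nK by simp
  have "ip w w = b\<^sup>2 - 2 * (b * (\<delta> * ip e1 e2)) + \<delta>\<^sup>2"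
    using e1(1) e2(1) form_commute[of K e2 e1] by (simp add: w_def form_simps utan_def power2_eq_square algebra_simps)
  then have "ip w w \<le> \<delta>\<^sup>2" using H by linarith
  then have nw: "nrm w \<le> \<delta>" using \<delta> by (simp add: rnorm_def real_le_lsqrt tangent_form_nonneg[OF q(1) wt])
  have "ip (G q) w \<le> nrm (G q) * nrm w" using tangent_CS[OF q(1,2) wt] by simp
  also have "\<dots> \<le> nrm (G q) * \<delta>" using nw nrm_nonneg[OF q(1,2)] by (intro mult_left_mono) auto
  finally have 2: "b * ip (G q) e1 - \<delta> * ip (G q) e2 \<le> nrm (G q) * \<delta>" by (simp add: w_def form_simps)
  have "L / 2 * b\<^sup>2 \<le> L / 2 * (2 * \<delta>)\<^sup>2" using b L by (intro mult_left_mono power_mono) auto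
  then have "\<delta> * nrm (G p) \<le> nrm (G q) * \<delta> + L / 2 * (2 * \<delta>)\<^sup>2" using 1 2 z_up p_lo by linarith
  then have "\<delta> * nrm (G p) \<le> \<delta> * (nrm (G q) + 2 * L * \<delta>)" by (simp add: power2_eq_square algebra_simps)
  then show ?thesis using \<delta> by simp
qed

text \<open>The room around p can be arbitrarily small, so the segment from \<open>xs\<close> is cut
  into pieces no longer than it. Every piece adds 2 L times its length, and the sum does not depend
  on their number. Balls being convex, all division points keep distance at most R0 < R from the
  centre.\<close>

lemma gradient_bound_hyp:
  assumes K': "K = -1" and o: "o' \<in> S" and G: "\<And>p. p \<in> rball K o' R \<Longrightarrow> G p \<in> tangent K p"
    and p: "p \<in> S" "d p o' < R" and xs: "xs \<in> S" "d xs o' < R" "G xs = 0"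
    and sm: "smooth_on K F G L (rball K o' R)" and sc: "strongly_gconvex_on K F G \<mu> (rball K o' R)" "0 \<le> \<mu>" and L: "0 < L"
  shows "nrm (G p) \<le> 2 * L * d p xs"
proof (cases "d p xs = 0")
  case True
  then have "G p = 0" using d_eq_0[OF p(1) xs(1)] xs by simp
  then show ?thesis using True by (simp add: rnorm_def form_simps)
next
  case False
  have nK: "\<not> 0 < K" using K' by simp
  define E where "E = d xs p"
  have E: "0 < E" using False d_nonneg[OF p(1) xs(1)] d_commute[of p xs] by (simp add: E_def)
  obtain e where e: "utan K xs e" "p = gpt K xs e E" using gpt_polar[OF xs(1) p(1)] by (auto simp: E_def)
  define R0 where "R0 = max (d p o') (d xs o')"
  have R0: "R0 < R" "d xs o' \<le> R0" "d (gpt K xs e E) o' \<le> R0" using p xs e(2) by (auto simp: R0_def)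
  define n where "n = nat \<lceil>E / (R - R0)\<rceil> + 1"
  have n: "1 \<le> n" "E / (R - R0) \<le> real n" unfolding n_def by linarith+
  define \<delta> where "\<delta> = E / real n"
  have \<delta>: "0 < \<delta>" "\<delta> \<le> R - R0" using n R0 E by (auto simp: \<delta>_def field_simps)
  define x where "x i = gpt K xs e (real i * \<delta>)" for i :: nat
  have xS: "x i \<in> S" for i using gpt_in[OF xs(1) e(1)] by (simp add: x_def)
  have xo: "d (x i) o' \<le> R0" if "i \<le> n" for i
    unfolding x_def
  proof (rule ball_segment[OF o xs(1) e(1) _ _ _ R0(2,3)])
    show "0 \<le> real i * \<delta>" using \<delta> by simp
    have "real i * \<delta> \<le> real n * \<delta>" using that \<delta> by (intro mult_right_mono) auto
    then show "real i * \<delta> \<le> E" using n by (simp add: \<delta>_def)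
  qed (use nK in auto)
  have ball: "rball K (x i) \<delta> \<subseteq> rball K o' R" if "i \<le> n" for i
  proof
    fix q assume q: "q \<in> rball K (x i) \<delta>"
    then have "q \<in> S" "d (x i) q \<le> \<delta>" by (auto simp: rball_def)
    then show "q \<in> rball K o' R" using d_triangle[OF o xS[of i], of q] xo[OF that] \<delta> d_commute[of "x i" o'] by (simp add: rball_def)
  qed
  have xN: "x i \<in> rball K o' R" if "i \<le> n" for i using xS xo[OF that] R0 d_commute[of "x i" o'] by (simp add: rball_def)
  have "nrm (G (x i)) \<le> 2 * L * (real i * \<delta>)" if "i \<le> n" for i using that
  proof (induction i)
    case 0
    then show ?case using xs by (simp add: x_def rnorm_def form_simps)
  next
    case (Suc i)
    have dd: "d (x (Suc i)) (x i) = \<delta>"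
      unfolding x_def using d_gpt[OF xs(1) e(1), of "real i * \<delta>" "real (Suc i) * \<delta>"] nK \<delta> by (simp add: algebra_simps)
    have i: "i \<le> n" using Suc by simp
    have "nrm (G (x (Suc i))) \<le> nrm (G (x i)) + 2 * L * \<delta>"
      by (rule gradient_step_hyp[OF K' xS G[OF xN[OF i]] xN[OF i] xS G[OF xN[OF Suc.prems]] dd \<delta>(1) ball[OF Suc.prems] sm sc L])
    then show ?case using Suc by (simp add: algebra_simps)
  qed
  from this[of n] have "nrm (G (x n)) \<le> 2 * L * (real n * \<delta>)" by simp
  moreover have "real n * \<delta> = E" using n by (simp add: \<delta>_def)
  moreover have "x n = p" using e(2) \<open>real n * \<delta> = E\<close> by (simp add: x_def)
  ultimately show ?thesis using d_commute[of xs p] by (simp add: E_def)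
qed

text \<open>
  The geodesic through \<open>o'\<close> in direction \<open>e\<close> leaves the ball on both sides beyond distance \<open>pi/2\<close>;
  its two ends are joined by a minimizing geodesic on the far side, which forces the slope to vanish.
\<close>

lemma large_ball_critical:
  assumes K': "K = 1" and o: "o' \<in> S" "G o' \<in> tangent K o'" and R: "pi/2 < R" "R < pi"
    and sc: "strongly_gconvex_on K F G 0 (rball K o' R)"
  shows "G o' = 0"
proof -
  obtain e where e: "utan K o' e" "ip (G o') e = nrm (G o')" using unit_gradient[of o' G, OF o] by blast
  let ?g = "gpt K o' e"
  have R2: "R \<le> 2 * pi - R" using R by simp
  have p: "pi / 2 \<le> R" "0 < pi" using R by auto
  have inN: "?g t \<in> rball K o' R" if "\<bar>t\<bar> \<le> R" for t
    using d_gpt[OF o(1) e(1), of t 0] that R gpt_in[OF o(1) e(1)] by (simp add: rball_def)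
  have per: "?g (t + 2 * pi) = ?g t" for t using K' by (simp add: gpt_def)
  have ineq: "F (?g s) + (t - s) * ip (G (?g s)) (gtan K o' e s) \<le> F (?g t)"
    if "?g s \<in> rball K o' R" "?g t \<in> rball K o' R" "\<bar>t - s\<bar> \<le> pi" for s t
    using convex_geo_0[OF sc order_refl o(1) e(1) that(1,2)] that(3) by simp
  define g where "g = nrm (G o')"
  define A B where "A = ip (G (?g R)) (gtan K o' e R)" and "B = ip (G (?g (-R))) (gtan K o' e (-R))"
  have NR: "?g R \<in> rball K o' R" "?g (-R) \<in> rball K o' R" "?g 0 \<in> rball K o' R" using inN[of R] inN[of "-R"] inN[of 0] R by auto
  have far: "?g (2 * pi - R) = ?g (-R)" "?g (R - 2 * pi) = ?g R" using per[of "-R"] per[of "R - 2 * pi"] by simp_all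
  \<comment> \<open>The ends at R and -R are also joined the other way round, by an arc of length 2
    pi - 2 R < pi; the gradient inequality is applied along it in both directions.\<close>
  have 1: "F (?g R) + (2 * pi - 2 * R) * A \<le> F (?g (-R))"
    using ineq[of R "2 * pi - R"] NR far R p by (simp add: A_def)
  have 2: "F (?g (-R)) - (2 * pi - 2 * R) * B \<le> F (?g R)"
    using ineq[of "-R" "R - 2 * pi"] NR far R p by (simp add: B_def algebra_simps)
  have g0: "?g 0 = o'" by simp
  have 3: "F o' + R * g \<le> F (?g R)" using ineq[of 0 R] NR R e(2) by (simp add: g_def)
  have 4: "F o' - R * g \<le> F (?g (-R))" using ineq[of 0 "-R"] NR R e(2) by (simp add: g_def)
  have 5: "F (?g R) - R * A \<le> F o'" using ineq[of R 0] NR R by (simp add: A_def)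
  have 6: "F (?g (-R)) + R * B \<le> F o'" using ineq[of "-R" 0] NR R by (simp add: B_def)
  define w where "w = 2 * pi - 2 * R"
  have w: "0 < w" using R by (simp add: w_def)
  have 12: "w * (A - B) \<le> 0" using 1 2 by (simp add: w_def algebra_simps)
  have gR: "R * g \<le> R * A" "R * B \<le> R * g" using 3 4 5 6 by linarith+
  then have gA: "g \<le> A" "B \<le> g" using R p by auto
  have "w * g \<le> w * A" using gA w by (intro mult_left_mono) auto
  moreover have "F (?g (-R)) \<le> F o' - R * B" using 6 by simp
  \<comment> \<open>From the near side A is at least g and B at most g, from the far side A \<le> B;
    so B = g, and this inequality then excludes g > 0.\<close>
  ultimately have c: "w * g + R * g + R * B \<le> 0" using 1 3 by (simp add: w_def)
  have "w * B \<le> w * g" using gA w by (intro mult_left_mono) auto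
  have "0 \<le> g" using nrm_nonneg[OF o] by (simp add: g_def)
  show ?thesis
  proof (rule ccontr)
    assume "G o' \<noteq> 0"
    then have gp: "0 < g"
      using tangent_form_eq_0[OF o] nrm_sq[OF o] \<open>0 \<le> g\<close> by (cases "g = 0") (auto simp: g_def)
    have "A - B \<le> 0" using 12 w by (simp add: mult_le_0_iff)
    then have "B = g" using gA by simp
    moreover have "0 < w * g" "0 < R * g" using w gp R p by auto
    ultimately show False using c by simp
  qed
qed

end

section \<open>Oracle complexity\<close>

lemma log2_le: "1 \<le> y \<Longrightarrow> log 2 y \<le> 3/2 * ln (y::real)"
proof -
  assume y: "1 \<le> y"
  have "2/3 \<le> ln (2::real)" by (rule ln2_ge_two_thirds)
  then have "ln y / ln 2 \<le> ln y / (2/3)" using y by (intro divide_left_mono) auto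
  then show ?thesis by (simp add: log_def)
qed

lemma exp_nat_ge: "(27/10) ^ n \<le> exp (real n)"
proof -
  have "27/10 \<le> exp (1::real)" using e_approx_32 by (simp add: abs_real_def inverse_eq_divide split: if_splits)
  then have "(27/10) ^ n \<le> exp (1::real) ^ n" by (intro power_mono) auto
  then show ?thesis by (simp add: exp_of_nat_mult[symmetric])
qed

lemma ln_const_bounds: "ln 12600 \<le> (10::real)" "ln 72 \<le> (5::real)"
proof -
  have "12600 \<le> (27/10::real) ^ 10" by (simp add: power_divide)
  then have "12600 \<le> exp (10::real)" using exp_nat_ge[of 10] by simp
  then show "ln 12600 \<le> (10::real)" by (metis exp_gt_zero ln_exp ln_le_cancel_iff zero_less_numeral)
  have "72 \<le> (27/10::real) ^ 5" by (simp add: power_divide)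
  then have "72 \<le> exp (5::real)" using exp_nat_ge[of 5] by simp
  then show "ln 72 \<le> (5::real)" by (metis exp_gt_zero ln_exp ln_le_cancel_iff zero_less_numeral)
qed

lemma stage_count_le:
  assumes "0 < \<mu> * r\<^sup>2 / \<eta>" "\<mu> * r\<^sup>2 / \<eta> \<le> y" "1 \<le> y"
  shows "real (stage_count \<mu> r \<eta>) \<le> max 1 (3/2 * ln y)"
proof -
  have "log 2 (\<mu> * r\<^sup>2 / \<eta>) \<le> log 2 y" using assms by simp
  also have "\<dots> \<le> 3/2 * ln y" using log2_le assms by simp
  finally have "log 2 (\<mu> * r\<^sup>2 / \<eta>) \<le> 3/2 * ln y" .
  then have "real_of_int (max 1 \<lceil>log 2 (\<mu> * r\<^sup>2 / \<eta>) - 1\<rceil>) \<le> max 1 (3/2 * ln y)" by linarith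
  then show ?thesis unfolding stage_count_def by linarith
qed

lemma exponent_exists:
  assumes "1 \<le> W" "ln W \<le> w"
  obtains m :: nat where "1 \<le> m" "W \<le> 2 ^ m" "real m \<le> 3/2 * w + 2"
proof -
  define m where "m = nat \<lceil>log 2 W\<rceil> + 1"
  have l: "0 \<le> log 2 W" "log 2 W \<le> 3/2 * w" using assms log2_le[OF assms(1)] by auto
  have m: "log 2 W \<le> real m" "real m \<le> log 2 W + 2" using l(1) unfolding m_def by linarith+
  have "W = 2 powr (log 2 W)" using assms by simp
  also have "\<dots> \<le> 2 powr (real m)" using m by (intro powr_mono) auto
  also have "\<dots> = 2 ^ m" by (rule powr_realpow) simp
  finally have "W \<le> 2 ^ m" .
  then show ?thesis using that[of m] m l by (simp add: m_def)
qed

context core begin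

text \<open>Four factors: O(\<zeta> H \<Lambda>) balls, O(\<Lambda>) stages per ball, O(sqrt Pc)
  iterations per stage with Pc \<le> \<Theta> \<kappa> \<zeta>, and O((1 + \<theta>) \<Lambda>)
  calls per iteration. The power 3/2 of \<zeta> comes from the first and the third. H and \<Theta>
  isolate the influence of the ball radius and of the scaling constants; 80000 covers 9 * 21/2 * 24
  * 34 = 77112.\<close>

lemma alg2_cost:
  fixes \<rho> \<epsilon> Rg cL \<zeta> H \<Theta> \<theta> x :: real
  assumes \<rho>: "0 < \<rho>" "min \<rho> Rg = r1" and Rg: "D \<le> Rg" and \<epsilon>: "0 < \<epsilon>" and cL: "Lt = cL * (L * (Rg + 1))" "0 < cL"
    and \<zeta>: "1 \<le> \<zeta>" "Rg + 1 \<le> 3 * \<zeta>" and H: "1 \<le> H" "1 / \<rho> \<le> H" and \<Theta>: "12 * cL / \<sigma> \<le> \<Theta>" "1 \<le> \<Theta>"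
    and \<theta>: "ln \<Theta> \<le> \<theta>" "ln H \<le> \<theta>" and x: "\<zeta> \<le> x" "L / \<mu> \<le> x" "L * Rg\<^sup>2 / \<epsilon> \<le> x"
  defines "B \<equiv> 80000 * H * sqrt \<Theta> * (1 + \<theta>) * ln (2 + x) ^ 3 * (\<zeta> powr (3/2) * sqrt (L / \<mu>))"
  shows "\<exists>out calls. alg2 K M fr \<rho> \<sigma> cL F G L \<mu> Rg s \<epsilon> out calls"
    and "\<And>out calls. alg2 K M fr \<rho> \<sigma> cL F G L \<mu> Rg s \<epsilon> out calls \<Longrightarrow>
      out \<in> N \<and> (out = s \<or> d out xs < D) \<and> F out \<le> F xs + \<epsilon> \<and> real calls \<le> B"
proof -
  define \<Lambda> where "\<Lambda> = ln (2 + x)"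
  define \<kappa> where "\<kappa> = L / \<mu>"
  have \<kappa>: "1 \<le> \<kappa>" using \<mu>_le_L \<mu> by (simp add: \<kappa>_def)
  have x1: "1 \<le> x" using \<zeta> x by simp
  have "exp (1::real) \<le> 2 + x" using e_less_272 x1 by simp
  then have \<Lambda>1: "1 \<le> \<Lambda>" unfolding \<Lambda>_def using x1 by (simp add: ln_ge_iff)
  have lx: "ln x \<le> \<Lambda>" using x1 by (simp add: \<Lambda>_def)
  have \<Lambda>x: "\<Lambda> \<le> 1 + x" using ln_le_minus_one[of "2 + x"] x1 by (simp add: \<Lambda>_def)
  have \<theta>0: "0 \<le> \<theta>" using \<theta>(2) H ln_ge_zero[of H] by linarith
  have Rg0: "0 < Rg" using Rg D0 by simp
  have Pc_le: "Pc \<le> \<Theta> * (\<kappa> * \<zeta>)"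
  proof -
    have "Pc = 4 * cL / \<sigma> * \<kappa> * (Rg + 1)" unfolding Pc_def unfolding cL(1) \<kappa>_def using \<sigma> \<mu> by (simp add: field_simps)
    also have "\<dots> \<le> 4 * cL / \<sigma> * \<kappa> * (3 * \<zeta>)" using \<zeta> cL \<sigma> \<kappa> by (intro mult_left_mono) auto
    also have "\<dots> = 12 * cL / \<sigma> * (\<kappa> * \<zeta>)" by simp
    also have "\<dots> \<le> \<Theta> * (\<kappa> * \<zeta>)" using \<Theta> \<kappa> \<zeta> by (intro mult_right_mono) auto
    finally show ?thesis .
  qed
  then have sq: "sqrt Pc \<le> sqrt \<Theta> * (sqrt \<kappa> * sqrt \<zeta>)" by (metis real_sqrt_le_mono real_sqrt_mult)
  have "\<kappa> * \<zeta> \<le> x * x" using x \<kappa> \<zeta> by (intro mult_mono) (auto simp: \<kappa>_def)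
  then have "\<Theta> * (\<kappa> * \<zeta>) \<le> \<Theta> * (x * x)" using \<Theta> by (intro mult_left_mono) auto
  then have Px: "Pc \<le> \<Theta> * (x * x)" using Pc_le by simp
  have lnP: "ln Pc \<le> \<theta> + 2 * \<Lambda>"
  proof -
    have "ln Pc \<le> ln (\<Theta> * (x * x))" using Px Pc by simp
    also have "\<dots> = ln \<Theta> + (ln x + ln x)" using \<Theta> x1 by (simp add: ln_mult)
    finally show ?thesis using \<theta> lx by linarith
  qed
  have P2: "1 \<le> Pc\<^sup>2" using Pc by (simp add: one_le_power)
  have lnP2: "ln (Pc\<^sup>2) = 2 * ln Pc" using Pc by (simp add: ln_realpow)
  have \<zeta>p: "\<zeta> powr (3/2) = \<zeta> * sqrt \<zeta>"
  proof -
    have "\<zeta> powr (3/2) = \<zeta> powr (1 + 1/2)" by simp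
    also have "\<dots> = \<zeta> * sqrt \<zeta>" using \<zeta> unfolding powr_add by (simp add: powr_half_sqrt)
    finally show ?thesis .
  qed
  have sqs: "1 \<le> sqrt \<Theta>" "1 \<le> sqrt \<kappa>" "1 \<le> sqrt \<zeta>" using \<Theta> \<kappa> \<zeta> by auto
  have B_eq: "B = 80000 * H * sqrt \<Theta> * (1 + \<theta>) * \<Lambda> ^ 3 * (\<zeta> * sqrt \<zeta> * sqrt \<kappa>)"
    by (simp add: B_def \<Lambda>_def \<zeta>p \<kappa>_def)
  have B0: "0 \<le> B" unfolding B_eq using H sqs \<theta>0 \<Lambda>1 \<zeta> by (intro mult_nonneg_nonneg) auto
  have \<theta>\<Lambda>: "1 + \<theta> \<le> (1 + \<theta>) * \<Lambda>" "\<Lambda> \<le> (1 + \<theta>) * \<Lambda>"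
    using mult_left_mono[OF \<Lambda>1, of "1 + \<theta>"] mult_right_mono[of 1 "1 + \<theta>" \<Lambda>] \<theta>0 \<Lambda>1 by auto
  have combine: "real T * (real J * (24 * sqrt Pc * (2 + real m))) \<le> B"
    if "real T \<le> 9 * \<zeta> * H * \<Lambda>" "real J \<le> 21/2 * \<Lambda>" "2 + real m \<le> 34 * ((1 + \<theta>) * \<Lambda>)" for T J m
  proof -
    have "real T * (real J * (24 * sqrt Pc * (2 + real m))) \<le>
      (9 * \<zeta> * H * \<Lambda>) * ((21/2 * \<Lambda>) * (24 * (sqrt \<Theta> * (sqrt \<kappa> * sqrt \<zeta>)) * (34 * ((1 + \<theta>) * \<Lambda>))))"
      using that sq Pc sqs \<Lambda>1 \<theta>0 \<zeta> H by (intro mult_mono mult_nonneg_nonneg) auto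
    also have "\<dots> = 77112 * (H * sqrt \<Theta> * (1 + \<theta>) * \<Lambda> ^ 3 * (\<zeta> * sqrt \<zeta> * sqrt \<kappa>))"
      by (simp add: power3_eq_cube)
    also have "\<dots> \<le> 80000 * (H * sqrt \<Theta> * (1 + \<theta>) * \<Lambda> ^ 3 * (\<zeta> * sqrt \<zeta> * sqrt \<kappa>))"
      using H sqs \<theta>0 \<Lambda>1 \<zeta> by (intro mult_right_mono mult_nonneg_nonneg) auto
    finally show ?thesis by (simp add: B_eq mult.assoc)
  qed
  have W1: "1 \<le> 12600 * Pc\<^sup>2" "ln (12600 * Pc\<^sup>2) \<le> 10 + 2 * \<theta> + 4 * \<Lambda>"
  proof -
    show "1 \<le> 12600 * Pc\<^sup>2" using P2 by simp
    have "ln (12600 * Pc\<^sup>2) = ln 12600 + ln (Pc\<^sup>2)" using P2 by (intro ln_mult_pos) auto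
    then show "ln (12600 * Pc\<^sup>2) \<le> 10 + 2 * \<theta> + 4 * \<Lambda>" using lnP lnP2 ln_const_bounds(1) by linarith
  qed
  obtain m0 where m0: "1 \<le> m0" "12600 * Pc\<^sup>2 \<le> 2 ^ m0" "real m0 \<le> 3/2 * (10 + 2 * \<theta> + 4 * \<Lambda>) + 2"
    using exponent_exists[OF W1] by blast
  have small: "1 \<le> m0 \<and> 12600 * Pc\<^sup>2 \<le> 2 ^ m0 \<and> real (stage_count \<mu> Rg \<epsilon>) * (24 * sqrt Pc * (2 + real m0)) \<le> B"
  proof (intro conjI m0)
    have "\<mu> * Rg\<^sup>2 / \<epsilon> \<le> L * Rg\<^sup>2 / \<epsilon>" using \<mu>_le_L \<epsilon> by (intro divide_right_mono mult_right_mono) auto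
    then have "real (stage_count \<mu> Rg \<epsilon>) \<le> max 1 (3/2 * ln x)"
      using x x1 \<mu> Rg0 \<epsilon> by (intro stage_count_le) auto
    then have 1: "real (stage_count \<mu> Rg \<epsilon>) \<le> 21/2 * \<Lambda>" using lx \<Lambda>1 by linarith
    have 2: "2 + real m0 \<le> 34 * ((1 + \<theta>) * \<Lambda>)"
    proof -
      define w where "w = (1 + \<theta>) * \<Lambda>"
      have "1 + \<theta> \<le> w" "\<Lambda> \<le> w" using \<theta>\<Lambda> by (auto simp: w_def)
      moreover have "real m0 \<le> 17 + 3 * \<theta> + 6 * \<Lambda>" using m0(3) by (simp add: field_simps)
      ultimately have "2 + real m0 \<le> 34 * w" using \<theta>0 \<Lambda>1 by linarith
      then show ?thesis by (simp add: w_def)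
    qed
    have "1 * 1 * 1 \<le> 9 * \<zeta> * H * \<Lambda>" using \<zeta> H \<Lambda>1 by (intro mult_mono) auto
    then show "real (stage_count \<mu> Rg \<epsilon>) * (24 * sqrt Pc * (2 + real m0)) \<le> B" using combine[of 1, OF _ 1 2] by simp
  qed
  have large: "\<exists>m\<ge>1. 12600 * max 1 (sqrt 2 ^ stage_count \<mu> \<rho> \<epsilon>' / \<rho>) * Pc\<^sup>2 \<le> 2 ^ m \<and>
          real T * (real (stage_count \<mu> \<rho> \<epsilon>') * (24 * sqrt Pc * (2 + real m))) \<le> B"
    if l: "\<rho> < Rg" "T = nat \<lceil>2 * Rg / \<rho> * ln (L * Rg\<^sup>2 / \<epsilon>)\<rceil>" "1 \<le> T"
       "\<epsilon>' = min (\<rho> * \<epsilon> / (4 * Rg)) (\<mu> * Rg\<^sup>2 / (2 * (real T)\<^sup>2))" for T \<epsilon>'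
  proof -
    have pos: "0 < L * Rg\<^sup>2 / \<epsilon>" using L Rg0 \<epsilon> by simp
    have lnL: "ln (L * Rg\<^sup>2 / \<epsilon>) \<le> \<Lambda>" using x(3) pos x1 unfolding \<Lambda>_def by simp
    define y where "y = Rg / \<rho>"
    have y1: "1 \<le> y" using l \<rho> by (simp add: y_def)
    have "2 * Rg / \<rho> * ln (L * Rg\<^sup>2 / \<epsilon>) \<le> 2 * y * \<Lambda>"
      using mult_left_mono[OF lnL, of "2 * y"] y1 unfolding y_def by simp
    moreover have "0 \<le> y * \<Lambda>" using y1 \<Lambda>1 by simp
    ultimately have "real T \<le> 2 * y * \<Lambda> + 1" unfolding l(2) by linarith
    moreover have "1 * 1 \<le> y * \<Lambda>" using y1 \<Lambda>1 by (intro mult_mono) auto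
    ultimately have Ty: "real T \<le> 3 * (y * \<Lambda>)" by linarith
    have yH: "y \<le> 3 * \<zeta> * H"
    proof -
      have "y = Rg * (1 / \<rho>)" by (simp add: y_def)
      also have "\<dots> \<le> (3 * \<zeta>) * H" using H \<zeta> Rg0 \<rho> by (intro mult_mono) auto
      finally show ?thesis by simp
    qed
    have T9: "real T \<le> 9 * \<zeta> * H * \<Lambda>"
    proof -
      have "y * \<Lambda> \<le> 3 * \<zeta> * H * \<Lambda>" using yH \<Lambda>1 by (intro mult_right_mono) auto
      then have "3 * (y * \<Lambda>) \<le> 3 * (3 * \<zeta> * H * \<Lambda>)" by (intro mult_left_mono) auto
      also have "\<dots> = 9 * \<zeta> * H * \<Lambda>" by simp
      finally show ?thesis using Ty by (rule order_trans[rotated])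
    qed
    have "0 < real T" using l(3) by simp
    then have \<epsilon>'p: "0 < \<epsilon>'" unfolding l(4) using \<epsilon> \<rho> Rg0 \<mu> by simp
    \<comment> \<open>The two entries of the minimum defining \<epsilon>' are treated separately:
      one gives 4 L Rg^2 / \<epsilon>, the other 2 (T \<rho> / Rg)^2 with T \<rho> / Rg \<le> 3
      \<Lambda> and \<Lambda> \<le> 2 x, hence 72.\<close>
    have bound: "\<mu> * \<rho>\<^sup>2 / \<epsilon>' \<le> 72 * (x * x)"
    proof -
      have x72: "x * 1 \<le> x * x" using x1 by (intro mult_left_mono) auto
      have "\<mu> * \<rho>\<^sup>2 / (\<rho> * \<epsilon> / (4 * Rg)) = 4 * (\<mu> * (\<rho> * Rg) / \<epsilon>)"
        using \<rho> Rg0 \<epsilon> by (simp add: power2_eq_square field_simps)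
      also have "\<mu> * (\<rho> * Rg) / \<epsilon> \<le> L * (Rg * Rg) / \<epsilon>"
        using \<mu>_le_L \<mu> L \<rho> l Rg0 \<epsilon> by (intro divide_right_mono mult_mono) auto
      finally have "\<mu> * \<rho>\<^sup>2 / (\<rho> * \<epsilon> / (4 * Rg)) \<le> 4 * (L * Rg\<^sup>2 / \<epsilon>)" by (simp add: power2_eq_square)
      then have a: "\<mu> * \<rho>\<^sup>2 / (\<rho> * \<epsilon> / (4 * Rg)) \<le> 72 * (x * x)"
        using x(3) x72 x1 by linarith
      have "\<mu> * \<rho>\<^sup>2 / (\<mu> * Rg\<^sup>2 / (2 * (real T)\<^sup>2)) = 2 * (real T / y)\<^sup>2"
        using \<mu> \<rho> Rg0 by (simp add: y_def power_divide field_simps)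
      also have "\<dots> \<le> 2 * (3 * \<Lambda>)\<^sup>2"
      proof -
        have "real T / y \<le> 3 * \<Lambda>" using Ty y1 by (simp add: divide_le_eq mult.commute mult.left_commute)
        then show ?thesis using y1 by (intro mult_left_mono power_mono) auto
      qed
      also have "\<dots> \<le> 2 * (3 * (x + x))\<^sup>2" using \<Lambda>x x1 \<Lambda>1 by (intro mult_left_mono power_mono) auto
      also have "\<dots> = 72 * (x * x)" by (simp add: power2_eq_square)
      finally have b: "\<mu> * \<rho>\<^sup>2 / (\<mu> * Rg\<^sup>2 / (2 * (real T)\<^sup>2)) \<le> 72 * (x * x)" .
      show ?thesis using a b unfolding l(4) min_def by auto
    qed
    let ?J = "stage_count \<mu> \<rho> \<epsilon>'"
    have x72: "1 * 1 \<le> x * x" using x1 by (intro mult_mono) auto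
    have "real ?J \<le> max 1 (3/2 * ln (72 * (x * x)))"
      by (rule stage_count_le[OF _ bound]) (use \<mu> \<rho> \<epsilon>'p x72 in auto)
    moreover have "ln (72 * (x * x)) = ln 72 + (ln x + ln x)" using x1 by (simp add: ln_mult)
    ultimately have J: "real ?J \<le> 15/2 + 3 * \<Lambda>" using ln_const_bounds(2) lx \<Lambda>1 by linarith
    then have J11: "real ?J \<le> 21/2 * \<Lambda>" using \<Lambda>1 by linarith
    let ?Y = "max 1 (sqrt 2 ^ ?J / \<rho>)"
    have lnY: "ln ?Y \<le> real ?J / 2 + \<theta>"
    proof -
      have s: "1 \<le> sqrt 2 ^ ?J" by simp
      have "sqrt 2 ^ ?J * (1 / \<rho>) \<le> sqrt 2 ^ ?J * H" using H by (intro mult_left_mono) auto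
      moreover have "1 * 1 \<le> sqrt 2 ^ ?J * H" using H s by (intro mult_mono) auto
      ultimately have "?Y \<le> sqrt 2 ^ ?J * H" by simp
      then have "ln ?Y \<le> ln (sqrt 2 ^ ?J * H)" using s H by (subst ln_le_cancel_iff) (auto intro: mult_pos_pos)
      also have "\<dots> = real ?J * ln (sqrt 2) + ln H" using H s by (simp add: ln_mult ln_realpow)
      also have "ln (sqrt 2) = ln 2 / 2" by (simp add: ln_sqrt)
      also have "real ?J * (ln 2 / 2) \<le> real ?J * (1 / 2)" using ln_le_minus_one[of 2] by (intro mult_left_mono) auto
      finally show ?thesis using \<theta> by simp
    qed
    have Y1: "1 \<le> ?Y" by simp
    have e: "12600 * ?Y * Pc\<^sup>2 = ?Y * (12600 * Pc\<^sup>2)" by simp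
    have "1 * 1 \<le> ?Y * (12600 * Pc\<^sup>2)" using Y1 W1 by (intro mult_mono) auto
    then have W: "1 \<le> 12600 * ?Y * Pc\<^sup>2" unfolding e by simp
    have "ln (12600 * ?Y * Pc\<^sup>2) = ln ?Y + ln (12600 * Pc\<^sup>2)" unfolding e using Y1 W1 by (intro ln_mult_pos) auto
    then have lW: "ln (12600 * ?Y * Pc\<^sup>2) \<le> 14 + 3 * \<theta> + 11/2 * \<Lambda>"
      using lnY J W1(2) by linarith
    obtain m where m: "1 \<le> m" "12600 * ?Y * Pc\<^sup>2 \<le> 2 ^ m"
        "real m \<le> 3/2 * (14 + 3 * \<theta> + 11/2 * \<Lambda>) + 2"
      using exponent_exists[OF W lW] by blast
    then have mm: "real m \<le> 23 + 9/2 * \<theta> + 33/4 * \<Lambda>" by (simp add: field_simps)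
    have "2 + real m \<le> 34 * ((1 + \<theta>) * \<Lambda>)"
    proof -
      define w where "w = (1 + \<theta>) * \<Lambda>"
      have "1 + \<theta> \<le> w" "\<Lambda> \<le> w" using \<theta>\<Lambda> by (auto simp: w_def)
      then have "2 + real m \<le> 34 * w" using mm \<theta>0 \<Lambda>1 by linarith
      then show ?thesis by (simp add: w_def)
    qed
    then show ?thesis using combine[OF T9 J11] m by blast
  qed
  note A = alg2_correct[OF \<rho> Rg \<epsilon> cL(1) small large B0]
  show "\<exists>out calls. alg2 K M fr \<rho> \<sigma> cL F G L \<mu> Rg s \<epsilon> out calls" by (rule A(1)) assumption+
  show "\<And>out calls. alg2 K M fr \<rho> \<sigma> cL F G L \<mu> Rg s \<epsilon> out calls \<Longrightarrow>
      out \<in> N \<and> (out = s \<or> d out xs < D) \<and> F out \<le> F xs + \<epsilon> \<and> real calls \<le> B" by (rule A(2)) assumption+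
qed

end

section \<open>The assumptions of \<open>core\<close> in the two geometries\<close>

lemma smooth_on_mono: "smooth_on K F G L N \<Longrightarrow> L \<le> L' \<Longrightarrow> N' \<subseteq> N \<Longrightarrow> smooth_on K F G L' N'"
  unfolding smooth_on_def
proof (intro ballI impI)
  fix x y v assume h: "\<forall>x\<in>N. \<forall>y\<in>N. \<forall>v\<in>tangent K x. rexp K x v = y \<and> rnorm K v = rdist K x y \<longrightarrow> F y \<le> F x + form K (G x) v + L / 2 * (rdist K x y)\<^sup>2"
    "L \<le> L'" "N' \<subseteq> N" "x \<in> N'" "y \<in> N'" "v \<in> tangent K x" "rexp K x v = y \<and> rnorm K v = rdist K x y"
  then have "F y \<le> F x + form K (G x) v + L / 2 * (rdist K x y)\<^sup>2" by blast
  moreover have "L / 2 * (rdist K x y)\<^sup>2 \<le> L' / 2 * (rdist K x y)\<^sup>2" using h(2) by (intro mult_right_mono) auto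
  ultimately show "F y \<le> F x + form K (G x) v + L' / 2 * (rdist K x y)\<^sup>2" by linarith
qed

lemma strongly_gconvex_on_mono: "strongly_gconvex_on K F G \<mu> N \<Longrightarrow> \<mu>' \<le> \<mu> \<Longrightarrow> N' \<subseteq> N \<Longrightarrow> strongly_gconvex_on K F G \<mu>' N'"
  unfolding strongly_gconvex_on_def
proof (intro ballI impI)
  fix x y v assume h: "\<forall>x\<in>N. \<forall>y\<in>N. \<forall>v\<in>tangent K x. rexp K x v = y \<and> rnorm K v = rdist K x y \<longrightarrow> F x + form K (G x) v + \<mu> / 2 * (rdist K x y)\<^sup>2 \<le> F y"
    "\<mu>' \<le> \<mu>" "N' \<subseteq> N" "x \<in> N'" "y \<in> N'" "v \<in> tangent K x" "rexp K x v = y \<and> rnorm K v = rdist K x y"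
  then have "F x + form K (G x) v + \<mu> / 2 * (rdist K x y)\<^sup>2 \<le> F y" by blast
  moreover have "\<mu>' / 2 * (rdist K x y)\<^sup>2 \<le> \<mu> / 2 * (rdist K x y)\<^sup>2" using h(2) by (intro mult_right_mono) auto
  ultimately show "F x + form K (G x) v + \<mu>' / 2 * (rdist K x y)\<^sup>2 \<le> F y" by linarith
qed

context space_form begin

text \<open>On the sphere a ball of radius R0 about every query lies in N, so
  \<open>gradient_bound_room\<close> applies with constant 4 / R0; the distances it requires to be
  at most 2 are below pi/2.\<close>

lemma core_room:
  fixes R0 \<sigma> r1 D L \<mu> Lt :: real
  assumes K': "K = 1" and N: "N \<subseteq> M" "N \<subseteq> S" and G: "\<And>p. p \<in> N \<Longrightarrow> G p \<in> tangent K p"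
    and sm: "smooth_on K F G L N" and sc: "strongly_gconvex_on K F G \<mu> N" and L: "0 < L" and \<mu>: "0 < \<mu>"
    and s: "s \<in> S" "d s xs \<le> D" and xs: "xs \<in> S" "\<And>q. q \<in> N \<Longrightarrow> F xs \<le> F q"
    and r1: "0 < r1" "r1 \<le> D" "r1 \<le> 1/2" "D + r1 < pi/2" and \<sigma>: "0 < \<sigma>" "\<sigma> \<le> 1" "\<sigma> \<le> 2 * cos (D + r1)"
    and R0: "0 < R0" "R0 \<le> 2" and room: "\<And>p. p \<in> S \<Longrightarrow> d s p \<le> r1 \<or> d p xs < D + r1 \<Longrightarrow> rball K p R0 \<subseteq> N"
    and Lt: "10000 * (4 / R0) * L * (D + 1) \<le> Lt"
  shows "core K fr M N F G L \<mu> D r1 (4 / R0) Lt \<sigma> xs s"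
proof -
  have self: "p \<in> rball K p R0" if "p \<in> S" for p using that R0 by (simp add: rball_def)
  have rx: "rball K xs R0 \<subseteq> N" using room[OF xs(1)] r1 xs by auto
  then have xN: "xs \<in> N" using self[OF xs(1)] by blast
  have Rpi: "R0 \<le> pi" using R0 pi_gt3 by linarith
  have Gxs: "G xs = 0" by (rule gradient_zero_at_minimizer[OF xs(1) G[OF xN] R0(1) Rpi rx sm xs(2)])
  show ?thesis
  proof
    fix p assume p: "p \<in> S" "d s p \<le> r1 \<or> d p xs < D + r1"
    have rp: "rball K p R0 \<subseteq> N" using room p by blast
    then have pN: "p \<in> N" using self[OF p(1)] by blast
    have "d p xs \<le> D + r1" using p s d_triangle[OF p(1) s(1) xs(1)] d_commute[of p s] by auto
    then have dp: "d p xs \<le> 2" using r1 pi_less_4 by linarith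
    have "nrm (G p) \<le> 4 / R0 * L * d p xs"
      by (rule gradient_bound_room[OF p(1) G[OF pN] R0 rp xs(1) xN Gxs xs(2) dp N(2) sm sc less_imp_le[OF \<mu>] L])
    then show "p \<in> N \<and> nrm (G p) \<le> 4 / R0 * L * d p xs" using pN by blast
  qed (use assms xN in \<open>auto simp: le_divide_eq\<close>)
qed

text \<open>In hyperbolic space the queries may come arbitrarily close to the boundary of the ball
  but stay strictly inside, which is what the constant 2 of \<open>gradient_bound_hyp\<close> asks
  for.\<close>

lemma core_hyp:
  fixes R r1 D L \<mu> Lt :: real
  assumes K': "K = -1" and N: "rball K o' R \<subseteq> M" and o: "o' \<in> S" and G: "\<And>p. p \<in> rball K o' R \<Longrightarrow> G p \<in> tangent K p"
    and sm: "smooth_on K F G L (rball K o' R)" and sc: "strongly_gconvex_on K F G \<mu> (rball K o' R)" and L: "0 < L" and \<mu>: "0 < \<mu>"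
    and s: "s \<in> S" "d s xs \<le> D" and xs: "xs \<in> S" "\<And>q. q \<in> rball K o' R \<Longrightarrow> F xs \<le> F q"
    and r1: "0 < r1" "r1 \<le> D" "r1 \<le> 1"
    and room: "\<And>p. p \<in> S \<Longrightarrow> d s p \<le> r1 \<or> d p xs < D + r1 \<Longrightarrow> d p o' < R"
    and Lt: "20000 * L * (D + 1) \<le> Lt"
  shows "core K fr M (rball K o' R) F G L \<mu> D r1 2 Lt 1 xs s"
proof -
  have nK: "\<not> 0 < K" using K' by simp
  have xo: "d xs o' < R" using room[OF xs(1)] r1 xs by auto
  have inN: "p \<in> rball K o' R" if "p \<in> S" "d p o' < R" for p using that d_commute[of p o'] by (simp add: rball_def)
  have rx: "rball K xs (R - d xs o') \<subseteq> rball K o' R"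
  proof
    fix q assume "q \<in> rball K xs (R - d xs o')"
    then show "q \<in> rball K o' R" using d_triangle[OF o xs(1), of q] d_commute[of xs o'] by (simp add: rball_def)
  qed
  have xN: "xs \<in> rball K o' R" using inN xs xo by blast
  have h: "0 < R - d xs o'" "0 < K \<Longrightarrow> R - d xs o' \<le> pi" using xo nK by auto
  have Gxs: "G xs = 0"
    by (rule gradient_zero_at_minimizer[OF xs(1) G[OF xN] h(1) _ rx sm xs(2)]) (use nK in auto)
  show ?thesis
  proof
    fix p assume p: "p \<in> S" "d s p \<le> r1 \<or> d p xs < D + r1"
    have po: "d p o' < R" using room p by blast
    have "nrm (G p) \<le> 2 * L * d p xs"
      by (rule gradient_bound_hyp[OF K' o G p(1) po xs(1) xo Gxs sm sc less_imp_le[OF \<mu>] L])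
    then show "p \<in> rball K o' R \<and> nrm (G p) \<le> 2 * L * d p xs" using inN p po by blast
  next
    show "rball K o' R \<subseteq> S" by (auto simp: rball_def)
  qed (use assms xN nK in auto)
qed

section \<open>Continuity, compactness and minimizers on large balls\<close>

lemma continuous_of_smooth_convex:
  assumes N: "N \<subseteq> S" and sm: "smooth_on K F G L N" and sc: "strongly_gconvex_on K F G \<mu> N" "0 \<le> \<mu>" and L: "0 \<le> L"
    and G: "\<And>p. p \<in> N \<Longrightarrow> G p \<in> tangent K p"
  shows "continuous_on N F"
  unfolding continuous_on_def
proof
  fix x assume x: "x \<in> N"
  have xS: "x \<in> S" using x N by blast
  have dc: "((\<lambda>y. d x y) \<longlongrightarrow> d x x) (at x within N)"
  proof -
    have ic: "continuous_on N (\<lambda>y. ip x y)" unfolding form_def by (intro continuous_intros)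
    have "continuous_on N (\<lambda>y. d x y)"
    proof (cases "K = 1")
      case True
      have "continuous_on N (\<lambda>y. arccos (ip x y))"
        by (intro continuous_on_arccos ic) (use form_range(1)[OF xS] N True in \<open>force simp: abs_le_iff\<close>)
      then show ?thesis using True by (simp add: rdist_def)
    next
      case False
      then have K': "K = -1" using K by auto
      have "continuous_on N (\<lambda>y. arcosh (- ip x y))"
      proof (rule continuous_on_compose2[OF continuous_on_arcosh[OF order_refl] continuous_on_minus[OF ic]])
        show "(\<lambda>y. - ip x y) ` N \<subseteq> {1..}" using form_range(2)[OF xS] N K' by force
      qed
      then show ?thesis using K' by (simp add: rdist_def)
    qed
    then show ?thesis using x by (simp add: continuous_on_def)
  qed
  define h where "h y = nrm (G x) * d x y + L / 2 * (d x y)\<^sup>2" for y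
  have "(h \<longlongrightarrow> nrm (G x) * d x x + L / 2 * (d x x)\<^sup>2) (at x within N)"
    unfolding h_def by (intro tendsto_intros dc)
  then have h0: "(h \<longlongrightarrow> 0) (at x within N)" using xS by simp
  have "\<bar>F y - F x\<bar> \<le> h y" if y: "y \<in> N" for y
  proof -
    have yS: "y \<in> S" using y N by blast
    obtain e where e: "utan K x e" "y = gpt K x e (d x y)" using gpt_polar[OF xS yS] by blast
    have pi: "0 < K \<Longrightarrow> \<bar>d x y - 0\<bar> \<le> pi" using d_le_pi[OF xS yS] d_nonneg[OF xS yS] by simp
    have "nrm e = 1" using e(1) by (simp add: utan_def rnorm_def)
    then have "\<bar>ip (G x) e\<bar> \<le> nrm (G x)" using tangent_CS[OF xS G[OF x], of e] e(1) by (simp add: utan_def)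
    then have "\<bar>d x y * ip (G x) e\<bar> \<le> d x y * nrm (G x)" unfolding abs_mult using d_nonneg[OF xS yS] by (simp add: mult_left_mono)
    moreover have "F y \<le> F x + d x y * ip (G x) e + L / 2 * (d x y)\<^sup>2"
      using smooth_geo[OF sm xS e(1), of 0 "d x y"] x y e(2) pi by simp
    moreover have "F x + d x y * ip (G x) e \<le> F y"
      using convex_geo_0[OF sc xS e(1), of 0 "d x y"] x y e(2) pi by simp
    moreover have "0 \<le> L / 2 * (d x y)\<^sup>2" using L by simp
    ultimately show ?thesis unfolding h_def by (simp add: mult.commute)
  qed
  then have "\<forall>\<^sub>F y in at x within N. norm (F y - F x) \<le> h y"
    by (auto simp: eventually_at_filter)
  then have "((\<lambda>y. F y - F x) \<longlongrightarrow> 0) (at x within N)" by (rule Lim_null_comparison[OF _ h0])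
  then show "(F \<longlongrightarrow> F x) (at x within N)" by (simp add: LIM_zero_iff)
qed

lemma compact_rball:
  assumes x: "x \<in> S" and r: "0 \<le> r" "0 < K \<longrightarrow> r \<le> pi" shows "compact (rball K x r)"
proof -
  define f where "f = (\<lambda>(t, u). gpt K x (fr x u) t)"
  have u: "utan K x (fr x u)" if "norm u = 1" for u
    using that frame_form[OF x, of u u] frame_tangent[OF x, of u] by (simp add: utan_def tangent_def norm_eq_1)
  have img: "rball K x r = f ` ({0..r} \<times> sphere 0 1)"
  proof
    show "f ` ({0..r} \<times> sphere 0 1) \<subseteq> rball K x r"
    proof (clarsimp simp: f_def)
      fix t and v :: 'a assume t: "0 \<le> t" "t \<le> r" "norm v = 1"
      have "d (gpt K x (fr x v) 0) (gpt K x (fr x v) t) = \<bar>t - 0\<bar>"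
        by (rule d_gpt[OF x u[OF t(3)]]) (use t r in auto)
      then show "gpt K x (fr x v) t \<in> rball K x r" using t gpt_in[OF x u[OF t(3)]] by (simp add: rball_def)
    qed
    show "rball K x r \<subseteq> f ` ({0..r} \<times> sphere 0 1)"
    proof
      fix q assume "q \<in> rball K x r"
      then have q: "q \<in> S" "d x q \<le> r" by (auto simp: rball_def)
      obtain e where e: "utan K x e" "q = gpt K x e (d x q)" using gpt_polar[OF x q(1)] by blast
      obtain v where v: "e = fr x v" using tangent_frame[OF x, of e] e(1) unfolding utan_def by blast
      have "norm v = 1" using e(1) frame_form[OF x, of v v] by (simp add: v utan_def norm_eq_1)
      then show "q \<in> f ` ({0..r} \<times> sphere 0 1)"
        using e(2) q d_nonneg[OF x q(1)] by (intro image_eqI[of _ _ "(d x q, v)"]) (auto simp: f_def v)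
    qed
  qed
  have bl: "bounded_linear (fr x)" using frame_linear[OF x] by (simp add: linear_conv_bounded_linear)
  have cs: "continuous_on UNIV (cs K)" "continuous_on UNIV (sn K)"
    using DERIV_cs[OF K] DERIV_sn[OF K] by (auto intro!: DERIV_continuous_on)
  have "continuous_on ({0..r} \<times> sphere 0 1) f"
    unfolding f_def gpt_def split_def
    by (intro continuous_intros continuous_on_compose2[OF cs(1)] continuous_on_compose2[OF cs(2)]
        bounded_linear.continuous_on[OF bl]) auto
  then show ?thesis unfolding img by (intro compact_continuous_image compact_Times) auto
qed

text \<open>The regularised functions are minimised over balls beyond the radii of the chart
  analysis, so existence comes from compactness instead of \<open>ball_minimizer\<close>.\<close>

lemma minimizer_exists:
  assumes x: "x \<in> S" and r: "0 \<le> r" "0 < K \<longrightarrow> r \<le> pi"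
    and sm: "smooth_on K F G L (rball K x r)" and sc: "strongly_gconvex_on K F G \<mu> (rball K x r)" "0 \<le> \<mu>" and L: "0 \<le> L"
    and G: "\<And>p. p \<in> rball K x r \<Longrightarrow> G p \<in> tangent K p"
  shows "\<exists>y\<in>rball K x r. \<forall>q\<in>rball K x r. F y \<le> F q"
proof -
  have "rball K x r \<subseteq> S" by (auto simp: rball_def)
  then have "continuous_on (rball K x r) F" by (rule continuous_of_smooth_convex[OF _ sm sc L G])
  moreover have "x \<in> rball K x r" using x r by (simp add: rball_def)
  then have "rball K x r \<noteq> {}" by blast
  ultimately show ?thesis using continuous_attains_inf[OF compact_rball[OF x r]] by blast
qed

end

section \<open>Invariants and cost of the regularisation rounds\<close>

lemma reg_rounds_inv:
  assumes "reg_rounds K M fr R \<sigma> cL cS cC \<kappa> F G L Rg x0 \<Delta> i y n" "i \<le> J"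
    and "P 0 x0"
    and step: "\<And>i y y' k. i < J \<Longrightarrow> P i y \<Longrightarrow>
      alg2 K M fr R \<sigma> cL (reg_fun K F x0 (\<Delta> / Rg\<^sup>2 / 2 ^ i)) (reg_grad K G x0 (\<Delta> / Rg\<^sup>2 / 2 ^ i))
        (L + cS * zeta_const K Rg * (\<Delta> / Rg\<^sup>2 / 2 ^ i)) (cC * delta_const K Rg * (\<Delta> / Rg\<^sup>2 / 2 ^ i)) Rg y (\<kappa> * \<Delta> / 2 ^ i) y' k
      \<Longrightarrow> P (Suc i) y' \<and> real k \<le> B"
  shows "P i y \<and> real n \<le> real i * B"
  using assms(1,2)
proof (induction rule: reg_rounds.induct)
  case start
  then show ?case using assms(3) by simp
next
  case (round i y n m y' k)
  have i: "i < J" using round.prems by simp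
  have I: "P i y" "real n \<le> real i * B" using round.IH i by auto
  have "P (Suc i) y' \<and> real k \<le> B" using step[OF i I(1)] round.hyps(3) unfolding round.hyps(2) by blast
  then show ?case using I(2) by (simp add: algebra_simps)
qed

lemma reg_rounds_exists:
  assumes "i \<le> J" "P 0 x0"
    and step: "\<And>i y y' k. i < J \<Longrightarrow> P i y \<Longrightarrow>
      alg2 K M fr R \<sigma> cL (reg_fun K F x0 (\<Delta> / Rg\<^sup>2 / 2 ^ i)) (reg_grad K G x0 (\<Delta> / Rg\<^sup>2 / 2 ^ i))
        (L + cS * zeta_const K Rg * (\<Delta> / Rg\<^sup>2 / 2 ^ i)) (cC * delta_const K Rg * (\<Delta> / Rg\<^sup>2 / 2 ^ i)) Rg y (\<kappa> * \<Delta> / 2 ^ i) y' k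
      \<Longrightarrow> P (Suc i) y' \<and> real k \<le> B"
    and ex: "\<And>i y. i < J \<Longrightarrow> P i y \<Longrightarrow>
      \<exists>y' k. alg2 K M fr R \<sigma> cL (reg_fun K F x0 (\<Delta> / Rg\<^sup>2 / 2 ^ i)) (reg_grad K G x0 (\<Delta> / Rg\<^sup>2 / 2 ^ i))
        (L + cS * zeta_const K Rg * (\<Delta> / Rg\<^sup>2 / 2 ^ i)) (cC * delta_const K Rg * (\<Delta> / Rg\<^sup>2 / 2 ^ i)) Rg y (\<kappa> * \<Delta> / 2 ^ i) y' k"
  shows "\<exists>y n. reg_rounds K M fr R \<sigma> cL cS cC \<kappa> F G L Rg x0 \<Delta> i y n"
  using assms(1)
proof (induction i)
  case 0 then show ?case using reg_rounds.start by blast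
next
  case (Suc i)
  then obtain y n where st: "reg_rounds K M fr R \<sigma> cL cS cC \<kappa> F G L Rg x0 \<Delta> i y n" by auto
  have "P i y \<and> real n \<le> real i * B"
    by (rule reg_rounds_inv[where P = P and B = B, OF st Suc_leD[OF Suc.prems] assms(2)]) (rule step; assumption)
  then have "P i y" ..
  then obtain y' k where "alg2 K M fr R \<sigma> cL (reg_fun K F x0 (\<Delta> / Rg\<^sup>2 / 2 ^ i)) (reg_grad K G x0 (\<Delta> / Rg\<^sup>2 / 2 ^ i))
        (L + cS * zeta_const K Rg * (\<Delta> / Rg\<^sup>2 / 2 ^ i)) (cC * delta_const K Rg * (\<Delta> / Rg\<^sup>2 / 2 ^ i)) Rg y (\<kappa> * \<Delta> / 2 ^ i) y' k"
    using ex[of i y] Suc.prems by auto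
  then show ?case using reg_rounds.round[OF st refl] by blast
qed

context space_form begin

text \<open>
  \<open>xm i\<close> is the minimizer of the \<open>i\<close>-th regularised function, \<open>D\<close> bounds its distance
  to every admissible starting point of round \<open>i\<close>.
\<close>

lemma reg_correct:
  fixes R' D r1 \<rho> \<sigma> cL cS cC \<kappa> L Rg \<Delta> \<epsilon> R0 H \<Theta> \<theta> \<Gamma> \<zeta> \<delta> \<Lambda> B :: real and xm :: "nat \<Rightarrow> 'a point"
    and F :: "'a point \<Rightarrow> real" and G :: "'a point \<Rightarrow> 'a point" and x0 xs :: "'a point" and M NN :: "'a point set"
    and mu :: "nat \<Rightarrow> real" and Fm :: "nat \<Rightarrow> 'a point \<Rightarrow> real" and Gm :: "nat \<Rightarrow> 'a point \<Rightarrow> 'a point"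
  defines "\<zeta> \<equiv> zeta_const K Rg" and "\<delta> \<equiv> delta_const K Rg" and "mu \<equiv> \<lambda>i. \<Delta> / Rg\<^sup>2 / 2 ^ i"
  defines "Fm \<equiv> \<lambda>i. reg_fun K F x0 (mu i)" and "Gm \<equiv> \<lambda>i. reg_grad K G x0 (mu i)"
  defines "NN \<equiv> rball K x0 R'"
  assumes x0: "x0 \<in> S" and NM: "NN \<subseteq> M" and R': "0 \<le> R'" "0 < K \<longrightarrow> R' < pi/2"
    and G: "\<And>p. p \<in> NN \<Longrightarrow> G p \<in> tangent K p" and sm: "smooth_on K F G L NN" and sc: "strongly_gconvex_on K F G 0 NN" and L: "0 < L"
    and Rg: "0 < Rg" and \<rho>: "0 < \<rho>" "min \<rho> Rg = r1" and D: "r1 \<le> D" "D \<le> Rg"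
    and r1: "0 < r1" "r1 \<le> 1" "0 < K \<Longrightarrow> r1 \<le> 1/2" and DK: "0 < K \<Longrightarrow> D + r1 < pi/2 \<and> 1 \<le> 2 * cos (D + r1)"
    and \<Delta>: "0 < \<Delta>" and \<epsilon>: "0 < \<epsilon>" and \<kappa>: "0 < \<kappa>" "\<kappa> \<le> 1/4"
    and cC: "0 < cC * \<delta>" "cC * \<delta> \<le> (if 0 < K then cos R' else 1)"
    and cS: "2 \<le> cS" "(if 0 < K then 1 else 1 + 3 * R') \<le> cS * \<zeta>"
    and xm: "\<And>i. xm i \<in> NN" "\<And>i q. q \<in> NN \<Longrightarrow> Fm i (xm i) \<le> Fm i q"
    and st0: "d x0 (xm 0) \<le> D" and stS: "\<And>i y. y \<in> NN \<Longrightarrow> Fm i y \<le> Fm i (xm i) + \<kappa> * \<Delta> / 2 ^ i \<Longrightarrow> d y (xm (Suc i)) < D"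
    and R0: "0 < R0" "R0 \<le> 2" and roomS: "\<And>i. 0 < K \<Longrightarrow> d x0 (xm i) + D + r1 + R0 \<le> R'"
    and roomH: "\<And>i. K = -1 \<Longrightarrow> d x0 (xm i) + D + r1 \<le> R' \<and> r1 < R'"
    and cL: "10000 * (4 / R0) \<le> cL" and \<zeta>1: "1 \<le> \<zeta>" "Rg + 1 \<le> 3 * \<zeta>" and H: "1 \<le> H" "1 / \<rho> \<le> H"
    and \<Theta>: "12 * cL \<le> \<Theta>" and \<theta>: "ln \<Theta> \<le> \<theta>" "ln H \<le> \<theta>"
    and \<Gamma>: "1 \<le> \<Gamma>" "cS / (cC * \<delta>) \<le> \<Gamma>" "cS / \<kappa> \<le> \<Gamma>"
    and xs: "xs \<in> NN" "d xs x0 \<le> Rg" "\<And>q. q \<in> NN \<Longrightarrow> F xs \<le> F q" and gap: "F x0 - F xs \<le> \<Delta>"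
  defines "\<Lambda> \<equiv> ln (2 + (\<zeta> + L * Rg\<^sup>2 / \<epsilon> + \<Delta> / \<epsilon>))"
  defines "B \<equiv> 4 * \<Lambda> * (80000 * H * sqrt \<Theta> * (1 + \<theta>) * (ln \<Gamma> + \<Lambda>) ^ 3 * (\<zeta> powr (3/2) * (sqrt (cS / (cC * \<delta>)) * sqrt (\<zeta> + L * Rg\<^sup>2 / \<epsilon>))))"
  shows "solves (reg_alg K M fr \<rho> 1 cL cS cC \<kappa> F G L Rg x0 \<Delta> \<epsilon>) M F xs \<epsilon> B"
proof -
  define x where "x = \<zeta> + L * Rg\<^sup>2 / \<epsilon> + \<Delta> / \<epsilon>"
  have xparts: "0 < L * Rg\<^sup>2 / \<epsilon>" "0 < \<Delta> / \<epsilon>" using L Rg \<epsilon> \<Delta> by auto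
  have x1: "1 \<le> x" using \<zeta>1 xparts by (simp add: x_def)
  have \<Lambda>x: "\<Lambda> = ln (2 + x)" by (simp add: \<Lambda>_def x_def add.assoc)
  have "exp (1::real) \<le> 2 + x" using e_less_272 x1 by simp
  then have \<Lambda>1: "1 \<le> \<Lambda>" unfolding \<Lambda>x using x1 by (simp add: ln_ge_iff)
  define J where "J = nat (\<lceil>log 2 (\<Delta> / \<epsilon>)\<rceil> + 1)"
  define b where "b = 80000 * H * sqrt \<Theta> * (1 + \<theta>) * (ln \<Gamma> + \<Lambda>) ^ 3 * (\<zeta> powr (3/2) * (sqrt (cS / (cC * \<delta>)) * sqrt (\<zeta> + L * Rg\<^sup>2 / \<epsilon>)))"
  have \<theta>0: "0 \<le> \<theta>" using \<theta>(2) H ln_ge_zero[of H] by linarith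
  have cL0: "0 < cL" using cL R0 by (smt (verit) divide_pos_pos)
  have "20000 \<le> 10000 * (4 / R0)" using R0 by (simp add: le_divide_eq)
  then have cL2: "20000 \<le> cL" using cL by linarith
  have \<Theta>1: "1 \<le> \<Theta>" using \<Theta> cL2 by linarith
  have ln\<Gamma>: "0 \<le> ln \<Gamma>" using \<Gamma> by simp
  have b0: "0 \<le> b" unfolding b_def using H \<Theta>1 \<theta>0 ln\<Gamma> \<Lambda>1 \<zeta>1 xparts cS cC
    by (intro mult_nonneg_nonneg zero_le_power real_sqrt_ge_zero) auto
  have mu_pos: "0 < mu i" for i using \<Delta> Rg by (simp add: mu_def)
  have cS0: "0 < cS * \<zeta>" using cS \<zeta>1 by simp
  \<comment> \<open>A round starts at \<open>x0\<close> or at the output of the previous round,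
    which is near-optimal for a function regularised twice as strongly; \<open>stS\<close> converts
    this into closeness to the new minimizer.\<close>
  define P where "P i y \<longleftrightarrow> y \<in> NN \<and> (i = 0 \<longrightarrow> y = x0) \<and> (0 < i \<longrightarrow> Fm (i - 1) y \<le> Fm (i - 1) (xm (i - 1)) + \<kappa> * \<Delta> / 2 ^ (i - 1))" for i y
  have round: "(\<exists>y' k. alg2 K M fr \<rho> 1 cL (Fm i) (Gm i) (L + cS * \<zeta> * mu i) (cC * \<delta> * mu i) Rg y (\<kappa> * \<Delta> / 2 ^ i) y' k) \<and>
     (\<forall>y' k. alg2 K M fr \<rho> 1 cL (Fm i) (Gm i) (L + cS * \<zeta> * mu i) (cC * \<delta> * mu i) Rg y (\<kappa> * \<Delta> / 2 ^ i) y' k \<longrightarrow>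
        P (Suc i) y' \<and> real k \<le> b)"
    if i: "i < J" and Py: "P i y" for i y
  proof -
    let ?L = "L + cS * \<zeta> * mu i" and ?\<mu> = "cC * \<delta> * mu i"
    have yN: "y \<in> NN" using Py by (simp add: P_def)
    have yS: "y \<in> S" using yN by (simp add: NN_def rball_def)
    have xmS: "xm j \<in> S" for j using xm(1)[of j] by (simp add: NN_def rball_def)
    have dy: "d y (xm i) \<le> D" and dy': "i = 0 \<and> y = x0 \<or> d y (xm i) < D"
    proof -
      show dd: "i = 0 \<and> y = x0 \<or> d y (xm i) < D"
        using Py stS[of y "i - 1"] by (cases i) (auto simp: P_def)
      then show "d y (xm i) \<le> D" using st0 by auto
    qed
    have smi: "smooth_on K (Fm i) (Gm i) ?L NN"
    proof (rule smooth_on_mono[OF _ _ order_refl])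
      show "smooth_on K (Fm i) (Gm i) (L + mu i * (if 0 < K then 1 else 1 + 3 * R')) NN"
        unfolding Fm_def Gm_def NN_def using reg_smooth[OF x0 R'(2) less_imp_le[OF mu_pos]] sm by (simp add: NN_def)
      show "L + mu i * (if 0 < K then 1 else 1 + 3 * R') \<le> ?L"
        using mult_left_mono[OF cS(2) less_imp_le[OF mu_pos[of i]]] by (simp add: mult.commute)
    qed
    have sci: "strongly_gconvex_on K (Fm i) (Gm i) ?\<mu> NN"
    proof (rule strongly_gconvex_on_mono[OF _ _ order_refl])
      show "strongly_gconvex_on K (Fm i) (Gm i) (mu i * (if 0 < K then cos R' else 1)) NN"
        unfolding Fm_def Gm_def NN_def using reg_convex[OF x0 R'(2) less_imp_le[OF mu_pos]] sc by (simp add: NN_def)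
      show "?\<mu> \<le> mu i * (if 0 < K then cos R' else 1)"
        using mult_left_mono[OF cC(2) less_imp_le[OF mu_pos[of i]]] by (simp add: mult.commute)
    qed
    have L': "0 < ?L" using L mult_pos_pos[OF cS0 mu_pos[of i]] by simp
    have \<mu>': "0 < ?\<mu>" using mult_pos_pos[OF cC(1) mu_pos[of i]] by simp
    have Gt: "Gm i p \<in> tangent K p" if "p \<in> NN" for p
      unfolding Gm_def by (rule reg_grad_tangent[OF x0]) (use that G in \<open>auto simp: NN_def rball_def\<close>)
    have NS: "NN \<subseteq> S" by (auto simp: NN_def rball_def)
    have Lt: "10000 * CG * ?L * (D + 1) \<le> cL * (?L * (Rg + 1))" if "10000 * CG \<le> cL" "0 < CG" for CG
    proof -
      have "10000 * CG * (?L * (D + 1)) \<le> cL * (?L * (Rg + 1))"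
        using that L' D r1 cL0 by (intro mult_mono mult_left_mono) auto
      then show ?thesis by (simp add: mult.assoc)
    qed
    have fromQ: "d x0 p \<le> d x0 (xm i) + D + r1" if "p \<in> S" "d y p \<le> r1 \<or> d p (xm i) < D + r1" for p
    proof -
      have "d p (xm i) \<le> D + r1" using that d_triangle[OF that(1) yS xmS[of i]] dy d_commute[of p y] by auto
      then show ?thesis using d_triangle[OF x0 xmS[of i] that(1)] d_commute[of p "xm i"] by linarith
    qed
    have "\<exists>CG. core K fr M NN (Fm i) (Gm i) ?L ?\<mu> D r1 CG (cL * (?L * (Rg + 1))) 1 (xm i) y"
    proof (cases "K = 1")
      case True
      have k: "0 < K" using True by simp
      have "core K fr M NN (Fm i) (Gm i) ?L ?\<mu> D r1 (4 / R0) (cL * (?L * (Rg + 1))) 1 (xm i) y"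
      proof (rule core_room[OF True NM NS Gt smi sci L' \<mu>' yS dy xmS xm(2) r1(1) D(1) r1(3)[OF k] _ _ _ _ R0])
        fix p assume p: "p \<in> S" "d y p \<le> r1 \<or> d p (xm i) < D + r1"
        show "rball K p R0 \<subseteq> NN"
        proof
          fix q assume "q \<in> rball K p R0"
          then have q: "q \<in> S" "d p q \<le> R0" by (auto simp: rball_def)
          have "d x0 q \<le> R'" using d_triangle[OF x0 p(1) q(1)] fromQ[OF p] roomS[OF k, of i] q(2) by linarith
          then show "q \<in> NN" using q by (simp add: NN_def rball_def)
        qed
      next
        show "10000 * (4 / R0) * ?L * (D + 1) \<le> cL * (?L * (Rg + 1))"
          by (rule Lt) (use cL R0 in auto)
      qed (use DK[OF k] in auto)
      then show ?thesis by blast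
    next
      case False
      then have K': "K = -1" using K by auto
      have "core K fr M NN (Fm i) (Gm i) ?L ?\<mu> D r1 2 (cL * (?L * (Rg + 1))) 1 (xm i) y"
        unfolding NN_def
      proof (rule core_hyp[OF K' _ x0 Gt[unfolded NN_def] smi[unfolded NN_def] sci[unfolded NN_def] L' \<mu>' yS dy xmS xm(2)[unfolded NN_def] r1(1) D(1) r1(2)])
        show "rball K x0 R' \<subseteq> M" using NM by (simp add: NN_def)
        show "20000 * ?L * (D + 1) \<le> cL * (?L * (Rg + 1))" using Lt[of 2] cL2 by simp
        fix p assume p: "p \<in> S" "d y p \<le> r1 \<or> d p (xm i) < D + r1"
        show "d p x0 < R'"
        proof (cases "i = 0 \<and> y = x0 \<and> d y p \<le> r1")
          case True
          then show ?thesis using roomH[OF K', of i] d_commute[of p x0] by auto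
        next
          case False
          have "d p (xm i) < D + r1"
          proof (cases "d p (xm i) < D + r1")
            case f: False
            then have "d y (xm i) < D" "d y p \<le> r1" using dy' False p by auto
            then show ?thesis using d_triangle[OF p(1) yS xmS[of i]] d_commute[of p y] by linarith
          qed
          then show ?thesis
            using d_triangle[OF p(1) xmS[of i] x0] roomH[OF K', of i] d_commute[of x0 "xm i"] by linarith
        qed
      qed
      then show ?thesis by blast
    qed
    then obtain CG where core: "core K fr M NN (Fm i) (Gm i) ?L ?\<mu> D r1 CG (cL * (?L * (Rg + 1))) 1 (xm i) y" by blast
    have ei: "0 < \<kappa> * \<Delta> / 2 ^ i" using \<kappa> \<Delta> by simp
    \<comment> \<open>Stopping after J rounds keeps the weight at least \<epsilon> / (2 Rg^2), so L
      divided by it is of order L Rg^2 / \<epsilon>.\<close>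
    have two_i: "2 ^ i \<le> 2 * (\<Delta> / \<epsilon>)"
    proof -
      have "real i < log 2 (\<Delta> / \<epsilon>) + 1" using i unfolding J_def by linarith
      then have "2 powr real i \<le> 2 powr (log 2 (\<Delta> / \<epsilon>) + 1)" by (intro powr_mono) auto
      also have "\<dots> = 2 * (\<Delta> / \<epsilon>)" using xparts by (simp add: powr_add)
      also have "2 powr real i = 2 ^ i" by (rule powr_realpow) simp
      finally show ?thesis .
    qed
    define y0 where "y0 = L * Rg\<^sup>2 / \<epsilon>"
    have Lm: "?L / mu i \<le> cS * (\<zeta> + y0)"
    proof -
      have "L / mu i = L * Rg\<^sup>2 / \<Delta> * 2 ^ i" using \<Delta> Rg by (simp add: mu_def field_simps)
      also have "\<dots> \<le> L * Rg\<^sup>2 / \<Delta> * (2 * (\<Delta> / \<epsilon>))" using two_i L Rg \<Delta> by (intro mult_left_mono) auto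
      also have "\<dots> = 2 * y0" using \<Delta> by (simp add: y0_def)
      also have "\<dots> \<le> cS * y0" using cS xparts by (intro mult_right_mono) (auto simp: y0_def)
      finally have "L / mu i \<le> cS * y0" .
      moreover have "?L / mu i = L / mu i + cS * \<zeta>" using mu_pos[of i] by (simp add: add_divide_distrib)
      ultimately show ?thesis by (simp add: algebra_simps)
    qed
    have y0: "0 < y0" using xparts by (simp add: y0_def)
    have kap: "?L / ?\<mu> \<le> cS / (cC * \<delta>) * (\<zeta> + y0)"
    proof -
      have "?L / ?\<mu> = ?L / mu i / (cC * \<delta>)" by (simp add: mult.commute)
      also have "\<dots> \<le> cS * (\<zeta> + y0) / (cC * \<delta>)" using Lm cC by (intro divide_right_mono) auto
      finally show ?thesis by simp
    qed
    have \<zeta>y: "\<zeta> + y0 \<le> x" using xparts by (simp add: x_def y0_def)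
    have X1: "\<zeta> \<le> \<Gamma> * x" using mult_mono[of 1 \<Gamma> \<zeta> x] \<Gamma> \<zeta>y y0 \<zeta>1 by simp
    have X2: "?L / ?\<mu> \<le> \<Gamma> * x"
    proof -
      have "cS / (cC * \<delta>) * (\<zeta> + y0) \<le> \<Gamma> * x" using \<Gamma> \<zeta>y y0 \<zeta>1 cS cC by (intro mult_mono) auto
      then show ?thesis using kap by linarith
    qed
    have X3: "?L * Rg\<^sup>2 / (\<kappa> * \<Delta> / 2 ^ i) \<le> \<Gamma> * x"
    proof -
      have "?L * Rg\<^sup>2 / (\<kappa> * \<Delta> / 2 ^ i) = (?L / mu i) / \<kappa>" using \<Delta> Rg \<kappa> by (simp add: mu_def field_simps)
      also have "\<dots> \<le> cS * (\<zeta> + y0) / \<kappa>" using Lm \<kappa> by (intro divide_right_mono) auto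
      also have "\<dots> = cS / \<kappa> * (\<zeta> + y0)" by simp
      also have "\<dots> \<le> \<Gamma> * x" using \<Gamma> \<zeta>y y0 \<zeta>1 cS \<kappa> by (intro mult_mono) auto
      finally show ?thesis .
    qed
    have \<Theta>': "12 * cL / 1 \<le> \<Theta>" using \<Theta> by simp
    note C = core.alg2_cost[OF core \<rho> D(2) ei refl cL0 \<zeta>1 H \<Theta>' \<Theta>1 \<theta> X1 X2 X3]
    have cost: "80000 * H * sqrt \<Theta> * (1 + \<theta>) * ln (2 + \<Gamma> * x) ^ 3 * (\<zeta> powr (3/2) * sqrt (?L / ?\<mu>)) \<le> b"
    proof -
      have "2 + \<Gamma> * x \<le> \<Gamma> * (2 + x)" using \<Gamma>(1) x1 by (simp add: algebra_simps)
      then have "ln (2 + \<Gamma> * x) \<le> ln (\<Gamma> * (2 + x))" using \<Gamma>(1) x1 by (subst ln_le_cancel_iff) (auto intro!: add_pos_nonneg)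
      also have "\<dots> = ln \<Gamma> + \<Lambda>" unfolding \<Lambda>x using \<Gamma>(1) x1 by (intro ln_mult_pos) auto
      finally have l: "ln (2 + \<Gamma> * x) \<le> ln \<Gamma> + \<Lambda>" .
      have l0: "0 \<le> ln (2 + \<Gamma> * x)" using \<Gamma>(1) x1 by (intro ln_ge_zero) (simp add: add_increasing2)
      have "sqrt (?L / ?\<mu>) \<le> sqrt (cS / (cC * \<delta>) * (\<zeta> + y0))" using kap by (rule real_sqrt_le_mono)
      then have s: "sqrt (?L / ?\<mu>) \<le> sqrt (cS / (cC * \<delta>)) * sqrt (\<zeta> + L * Rg\<^sup>2 / \<epsilon>)"
        unfolding y0_def by (simp only: real_sqrt_mult)
      show ?thesis unfolding b_def
        using l l0 s H \<Theta>1 \<theta>0 \<zeta>1 L' \<mu>'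
        by (intro mult_mono[OF mult_left_mono[OF power_mono] mult_left_mono] mult_nonneg_nonneg zero_le_power) auto
    qed
    have "P (Suc i) y' \<and> real k \<le> b"
      if "alg2 K M fr \<rho> 1 cL (Fm i) (Gm i) ?L ?\<mu> Rg y (\<kappa> * \<Delta> / 2 ^ i) y' k" for y' k
      using C(2)[OF that] cost by (auto simp: P_def)
    then show ?thesis using C(1) by blast
  qed
  have stepJ: "P (Suc i) y' \<and> real k \<le> b"
    if "i < J" "P i y" "alg2 K M fr \<rho> 1 cL (reg_fun K F x0 (\<Delta> / Rg\<^sup>2 / 2 ^ i)) (reg_grad K G x0 (\<Delta> / Rg\<^sup>2 / 2 ^ i))
        (L + cS * zeta_const K Rg * (\<Delta> / Rg\<^sup>2 / 2 ^ i)) (cC * delta_const K Rg * (\<Delta> / Rg\<^sup>2 / 2 ^ i)) Rg y (\<kappa> * \<Delta> / 2 ^ i) y' k" for i y y' k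
    using round[OF that(1,2)] that(3) unfolding Fm_def Gm_def mu_def \<zeta>_def \<delta>_def by blast
  have exJ: "\<exists>y' k. alg2 K M fr \<rho> 1 cL (reg_fun K F x0 (\<Delta> / Rg\<^sup>2 / 2 ^ i)) (reg_grad K G x0 (\<Delta> / Rg\<^sup>2 / 2 ^ i))
        (L + cS * zeta_const K Rg * (\<Delta> / Rg\<^sup>2 / 2 ^ i)) (cC * delta_const K Rg * (\<Delta> / Rg\<^sup>2 / 2 ^ i)) Rg y (\<kappa> * \<Delta> / 2 ^ i) y' k"
    if "i < J" "P i y" for i y
    using round[OF that(1,2)] unfolding Fm_def Gm_def mu_def \<zeta>_def \<delta>_def by blast
  have x0N: "x0 \<in> NN" using x0 R' by (simp add: NN_def rball_def)
  then have P0: "P 0 x0" by (simp add: P_def)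
  have run: "reg_alg K M fr \<rho> 1 cL cS cC \<kappa> F G L Rg x0 \<Delta> \<epsilon> out calls \<longleftrightarrow>
      reg_rounds K M fr \<rho> 1 cL cS cC \<kappa> F G L Rg x0 \<Delta> J out calls" for out calls
    by (simp add: reg_alg_def J_def)
  have JL: "real J \<le> 4 * \<Lambda>"
  proof (cases "\<Delta> / \<epsilon> \<le> 1")
    case True
    then have "log 2 (\<Delta> / \<epsilon>) \<le> 0" using xparts by simp
    then have "\<lceil>log 2 (\<Delta> / \<epsilon>)\<rceil> \<le> 0" by linarith
    then have "nat (\<lceil>log 2 (\<Delta> / \<epsilon>)\<rceil> + 1) \<le> nat 1" by (intro nat_mono) linarith
    then have "real J \<le> 1" unfolding J_def by simp
    then show ?thesis using \<Lambda>1 by linarith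
  next
    case False
    then have "log 2 (\<Delta> / \<epsilon>) \<le> 3/2 * ln (\<Delta> / \<epsilon>)" "0 \<le> log 2 (\<Delta> / \<epsilon>)" using log2_le by auto
    moreover have "ln (\<Delta> / \<epsilon>) \<le> \<Lambda>" unfolding \<Lambda>x using xparts x_def \<zeta>1 by simp
    ultimately have "log 2 (\<Delta> / \<epsilon>) \<le> 3/2 * \<Lambda>" "0 \<le> log 2 (\<Delta> / \<epsilon>)" by auto
    moreover have "real J \<le> log 2 (\<Delta> / \<epsilon>) + 2" using \<open>0 \<le> log 2 (\<Delta> / \<epsilon>)\<close> unfolding J_def by linarith
    ultimately show ?thesis using \<Lambda>1 by linarith
  qed
  have final: "out \<in> M \<and> F out - F xs \<le> \<epsilon> \<and> real calls \<le> B"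
    if r: "reg_rounds K M fr \<rho> 1 cL cS cC \<kappa> F G L Rg x0 \<Delta> J out calls" for out calls
  proof -
    have "P J out \<and> real calls \<le> real J * b"
      by (rule reg_rounds_inv[where P = P and B = b, OF r order_refl P0]) (rule stepJ; assumption)
    then have I: "P J out" "real calls \<le> real J * b" by auto
    have oN: "out \<in> NN" using I by (simp add: P_def)
    have "real J * b \<le> 4 * \<Lambda> * b" using JL b0 by (rule mult_right_mono)
    then have "real calls \<le> B" using I(2) unfolding B_def b_def by linarith
    moreover have "F out - F xs \<le> \<epsilon>"
    proof (cases "J = 0")
      case True
      then have "\<lceil>log 2 (\<Delta> / \<epsilon>)\<rceil> + 1 \<le> 0" unfolding J_def by simp
      then have "log 2 (\<Delta> / \<epsilon>) \<le> 0" by linarith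
      then have "\<Delta> / \<epsilon> \<le> 1" using xparts by simp
      then have "\<Delta> \<le> \<epsilon>" using \<epsilon> by simp
      moreover have "out = x0" using I True by (simp add: P_def)
      ultimately show ?thesis using gap by simp
    next
      case False
      define i where "i = J - 1"
      have J: "J = Suc i" using False by (simp add: i_def)
      have Fo: "Fm i out \<le> Fm i (xm i) + \<kappa> * \<Delta> / 2 ^ i" using I(1) J by (simp add: P_def)
      have "log 2 (\<Delta> / \<epsilon>) \<le> real i" using J unfolding J_def by linarith
      then have "2 powr (log 2 (\<Delta> / \<epsilon>)) \<le> 2 powr (real i)" by (intro powr_mono) auto
      also have "\<dots> = 2 ^ i" by (rule powr_realpow) simp
      finally have "\<Delta> / \<epsilon> \<le> 2 ^ i" using xparts by simp
      then have \<Delta>i: "\<Delta> / 2 ^ i \<le> \<epsilon>" using \<epsilon> by (simp add: field_simps)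
      have "\<kappa> * (\<Delta> / 2 ^ i) \<le> 1/4 * \<epsilon>" using \<kappa> \<Delta>i \<Delta> by (intro mult_mono) auto
      then have k: "\<kappa> * \<Delta> / 2 ^ i \<le> \<epsilon> / 4" by simp
      \<comment> \<open>The final error is at most \<epsilon> / 4 from the accuracy of the last
        round plus \<epsilon> / 2 from the regulariser at \<open>xs\<close>, whose last weight is at
        most \<epsilon> / Rg^2.\<close>
      have "0 \<le> mu i / 2 * (d out x0)\<^sup>2" using mu_pos[of i] by simp
      then have "F out \<le> Fm i out" by (simp add: Fm_def reg_fun_def)
      moreover have "Fm i (xm i) \<le> Fm i xs" by (rule xm(2)[OF xs(1)])
      moreover have "Fm i xs \<le> F xs + mu i / 2 * Rg\<^sup>2"
      proof -
        have "xs \<in> S" using xs(1) by (simp add: NN_def rball_def)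
        then have "(d xs x0)\<^sup>2 \<le> Rg\<^sup>2" using xs(2) d_nonneg[OF _ x0] by (intro power_mono) auto
        then have "mu i / 2 * (d xs x0)\<^sup>2 \<le> mu i / 2 * Rg\<^sup>2" using mu_pos[of i] by (intro mult_left_mono) auto
        then show ?thesis by (simp add: Fm_def reg_fun_def)
      qed
      moreover have "mu i / 2 * Rg\<^sup>2 \<le> \<epsilon> / 2"
      proof -
        have "mu i / 2 * Rg\<^sup>2 = (\<Delta> / 2 ^ i) / 2" using Rg by (simp add: mu_def)
        also have "\<dots> \<le> \<epsilon> / 2" using \<Delta>i by (rule divide_right_mono) simp
        finally show ?thesis .
      qed
      ultimately have "F out \<le> F xs + \<epsilon> / 2 + \<epsilon> / 4" using Fo k by linarith
      then show ?thesis using \<epsilon> by simp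
    qed
    ultimately show ?thesis using oN NM by blast
  qed
  have "\<exists>out calls. reg_rounds K M fr \<rho> 1 cL cS cC \<kappa> F G L Rg x0 \<Delta> J out calls"
    by (rule reg_rounds_exists[where P = P and B = b, OF order_refl P0]) (rule stepJ exJ; assumption)+
  then show ?thesis unfolding solves_def run using final by blast
qed

end

section \<open>Elementary bounds and the absorption of constants\<close>

lemma solves_mono: "solves run M F x \<epsilon> B \<Longrightarrow> B \<le> B' \<Longrightarrow> solves run M F x \<epsilon> B'"
  unfolding solves_def by (meson order_trans)

lemma zeta_const_bounds:
  assumes "K = 1 \<or> K = -1" "0 < Rg" "0 < K \<Longrightarrow> Rg < pi/2"
  shows "1 \<le> zeta_const K Rg" "Rg + 1 \<le> 3 * zeta_const K Rg" "K = -1 \<Longrightarrow> Rg \<le> zeta_const K Rg"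
proof -
  have *: "1 \<le> zeta_const K Rg \<and> Rg \<le> zeta_const K Rg" if k: "K = -1"
  proof
    have s: "0 < sinh Rg" using assms by simp
    have z: "zeta_const K Rg = Rg * cosh Rg / sinh Rg" using k by (simp add: zeta_const_def)
    show "1 \<le> zeta_const K Rg" unfolding z using sinh_le_mult_cosh[of Rg] assms s by (simp add: le_divide_eq)
    have "sinh Rg \<le> cosh Rg" using sinh_le_cosh_real[of Rg] .
    then have "Rg * sinh Rg \<le> Rg * cosh Rg" using assms by (intro mult_left_mono) auto
    then show "Rg \<le> zeta_const K Rg" unfolding z using s by (simp add: le_divide_eq)
  qed
  then show "K = -1 \<Longrightarrow> Rg \<le> zeta_const K Rg" by blast
  show "1 \<le> zeta_const K Rg" using * assms(1) by (auto simp: zeta_const_def)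
  show "Rg + 1 \<le> 3 * zeta_const K Rg"
  proof (cases "K = 1")
    case True
    then have "Rg < 2" using assms(3) pi_less_4 by simp
    then show ?thesis using True by (simp add: zeta_const_def)
  next
    case False
    then show ?thesis using * assms(1) by linarith
  qed
qed

lemma delta_const_bounds:
  assumes "K = 1" "0 < Rg" "Rg < pi/2"
  shows "cos Rg \<le> delta_const K Rg" "delta_const K Rg \<le> 1"
proof -
  have s: "0 < sin Rg" using assms by (intro sin_gt_zero) auto
  have c: "0 < cos Rg" using assms by (intro cos_gt_zero) auto
  have d: "delta_const K Rg = Rg * cos Rg / sin Rg" using assms by (simp add: delta_const_def cot_def)
  have "sin Rg \<le> Rg" using assms by (simp add: sin_x_le_x)
  then have "cos Rg * sin Rg \<le> Rg * cos Rg" using c by (simp add: mult.commute)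
  then show "cos Rg \<le> delta_const K Rg" unfolding d using s by (simp add: le_divide_eq)
  show "delta_const K Rg \<le> 1" unfolding d using mult_cos_le_sin[of Rg] assms s by (simp add: divide_le_eq)
qed

lemma sin_half_ge: assumes "0 < R" "R < pi/2" shows "R / 4 \<le> sin (R / 2)"
proof -
  have "cos (pi/3) \<le> cos (R/2)" using assms by (intro cos_monotone_0_pi_le) auto
  then have "1/2 \<le> cos (R/2)" by (simp add: cos_60)
  then have "R/2 * (1/2) \<le> R/2 * cos (R/2)" using assms by (intro mult_left_mono) auto
  also have "\<dots> \<le> sin (R/2)" using assms by (intro mult_cos_le_sin) auto
  finally show ?thesis by simp
qed

text \<open>The angles occurring for general R are at most pi/2 - R/2; this bound, linear in R, is
  the origin of the powers of 1 + 1/R in the rates.\<close>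

lemma cos_complement_ge: assumes "0 < R" "R < pi/2" "0 \<le> t" "t \<le> pi/2 - R/2" shows "R / 4 \<le> cos t"
proof -
  have "sin (R/2) \<le> sin (pi/2 - t)" using assms by (intro sin_monotone_2pi_le) auto
  then show ?thesis using sin_half_ge[OF assms(1,2)] by (simp add: sin_diff)
qed

text \<open>u stands for 1 or 1 + 1/R and carries the dependence on the radius. H, q and 1 +
  \<theta> are each linear in u, so u^3 arises, and the numerical factor is far below 10^30. The
  same crude exponents serve all four statements.\<close>

lemma accelerated_bound:
  fixes u \<Lambda> H q \<theta> Y :: real
  assumes u: "1 \<le> u" and \<Lambda>: "1 \<le> \<Lambda>" and Y: "0 \<le> Y" and H: "0 \<le> H" "H \<le> 8 * u" and q: "0 \<le> q" "q \<le> 2400000 * u"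
    and \<theta>: "0 \<le> 1 + \<theta>" "1 + \<theta> \<le> 18 * u"
  shows "80000 * H * q * (1 + \<theta>) * \<Lambda> ^ 3 * Y \<le> u ^ 10 * (10 ^ 30 * \<Lambda> ^ 10) * Y"
proof -
  have "80000 * H * q * (1 + \<theta>) \<le> 80000 * (8 * u) * (2400000 * u) * (18 * u)"
    using assms by (intro mult_mono mult_nonneg_nonneg) auto
  also have "\<dots> = 27648000000000 * u ^ 3" by (simp add: power3_eq_cube)
  also have "\<dots> \<le> 10 ^ 30 * u ^ 10" using u by (intro mult_mono power_increasing) auto
  finally have a: "80000 * H * q * (1 + \<theta>) \<le> 10 ^ 30 * u ^ 10" .
  have "80000 * H * q * (1 + \<theta>) * \<Lambda> ^ 3 * Y \<le> 10 ^ 30 * u ^ 10 * \<Lambda> ^ 10 * Y"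
    using a \<Lambda> u Y by (intro mult_right_mono[OF mult_mono[OF a power_increasing]]) auto
  then show ?thesis by (simp add: mult_ac)
qed

text \<open>Beyond \<open>accelerated_bound\<close> there are 4 \<Lambda> rounds, the shift l inside
  the cubed logarithm, worth three more powers of u, and the square root g, worth one: u^7
  \<Lambda>^4 in total.\<close>

lemma regularised_bound:
  fixes u \<Lambda> H q \<theta> Z W g l \<delta>' :: real
  assumes u: "1 \<le> u" and \<Lambda>: "1 \<le> \<Lambda>" and Z: "0 \<le> Z" and W: "0 \<le> W" and H: "0 \<le> H" "H \<le> 8 * u" and q: "0 \<le> q" "q \<le> 2400000 * u"
    and \<theta>: "0 \<le> 1 + \<theta>" "1 + \<theta> \<le> 18 * u" and l: "0 \<le> l" "l \<le> 17 * u" and g: "0 \<le> g" "g \<le> 7 * u * \<delta>'" and \<delta>': "0 \<le> \<delta>'"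
  shows "4 * \<Lambda> * (80000 * H * q * (1 + \<theta>) * (l + \<Lambda>) ^ 3 * (Z * (g * W))) \<le> u ^ 10 * (10 ^ 30 * \<Lambda> ^ 10) * (Z * \<delta>' * W)"
proof -
  have "17 * u * 1 \<le> 17 * u * \<Lambda>" "1 * \<Lambda> \<le> u * \<Lambda>" using u \<Lambda> by (intro mult_left_mono mult_right_mono; simp)+
  then have l': "l + \<Lambda> \<le> 18 * u * \<Lambda>" using l by linarith
  have "4 * \<Lambda> * (80000 * H * q * (1 + \<theta>) * (l + \<Lambda>) ^ 3 * (Z * (g * W))) \<le>
     4 * \<Lambda> * (80000 * (8 * u) * (2400000 * u) * (18 * u) * (18 * u * \<Lambda>) ^ 3 * (Z * ((7 * u * \<delta>') * W)))"
    using assms l' by (intro mult_left_mono[of _ _ "4 * \<Lambda>"] mult_mono mult_nonneg_nonneg power_mono) auto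
  also have "\<dots> = 4514807808000000000 * u ^ 7 * \<Lambda> ^ 4 * (Z * \<delta>' * W)"
    by (simp add: power_mult_distrib eval_nat_numeral)
  also have "\<dots> \<le> 10 ^ 30 * u ^ 10 * \<Lambda> ^ 10 * (Z * \<delta>' * W)"
    using assms by (intro mult_right_mono mult_mono power_increasing mult_nonneg_nonneg) auto
  finally show ?thesis by (simp add: mult_ac)
qed

lemma ln_bound_2_7: "0 < x \<Longrightarrow> x \<le> (27/10::real) ^ n \<Longrightarrow> ln x \<le> real n"
  using exp_nat_ge[of n] by (metis exp_gt_zero ln_exp ln_le_cancel_iff order_trans)

context core begin

lemma alg2_solves:
  fixes \<rho> \<epsilon> Rg cL H \<theta> u \<zeta> X :: real
  assumes \<rho>: "0 < \<rho>" "min \<rho> Rg = r1" and Rg: "D \<le> Rg" and \<epsilon>: "0 < \<epsilon>" and cL: "Lt = cL * (L * (Rg + 1))" "0 < cL"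
    and \<zeta>: "1 \<le> \<zeta>" "Rg + 1 \<le> 3 * \<zeta>" and H: "1 \<le> H" "1 / \<rho> \<le> H" and \<Theta>: "1 \<le> 12 * cL / \<sigma>"
    and \<theta>: "ln (12 * cL / \<sigma>) \<le> \<theta>" "ln H \<le> \<theta>"
    and u: "1 \<le> u" "H \<le> 8 * u" "sqrt (12 * cL / \<sigma>) \<le> 2400000 * u" "1 + \<theta> \<le> 18 * u"
  defines "X \<equiv> \<zeta> + L / \<mu> + L * Rg\<^sup>2 / \<epsilon>"
  shows "solves (alg2 K M fr \<rho> \<sigma> cL F G L \<mu> Rg s \<epsilon>) M F xs \<epsilon> (u ^ 10 * hidden X * (\<zeta> powr (3/2) * sqrt (L / \<mu>)))"
proof -
  have p: "0 \<le> L / \<mu>" "0 \<le> L * Rg\<^sup>2 / \<epsilon>" using L \<mu> \<epsilon> by auto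
  have X: "\<zeta> \<le> X" "L / \<mu> \<le> X" "L * Rg\<^sup>2 / \<epsilon> \<le> X" using p \<zeta> by (auto simp: X_def)
  have "exp (1::real) \<le> 2 + X" using e_less_272 X \<zeta> by simp
  then have \<Lambda>: "1 \<le> ln (2 + X)" using X \<zeta> by (simp add: ln_ge_iff)
  have \<theta>0: "0 \<le> \<theta>" using \<theta>(2) H ln_ge_zero[of H] by linarith
  note C = alg2_cost[OF \<rho> Rg \<epsilon> cL \<zeta> H order_refl \<Theta> \<theta> X]
  have "80000 * H * sqrt (12 * cL / \<sigma>) * (1 + \<theta>) * ln (2 + X) ^ 3 * (\<zeta> powr (3/2) * sqrt (L / \<mu>))
      \<le> u ^ 10 * (10 ^ 30 * ln (2 + X) ^ 10) * (\<zeta> powr (3/2) * sqrt (L / \<mu>))"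
    by (rule accelerated_bound) (use u \<Lambda> p H \<theta>0 \<Theta> in auto)
  then have le: "80000 * H * sqrt (12 * cL / \<sigma>) * (1 + \<theta>) * ln (2 + X) ^ 3 * (\<zeta> powr (3/2) * sqrt (L / \<mu>))
      \<le> u ^ 10 * hidden X * (\<zeta> powr (3/2) * sqrt (L / \<mu>))" unfolding hidden_def .
  show ?thesis unfolding solves_def using C(1) C(2) le N(1) by (smt (verit, best) subsetD)
qed

end

section \<open>Radii and constants for unit and for smaller balls\<close>

context space_form begin

lemma settingD:
  assumes "setting K M fr F G x0 xs Rg N"
  shows "M \<subseteq> S" "x0 \<in> S" "xs \<in> S" "N \<subseteq> M" "\<And>p. p \<in> M \<Longrightarrow> G p \<in> tangent K p" "\<And>p. p \<in> M \<Longrightarrow> F xs \<le> F p"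
    "0 < Rg" "d x0 xs \<le> Rg"
  using assms unfolding setting_def twice_differentiable_def has_rgrad_def by auto

lemma rball_sub:
  assumes "p \<in> S" "q \<in> S" "d q p + r \<le> r'" shows "rball K p r \<subseteq> rball K q r'"
proof
  fix z assume z: "z \<in> rball K p r"
  then show "z \<in> rball K q r'" using d_triangle[OF assms(2,1), of z] assms(3) by (simp add: rball_def)
qed

text \<open>On the sphere 2 Rg + 1 < pi/2 forces Rg < 2/7. Hence r1 = Rg, queries reach at most 3 Rg
  from x0 and keep room 1/2, and Rg + r1 < pi/3 allows \<sigma> = 1. The constant 200000 dominates
  both 10000 * 8 for the sphere and 20000 for hyperbolic space.\<close>

lemma boost_unit_ball:
  assumes st: "setting K M fr F G x0 xs Rg (exp_ball K x0 (2 * Rg + 1))" and k: "0 < K \<Longrightarrow> 2 * Rg + 1 < pi / 2"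
    and L: "0 < L" and \<mu>: "0 < \<mu>" and \<epsilon>: "0 < \<epsilon>"
    and sm: "smooth_on K F G L (exp_ball K x0 (2 * Rg + 1))"
    and sc: "strongly_gconvex_on K F G \<mu> (exp_ball K x0 (2 * Rg + 1))"
  shows "solves (alg2 K M fr 1 1 200000 F G L \<mu> Rg x0 \<epsilon>) M F xs \<epsilon>
     (hidden (zeta_const K Rg + L / \<mu> + L * Rg\<^sup>2 / \<epsilon>) * (zeta_const K Rg powr (3 / 2) * sqrt (L / \<mu>)))"
proof -
  note s = settingD[OF st]
  define N where "N = rball K x0 (2 * Rg + 1)"
  have eN: "exp_ball K x0 (2 * Rg + 1) = N" unfolding N_def by (rule exp_ball_eq[OF s(2)]) (use k pi_gt3 in linarith)
  note s = s[unfolded eN] and sm = sm[unfolded eN] and sc = sc[unfolded eN]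
  have NS: "N \<subseteq> S" by (auto simp: N_def rball_def)
  have G: "G p \<in> tangent K p" if "p \<in> N" for p using s(4,5) that by blast
  have mn: "F xs \<le> F p" if "p \<in> N" for p using s(4,6) that by blast
  define r1 where "r1 = min 1 Rg"
  have r1: "0 < r1" "r1 \<le> Rg" "r1 \<le> 1" using s(7) by (auto simp: r1_def)
  have reach: "d x0 p < 2 * Rg + r1" if "p \<in> S" "d x0 p \<le> r1 \<or> d p xs < Rg + r1" for p
    using that d_triangle[OF s(2,3) that(1)] d_commute[of p xs] s(7,8) by auto
  have "\<exists>CG. core K fr M N F G L \<mu> Rg r1 CG (200000 * (L * (Rg + 1))) 1 xs x0"
  proof (cases "K = 1")
    case True
    then have k: "2 * Rg + 1 < pi / 2" using k by simp
    have Rg: "Rg < 2/7" using k pi_approx by simp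
    have "cos (pi/3) \<le> cos (Rg + r1)" using r1 Rg pi_gt3 by (intro cos_monotone_0_pi_le) auto
    then have c: "1 \<le> 2 * cos (Rg + r1)" by (simp add: cos_60)
    have "core K fr M N F G L \<mu> Rg r1 (4 / (1/2)) (200000 * (L * (Rg + 1))) 1 xs x0"
    proof (rule core_room[OF True s(4) NS G sm sc L \<mu> s(2,8,3) mn r1(1,2)])
      fix p assume p: "p \<in> S" "d x0 p \<le> r1 \<or> d p xs < Rg + r1"
      show "rball K p (1/2) \<subseteq> N" unfolding N_def
        by (rule rball_sub[OF p(1) s(2)]) (use reach[OF p] r1 Rg in linarith)
    next
      show "10000 * (4 / (1/2)) * L * (Rg + 1) \<le> 200000 * (L * (Rg + 1))" using L s(7) by simp
    qed (use r1 Rg c k in auto)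
    then show ?thesis by blast
  next
    case False
    then have K': "K = -1" using K by auto
    have "core K fr M N F G L \<mu> Rg r1 2 (200000 * (L * (Rg + 1))) 1 xs x0" unfolding N_def
    proof (rule core_hyp[OF K' _ s(2) G[unfolded N_def] sm[unfolded N_def] sc[unfolded N_def] L \<mu> s(2,8,3) mn[unfolded N_def] r1])
      fix p assume p: "p \<in> S" "d x0 p \<le> r1 \<or> d p xs < Rg + r1"
      show "d p x0 < 2 * Rg + 1" using reach[OF p] r1 d_commute[of p x0] by linarith
    next
      show "20000 * L * (Rg + 1) \<le> 200000 * (L * (Rg + 1))" using L s(7) by simp
    qed (use s(4) in \<open>auto simp: N_def\<close>)
    then show ?thesis by blast
  qed
  then obtain CG where c: "core K fr M N F G L \<mu> Rg r1 CG (200000 * (L * (Rg + 1))) 1 xs x0" by blast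
  have "Rg < pi/2" if "0 < K" using k[OF that] s(7) by simp
  then have \<zeta>: "1 \<le> zeta_const K Rg" "Rg + 1 \<le> 3 * zeta_const K Rg" using zeta_const_bounds(1,2)[OF K s(7)] by auto
  have "ln 2400000 \<le> real 15" by (rule ln_bound_2_7) (simp_all add: power_divide)
  then have l: "ln 2400000 \<le> (15::real)" by simp
  have q: "sqrt 2400000 \<le> (2400000::real)" by (intro real_le_lsqrt) auto
  have "solves (alg2 K M fr 1 1 200000 F G L \<mu> Rg x0 \<epsilon>) M F xs \<epsilon>
     (1 ^ 10 * hidden (zeta_const K Rg + L / \<mu> + L * Rg\<^sup>2 / \<epsilon>) * (zeta_const K Rg powr (3 / 2) * sqrt (L / \<mu>)))"
    by (rule core.alg2_solves[OF c _ _ order_refl \<epsilon> refl _ \<zeta>, where H = 1 and \<theta> = 15]) (use l q in \<open>auto simp: r1_def\<close>)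
  then show ?thesis by simp
qed

text \<open>Queries lie within 2 Rg + R/8 of x0 and within Rg + R/8 of xs, so room R/2 remains in
  both balls defining N; 80000 / R is 10000 * 4 / (R/2). Close to a quarter circle cos (Rg + r1) is
  only known to be at least R/4, hence the reduced accuracy factor \<sigma>.\<close>

lemma boost_small_balls:
  fixes R c :: real
  assumes K': "K = 1" and c: "1 < c" and R: "0 < R" "c * Rg + R < pi / 2"
    and N: "N = exp_ball 1 x0 (2 * Rg + R) \<inter> rball 1 xs (c * Rg + R)"
    and st: "setting 1 M fr F G x0 xs Rg N"
    and L: "0 < L" and \<mu>: "0 < \<mu>" and \<epsilon>: "0 < \<epsilon>" and sm: "smooth_on 1 F G L N" and sc: "strongly_gconvex_on 1 F G \<mu> N"
  shows "solves (alg2 1 M fr (R / 8) (min 1 (R / 4)) (80000 / R) F G L \<mu> Rg x0 \<epsilon>) M F xs \<epsilon>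
     ((1 + 1 / R) ^ 10 * hidden (zeta_const 1 Rg + L / \<mu> + L * Rg\<^sup>2 / \<epsilon>) * (zeta_const 1 Rg powr (3 / 2) * sqrt (L / \<mu>)))"
proof -
  note s = settingD[OF st[folded K']] and sm = sm[folded K'] and sc = sc[folded K']
  have "1 * Rg \<le> c * Rg" using c s(7) by (intro mult_right_mono) auto
  then have cRg: "Rg \<le> c * Rg" by simp
  have RR: "Rg + R < pi/2" "R < pi/2" using cRg R s(7) by linarith+
  then have R16: "R < 8/5" using pi_approx by simp
  have eN: "N = rball K x0 (2 * Rg + R) \<inter> rball K xs (c * Rg + R)"
    using exp_ball_eq[OF s(2), of "2 * Rg + R"] RR R N K' by simp
  have NS: "N \<subseteq> S" by (auto simp: eN rball_def)
  have G: "G p \<in> tangent K p" if "p \<in> N" for p using s(4,5) that by blast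
  have mn: "F xs \<le> F p" if "p \<in> N" for p using s(4,6) that by blast
  define r1 where "r1 = min (R / 8) Rg"
  have r1: "0 < r1" "r1 \<le> Rg" "r1 \<le> R / 8" using s(7) R by (auto simp: r1_def)
  \<comment> \<open>The minimum secures \<sigma> \<le> 1 for large R, where no admissible Rg
    exists.\<close>
  have sg: "min 1 (R / 4) = R / 4" using R16 by simp
  have cs: "R / 4 \<le> cos (Rg + r1)" by (rule cos_complement_ge) (use R RR r1 s(7) in auto)
  have core: "core K fr M N F G L \<mu> Rg r1 (4 / (R / 2)) (80000 / R * (L * (Rg + 1))) (R / 4) xs x0"
  proof (rule core_room[OF K' s(4) NS G sm sc L \<mu> s(2,8,3) mn r1(1,2)])
    fix p assume p: "p \<in> S" "d x0 p \<le> r1 \<or> d p xs < Rg + r1"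
    have "d x0 p \<le> 2 * Rg + r1" using p d_triangle[OF s(2,3) p(1)] d_commute[of p xs] s(7,8) by auto
    moreover have "d xs p \<le> Rg + r1"
      using p d_triangle[OF s(3,2) p(1)] d_commute[of p xs] d_commute[of x0 xs] s(8) by auto
    moreover have "d xs p + R / 2 \<le> c * Rg + R" if "d xs p \<le> Rg + r1" using that r1 R(1) cRg by linarith
    ultimately show "rball K p (R / 2) \<subseteq> N" unfolding eN
      using rball_sub[OF p(1) s(2), of "R/2" "2 * Rg + R"] rball_sub[OF p(1) s(3), of "R/2" "c * Rg + R"] r1 R(1) by simp
  next
    show "10000 * (4 / (R / 2)) * L * (Rg + 1) \<le> 80000 / R * (L * (Rg + 1))" by simp
  qed (use r1 R16 cs RR R in auto)
  define v where "v = 1 / R"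
  have v: "1/2 \<le> v" using R R16 by (simp add: v_def le_divide_eq)
  have \<Theta>: "12 * (80000 / R) / (R / 4) = 3840000 * v\<^sup>2" using R by (simp add: v_def power2_eq_square)
  have v2: "(1/2)\<^sup>2 \<le> v\<^sup>2" using v by (intro power_mono) auto
  have lv: "ln v \<le> v" using ln_le_minus_one[of v] v by linarith
  have "ln 3840000 \<le> real 16" "ln 8 \<le> real 3" by (rule ln_bound_2_7; simp add: power_divide)+
  then have l16: "ln 3840000 \<le> (16::real)" "ln 8 \<le> (3::real)" by simp_all
  have "ln (3840000 * v\<^sup>2) = ln 3840000 + (ln v + ln v)" using v by (simp add: power2_eq_square ln_mult)
  then have l1: "ln (3840000 * v\<^sup>2) \<le> 16 + 2 * v" using l16 lv by linarith
  have "ln (8 * v) = ln 8 + ln v" using v by (simp add: ln_mult)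
  then have l2: "ln (8 * v) \<le> 16 + 2 * v" using l16 lv v by linarith
  have "3840000 * v\<^sup>2 \<le> (2400000 * (1 + v))\<^sup>2"
  proof -
    have "3840000 * v\<^sup>2 \<le> 2400000\<^sup>2 * (1 + v)\<^sup>2" using v by (intro mult_mono power_mono) auto
    then show ?thesis by (simp only: power_mult_distrib)
  qed
  then have q: "sqrt (3840000 * v\<^sup>2) \<le> 2400000 * (1 + v)" using v by (intro real_le_lsqrt) auto
  have \<zeta>: "1 \<le> zeta_const K Rg" "Rg + 1 \<le> 3 * zeta_const K Rg" using zeta_const_bounds(1,2)[OF K s(7)] RR R by auto
  have "solves (alg2 K M fr (R / 8) (R / 4) (80000 / R) F G L \<mu> Rg x0 \<epsilon>) M F xs \<epsilon>
     ((1 + v) ^ 10 * hidden (zeta_const K Rg + L / \<mu> + L * Rg\<^sup>2 / \<epsilon>) * (zeta_const K Rg powr (3 / 2) * sqrt (L / \<mu>)))"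
  proof (rule core.alg2_solves[OF core _ _ order_refl \<epsilon> refl _ \<zeta>, where H = "8 * v" and \<theta> = "16 + 2 * v"], unfold \<Theta>)
    show "1 / (R / 8) \<le> 8 * v" by (simp add: v_def)
    show "1 \<le> 3840000 * v\<^sup>2" using v2 by (simp add: power2_eq_square)
  qed (use R v l1 l2 q in \<open>auto simp: r1_def\<close>)
  then show ?thesis unfolding sg v_def K' .
qed

text \<open>The minimizer \<open>xs'\<close> in the conclusion is separate from \<open>xs\<close>
  because in the degenerate spherical case the argument runs with x0 as minimizer, of the same value
  as the given one. u collects the dependence on the radius.\<close>

lemma reg_solves:
  fixes R' D r1 \<rho> cL cS cC \<kappa> L Rg \<Delta> \<epsilon> R0 H \<theta> \<Gamma> u :: real and xm :: "nat \<Rightarrow> 'a point"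
    and F :: "'a point \<Rightarrow> real" and G :: "'a point \<Rightarrow> 'a point" and x0 xs xs' :: "'a point" and M NN :: "'a point set"
  defines "NN \<equiv> rball K x0 R'"
  assumes x0: "x0 \<in> S" and NM: "NN \<subseteq> M" and R': "0 \<le> R'" "0 < K \<longrightarrow> R' < pi/2"
    and G: "\<And>p. p \<in> NN \<Longrightarrow> G p \<in> tangent K p" and sm: "smooth_on K F G L NN" and sc: "strongly_gconvex_on K F G 0 NN" and L: "0 < L"
    and Rg: "0 < Rg" "0 < K \<Longrightarrow> Rg < pi/2" and \<rho>: "0 < \<rho>" "min \<rho> Rg = r1" and D: "r1 \<le> D" "D \<le> Rg"
    and r1: "0 < r1" "r1 \<le> 1" "0 < K \<Longrightarrow> r1 \<le> 1/2" and DK: "0 < K \<Longrightarrow> D + r1 < pi/2 \<and> 1 \<le> 2 * cos (D + r1)"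
    and \<Delta>: "0 < \<Delta>" and \<epsilon>: "0 < \<epsilon>" and \<kappa>: "0 < \<kappa>" "\<kappa> \<le> 1/4"
    and cC: "0 < cC" "cC \<le> (if 0 < K then cos R' else 1)"
    and cS: "2 \<le> cS" "(if 0 < K then 1 else 1 + 3 * R') \<le> cS * zeta_const K Rg"
    and xm: "\<And>i. xm i \<in> NN" "\<And>i q. q \<in> NN \<Longrightarrow> reg_fun K F x0 (\<Delta> / Rg\<^sup>2 / 2 ^ i) (xm i) \<le> reg_fun K F x0 (\<Delta> / Rg\<^sup>2 / 2 ^ i) q"
    and st0: "d x0 (xm 0) \<le> D"
    and stS: "\<And>i y. y \<in> NN \<Longrightarrow> reg_fun K F x0 (\<Delta> / Rg\<^sup>2 / 2 ^ i) y \<le> reg_fun K F x0 (\<Delta> / Rg\<^sup>2 / 2 ^ i) (xm i) + \<kappa> * \<Delta> / 2 ^ i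
        \<Longrightarrow> d y (xm (Suc i)) < D"
    and R0: "0 < R0" "R0 \<le> 2" and roomS: "\<And>i. 0 < K \<Longrightarrow> d x0 (xm i) + D + r1 + R0 \<le> R'"
    and roomH: "\<And>i. K = -1 \<Longrightarrow> d x0 (xm i) + D + r1 \<le> R' \<and> r1 < R'"
    and cL: "10000 * (4 / R0) \<le> cL" and H: "1 \<le> H" "1 / \<rho> \<le> H"
    and \<theta>: "ln (12 * cL) \<le> \<theta>" "ln H \<le> \<theta>"
    and \<Gamma>: "1 \<le> \<Gamma>" "cS / (cC * delta_const K Rg) \<le> \<Gamma>" "cS / \<kappa> \<le> \<Gamma>"
    and xs: "xs \<in> NN" "d xs x0 \<le> Rg" "\<And>q. q \<in> NN \<Longrightarrow> F xs \<le> F q" and gap: "F x0 - F xs \<le> \<Delta>" and xs': "F xs' = F xs"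
    and u: "1 \<le> u" "H \<le> 8 * u" "sqrt (12 * cL) \<le> 2400000 * u" "1 + \<theta> \<le> 18 * u" "ln \<Gamma> \<le> 17 * u" "sqrt (cS / cC) \<le> 7 * u"
  shows "solves (reg_alg K M fr \<rho> 1 cL cS cC \<kappa> F G L Rg x0 \<Delta> \<epsilon>) M F xs' \<epsilon>
    (u ^ 10 * hidden (zeta_const K Rg + L * Rg\<^sup>2 / \<epsilon> + \<Delta> / \<epsilon>)
      * (zeta_const K Rg powr (3/2) * delta_const K Rg powr (- 1 / 2) * sqrt (zeta_const K Rg + L * Rg\<^sup>2 / \<epsilon>)))"
proof -
  note \<zeta> = zeta_const_bounds(1,2)[OF K Rg]
  have \<delta>: "0 < delta_const K Rg" "delta_const K Rg \<le> 1"
  proof -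
    have "0 < delta_const K Rg \<and> delta_const K Rg \<le> 1"
    proof (cases "K = 1")
      case True
      have "0 < cos Rg" using Rg True by (intro cos_gt_zero) auto
      then show ?thesis using delta_const_bounds[OF True Rg(1)] Rg(2) True by auto
    next
      case False
      then show ?thesis using K by (auto simp: delta_const_def)
    qed
    then show "0 < delta_const K Rg" "delta_const K Rg \<le> 1" by auto
  qed
  have cCd: "0 < cC * delta_const K Rg" "cC * delta_const K Rg \<le> (if 0 < K then cos R' else 1)"
  proof -
    have "cC * delta_const K Rg \<le> cC * 1" using cC by (intro mult_left_mono[OF \<delta>(2)]) simp
    then show "cC * delta_const K Rg \<le> (if 0 < K then cos R' else 1)" using cC(2) by linarith
  qed (use cC \<delta> in simp)
  let ?x = "zeta_const K Rg + L * Rg\<^sup>2 / \<epsilon> + \<Delta> / \<epsilon>"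
  have p: "0 \<le> L * Rg\<^sup>2 / \<epsilon>" "0 < \<Delta> / \<epsilon>" using L \<Delta> \<epsilon> by auto
  have "exp (1::real) \<le> 2 + ?x" using e_less_272 p \<zeta> by linarith
  then have \<Lambda>: "1 \<le> ln (2 + ?x)" using p \<zeta> by (subst ln_ge_iff) auto
  have \<theta>0: "0 \<le> \<theta>" using \<theta>(2) H ln_ge_zero[of H] by linarith
  have g: "sqrt (cS / (cC * delta_const K Rg)) \<le> 7 * u * delta_const K Rg powr (- 1 / 2)"
  proof -
    have "delta_const K Rg powr (- 1 / 2) = 1 / sqrt (delta_const K Rg)"
      using \<delta> by (simp add: powr_minus_divide powr_half_sqrt)
    then have "sqrt (cS / (cC * delta_const K Rg)) = sqrt (cS / cC) * delta_const K Rg powr (- 1 / 2)"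
      by (simp add: real_sqrt_divide real_sqrt_mult)
    then show ?thesis using u by (simp add: mult_right_mono)
  qed
  have cL0: "0 \<le> cL" using cL R0 by (smt (verit) divide_pos_pos)
  have "solves (reg_alg K M fr \<rho> 1 cL cS cC \<kappa> F G L Rg x0 \<Delta> \<epsilon>) M F xs \<epsilon>
     (4 * ln (2 + ?x) * (80000 * H * sqrt (12 * cL) * (1 + \<theta>) * (ln \<Gamma> + ln (2 + ?x)) ^ 3
       * (zeta_const K Rg powr (3/2) * (sqrt (cS / (cC * delta_const K Rg)) * sqrt (zeta_const K Rg + L * Rg\<^sup>2 / \<epsilon>)))))"
    by (rule reg_correct[OF x0 NM[unfolded NN_def] R' G[unfolded NN_def] sm[unfolded NN_def] sc[unfolded NN_def] L Rg(1) \<rho> D r1 DK \<Delta> \<epsilon> \<kappa> cCd cS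
        xm[unfolded NN_def] st0 stS[unfolded NN_def] R0 roomS roomH cL \<zeta> H order_refl \<theta> \<Gamma> xs[unfolded NN_def] gap]) assumption+
  moreover have "4 * ln (2 + ?x) * (80000 * H * sqrt (12 * cL) * (1 + \<theta>) * (ln \<Gamma> + ln (2 + ?x)) ^ 3
       * (zeta_const K Rg powr (3/2) * (sqrt (cS / (cC * delta_const K Rg)) * sqrt (zeta_const K Rg + L * Rg\<^sup>2 / \<epsilon>))))
    \<le> u ^ 10 * (10 ^ 30 * ln (2 + ?x) ^ 10)
      * (zeta_const K Rg powr (3/2) * delta_const K Rg powr (- 1 / 2) * sqrt (zeta_const K Rg + L * Rg\<^sup>2 / \<epsilon>))"
    by (rule regularised_bound) (use u \<Lambda> H \<theta>0 cL0 \<Gamma> g p \<zeta> cS cCd in auto)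
  ultimately have "solves (reg_alg K M fr \<rho> 1 cL cS cC \<kappa> F G L Rg x0 \<Delta> \<epsilon>) M F xs \<epsilon> (u ^ 10 * hidden ?x
      * (zeta_const K Rg powr (3/2) * delta_const K Rg powr (- 1 / 2) * sqrt (zeta_const K Rg + L * Rg\<^sup>2 / \<epsilon>)))"
    unfolding hidden_def by (rule solves_mono)
  then show ?thesis unfolding solves_def xs' .
qed

text \<open>
  Halving the weight of the regulariser moves its minimizer by at most \<open>Rg / sqrt (3 * c0)\<close>: add the
  strong convexity inequalities of both functions at their minimizers.
\<close>

lemma regularised_path:
  fixes R' \<kappa> cC Rg m L :: real and x0 x y z :: "'a point" and F :: "'a point \<Rightarrow> real" and G :: "'a point \<Rightarrow> 'a point" and NN :: "'a point set"
  defines "NN \<equiv> rball K x0 R'"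
  assumes x0: "x0 \<in> S" and R': "Rg < R'" "0 < K \<longrightarrow> R' < pi/2"
    and G: "\<And>p. p \<in> NN \<Longrightarrow> G p \<in> tangent K p" and sm: "smooth_on K F G L NN" and sc: "strongly_gconvex_on K F G 0 NN"
    and Rg: "0 < Rg" and m: "0 < m" and c0: "7/10 \<le> (if 0 < K then cos Rg else 1)"
    and cC: "0 < cC" "cC \<le> (if 0 < K then cos R' else 1)" and \<kappa>: "\<kappa> \<le> cC / 200"
    and x: "x \<in> NN" "\<And>q. q \<in> NN \<Longrightarrow> reg_fun K F x0 (2 * m) x \<le> reg_fun K F x0 (2 * m) q"
    and z: "z \<in> NN" "\<And>q. q \<in> NN \<Longrightarrow> reg_fun K F x0 m z \<le> reg_fun K F x0 m q"
    and dx: "d x x0 \<le> Rg" and dz: "d z x0 \<le> Rg"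
    and y: "y \<in> NN" "reg_fun K F x0 (2 * m) y \<le> reg_fun K F x0 (2 * m) x + \<kappa> * (2 * m * Rg\<^sup>2)"
  shows "d y z < Rg"
proof -
  let ?c = "if 0 < K then cos Rg else 1"
  have NS: "NN \<subseteq> S" by (auto simp: NN_def rball_def)
  have BN: "rball K x0 Rg \<subseteq> NN" unfolding NN_def by (rule rball_sub) (use x0 R' in auto)
  have S: "x \<in> S" "y \<in> S" "z \<in> S" using x y z NS by auto
  have growth: "reg_fun K F x0 k w + b / 2 * (d w q)\<^sup>2 \<le> reg_fun K F x0 k q"
    if sc: "strongly_gconvex_on K (reg_fun K F x0 k) (reg_grad K G x0 k) b N" and w: "w \<in> N" "w \<in> NN" "d w x0 \<le> Rg" and q: "q \<in> N" "q \<in> S"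
      and min: "\<And>q. q \<in> NN \<Longrightarrow> reg_fun K F x0 k w \<le> reg_fun K F x0 k q" and k: "0 < k" for k w b N q
  proof -
    have wS: "w \<in> S" using w NS by auto
    have smk: "smooth_on K (reg_fun K F x0 k) (reg_grad K G x0 k) (L + k * (if 0 < K then 1 else 1 + 3 * R')) NN"
      unfolding NN_def by (rule reg_smooth) (use x0 R' k sm in \<open>auto simp: NN_def\<close>)
    have g0: "reg_grad K G x0 k w = 0"
    proof (rule gradient_zero_at_minimizer[OF wS _ _ _ _ smk min])
      show "reg_grad K G x0 k w \<in> tangent K w" by (rule reg_grad_tangent[where G = G, OF x0 wS G[OF w(2)]])
      show "rball K w (R' - Rg) \<subseteq> NN" unfolding NN_def by (rule rball_sub[OF wS x0]) (use w d_commute[of w x0] in simp)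
      show "0 < R' - Rg" using R' by simp
      show "0 < K \<Longrightarrow> R' - Rg \<le> pi" using R' Rg pi_gt_zero by linarith
    qed
    obtain e where e: "utan K w e" "q = gpt K w e (d w q)" using gpt_polar wS q by blast
    have pi: "0 < K \<Longrightarrow> \<bar>d w q - 0\<bar> \<le> pi" using d_nonneg[OF wS q(2)] d_le_pi[OF wS q(2)] by simp
    have "reg_fun K F x0 k (gpt K w e (d w q)) \<ge> reg_fun K F x0 k (gpt K w e 0)
        + (d w q - 0) * ip (reg_grad K G x0 k (gpt K w e 0)) (gtan K w e 0) + b / 2 * (d w q - 0)\<^sup>2"
      by (rule convex_geo[OF sc wS e(1) _ _ pi]) (use w q e(2) in auto)
    then show ?thesis using g0 e(2) by (simp add: form_def)
  qed
  have xzS: "d x z = d z x" by (rule d_commute)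
  have convex: "strongly_gconvex_on K (reg_fun K F x0 k) (reg_grad K G x0 k) (k * ?c) (rball K x0 Rg)" if "0 < k" for k
    by (rule reg_convex[OF x0]) (use R' that strongly_gconvex_on_mono[OF sc order_refl BN] in auto)
  have in_ball: "x \<in> rball K x0 Rg" "z \<in> rball K x0 Rg" using S dx dz d_commute by (auto simp: rball_def)
  let ?A = "(d x x0)\<^sup>2" and ?B = "(d z x0)\<^sup>2" and ?D = "(d x z)\<^sup>2"
  have gx: "reg_fun K F x0 (2 * m) x + (2 * m * ?c) / 2 * ?D \<le> reg_fun K F x0 (2 * m) z"
    by (rule growth[OF convex in_ball(1) x(1) dx in_ball(2) S(3) x(2)]) (use m in auto)
  have gz: "reg_fun K F x0 m z + (m * ?c) / 2 * (d z x)\<^sup>2 \<le> reg_fun K F x0 m x"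
    by (rule growth[OF convex in_ball(2) z(1) dz in_ball(1) S(1) z(2)]) (use m in auto)
  \<comment> \<open>Comparing the two minimizers cancels F. Weights 2 m and m give the factor 3, and
    with 7/10 from \<open>c0\<close> the squared distance is at most Rg^2 / 2.1, below (7/10
    Rg)^2.\<close>
  have "m * (3 * (?c * ?D) + ?A) \<le> m * ?B"
    using gx gz unfolding reg_fun_def xzS[symmetric] by (simp add: algebra_simps split del: if_split)
  then have "3 * (?c * ?D) + ?A \<le> ?B" using m by (simp split del: if_split)
  moreover have "?B \<le> Rg\<^sup>2" using dz d_nonneg[OF S(3) x0] by (intro power_mono) auto
  moreover have "7/10 * ?D \<le> ?c * ?D" using c0 by (intro mult_right_mono) auto
  moreover have "0 \<le> ?A" by simp
  ultimately have "21/10 * ?D \<le> Rg\<^sup>2" by linarith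
  moreover have "0 \<le> Rg\<^sup>2" by simp
  ultimately have "?D \<le> 49/100 * Rg\<^sup>2" by linarith
  then have "?D \<le> (7/10 * Rg)\<^sup>2" by (simp add: power_mult_distrib power_divide)
  then have xz: "d x z \<le> 7/10 * Rg" by (rule power2_le_imp_le) (use Rg in simp)
  let ?C = "if 0 < K then cos R' else 1"
  have "reg_fun K F x0 (2 * m) x + (2 * m * ?C) / 2 * (d x y)\<^sup>2 \<le> reg_fun K F x0 (2 * m) y"
  proof (rule growth[OF _ x(1) x(1) dx y(1) S(2) x(2)])
    show "strongly_gconvex_on K (reg_fun K F x0 (2 * m)) (reg_grad K G x0 (2 * m)) (2 * m * ?C) NN"
      unfolding NN_def by (rule reg_convex[OF x0]) (use R' m sc in \<open>auto simp: NN_def\<close>)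
  qed (use m in auto)
  then have "m * (?C * (d x y)\<^sup>2) \<le> m * (2 * \<kappa> * Rg\<^sup>2)" using y(2) by (simp add: algebra_simps split del: if_split)
  then have "?C * (d x y)\<^sup>2 \<le> 2 * \<kappa> * Rg\<^sup>2" using m by (simp split del: if_split)
  moreover have "cC * (d x y)\<^sup>2 \<le> ?C * (d x y)\<^sup>2" using cC by (intro mult_right_mono) auto
  \<comment> \<open>\<kappa> \<le> cC / 200 is chosen so that the inexact output is within Rg / 10
    of the old minimizer; the total 8/10 Rg is strictly less than Rg.\<close>
  moreover have "2 * \<kappa> * Rg\<^sup>2 \<le> cC * (1/10 * Rg)\<^sup>2"
    using mult_right_mono[OF \<kappa>, of "2 * Rg\<^sup>2"] by (simp add: power_mult_distrib power_divide mult.commute mult.left_commute)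
  ultimately have "cC * (d x y)\<^sup>2 \<le> cC * (1/10 * Rg)\<^sup>2" by linarith
  then have "(d x y)\<^sup>2 \<le> (1/10 * Rg)\<^sup>2" using cC by simp
  then have "d x y \<le> 1/10 * Rg" by (rule power2_le_imp_le) (use Rg in simp)
  then show ?thesis using xz d_triangle[OF S(2,1,3)] d_commute[of x y] Rg by linarith
qed

text \<open>Comparing with \<open>xs\<close>, which has the smallest F, shows that the regulariser
  is no larger at the minimizer than at \<open>xs\<close>.\<close>

lemma reg_minimizers:
  fixes R' Rg m L :: real and F :: "'a point \<Rightarrow> real" and G :: "'a point \<Rightarrow> 'a point"
  assumes x0: "x0 \<in> S" and R': "0 \<le> R'" "0 < K \<longrightarrow> R' < pi/2"
    and G: "\<And>p. p \<in> rball K x0 R' \<Longrightarrow> G p \<in> tangent K p" and sm: "smooth_on K F G L (rball K x0 R')"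
    and sc: "strongly_gconvex_on K F G 0 (rball K x0 R')" and L: "0 < L" and m: "0 < m"
    and xs: "xs \<in> rball K x0 R'" "d xs x0 \<le> Rg" "\<And>q. q \<in> rball K x0 R' \<Longrightarrow> F xs \<le> F q"
  shows "\<exists>x\<in>rball K x0 R'. (\<forall>q\<in>rball K x0 R'. reg_fun K F x0 m x \<le> reg_fun K F x0 m q) \<and> d x x0 \<le> Rg"
proof -
  have sm': "smooth_on K (reg_fun K F x0 m) (reg_grad K G x0 m) (L + m * (if 0 < K then 1 else 1 + 3 * R')) (rball K x0 R')"
    by (rule reg_smooth) (use x0 R' m sm in auto)
  have sc': "strongly_gconvex_on K (reg_fun K F x0 m) (reg_grad K G x0 m) (m * (if 0 < K then cos R' else 1)) (rball K x0 R')"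
    by (rule reg_convex) (use x0 R' m sc in auto)
  have "0 \<le> cos R'" if "0 < K" using R' that by (intro cos_ge_zero) auto
  then have nn: "0 \<le> m * (if 0 < K then cos R' else 1)" "0 \<le> L + m * (if 0 < K then 1 else 1 + 3 * R')" using m L R' by auto
  have pi: "0 < K \<longrightarrow> R' \<le> pi" using R' by auto
  have G': "reg_grad K G x0 m p \<in> tangent K p" if "p \<in> rball K x0 R'" for p
    by (rule reg_grad_tangent[where G = G, OF x0 _ G[OF that]]) (use that in \<open>simp add: rball_def\<close>)
  obtain x where x: "x \<in> rball K x0 R'" "\<And>q. q \<in> rball K x0 R' \<Longrightarrow> reg_fun K F x0 m x \<le> reg_fun K F x0 m q"
    using minimizer_exists[OF x0 R'(1) pi sm' sc' nn G'] by blast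
  have S: "x \<in> S" "xs \<in> S" using x xs by (auto simp: rball_def)
  have "F x + m / 2 * (d x x0)\<^sup>2 \<le> F xs + m / 2 * (d xs x0)\<^sup>2" using x(2)[OF xs(1)] by (simp add: reg_fun_def)
  then have "m / 2 * (d x x0)\<^sup>2 \<le> m / 2 * (d xs x0)\<^sup>2" using xs(3)[OF x(1)] by linarith
  then have "(d x x0)\<^sup>2 \<le> (d xs x0)\<^sup>2" using m by simp
  then have "d x x0 \<le> d xs x0" by (rule power2_le_imp_le) (rule d_nonneg[OF S(2) x0])
  then show ?thesis using x xs(2) by force
qed

text \<open>With D = Rg queries stay within 2 Rg + r1 of x0, and on the sphere R0 is the extra room
  for the gradient bound. The condition 7/10 \<le> cos Rg is what \<open>regularised_path\<close>
  needs.\<close>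

lemma reg_solves_room:
  fixes R' r1 \<rho> cL cS cC \<kappa> L Rg \<Delta> \<epsilon> R0 H \<theta> \<Gamma> u :: real
    and F :: "'a point \<Rightarrow> real" and G :: "'a point \<Rightarrow> 'a point" and x0 xs :: "'a point" and M NN :: "'a point set"
  defines "NN \<equiv> rball K x0 R'"
  assumes x0: "x0 \<in> S" and NM: "NN \<subseteq> M" and R': "0 < K \<longrightarrow> R' < pi/2"
    and G: "\<And>p. p \<in> NN \<Longrightarrow> G p \<in> tangent K p" and sm: "smooth_on K F G L NN" and sc: "strongly_gconvex_on K F G 0 NN" and L: "0 < L"
    and Rg: "0 < Rg" "0 < K \<Longrightarrow> Rg < pi/2" and \<rho>: "0 < \<rho>" "min \<rho> Rg = r1"
    and r1: "r1 \<le> 1" "0 < K \<Longrightarrow> r1 \<le> 1/2" and DK: "0 < K \<Longrightarrow> Rg + r1 < pi/2 \<and> 1 \<le> 2 * cos (Rg + r1)"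
    and c0: "7/10 \<le> (if 0 < K then cos Rg else 1)"
    and \<Delta>: "0 < \<Delta>" and \<epsilon>: "0 < \<epsilon>" and \<kappa>: "0 < \<kappa>" "\<kappa> \<le> 1/4" "\<kappa> \<le> cC * delta_const K Rg / 200"
    and cC: "0 < cC" "cC \<le> (if 0 < K then cos R' else 1)"
    and cS: "2 \<le> cS" "(if 0 < K then 1 else 1 + 3 * R') \<le> cS * zeta_const K Rg"
    and R0: "0 < R0" "R0 \<le> 2" and room: "2 * Rg + r1 + (if 0 < K then R0 else 0) \<le> R'"
    and cL: "10000 * (4 / R0) \<le> cL" and H: "1 \<le> H" "1 / \<rho> \<le> H"
    and \<theta>: "ln (12 * cL) \<le> \<theta>" "ln H \<le> \<theta>"
    and \<Gamma>: "1 \<le> \<Gamma>" "cS / (cC * delta_const K Rg) \<le> \<Gamma>" "cS / \<kappa> \<le> \<Gamma>"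
    and xs: "xs \<in> S" "d x0 xs \<le> Rg" "\<And>q. q \<in> NN \<Longrightarrow> F xs \<le> F q" and gap: "F x0 - F xs \<le> \<Delta>"
    and u: "1 \<le> u" "H \<le> 8 * u" "sqrt (12 * cL) \<le> 2400000 * u" "1 + \<theta> \<le> 18 * u" "ln \<Gamma> \<le> 17 * u" "sqrt (cS / cC) \<le> 7 * u"
  shows "solves (reg_alg K M fr \<rho> 1 cL cS cC \<kappa> F G L Rg x0 \<Delta> \<epsilon>) M F xs \<epsilon>
    (u ^ 10 * hidden (zeta_const K Rg + L * Rg\<^sup>2 / \<epsilon> + \<Delta> / \<epsilon>)
      * (zeta_const K Rg powr (3/2) * delta_const K Rg powr (- 1 / 2) * sqrt (zeta_const K Rg + L * Rg\<^sup>2 / \<epsilon>)))"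
proof -
  have r1': "0 < r1" "r1 \<le> Rg" using \<rho> Rg by auto
  have R'': "0 \<le> R'" "Rg < R'" using room r1' Rg R0 by (auto split: if_splits)
  define mu where "mu i = \<Delta> / Rg\<^sup>2 / 2 ^ i" for i :: nat
  have mu: "0 < mu i" for i using \<Delta> Rg by (simp add: mu_def)
  have mu2: "mu i = 2 * mu (Suc i)" for i by (simp add: mu_def)
  have xsN: "xs \<in> NN" "d xs x0 \<le> Rg" using xs R'' d_commute[of xs x0] by (auto simp: NN_def rball_def)
  have "\<exists>x\<in>NN. (\<forall>q\<in>NN. reg_fun K F x0 (mu i) x \<le> reg_fun K F x0 (mu i) q) \<and> d x x0 \<le> Rg" for i
    unfolding NN_def using reg_minimizers[OF x0 R''(1) R' G[unfolded NN_def] sm[unfolded NN_def] sc[unfolded NN_def] L mu] xsN xs(3)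
    unfolding NN_def by blast
  then obtain xm where xm: "\<And>i. xm i \<in> NN" "\<And>i q. q \<in> NN \<Longrightarrow> reg_fun K F x0 (mu i) (xm i) \<le> reg_fun K F x0 (mu i) q"
    "\<And>i. d (xm i) x0 \<le> Rg" by metis
  have \<delta>: "delta_const K Rg \<le> 1"
    using delta_const_bounds(2)[of K Rg] Rg K by (cases "K = 1") (auto simp: delta_const_def)
  have "cC * delta_const K Rg \<le> cC * 1" using cC by (intro mult_left_mono[OF \<delta>]) simp
  then have \<kappa>C: "\<kappa> \<le> cC / 200" using \<kappa>(3) by linarith
  have room': "2 * Rg + r1 \<le> R'" "0 < K \<Longrightarrow> 2 * Rg + r1 + R0 \<le> R'" using room R0 by (auto split: if_splits)
  have stS: "d y (xm (Suc i)) < Rg"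
    if y: "y \<in> NN" "reg_fun K F x0 (mu i) y \<le> reg_fun K F x0 (mu i) (xm i) + \<kappa> * \<Delta> / 2 ^ i" for i y
  proof -
    have "\<kappa> * \<Delta> / 2 ^ i = \<kappa> * (2 * mu (Suc i) * Rg\<^sup>2)" using Rg by (simp add: mu_def)
    then show ?thesis
      using regularised_path[OF x0 R''(2) R' G[unfolded NN_def] sm[unfolded NN_def] sc[unfolded NN_def] Rg(1) mu[of "Suc i"] c0 cC \<kappa>C
          xm(1)[of i, unfolded NN_def] xm(2)[where i = i, unfolded NN_def mu2[of i]] xm(1)[of "Suc i", unfolded NN_def]
          xm(2)[where i = "Suc i", unfolded NN_def] xm(3)[of i] xm(3)[of "Suc i"] y(1)[unfolded NN_def]] y(2)
      unfolding mu2[of i] by simp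
  qed
  have x0m: "d x0 (xm i) \<le> Rg" for i using xm(3) d_commute[of x0] by simp
  show ?thesis
  proof (rule reg_solves[where xm = xm and D = Rg, OF x0 NM[unfolded NN_def] R''(1) R' G[unfolded NN_def] sm[unfolded NN_def] sc[unfolded NN_def] L Rg \<rho>
        r1'(2) order_refl r1'(1) r1 DK \<Delta> \<epsilon> \<kappa>(1,2) cC cS xm(1)[unfolded NN_def] xm(2)[unfolded mu_def NN_def] x0m stS[unfolded mu_def NN_def] R0 _ _
        cL H \<theta> \<Gamma> xsN(1)[unfolded NN_def] xsN(2) xs(3)[unfolded NN_def] gap refl u])
    show "0 < K \<Longrightarrow> d x0 (xm i) + Rg + r1 + R0 \<le> R'" for i using room' x0m[of i] by linarith
    show "K = -1 \<Longrightarrow> d x0 (xm i) + Rg + r1 \<le> R' \<and> r1 < R'" for i using room' x0m[of i] r1' Rg by simp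
  qed assumption+
qed

text \<open>On the sphere the working radius is reduced to 2 Rg + 1/2, at most pi/2 - 1/2, so that
  its cosine is at least cC = 1/4; room 1/5 still fits because Rg < 2/7. In hyperbolic space 1 + 3
  (2 Rg + 1) \<le> 10 \<zeta> explains cS = 10.\<close>

lemma reg_unit_ball:
  assumes st: "setting K M fr F G x0 xs Rg (exp_ball K x0 (2 * Rg + 1))" and k: "0 < K \<Longrightarrow> 2 * Rg + 1 < pi / 2"
    and L: "0 < L" and \<Delta>: "0 < \<Delta>" and \<epsilon>: "0 < \<epsilon>" and gap: "F x0 - F xs \<le> \<Delta>"
    and sm: "smooth_on K F G L (exp_ball K x0 (2 * Rg + 1))"
    and sc: "gconvex_on K F G (exp_ball K x0 (2 * Rg + 1))"
  shows "solves (reg_alg K M fr 1 1 200000 10 (1/4) (1/10^4) F G L Rg x0 \<Delta> \<epsilon>) M F xs \<epsilon>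
    (hidden (zeta_const K Rg + L * Rg\<^sup>2 / \<epsilon> + \<Delta> / \<epsilon>)
      * (zeta_const K Rg powr (3/2) * delta_const K Rg powr (- 1 / 2) * sqrt (zeta_const K Rg + L * Rg\<^sup>2 / \<epsilon>)))"
proof -
  note s = settingD[OF st]
  have eN: "exp_ball K x0 (2 * Rg + 1) = rball K x0 (2 * Rg + 1)" by (rule exp_ball_eq[OF s(2)]) (use k pi_gt3 in linarith)
  note s = s[unfolded eN] and sm = sm[unfolded eN] and sc = sc[unfolded eN gconvex_on_def]
  define R' where "R' = (if 0 < K then 2 * Rg + 1/2 else 2 * Rg + 1)"
  have sub: "rball K x0 R' \<subseteq> rball K x0 (2 * Rg + 1)" by (auto simp: R'_def rball_def)
  have Rg: "Rg < 2/7" if "0 < K" using k[OF that] pi_approx by simp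
  have R'2: "0 < K \<longrightarrow> R' < pi/2" using k by (auto simp: R'_def)
  define r1 where "r1 = min 1 Rg"
  have r1: "0 < r1" "r1 \<le> Rg" "r1 \<le> 1" using s(7) by (auto simp: r1_def)
  have c60: "1/2 \<le> cos t" if "0 \<le> t" "t \<le> pi/3" for t
    using that cos_monotone_0_pi_le[of t "pi/3"] by (simp add: cos_60)
  have cRg: "7/8 \<le> cos Rg" if "0 < K"
    using cos_half_ge cos_monotone_0_pi_le[of Rg "1/2"] Rg[OF that] s(7) pi_gt3 by simp
  have \<delta>: "7/8 \<le> delta_const K Rg" "delta_const K Rg \<le> 1"
    using delta_const_bounds[of K Rg] cRg Rg s(7) pi_gt3 K by (cases "K = 1"; force simp: delta_const_def)+
  have "0 < K \<Longrightarrow> Rg < pi/2" using k s(7) by simp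
  then have \<zeta>: "1 \<le> zeta_const K Rg" "K = -1 \<Longrightarrow> Rg \<le> zeta_const K Rg" using zeta_const_bounds(1,3)[OF K s(7)] by auto
  have "ln 2400000 \<le> real 15" "ln 100000 \<le> real 17" by (rule ln_bound_2_7; simp add: power_divide)+
  then have l: "ln 2400000 \<le> (15::real)" "ln 100000 \<le> (17::real)" by simp_all
  have q: "sqrt 2400000 \<le> (2400000::real)" "sqrt 40 \<le> (7::real)" by (intro real_le_lsqrt; simp)+
  have "solves (reg_alg K M fr 1 1 200000 10 (1/4) (1/10^4) F G L Rg x0 \<Delta> \<epsilon>) M F xs \<epsilon>
    (1 ^ 10 * hidden (zeta_const K Rg + L * Rg\<^sup>2 / \<epsilon> + \<Delta> / \<epsilon>)
      * (zeta_const K Rg powr (3/2) * delta_const K Rg powr (- 1 / 2) * sqrt (zeta_const K Rg + L * Rg\<^sup>2 / \<epsilon>)))"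
  proof (rule reg_solves_room[where R' = R' and ?r1.0 = r1 and ?R0.0 = "1/5" and H = 1 and \<theta> = 15 and \<Gamma> = 100000, OF s(2) _ R'2])
    show "smooth_on K F G L (rball K x0 R')" by (rule smooth_on_mono[OF sm order_refl sub])
    show "strongly_gconvex_on K F G 0 (rball K x0 R')" by (rule strongly_gconvex_on_mono[OF sc order_refl sub])
    show "rball K x0 R' \<subseteq> M" using sub s(4) by blast
    show "G p \<in> tangent K p" if "p \<in> rball K x0 R'" for p using s(4,5) sub that by blast
    show "F xs \<le> F p" if "p \<in> rball K x0 R'" for p using s(4,6) sub that by blast
    show "0 < K \<Longrightarrow> Rg < pi/2" using Rg pi_gt3 by simp
    show "0 < K \<Longrightarrow> r1 \<le> 1/2" using Rg r1 by simp
    show "Rg + r1 < pi/2 \<and> 1 \<le> 2 * cos (Rg + r1)" if "0 < K"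
      using Rg[OF that] r1 s(7) c60[of "Rg + r1"] pi_gt3 by auto
    show "7/10 \<le> (if 0 < K then cos Rg else 1)" using cRg by auto
    show "1/10^4 \<le> 1/4 * delta_const K Rg / 200" using \<delta> by simp
    show "1/4 \<le> (if 0 < K then cos R' else 1)"
    proof (cases "0 < K")
      case True
      have "1 / 4 \<le> cos R'" by (rule cos_complement_ge) (use k[OF True] True s(7) pi_gt3 in \<open>auto simp: R'_def\<close>)
      then show ?thesis by simp
    qed simp
    show "(if 0 < K then 1 else 1 + 3 * R') \<le> 10 * zeta_const K Rg"
      using \<zeta> K by (auto simp: R'_def)
    show "2 * Rg + r1 + (if 0 < K then 1/5 else 0) \<le> R'" using Rg r1 by (auto simp: R'_def)
    show "10 / (1/4 * delta_const K Rg) \<le> 100000" using \<delta> by (simp add: divide_le_eq)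
  qed (use s \<delta> L \<Delta> \<epsilon> gap l q r1 in \<open>auto simp: r1_def\<close>)
  then show ?thesis by simp
qed

text \<open>
  When the ball of radius \<open>2 * Rg + R\<close> contains a closed hemisphere in its interior, g-convexity forces
  the gradient at \<open>x0\<close> to vanish, so that \<open>x0\<close> minimizes \<open>F\<close> and all its regularisations.
\<close>

lemma reg_small_balls:
  fixes R c :: real
  assumes K': "K = 1" and c: "1 < c" and R: "0 < R" "c * Rg + R < pi / 2"
    and st: "setting 1 M fr F G x0 xs Rg (exp_ball 1 x0 (2 * Rg + R))"
    and L: "0 < L" and \<Delta>: "0 < \<Delta>" and \<epsilon>: "0 < \<epsilon>" and gap: "F x0 - F xs \<le> \<Delta>"
    and sm: "smooth_on 1 F G L (exp_ball 1 x0 (2 * Rg + R))" and sc: "gconvex_on 1 F G (exp_ball 1 x0 (2 * Rg + R))"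
  shows "solves (reg_alg 1 M fr (R / 8) 1 (200000 / R) 2 (R / 4) (min (1/4) (R ^ 4 / 10 ^ 5)) F G L Rg x0 \<Delta> \<epsilon>) M F xs \<epsilon>
    ((1 + 1 / R) ^ 10 * hidden (zeta_const 1 Rg + L * Rg\<^sup>2 / \<epsilon> + \<Delta> / \<epsilon>)
      * (zeta_const 1 Rg powr (3/2) * delta_const 1 Rg powr (- 1 / 2) * sqrt (zeta_const 1 Rg + L * Rg\<^sup>2 / \<epsilon>)))"
proof -
  have k: "0 < K" using K' by simp
  note s = settingD[OF st[folded K']]
  have "1 * Rg \<le> c * Rg" using c s(7) by (intro mult_right_mono) auto
  then have RR: "Rg + R < pi/2" "R < pi/2" "Rg < pi/2" using R s(7) by linarith+
  then have R16: "R < 8/5" "Rg < 8/5" using pi_approx by simp_all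
  have eN: "exp_ball K x0 (2 * Rg + R) = rball K x0 (2 * Rg + R)" by (rule exp_ball_eq[OF s(2)]) (use RR R in linarith)
  note s = s[unfolded eN] and sm = sm[folded K', unfolded eN] and sc = sc[folded K', unfolded eN gconvex_on_def]
  \<comment> \<open>The value is 2 Rg + R/2 if the full ball lies in a hemisphere and R/2 otherwise;
    either way it is at most pi/2 - R/2, so its cosine is at least R/4.\<close>
  define R' where "R' = min (2 * Rg + R / 2) (R / 2 + (if 2 * Rg + R \<le> pi / 2 then 2 * Rg else 0))"
  have sub: "rball K x0 R' \<subseteq> rball K x0 (2 * Rg + R)" using s(7) R by (auto simp: R'_def rball_def)
  define r1 where "r1 = min (R / 8) Rg"
  have r1: "0 < r1" "r1 \<le> Rg" "r1 \<le> R / 8" using s(7) R by (auto simp: r1_def)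
  have c60: "1/2 \<le> cos t" if "0 \<le> t" "t \<le> pi/3" for t
    using that cos_monotone_0_pi_le[of t "pi/3"] by (simp add: cos_60)
  \<comment> \<open>Two demands are met: \<kappa> \<le> (R/4) (7/10) / 200 for the path of
    minimizers, and 2 \<kappa> Rg^2 < r1^2 in the degenerate case. Both use R < 8/5.\<close>
  define \<kappa> where "\<kappa> = R ^ 4 / 10 ^ 5"
  have R4: "R ^ 4 = R * R ^ 3" "R ^ 4 = R\<^sup>2 * R\<^sup>2" by (simp_all add: eval_nat_numeral)
  have "R ^ 3 \<le> (8/5) ^ 3" "R\<^sup>2 \<le> (8/5)\<^sup>2" using R16 R by (intro power_mono; simp)+
  then have R3: "R ^ 3 \<le> 5" "R\<^sup>2 \<le> 3" by (simp_all add: eval_nat_numeral)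
  have R4': "R ^ 4 \<le> 5 * R" "R ^ 4 \<le> 3 * R\<^sup>2" using mult_left_mono[OF R3(1), of R] mult_right_mono[OF R3(2), of "R\<^sup>2"] R
    unfolding R4 by (simp_all add: eval_nat_numeral)
  have \<kappa>: "0 < \<kappa>" "\<kappa> \<le> 1/4" "min (1/4) (R ^ 4 / 10 ^ 5) = \<kappa>" using R R4' R16 by (auto simp: \<kappa>_def)
  have \<delta>: "cos Rg \<le> delta_const K Rg" "delta_const K Rg \<le> 1" using delta_const_bounds[OF K' s(7)] RR by auto
  have "R / 4 \<le> cos Rg" by (rule cos_complement_ge) (use R RR s(7) in auto)
  then have \<delta>R: "R / 4 \<le> delta_const K Rg" using \<delta> by linarith
  have cosR': "R / 4 \<le> cos R'" by (rule cos_complement_ge) (use R RR s(7) in \<open>auto simp: R'_def\<close>)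
  have R'2: "0 < K \<longrightarrow> R' < pi/2" "0 \<le> R'" using RR s(7) R by (auto simp: R'_def)
  have \<zeta>: "zeta_const K Rg = 1" using k by (simp add: zeta_const_def)
  define v where "v = 1 / R"
  have v: "1/2 \<le> v" using R R16 by (simp add: v_def le_divide_eq)
  define u where "u = 1 + v"
  have u1: "1 \<le> u" "v \<le> u" using v by (auto simp: u_def)
  have cL: "12 * (200000 / R) = 2400000 * v" by (simp add: v_def)
  have lv: "ln v \<le> v" "ln u \<le> v" using ln_le_minus_one[of v] ln_le_minus_one[of u] v by (auto simp: u_def)
  have "ln 2400000 \<le> real 15" "ln 8 \<le> real 3" "ln 200000 \<le> real 13" by (rule ln_bound_2_7; simp add: power_divide)+
  then have ll: "ln 2400000 \<le> (15::real)" "ln 8 \<le> (3::real)" "ln 200000 \<le> (13::real)" by simp_all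
  have l1: "ln (2400000 * v) \<le> 15 + v" "ln (8 * v) \<le> 15 + v" using ll lv v by (auto simp: ln_mult)
  have l2: "ln (200000 * u ^ 4) \<le> 17 * u" using ll lv u1 by (simp add: ln_mult ln_realpow u_def)
  have q1: "sqrt (2400000 * v) \<le> 2400000 * u"
  proof (rule real_le_lsqrt)
    have "2400000 * v * 1 \<le> (2400000 * u) * (2400000 * u)" using v u1 by (intro mult_mono) auto
    then show "2400000 * v \<le> (2400000 * u)\<^sup>2" by (simp add: power2_eq_square)
  qed (use u1 v in auto)
  have q2: "sqrt (2 / (R / 4)) \<le> 7 * u"
  proof (rule real_le_lsqrt)
    have "8 * v * 1 \<le> (8 * u) * u" using v u1 by (intro mult_mono) auto
    also have "\<dots> \<le> (7 * u)\<^sup>2" using u1 by (simp add: power2_eq_square)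
    finally show "2 / (R / 4) \<le> (7 * u)\<^sup>2" by (simp add: v_def)
  qed (use u1 R in auto)
  have \<Gamma>1: "1 \<le> 200000 * u ^ 4" using one_le_power[OF u1(1), of 4] by simp
  have \<Gamma>2: "2 / (R / 4 * delta_const K Rg) \<le> 200000 * u ^ 4"
  proof -
    have "R / 4 * (R / 4) \<le> R / 4 * delta_const K Rg" using \<delta>R R by (intro mult_left_mono) auto
    then have "2 / (R / 4 * delta_const K Rg) \<le> 2 / (R / 4 * (R / 4))" using R by (intro divide_left_mono mult_pos_pos) (use \<delta>R in auto)
    also have "\<dots> = 32 * v ^ 2" by (simp add: v_def power2_eq_square)
    also have "\<dots> \<le> 32 * u ^ 2" using u1 v by (intro mult_left_mono power_mono) auto
    also have "\<dots> \<le> 200000 * u ^ 4" using u1 by (intro mult_mono power_increasing) auto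
    finally show ?thesis .
  qed
  have "2 / \<kappa> = 200000 * v ^ 4" by (simp add: v_def \<kappa>_def power_divide)
  also have "\<dots> \<le> 200000 * u ^ 4" using u1 v by (intro mult_left_mono power_mono) auto
  finally have \<Gamma>3: "2 / \<kappa> \<le> 200000 * u ^ 4" .
  have smR: "smooth_on K F G L (rball K x0 R')" by (rule smooth_on_mono[OF sm order_refl sub])
  have scR: "strongly_gconvex_on K F G 0 (rball K x0 R')" by (rule strongly_gconvex_on_mono[OF sc order_refl sub])
  have MR: "rball K x0 R' \<subseteq> M" using sub s(4) by blast
  have GR: "G p \<in> tangent K p" if "p \<in> rball K x0 R'" for p using s(4,5) sub that by blast
  have mR: "F xs \<le> F p" if "p \<in> rball K x0 R'" for p using s(4,6) sub that by blast
  have "solves (reg_alg K M fr (R / 8) 1 (200000 / R) 2 (R / 4) \<kappa> F G L Rg x0 \<Delta> \<epsilon>) M F xs \<epsilon>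
    (u ^ 10 * hidden (zeta_const K Rg + L * Rg\<^sup>2 / \<epsilon> + \<Delta> / \<epsilon>)
      * (zeta_const K Rg powr (3/2) * delta_const K Rg powr (- 1 / 2) * sqrt (zeta_const K Rg + L * Rg\<^sup>2 / \<epsilon>)))"
  proof (cases "2 * Rg + R \<le> pi / 2")
    case True
    then have R': "R' = 2 * Rg + R / 2" by (simp add: R'_def)
    have "cos (pi/4) \<le> cos Rg" using True R s(7) by (intro cos_monotone_0_pi_le) auto
    moreover have "7/5 \<le> sqrt 2" by (intro real_le_rsqrt) (simp add: power2_eq_square)
    ultimately have cRg: "7/10 \<le> cos Rg" by (simp add: cos_45)
    show ?thesis
    proof (rule reg_solves_room[where R' = R' and ?r1.0 = r1 and ?R0.0 = "R / 5" and H = "8 * v" and \<theta> = "15 + v" and \<Gamma> = "200000 * u ^ 4",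
          OF s(2) MR R'2(1) GR smR scR L s(7) RR(3)], unfold cL)
      show "Rg + r1 < pi/2 \<and> 1 \<le> 2 * cos (Rg + r1)"
        using True r1 s(7) c60[of "Rg + r1"] pi_gt3 by auto
      have "\<kappa> \<le> R / 4 * (7/10) / 200" using R4' R by (simp add: \<kappa>_def)
      also have "\<dots> \<le> R / 4 * delta_const K Rg / 200"
        using cRg \<delta> R by (intro divide_right_mono mult_left_mono) auto
      finally show "\<kappa> \<le> R / 4 * delta_const K Rg / 200" .
      show "1 / (R / 8) \<le> 8 * v" by (simp add: v_def)
      show "10000 * (4 / (R / 5)) \<le> 200000 / R" by simp
      show "1 + (15 + v) \<le> 18 * u" using v by (simp add: u_def)
      show "2 * Rg + r1 + (if 0 < K then R / 5 else 0) \<le> R'" using r1(3) R(1) by (simp add: R')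
    qed (use s R R16 r1 cRg \<kappa> cosR' \<zeta> k \<Delta> \<epsilon> gap v u1 l1 l2 q1 q2 \<Gamma>1 \<Gamma>2 \<Gamma>3 mR in \<open>auto simp: r1_def R'\<close>)
  next
    case False
    then have R': "R' = R / 2" using s(7) by (simp add: R'_def)
    have x0N: "x0 \<in> rball K x0 (2 * Rg + R)" "x0 \<in> rball K x0 R'" using s(2,7) R by (auto simp: R' rball_def)
    have "G x0 = 0"
      by (rule large_ball_critical[where G = G, OF K' s(2) GR[OF x0N(2)] _ _ sc]) (use False RR R in auto)
    have x0min: "F x0 \<le> F q" if q: "q \<in> rball K x0 (2 * Rg + R)" for q
    proof -
      have qS: "q \<in> S" using q by (simp add: rball_def)
      obtain e where e: "utan K x0 e" "q = gpt K x0 e (d x0 q)" using gpt_polar s(2) qS by blast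
      have "F (gpt K x0 e (d x0 q)) \<ge> F (gpt K x0 e 0) + (d x0 q - 0) * ip (G (gpt K x0 e 0)) (gtan K x0 e 0)"
        by (rule convex_geo_0[OF sc order_refl s(2) e(1)]) (use x0N q e(2) d_nonneg[OF s(2) qS] d_le_pi[OF s(2) qS] in auto)
      then show ?thesis using \<open>G x0 = 0\<close> e(2) by (simp add: form_def)
    qed
    have xsN: "xs \<in> rball K x0 (2 * Rg + R)" using s(3,7,8) R by (simp add: rball_def)
    have eq: "F xs = F x0" using x0min[OF xsN] s(4,6) x0N(1) by (metis antisym subsetD)
    have x0min': "F x0 \<le> F q" if "q \<in> rball K x0 R'" for q using x0min sub that by blast
    have m0: "0 < \<Delta> / Rg\<^sup>2 / 2 ^ i" for i :: nat using \<Delta> s(7) by simp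
    show ?thesis
    \<comment> \<open>Beyond a hemisphere half the squared distance is no longer convex, so the
      large ball cannot be used. As x0 minimizes every regularised function, D can shrink to the
      ball radius r1, and a ball of radius R/2 contains all queries.\<close>
    proof (rule reg_solves[where xm = "\<lambda>_. x0" and D = r1 and R' = R' and ?r1.0 = r1 and ?R0.0 = "R / 5" and H = "8 * v" and \<theta> = "15 + v" and \<Gamma> = "200000 * u ^ 4"
          and xs = x0, OF s(2) MR R'2(2,1) GR smR scR L s(7) RR(3)], unfold cL)
      show "r1 + r1 < pi/2 \<and> 1 \<le> 2 * cos (r1 + r1)"
        using R16 r1 s(7) c60[of "r1 + r1"] pi_gt3 by auto
      show "1 / (R / 8) \<le> 8 * v" by (simp add: v_def)
      show "10000 * (4 / (R / 5)) \<le> 200000 / R" by simp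
      show "1 + (15 + v) \<le> 18 * u" using v by (simp add: u_def)
      show "d x0 x0 + r1 + r1 + R / 5 \<le> R'" using r1(3) R(1) s(2) by (simp add: R')
      show "reg_fun K F x0 (\<Delta> / Rg\<^sup>2 / 2 ^ i) x0 \<le> reg_fun K F x0 (\<Delta> / Rg\<^sup>2 / 2 ^ i) q" if "q \<in> rball K x0 R'" for i q
      proof -
        have "0 \<le> \<Delta> / Rg\<^sup>2 / 2 ^ i / 2 * (d q x0)\<^sup>2" using m0[of i] by (intro mult_nonneg_nonneg) auto
        then have "F x0 \<le> F q + \<Delta> / Rg\<^sup>2 / 2 ^ i / 2 * (d q x0)\<^sup>2" using x0min'[OF that] by linarith
        then show ?thesis using s(2) by (simp add: reg_fun_def)
      qed
      fix i y assume y: "y \<in> rball K x0 R'"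
        "reg_fun K F x0 (\<Delta> / Rg\<^sup>2 / 2 ^ i) y \<le> reg_fun K F x0 (\<Delta> / Rg\<^sup>2 / 2 ^ i) x0 + \<kappa> * \<Delta> / 2 ^ i"
      let ?m = "\<Delta> / Rg\<^sup>2 / 2 ^ i"
      have yS: "y \<in> S" using y by (simp add: rball_def)
      have "?m / 2 * (d y x0)\<^sup>2 \<le> \<kappa> * \<Delta> / 2 ^ i" using y(2) x0min'[OF y(1)] s(2) by (simp add: reg_fun_def)
      also have "\<kappa> * \<Delta> / 2 ^ i = ?m / 2 * (2 * \<kappa> * Rg\<^sup>2)" using s(7) by simp
      finally have "(d y x0)\<^sup>2 \<le> 2 * \<kappa> * Rg\<^sup>2" using m0[of i] by (subst (asm) mult_le_cancel_left_pos) auto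
      \<comment> \<open>r1 is the smaller of R/8 and Rg: against Rg the bound \<kappa> \<le> 1/4
        suffices, against R/8 the bound R^4 \<le> 3 R^2.\<close>
      also have "2 * \<kappa> * Rg\<^sup>2 < r1\<^sup>2"
      proof -
        have "\<kappa> \<le> 1/4" using \<kappa> by simp
        then have "2 * \<kappa> * Rg\<^sup>2 \<le> 1/2 * Rg\<^sup>2" by (intro mult_right_mono) auto
        also have "\<dots> < Rg\<^sup>2" using s(7) by simp
        finally have a: "2 * \<kappa> * Rg\<^sup>2 < Rg\<^sup>2" .
        have "Rg\<^sup>2 \<le> (8/5)\<^sup>2" using s(7) R16 by (intro power_mono) auto
        then have "2 * \<kappa> * Rg\<^sup>2 \<le> 2 * \<kappa> * 3" using \<kappa> by (intro mult_left_mono) (auto simp: power2_eq_square)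
        also have "\<dots> \<le> 18 / 10 ^ 5 * R\<^sup>2" using R4'(2) by (simp add: \<kappa>_def)
        also have "\<dots> < (R / 8)\<^sup>2" using R by (simp add: power_divide)
        finally have "2 * \<kappa> * Rg\<^sup>2 < (R / 8)\<^sup>2" .
        then show ?thesis using a by (simp add: r1_def min_def)
      qed
      finally have "(d y x0)\<^sup>2 < r1\<^sup>2" .
      then show "d y x0 < r1" by (rule power2_less_imp_less) (use r1 in simp)
    qed (use s R R16 r1 \<kappa> cosR' \<zeta> k \<Delta> \<epsilon> gap v u1 l1 l2 q1 q2 \<Gamma>1 \<Gamma>2 \<Gamma>3 x0min' x0N eq in \<open>auto simp: r1_def R'\<close>)
  qed
  then show ?thesis unfolding \<kappa>(3) u_def v_def K' .
qed

end

theorem theorem7: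
  shows
    "(\<exists>cL>0. \<forall>K (M :: 'a::euclidean_space point set) frame F G x0 xs Rg L \<mu> \<epsilon>.
        (K = 1 \<or> K = -1) \<and> (K > 0 \<longrightarrow> 2 * Rg + 1 < pi / (2 * sqrt K)) \<and>
        setting K M frame F G x0 xs Rg (exp_ball K x0 (2 * Rg + 1)) \<and>
        0 < L \<and> 0 < \<mu> \<and> 0 < \<epsilon> \<and>
        smooth_on K F G L (exp_ball K x0 (2 * Rg + 1)) \<and>
        strongly_gconvex_on K F G \<mu> (exp_ball K x0 (2 * Rg + 1)) \<longrightarrow>
        solves (alg2 K M frame 1 1 cL F G L \<mu> Rg x0 \<epsilon>) M F xs \<epsilon>
          (hidden (zeta_const K Rg + L / \<mu> + L * Rg\<^sup>2 / \<epsilon>)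
             * (zeta_const K Rg powr (3 / 2) * sqrt (L / \<mu>))))
   \<and>
     (\<exists>cL>0. \<exists>cS>0. \<exists>cC>0. \<exists>\<kappa>>0. \<kappa> \<le> 1 / 4 \<and>
      (\<forall>K (M :: 'a point set) frame F G x0 xs Rg L \<Delta> \<epsilon>.
        (K = 1 \<or> K = -1) \<and> (K > 0 \<longrightarrow> 2 * Rg + 1 < pi / (2 * sqrt K)) \<and>
        setting K M frame F G x0 xs Rg (exp_ball K x0 (2 * Rg + 1)) \<and>
        0 < L \<and> 0 < \<epsilon> \<and> 0 < \<Delta> \<and> F x0 - F xs \<le> \<Delta> \<and>
        smooth_on K F G L (exp_ball K x0 (2 * Rg + 1)) \<and>
        gconvex_on K F G (exp_ball K x0 (2 * Rg + 1)) \<longrightarrow>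
        solves (reg_alg K M frame 1 1 cL cS cC \<kappa> F G L Rg x0 \<Delta> \<epsilon>) M F xs \<epsilon>
          (hidden (zeta_const K Rg + L * Rg\<^sup>2 / \<epsilon> + \<Delta> / \<epsilon>)
             * (zeta_const K Rg powr (3 / 2) * delta_const K Rg powr (- 1 / 2)
                * sqrt (zeta_const K Rg + L * Rg\<^sup>2 / \<epsilon>)))))
   \<and>
     (\<forall>c>1. \<forall>R>0. \<exists>\<rho>>0. \<exists>\<sigma>>0. \<rho> \<le> R \<and> \<sigma> \<le> 1 \<and>
      (\<exists>cL>0. \<forall>(M :: 'a point set) frame F G x0 xs Rg L \<mu> \<epsilon> N.
        c * Rg + R < pi / 2 \<and>
        N = exp_ball 1 x0 (2 * Rg + R) \<inter> rball 1 xs (c * Rg + R) \<and>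
        setting 1 M frame F G x0 xs Rg N \<and>
        0 < L \<and> 0 < \<mu> \<and> 0 < \<epsilon> \<and>
        smooth_on 1 F G L N \<and> strongly_gconvex_on 1 F G \<mu> N \<longrightarrow>
        solves (alg2 1 M frame \<rho> \<sigma> cL F G L \<mu> Rg x0 \<epsilon>) M F xs \<epsilon>
          ((1 + 1 / R) ^ 10 * hidden (zeta_const 1 Rg + L / \<mu> + L * Rg\<^sup>2 / \<epsilon>)
             * (zeta_const 1 Rg powr (3 / 2) * sqrt (L / \<mu>)))))
   \<and>
     (\<forall>c>1. \<forall>R>0. \<exists>\<rho>>0. \<exists>\<sigma>>0. \<rho> \<le> R \<and> \<sigma> \<le> 1 \<and>
      (\<exists>cL>0. \<exists>cS>0. \<exists>cC>0. \<exists>\<kappa>>0. \<kappa> \<le> 1 / 4 \<and>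
       (\<forall>(M :: 'a point set) frame F G x0 xs Rg L \<Delta> \<epsilon>.
        c * Rg + R < pi / 2 \<and>
        setting 1 M frame F G x0 xs Rg (exp_ball 1 x0 (2 * Rg + R)) \<and>
        0 < L \<and> 0 < \<epsilon> \<and> 0 < \<Delta> \<and> F x0 - F xs \<le> \<Delta> \<and>
        smooth_on 1 F G L (exp_ball 1 x0 (2 * Rg + R)) \<and>
        gconvex_on 1 F G (exp_ball 1 x0 (2 * Rg + R)) \<longrightarrow>
        solves (reg_alg 1 M frame \<rho> \<sigma> cL cS cC \<kappa> F G L Rg x0 \<Delta> \<epsilon>) M F xs \<epsilon>
          ((1 + 1 / R) ^ 10 * hidden (zeta_const 1 Rg + L * Rg\<^sup>2 / \<epsilon> + \<Delta> / \<epsilon>)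
             * (zeta_const 1 Rg powr (3 / 2) * delta_const 1 Rg powr (- 1 / 2)
                * sqrt (zeta_const 1 Rg + L * Rg\<^sup>2 / \<epsilon>))))))"
proof (intro conjI, goal_cases)
  have sf: "space_form K frame" if "K = 1 \<or> K = -1" "setting K M frame F G x0 xs Rg N"
    for K and M N :: "'a point set" and frame F G x0 xs Rg
    using that by (simp add: space_form_def setting_def)
  have sf1: "space_form 1 frame" if "setting 1 M frame F G x0 xs Rg N"
    for M N :: "'a point set" and frame F G x0 xs Rg
    using sf[OF _ that] by simp
  have sq: "2 * Rg + 1 < pi / 2" if "K = 1 \<or> K = -1" "K > 0 \<longrightarrow> 2 * Rg + 1 < pi / (2 * sqrt K)" "K > 0" for K Rg :: real
    using that by auto
  {
    case 1
    show ?case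
    proof ((intro exI[of _ 200000] conjI allI impI; (elim conjE)?), goal_cases)
      case (2 K M frame F G x0 xs Rg L \<mu> \<epsilon>)
      show ?case by (rule space_form.boost_unit_ball[OF sf[OF 2(1,3)] 2(3) sq[OF 2(1,2)] 2(4-8)])
    qed simp
  next
    case 2
    show ?case
    proof (rule exI[of _ 200000], rule conjI, simp, rule exI[of _ 10], rule conjI, simp, rule exI[of _ "1/4"], rule conjI, simp,
        rule exI[of _ "1/10^4"], (intro conjI allI impI; (elim conjE)?), goal_cases)
      case (3 K M frame F G x0 xs Rg L \<Delta> \<epsilon>)
      show ?case by (rule space_form.reg_unit_ball[OF sf[OF 3(1,3)] 3(3) sq[OF 3(1,2)] 3(4,6,5,7-9)])
    qed simp_all
  next
    case 3
    show ?case
    proof (intro allI impI, goal_cases)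
      case (1 c R)
      show ?case
      proof (rule exI[of _ "R / 8"], rule conjI, simp add: 1, rule exI[of _ "min 1 (R / 4)"], rule conjI, simp add: 1,
          (intro exI[of _ "80000 / R"] conjI allI impI; (elim conjE)?), goal_cases)
        case (4 M frame F G x0 xs Rg L \<mu> \<epsilon> N)
        show ?case by (rule space_form.boost_small_balls[OF sf1[OF 4(3)] refl 1 4])
      qed (use 1 in auto)
    qed
  next
    case 4
    show ?case
    proof (intro allI impI, goal_cases)
      case (1 c R)
      show ?case
      proof (rule exI[of _ "R / 8"], rule conjI, simp add: 1, rule exI[of _ 1], rule conjI, simp, rule conjI, simp add: 1, rule conjI, simp,
          rule exI[of _ "200000 / R"], rule conjI, simp add: 1, rule exI[of _ 2], rule conjI, simp, rule exI[of _ "R / 4"], rule conjI, simp add: 1,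
          rule exI[of _ "min (1/4) (R ^ 4 / 10 ^ 5)"], (intro conjI allI impI; (elim conjE)?), goal_cases)
        case (3 M frame F G x0 xs Rg L \<Delta> \<epsilon>)
        show ?case by (rule space_form.reg_small_balls[OF sf1[OF 3(2)] refl 1 3(1,2,3,5,4,6-8)])
      qed (use 1 in auto)
    qed
  }
qed

end
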